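(* Let $\alpha\in\mathscr{S}'(\mathbb{R}^{\ge0})\cap L^1_{\mathrm{loc}}(\mathbb{R}^{\ge0})$, let $a=\mathcal{F}\alpha$, and let $\chi_0\in C_{\mathrm c}^\infty(\mathbb{R}^+)$ with $\int_0^\infty\chi_0(\sigma)\,d\sigma=1$. Suppose we are given distributions $a_0,b,c,g,p\in\mathscr{S}'(\mathbb{R})$ of the following form: 1. $a_0(\tau)=\sum_{j\in\mathcal{J}}a_0^{(j)}(\tau-i0)^{-j}$ for some finite subset $\mathcal{J}\subset\mathbb{R}^+$ of positive real numbers and some $\{a_0^{(j)}\}_{j\in\mathcal{J}}\subset\mathbb{C}$; 2. $b=\mathcal{F}\beta$ for some $\beta\in\mathscr{S}'(\mathbb{R}^{\ge0})\cap L^1_{\mathrm{loc}}(\mathbb{R}^{\ge0})$; 3. $c=\mathcal{F}\gamma$ for some $\gamma\in\mathscr{S}'(\mathbb{R}^{\ge0})\cap L^1_{\mathrm{loc}}(\mathbb{R}^{\ge0})$, such that $c$ is continuous in some neighborhood of the origin; 4. $g\in\tau L^{1,N}_{\mathrm{loc}}(\mathbb{R}_\tau)$ with discrete singular support, for some $N\in\mathbb{N}$; 5. $p\in\mathscr{S}'(\mathbb{R})$ has discrete singular support not containing the origin and vanishes at the origin; such that $a(\tau)=a_{00}\mathcal{F}\chi_0(\tau)+a_0(\tau)+b(\tau)+c(\tau)$ for some $a_{00}\in\mathbb{C}$, where $c=g+p$, and such that $\gamma\in\langle\sigma\rangle^KL^\infty(\mathbb{R}_\sigma)$ for some $K\ge0$.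 Suppose moreover that there is a nondecreasing continuous function $\mathfrak{R}:\mathbb{R}^+\to\mathbb{R}^+$ such that - $\lVert\tau^{-1}g(\tau)\rVert_{L^{1,N}[-T,+T]}\le\mathfrak{R}(T)$ for all $T\ge1$, and - for some integer $M\ge\max\{K+1,N\}$, $$\sup_{\Sigma>1,\,T>1}\frac{\Sigma^N}{\mathfrak{R}(T)}\left|\int_{-T}^{+T}\frac{p(\tau)}{\tau}e^{i\tau\Sigma}\Big(1-\frac{\tau^2}{T^2}\Big)^M d\tau\right|<\infty.$$ Then, for any $\Lambda>0$, $$\int_0^\Sigma\alpha(\sigma)\,d\sigma=a_{00}+\sum_{j\in\mathcal{J}}\frac{e^{i\pi j/2}}{j!}a_0^{(j)}\Sigma^j+\int_0^\Sigma\beta(\sigma)\,d\sigma+O\big(\Sigma^K\mathcal{R}(\Sigma)^{-1}\big)$$ as $\Sigma\to\infty$, where $\mathcal{R}(\Sigma)=\max\big\{1,\ \sup\{T>0:\ T\,\mathfrak{R}(T)\le\Lambda\Sigma^{N-K}\}\big\}$.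
   Context: Notation: $\mathbb{R}^+=(0,\infty)$, $\mathbb{N}=\{0,1,2,\ldots\}$, $\langle\sigma\rangle=(1+\sigma^2)^{1/2}$. $\mathscr{S}'(\mathbb{R}^{\ge0})$ is the set of tempered distributions on $\mathbb{R}$ supported in $[0,\infty)$. Elements of $\mathscr{S}'(\mathbb{R}^{\ge0})\cap L^1_{\mathrm{loc}}(\mathbb{R}^{\ge0})$ are (possibly complex-valued) locally integrable functions, extended by zero to the negative half-line, that define tempered distributions. The Fourier transform is $\mathcal{F}u(\tau)=\int e^{-i\tau\sigma}u(\sigma)\,d\sigma$. For real $j>0$, $j!=\Gamma(j+1)$ and $(\tau-i0)^{-j}$ is the distributional limit $\lim_{\epsilon\to0^+}(\tau-i\epsilon)^{-j}$ (principal branch). $\langle\sigma\rangle^KL^\infty$ is the space of functions $u$ with $\langle\sigma\rangle^{-K}u\in L^\infty$. $L^{1,N}(I)$ is the $L^1$-based Sobolev space with norm $\lVert u\rVert_{L^{1,N}(I)}=\sum_{j=0}^N\lVert\partial^ju\rVert_{L^1(I)}$. $g\in\tau L^{1,N}_{\mathrm{loc}}(\mathbb{R}_\tau)$ means $g=\tau u$ with $u\in L^{1,N}_{\mathrm{loc}}(\mathbb{R})$, and then $\tau^{-1}g$ denotes $u$. The integral involving $p$ is a distributional pairing on $[-T,T]$, well defined for those $T$ with $\pm T\notin\operatorname{singsupp}p$: near $\tau=\pm T$ it is an ordinary integral of a smooth function, and away from $\pm T$ it is the pairing with a smooth cutoff. The supremum is over such $T$. Since $p$ is smooth near $0$ with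 $p(0)=0$, $p(\tau)/\tau$ is smooth near $0$. *)

theory Defs
  imports "HOL-Analysis.Analysis" "HOL-Library.Landau_Symbols"
begin

definition nth_deriv :: "nat \<Rightarrow> (real \<Rightarrow> complex) \<Rightarrow> real \<Rightarrow> complex" where
  "nth_deriv n f = ((\<lambda>h x. vector_derivative h (at x)) ^^ n) f"

text \<open>Meant for open \<open>U\<close> only: all iterated derivatives at a point of \<open>U\<close> then depend
  only on the values of \<open>f\<close> in \<open>U\<close>.\<close>

definition smooth_on :: "real set \<Rightarrow> (real \<Rightarrow> complex) \<Rightarrow> bool" where
  "smooth_on U f \<longleftrightarrow> (\<forall>n. \<forall>x\<in>U. nth_deriv n f differentiable (at x))"

text \<open>\<open>C\<^sub>c\<^sup>\<infinity>(U)\<close>, its elements being extended by zero to the real line.\<close>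

definition test_functions :: "real set \<Rightarrow> (real \<Rightarrow> complex) set" where
  "test_functions U =
     {\<phi>. smooth_on UNIV \<phi> \<and> compact (closure {x. \<phi> x \<noteq> 0}) \<and> closure {x. \<phi> x \<noteq> 0} \<subseteq> U}"

definition schwartz :: "(real \<Rightarrow> complex) set" where
  "schwartz =
     {\<phi>. smooth_on UNIV \<phi> \<and> (\<forall>k m. bounded (range (\<lambda>x. x ^ k *\<^sub>R nth_deriv m \<phi> x)))}"

definition schwartz_seminorm :: "nat \<Rightarrow> nat \<Rightarrow> (real \<Rightarrow> complex) \<Rightarrow> real" where
  "schwartz_seminorm k m \<phi> = (SUP x. norm (x ^ k *\<^sub>R nth_deriv m \<phi> x))"

text \<open>A distribution is a functional on complex-valued functions of which only the values at
  Schwartz functions matter; equality of two tempered distributions therefore always means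
  equality at all elements of \<open>schwartz\<close>.\<close>

type_synonym distribution = "(real \<Rightarrow> complex) \<Rightarrow> complex"

definition tempered :: "distribution \<Rightarrow> bool" where
  "tempered u \<longleftrightarrow>
     (\<forall>\<phi>\<in>schwartz. \<forall>\<psi>\<in>schwartz. u (\<lambda>x. \<phi> x + \<psi> x) = u \<phi> + u \<psi>) \<and>
     (\<forall>z. \<forall>\<phi>\<in>schwartz. u (\<lambda>x. z * \<phi> x) = z * u \<phi>) \<and>
     (\<exists>C k. \<forall>\<phi>\<in>schwartz. norm (u \<phi>) \<le> C * (\<Sum>i\<le>k. \<Sum>j\<le>k. schwartz_seminorm i j \<phi>))"

definition function_pairing :: "(real \<Rightarrow> complex) \<Rightarrow> distribution" where
  "function_pairing f \<phi> = (LINT x|lebesgue. f x * \<phi> x)"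

text \<open>The distribution \<open>u\<close> is equal to the function \<open>h\<close> on the open set \<open>U\<close>.\<close>

definition equals_function_on :: "distribution \<Rightarrow> real set \<Rightarrow> (real \<Rightarrow> complex) \<Rightarrow> bool" where
  "equals_function_on u U h \<longleftrightarrow> (\<forall>\<phi>\<in>test_functions U. u \<phi> = function_pairing h \<phi>)"

definition sing_supp :: "distribution \<Rightarrow> real set" where
  "sing_supp u =
     {x. \<not> (\<exists>U h. open U \<and> x \<in> U \<and> smooth_on U h \<and> equals_function_on u U h)}"

definition continuous_near_origin :: "distribution \<Rightarrow> bool" where
  "continuous_near_origin u \<longleftrightarrow>
     (\<exists>U h. open U \<and> 0 \<in> U \<and> continuous_on U h \<and> equals_function_on u U h)"

definition vanishes_at_origin :: "distribution \<Rightarrow> bool" where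
  "vanishes_at_origin u \<longleftrightarrow>
     (\<exists>U h. open U \<and> 0 \<in> U \<and> smooth_on U h \<and> equals_function_on u U h \<and> h 0 = 0)"

definition locally_integrable :: "(real \<Rightarrow> complex) \<Rightarrow> bool" where
  "locally_integrable f \<longleftrightarrow> (\<forall>K. compact K \<longrightarrow> f absolutely_integrable_on K)"

text \<open>A locally integrable \<open>f\<close> defines a tempered distribution if the functional
  \<open>\<phi> \<mapsto> \<integral> f \<phi>\<close> on test functions has a tempered extension. The extension is unique, test
  functions being dense in \<open>schwartz\<close>. For a general Schwartz function \<open>\<phi>\<close> it need not be
  an absolutely convergent integral: consider \<open>f x = exp x * cos (exp x)\<close>.\<close>

definition tempered_extension :: "(real \<Rightarrow> complex) \<Rightarrow> distribution \<Rightarrow> bool" where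
  "tempered_extension f u \<longleftrightarrow> tempered u \<and> equals_function_on u UNIV f"

definition distribution_of :: "(real \<Rightarrow> complex) \<Rightarrow> distribution" where
  "distribution_of f = (SOME u. tempered_extension f u)"

definition tempered_L1loc_halfline :: "(real \<Rightarrow> complex) set" where
  "tempered_L1loc_halfline =
     {f. locally_integrable f \<and> (\<forall>x<0. f x = 0) \<and> (\<exists>u. tempered_extension f u)}"

definition fourier :: "(real \<Rightarrow> complex) \<Rightarrow> real \<Rightarrow> complex" where
  "fourier f \<tau> = (LINT \<sigma>|lebesgue. exp (- (\<i> * of_real \<tau> * of_real \<sigma>)) * f \<sigma>)"

definition fourier_dist :: "distribution \<Rightarrow> distribution" where
  "fourier_dist u \<phi> = u (fourier \<phi>)"

text \<open>\<open>(\<tau> - i0)\<^sup>s\<close>; the base \<open>\<tau> - i\<epsilon>\<close> avoids the branch cut of \<open>powr\<close>.\<close>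

definition minus_i0_powr :: "real \<Rightarrow> distribution" where
  "minus_i0_powr s \<phi> =
     Lim (at_right 0)
       (\<lambda>\<epsilon>. LINT \<tau>|lebesgue. (of_real \<tau> - \<i> * of_real \<epsilon>) powr of_real s * \<phi> \<tau>)"

definition japanese :: "real \<Rightarrow> real" where
  "japanese \<sigma> = sqrt (1 + \<sigma>\<^sup>2)"

definition weighted_Linf :: "real \<Rightarrow> (real \<Rightarrow> complex) set" where
  "weighted_Linf K =
     {u. (\<lambda>\<sigma>. of_real (japanese \<sigma> powr (- K)) * u \<sigma>) \<in> borel_measurable lebesgue \<and>
         (\<exists>C. AE \<sigma> in lebesgue. norm (of_real (japanese \<sigma> powr (- K)) * u \<sigma>) \<le> C)}"

definition has_weak_deriv ::
    "nat \<Rightarrow> real set \<Rightarrow> (real \<Rightarrow> complex) \<Rightarrow> (real \<Rightarrow> complex) \<Rightarrow> bool" where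
  "has_weak_deriv j I u v \<longleftrightarrow>
     u absolutely_integrable_on I \<and> v absolutely_integrable_on I \<and>
     (\<forall>\<phi>\<in>test_functions (interior I).
        (LINT x:I|lebesgue. u x * nth_deriv j \<phi> x) = (-1) ^ j * (LINT x:I|lebesgue. v x * \<phi> x))"

definition sobolev_L1 :: "nat \<Rightarrow> real set \<Rightarrow> (real \<Rightarrow> complex) set" where
  "sobolev_L1 N I = {u. \<forall>j\<le>N. \<exists>v. has_weak_deriv j I u v}"

text \<open>Weak derivatives are unique up to null sets, so that the norm below does not depend on
  the choice made in \<open>weak_deriv\<close>.\<close>

definition weak_deriv :: "nat \<Rightarrow> real set \<Rightarrow> (real \<Rightarrow> complex) \<Rightarrow> real \<Rightarrow> complex" where
  "weak_deriv j I u = (SOME v. has_weak_deriv j I u v)"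

definition sobolev_L1_norm :: "nat \<Rightarrow> real set \<Rightarrow> (real \<Rightarrow> complex) \<Rightarrow> real" where
  "sobolev_L1_norm N I u = (\<Sum>j\<le>N. LINT x:I|lebesgue. norm (weak_deriv j I u x))"

definition sobolev_L1_loc :: "nat \<Rightarrow> (real \<Rightarrow> complex) set" where
  "sobolev_L1_loc N = {u. \<forall>T>0. u \<in> sobolev_L1 N {-T..T}}"

text \<open>\<open>has_truncated_pairing p T w I\<close> says that \<open>I\<close> is the distributional pairing
  \<open>\<integral>\<^bsub>-T\<^esub>\<^bsup>T\<^esup> p(\<tau>)/\<tau> w(\<tau>) d\<tau>\<close>, for smooth \<open>w\<close> and for \<open>p\<close> that is smooth near \<open>\<plusminus>T\<close> and
  near \<open>0\<close> and vanishes at \<open>0\<close>. The smooth cutoff \<open>\<psi>\<close> is supported in the open interval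
  and away from \<open>0\<close>. On the support of \<open>1 - \<psi>\<close> in \<open>[-T, T]\<close> the distribution \<open>p\<close> is a
  smooth function \<open>h\<close>, and there the pairing is an ordinary integral, with the smooth function
  \<open>h(\<tau>)/\<tau>\<close> near \<open>0\<close>. For \<open>\<plusminus>T \<notin> sing_supp p\<close> such \<open>U\<close>, \<open>h\<close>, \<open>\<psi>\<close> exist, and the value
  \<open>I\<close> does not depend on their choice.\<close>

definition has_truncated_pairing ::
    "distribution \<Rightarrow> real \<Rightarrow> (real \<Rightarrow> complex) \<Rightarrow> complex \<Rightarrow> bool" where
  "has_truncated_pairing p T w I \<longleftrightarrow>
     (\<exists>U h \<psi>. open U \<and> {-T, 0, T} \<subseteq> U \<and> smooth_on U h \<and> equals_function_on p U h \<and>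
        \<psi> \<in> test_functions ({-T<..<T} - {0}) \<and> closure {\<tau>\<in>{-T..T}. \<psi> \<tau> \<noteq> 1} \<subseteq> U \<and>
        I = p (\<lambda>\<tau>. \<psi> \<tau> * (w \<tau> / of_real \<tau>)) +
            (LINT \<tau>:{-T..T}|lebesgue. (1 - \<psi> \<tau>) * (h \<tau> / of_real \<tau>) * w \<tau>))"

text \<open>For positive nondecreasing \<open>\<RR>\<close> and \<open>S > 0\<close>, the set below is nonempty and bounded, so
  that the real supremum is meaningful.\<close>

definition remainder_rate :: "(real \<Rightarrow> real) \<Rightarrow> real \<Rightarrow> nat \<Rightarrow> real \<Rightarrow> real \<Rightarrow> real" where
  "remainder_rate \<RR> \<Lambda> N K S =
     max 1 (Sup {T. T > 0 \<and> T * \<RR> T \<le> \<Lambda> * S powr (real N - K)})"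

end

theory Submission
  imports Defs
    "HOL-Probability.Characteristic_Functions"
    "HOL-Probability.Sinc_Integral"
    "HOL-Computational_Algebra.Polynomial"
begin

text \<open>
  Testing the decomposition against inverse Fourier transforms of test functions that approach the
  indicator of \<open>[0, \<Sigma>]\<close> gives all terms of the expansion, and leaves \<open>\<integral>\<^sub>0\<^sup>\<Sigma> \<gamma>\<close> to be bounded.
  Replace the indicator of \<open>(-\<infinity>, \<Sigma>]\<close> by its mean \<open>W\<close> with the kernel whose Fourier transform is
  \<open>(1 - \<tau>\<^sup>2/T\<^sup>2)\<^sup>M\<close> on \<open>[-T, T]\<close>. Bessel-type recurrences show that \<open>W\<close> differs from the indicator by
  \<open>O((1 + T|\<sigma> - \<Sigma>|)\<^bsup>-M-1\<^esup>)\<close>, so that the replacement costs \<open>O(\<Sigma>\<^sup>K/T)\<close>. On the side of \<open>\<tau>\<close>, the pairing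
  of \<open>\<gamma>\<close> with \<open>W\<close> is the truncated pairing of \<open>c(\<tau>)/\<tau>\<close> with \<open>e\<^bsup>i\<tau>\<Sigma>\<^esup>(1 - \<tau>\<^sup>2/T\<^sup>2)\<^sup>M\<close>: the part of \<open>p\<close> is bounded
  by hypothesis, and in the part of \<open>g\<close> one integrates by parts \<open>N\<close> times, so both are
  \<open>O(\<Sigma>\<^bsup>-N\<^esup> R(T))\<close>. Finally \<open>T\<close> is chosen close to the supremum that defines the rate.
\<close>

text \<open>The obstacle is the passage from \<open>\<gamma>\<close> to the truncated pairing. The
  symbol of a step has a pole at \<tau> = 0, and c can be tested with smooth functions only. The
  pole is removed by subtracting a second wave, cut off at |\<tau>| \<le> r and with phase Y, which
  on the other side gives the step a lower end around Y. The resulting bounded symbol is split with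
  the cutoff \<psi> of the truncated pairing: the part with \<psi> is a test function, on which p
  acts as a distribution; the other part lives where p is a smooth function h, and the pairing
  reaches it by mollification. Then Y tends to -\<infinity> with r fixed, which removes the lower
  end because \<gamma> lives on the half-line, and r tends to 0 afterwards. This order works because
  the remaining term is at most the L1 norm of g/\<tau> + h/\<tau> on [-r, r], whatever Y is; here
  h(0) = 0 enters. The order M serves twice: M \<ge> K + 1 makes the smoothing error integrable
  against the growth of \<gamma>, and M \<ge> N makes the boundary terms of N integrations by parts
  vanish.\<close>

lemma nth_deriv_0 [simp]: "nth_deriv 0 f = f"
  by (simp add: nth_deriv_def)

lemma nth_deriv_Suc: "nth_deriv (Suc n) f x = vector_derivative (nth_deriv n f) (at x)"
  by (simp add: nth_deriv_def)

lemma nth_deriv_add: "nth_deriv (m + n) f = nth_deriv m (nth_deriv n f)"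
  by (simp add: nth_deriv_def funpow_add)

lemma nth_deriv_Suc': "nth_deriv (Suc n) f = nth_deriv n (nth_deriv 1 f)"
  using nth_deriv_add[of n 1 f] by simp

lemma vector_derivative_cong_open:
  assumes "open U" "x \<in> U" "\<And>y. y \<in> U \<Longrightarrow> f y = g y"
  shows "vector_derivative f (at x) = vector_derivative g (at x)"
proof (rule vector_derivative_cong_eq)
  show "\<forall>\<^sub>F y in nhds x. y \<in> UNIV \<longrightarrow> f y = g y"
    using eventually_nhds_in_open[OF assms(1,2)] assms(3) by (auto elim: eventually_mono)
qed simp_all

lemma nth_deriv_cong_open:
  assumes "open U" "x \<in> U" "\<And>y. y \<in> U \<Longrightarrow> f y = g y"
  shows "nth_deriv n f x = nth_deriv n g x"
  using assms(2)
proof (induction n arbitrary: x)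
  case 0
  show ?case using assms(3)[OF 0] by simp
next
  case (Suc n)
  then show ?case
    unfolding nth_deriv_Suc by (intro vector_derivative_cong_open[OF assms(1)]) auto
qed

lemma differentiable_cong_open:
  fixes f g :: "real \<Rightarrow> complex"
  assumes "open U" "x \<in> U" "\<And>y. y \<in> U \<Longrightarrow> f y = g y" "f differentiable at x"
  shows "g differentiable at x"
  using has_derivative_transform_within_open[OF _ assms(1,2)] assms(3,4)
  unfolding differentiable_def by blast

lemma smooth_on_cong:
  assumes "open U" "smooth_on U f" "\<And>y. y \<in> U \<Longrightarrow> f y = g y"
  shows "smooth_on U g"
  unfolding smooth_on_def
proof (intro allI ballI)
  fix n x assume x: "x \<in> U"
  show "nth_deriv n g differentiable at x"
  proof (rule differentiable_cong_open[OF assms(1) x])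
    show "nth_deriv n f differentiable at x" using assms(2) x by (simp add: smooth_on_def)
    show "nth_deriv n f y = nth_deriv n g y" if "y \<in> U" for y
      by (rule nth_deriv_cong_open[OF assms(1) that assms(3)])
  qed
qed

section \<open>Smooth functions and rules for proving smoothness\<close>

lemma smooth_on_subset: "smooth_on U f \<Longrightarrow> V \<subseteq> U \<Longrightarrow> smooth_on V f"
  by (auto simp: smooth_on_def)

lemma smooth_on_Un: "smooth_on U f \<Longrightarrow> smooth_on V f \<Longrightarrow> smooth_on (U \<union> V) f"
  by (auto simp: smooth_on_def)

lemma smooth_on_has_vector_derivative:
  assumes "smooth_on U f" "x \<in> U"
  shows "(f has_vector_derivative nth_deriv 1 f x) (at x)"
proof -
  have "f differentiable at x"
    using assms unfolding smooth_on_def by (metis nth_deriv_0)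
  then show ?thesis
    by (simp add: nth_deriv_Suc vector_derivative_works)
qed

lemma smooth_on_nth_deriv: "smooth_on U f \<Longrightarrow> smooth_on U (nth_deriv n f)"
  unfolding smooth_on_def nth_deriv_add[symmetric] by blast

lemma smooth_on_continuous:
  assumes "smooth_on U f" shows "continuous_on U f"
  using smooth_on_has_vector_derivative[OF assms]
  by (meson continuous_at_imp_continuous_on has_vector_derivative_continuous)

text \<open>\<open>P\<close> is a class of functions closed, on \<open>U\<close>, under
  differentiation. Iterating the closure reaches every derivative without a formula for any of them.
  Agreement is claimed on \<open>U\<close> only, because the derivative is prescribed only
  there.\<close>

lemma nth_deriv_eq_coinduct:
  assumes "open U" "P f"
    and step: "\<And>f. P f \<Longrightarrow> \<exists>f'. P f' \<and> (\<forall>x\<in>U. (f has_vector_derivative f' x) (at x))"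
  shows "\<exists>f'. P f' \<and> (\<forall>x\<in>U. nth_deriv n f x = f' x)"
proof (induction n)
  case 0
  show ?case using assms(2) by auto
next
  case (Suc n)
  then obtain f' where f': "P f'" "\<forall>x\<in>U. nth_deriv n f x = f' x" by blast
  obtain f'' where f'': "P f''" "\<forall>x\<in>U. (f' has_vector_derivative f'' x) (at x)"
    using step[OF f'(1)] by blast
  have "nth_deriv (Suc n) f x = f'' x" if "x \<in> U" for x
    unfolding nth_deriv_Suc
    using vector_derivative_cong_open[OF assms(1) that] f'(2) f''(2) that
    by (metis vector_derivative_at)
  then show ?case using f'' by blast
qed

lemma smooth_on_coinduct:
  assumes "open U" "P f"
    and step: "\<And>f. P f \<Longrightarrow> \<exists>f'. P f' \<and> (\<forall>x\<in>U. (f has_vector_derivative f' x) (at x))"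
  shows "smooth_on U f"
  unfolding smooth_on_def
proof (intro allI ballI)
  fix n x assume "x \<in> U"
  obtain f' where f': "P f'" "\<forall>x\<in>U. nth_deriv n f x = f' x"
    using nth_deriv_eq_coinduct[of U P f n, OF assms(1,2) step] by blast
  obtain f'' where "\<forall>x\<in>U. (f' has_vector_derivative f'' x) (at x)"
    using step[OF f'(1)] by blast
  then have d: "f' differentiable at x"
    using \<open>x \<in> U\<close> by (auto simp: has_vector_derivative_def differentiable_def)
  show "nth_deriv n f differentiable at x"
    by (rule differentiable_cong_open[OF assms(1) \<open>x \<in> U\<close> _ d]) (simp add: f'(2))
qed

text \<open>The invariant joins \<open>f\<close> itself to the smooth functions, since after one
  step only \<open>f'\<close> and its derivatives occur.\<close>

lemma smooth_on_derivD:
  assumes "open U" "smooth_on U f'" "\<And>x. x \<in> U \<Longrightarrow> (f has_vector_derivative f' x) (at x)"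
  shows "smooth_on U f"
proof (rule smooth_on_coinduct[OF assms(1), where P = "\<lambda>h. h = f \<or> smooth_on U h"])
  fix h assume "h = f \<or> smooth_on U h"
  then show "\<exists>h'. (h' = f \<or> smooth_on U h') \<and> (\<forall>x\<in>U. (h has_vector_derivative h' x) (at x))"
    using assms(2) assms(3) smooth_on_has_vector_derivative[of U h] smooth_on_nth_deriv[of U h 1] by blast
qed simp

lemma nth_deriv_Suc_eq:
  assumes "open U" "x \<in> U" "\<And>x. x \<in> U \<Longrightarrow> (f has_vector_derivative f' x) (at x)"
  shows "nth_deriv (Suc n) f x = nth_deriv n f' x"
  unfolding nth_deriv_Suc'
  by (rule nth_deriv_cong_open[OF assms(1,2)]) (simp add: nth_deriv_Suc vector_derivative_at[OF assms(3)])

text \<open>The derivative of a product is a sum of products, so an invariant for coinduction has to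
  be closed under both operations at once.\<close>

inductive smooth_algebra :: "real set \<Rightarrow> (real \<Rightarrow> complex) \<Rightarrow> bool" for U where
  base: "smooth_on U f \<Longrightarrow> smooth_algebra U f"
| add: "smooth_algebra U f \<Longrightarrow> smooth_algebra U g \<Longrightarrow> smooth_algebra U (\<lambda>x. f x + g x)"
| mult: "smooth_algebra U f \<Longrightarrow> smooth_algebra U g \<Longrightarrow> smooth_algebra U (\<lambda>x. f x * g x)"

lemma smooth_algebra_deriv:
  assumes "smooth_algebra U f"
  shows "\<exists>f'. smooth_algebra U f' \<and> (\<forall>x\<in>U. (f has_vector_derivative f' x) (at x))"
  using assms
proof induction
  case (base f)
  then show ?case
    using smooth_on_has_vector_derivative smooth_on_nth_deriv smooth_algebra.base by blast
next
  case (add f g)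
  then obtain f' g' where "smooth_algebra U f'" "smooth_algebra U g'"
    "\<forall>x\<in>U. (f has_vector_derivative f' x) (at x)" "\<forall>x\<in>U. (g has_vector_derivative g' x) (at x)"
    by blast
  then show ?case
    by (intro exI[of _ "\<lambda>x. f' x + g' x"]) (auto intro: smooth_algebra.add has_vector_derivative_add)
next
  case (mult f g)
  then obtain f' g' where "smooth_algebra U f'" "smooth_algebra U g'"
    "\<forall>x\<in>U. (f has_vector_derivative f' x) (at x)" "\<forall>x\<in>U. (g has_vector_derivative g' x) (at x)"
    by blast
  then show ?case using mult(1,2)
    by (intro exI[of _ "\<lambda>x. f x * g' x + f' x * g x"])
      (auto intro: smooth_algebra.intros has_vector_derivative_mult)
qed

lemma smooth_algebra_smooth_on: "open U \<Longrightarrow> smooth_algebra U f \<Longrightarrow> smooth_on U f"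
  by (rule smooth_on_coinduct[where P = "smooth_algebra U"]) (auto intro: smooth_algebra_deriv)

lemma smooth_on_add:
  "open U \<Longrightarrow> smooth_on U f \<Longrightarrow> smooth_on U g \<Longrightarrow> smooth_on U (\<lambda>x. f x + g x)"
  by (erule smooth_algebra_smooth_on) (simp add: smooth_algebra.base smooth_algebra.add)

lemma smooth_on_mult:
  "open U \<Longrightarrow> smooth_on U f \<Longrightarrow> smooth_on U g \<Longrightarrow> smooth_on U (\<lambda>x. f x * g x)"
  by (erule smooth_algebra_smooth_on) (simp add: smooth_algebra.base smooth_algebra.mult)

lemma smooth_on_const: "open U \<Longrightarrow> smooth_on U (\<lambda>x. c)"
  by (rule smooth_on_coinduct[where P = "\<lambda>f. \<exists>c. f = (\<lambda>x. c)"]) (auto intro!: derivative_eq_intros)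

lemma smooth_on_of_real: "open U \<Longrightarrow> smooth_on U (\<lambda>x. of_real x)"
  by (rule smooth_on_derivD[OF _ smooth_on_const[of U 1]])
    (auto simp: has_vector_derivative_def has_derivative_of_real scaleR_conv_of_real intro!: derivative_eq_intros)

lemma smooth_on_uminus: "open U \<Longrightarrow> smooth_on U f \<Longrightarrow> smooth_on U (\<lambda>x. - f x)"
  using smooth_on_mult[of U "\<lambda>x. -1" f] smooth_on_const[of U "-1"] by simp

lemma smooth_on_diff:
  "open U \<Longrightarrow> smooth_on U f \<Longrightarrow> smooth_on U g \<Longrightarrow> smooth_on U (\<lambda>x. f x - g x)"
  using smooth_on_add[of U f "\<lambda>x. - g x"] smooth_on_uminus[of U g] by simp

lemma smooth_on_power: "open U \<Longrightarrow> smooth_on U f \<Longrightarrow> smooth_on U (\<lambda>x. f x ^ n)"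
  by (induction n) (auto intro: smooth_on_const smooth_on_mult)

lemma smooth_on_exp: "open U \<Longrightarrow> smooth_on U (\<lambda>x. exp (c * of_real x))"
proof (rule smooth_on_coinduct[where P = "\<lambda>f. \<exists>d. f = (\<lambda>x. d * exp (c * of_real x))"])
  fix f assume "\<exists>d. f = (\<lambda>x. d * exp (c * complex_of_real x))"
  then obtain d where f: "f = (\<lambda>x. d * exp (c * complex_of_real x))" by blast
  have "((\<lambda>x. exp (c * of_real x)) has_vector_derivative c * exp (c * of_real x)) (at x)" for x
  proof -
    have "((\<lambda>z. exp (c * z)) has_field_derivative c * exp (c * of_real x)) (at (of_real x))"
      by (auto intro!: derivative_eq_intros)
    from has_vector_derivative_real_field[OF this] show ?thesis by simp
  qed
  then have "\<forall>x. (f has_vector_derivative d * (c * exp (c * of_real x))) (at x)"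
    unfolding f by (auto intro: has_vector_derivative_mult_right)
  then show "\<exists>f'. (\<exists>d. f' = (\<lambda>x. d * exp (c * complex_of_real x))) \<and>
             (\<forall>x\<in>U. (f has_vector_derivative f' x) (at x))"
    by (intro exI[of _ "\<lambda>x. d * c * exp (c * of_real x)"] conjI exI[of _ "d * c"] refl)
      (simp add: mult.assoc)
qed (auto intro: exI[of _ 1])

text \<open>The function 1/x alone is not closed under differentiation; the multiples of all inverse
  powers are.\<close>

lemma smooth_on_inverse: "open U \<Longrightarrow> 0 \<notin> U \<Longrightarrow> smooth_on U (\<lambda>x. inverse (of_real x))"
proof (rule smooth_on_coinduct[where P = "\<lambda>f. \<exists>d n. f = (\<lambda>x. d * inverse (of_real x) ^ n)"])
  fix f assume U: "0 \<notin> U" and "\<exists>d n. f = (\<lambda>x. d * inverse (complex_of_real x) ^ n)"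
  then obtain d n where f: "f = (\<lambda>x. d * inverse (complex_of_real x) ^ n)" by blast
  have "(f has_vector_derivative (- d * of_nat n) * inverse (of_real x) ^ Suc n) (at x)" if "x \<in> U" for x
  proof -
    have "((\<lambda>z. d * inverse z ^ n) has_field_derivative (- d * of_nat n) * inverse (of_real x) ^ Suc n) (at (complex_of_real x))"
    proof (cases n)
      case (Suc m)
      have "((\<lambda>z. d * inverse z ^ n) has_field_derivative
          d * (of_nat n * inverse (complex_of_real x) ^ (n - Suc 0)
            * - (inverse (of_real x) * 1 * inverse (of_real x)))) (at (complex_of_real x))"
        by (rule derivative_eq_intros refl | use U that in fastforce)+
      then show ?thesis by (rule DERIV_cong) (simp add: Suc mult_ac)
    qed (auto intro!: derivative_eq_intros)
    from has_vector_derivative_real_field[OF this] show ?thesis by (simp add: f o_def)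
  qed
  then show "\<exists>f'. (\<exists>d n. f' = (\<lambda>x. d * inverse (complex_of_real x) ^ n)) \<and>
             (\<forall>x\<in>U. (f has_vector_derivative f' x) (at x))"
    by (intro exI[of _ "\<lambda>x. (- d * of_nat n) * inverse (of_real x) ^ Suc n"]) blast
qed (auto intro!: exI[of _ 1])

text \<open>The invariant ranges over all smooth \<open>f\<close> and scalars \<open>c\<close>: each
  step differentiates \<open>f\<close> and collects the factor \<open>a\<close> of the chain rule in
  \<open>c\<close>.\<close>

lemma smooth_on_affine: "smooth_on UNIV f \<Longrightarrow> smooth_on UNIV (\<lambda>x. f (a * x + b))"
proof (rule smooth_on_coinduct[where P = "\<lambda>h. \<exists>f c. smooth_on UNIV f \<and> h = (\<lambda>x. c * f (a * x + b))"])
  fix h assume "\<exists>f c. smooth_on UNIV f \<and> h = (\<lambda>x. c * f (a * x + b))"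
  then obtain f c where f: "smooth_on UNIV f" "h = (\<lambda>x. c * f (a * x + b))" by blast
  have "((\<lambda>x. f (a * x + b)) has_vector_derivative a *\<^sub>R nth_deriv 1 f (a * x + b)) (at x)" for x
  proof -
    have "((\<lambda>x. a * x + b) has_vector_derivative a) (at x)"
      by (auto intro!: derivative_eq_intros)
    then show ?thesis
      using vector_diff_chain_at[OF _ smooth_on_has_vector_derivative[OF f(1) UNIV_I]]
      by (auto simp: o_def)
  qed
  then have "(h has_vector_derivative (c * of_real a) * nth_deriv 1 f (a * x + b)) (at x)" for x
    unfolding f(2) using has_vector_derivative_mult_right[of "\<lambda>x. f (a * x + b)" _ _ c]
    by (fastforce simp: scaleR_conv_of_real mult.assoc)
  moreover have "smooth_on UNIV (nth_deriv 1 f)" using f smooth_on_nth_deriv by blast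
  ultimately show "\<exists>h'. (\<exists>f c. smooth_on UNIV f \<and> h' = (\<lambda>x. c * f (a * x + b))) \<and>
             (\<forall>x\<in>UNIV. (h has_vector_derivative h' x) (at x))"
    by (intro exI[of _ "\<lambda>x. (c * of_real a) * nth_deriv 1 f (a * x + b)"]) blast
qed (auto intro!: exI[of _ 1])

lemmas smooth_on_intros =
  smooth_on_add smooth_on_mult smooth_on_const smooth_on_of_real smooth_on_uminus
  smooth_on_diff smooth_on_power smooth_on_exp

lemma nth_deriv_mult_const:
  assumes "open U" "smooth_on U f" "x \<in> U"
  shows "nth_deriv n (\<lambda>x. c * f x) x = c * nth_deriv n f x"
  using assms(2)
proof (induction n arbitrary: f)
  case (Suc n)
  have "nth_deriv (Suc n) (\<lambda>x. c * f x) x = nth_deriv n (\<lambda>x. c * nth_deriv 1 f x) x"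
    by (rule nth_deriv_Suc_eq[OF assms(1,3)])
      (intro has_vector_derivative_mult_right smooth_on_has_vector_derivative[OF Suc.prems])
  then show ?case
    using Suc.IH[OF smooth_on_nth_deriv[OF Suc.prems]] by (simp add: nth_deriv_Suc'[of n f])
qed simp

lemma nth_deriv_plus:
  assumes "open U" "smooth_on U f" "smooth_on U g" "x \<in> U"
  shows "nth_deriv n (\<lambda>x. f x + g x) x = nth_deriv n f x + nth_deriv n g x"
  using assms(2,3)
proof (induction n arbitrary: f g)
  case (Suc n)
  have "nth_deriv (Suc n) (\<lambda>x. f x + g x) x = nth_deriv n (\<lambda>x. nth_deriv 1 f x + nth_deriv 1 g x) x"
    by (rule nth_deriv_Suc_eq[OF assms(1,4)])
      (intro has_vector_derivative_add smooth_on_has_vector_derivative[of U] Suc.prems)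
  then show ?case
    using Suc.IH[OF smooth_on_nth_deriv[OF Suc.prems(1)] smooth_on_nth_deriv[OF Suc.prems(2)]]
    by (simp add: nth_deriv_Suc'[of n f] nth_deriv_Suc'[of n g])
qed simp

subsection \<open>Test functions and cutoffs\<close>

text \<open>A compact set outside which \<open>\<phi>\<close> vanishes is easier to exhibit than the
  closure of the support, which it contains.\<close>

lemma test_functionsI:
  assumes "smooth_on UNIV \<phi>" "compact C" "C \<subseteq> U" "\<And>x. x \<notin> C \<Longrightarrow> \<phi> x = 0"
  shows "\<phi> \<in> test_functions U"
proof -
  have "closure {x. \<phi> x \<noteq> 0} \<subseteq> C"
    using assms by (intro closure_minimal) (auto simp: compact_imp_closed)
  moreover from this have "compact (closure {x. \<phi> x \<noteq> 0})"
    using compact_Int_closed[OF assms(2), of "closure {x. \<phi> x \<noteq> 0}"] by (simp add: Int_absorb1)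
  ultimately show ?thesis
    using assms unfolding test_functions_def by auto
qed

lemma test_functionsE:
  assumes "\<phi> \<in> test_functions U"
  obtains C where "smooth_on UNIV \<phi>" "compact C" "C \<subseteq> U" "\<And>x. x \<notin> C \<Longrightarrow> \<phi> x = 0"
  using assms closure_subset[of "{x. \<phi> x \<noteq> 0}"] unfolding test_functions_def by blast

lemma test_functions_smooth: "\<phi> \<in> test_functions U \<Longrightarrow> smooth_on UNIV \<phi>"
  by (simp add: test_functions_def)

lemma test_functions_mono: "\<phi> \<in> test_functions U \<Longrightarrow> U \<subseteq> V \<Longrightarrow> \<phi> \<in> test_functions V"
  by (auto simp: test_functions_def)

lemma test_functions_mult:
  assumes "\<phi> \<in> test_functions U" "smooth_on UNIV f"
  shows "(\<lambda>x. f x * \<phi> x) \<in> test_functions U"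
proof -
  obtain C where "smooth_on UNIV \<phi>" "compact C" "C \<subseteq> U" "\<And>x. x \<notin> C \<Longrightarrow> \<phi> x = 0"
    using test_functionsE[OF assms(1)] by blast
  then show ?thesis
    using assms by (intro test_functionsI[of _ C]) (auto intro: smooth_on_mult)
qed

lemma test_functions_add:
  assumes "\<phi> \<in> test_functions U" "\<psi> \<in> test_functions U"
  shows "(\<lambda>x. \<phi> x + \<psi> x) \<in> test_functions U"
proof -
  obtain C where C: "smooth_on UNIV \<phi>" "compact C" "C \<subseteq> U" "\<And>x. x \<notin> C \<Longrightarrow> \<phi> x = 0"
    using test_functionsE[OF assms(1)] by blast
  obtain D where D: "smooth_on UNIV \<psi>" "compact D" "D \<subseteq> U" "\<And>x. x \<notin> D \<Longrightarrow> \<psi> x = 0"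
    using test_functionsE[OF assms(2)] by blast
  show ?thesis
    using C D by (intro test_functionsI[of _ "C \<union> D"]) (auto intro: smooth_on_add)
qed

text \<open>Here \<open>f\<close> is smooth on \<open>U\<close> only. The product is smooth there,
  and it vanishes on the open complement of a compact set inside \<open>U\<close>; these two open
  sets cover the line.\<close>

lemma test_functions_mult_local:
  assumes "\<phi> \<in> test_functions U" "open U" "smooth_on U f"
  shows "(\<lambda>x. \<phi> x * f x) \<in> test_functions U"
proof -
  obtain C where C: "smooth_on UNIV \<phi>" "compact C" "C \<subseteq> U" "\<And>x. x \<notin> C \<Longrightarrow> \<phi> x = 0"
    using test_functionsE[OF assms(1)] by blast
  have "smooth_on U (\<lambda>x. \<phi> x * f x)"
    using assms C(1) by (intro smooth_on_mult) (auto intro: smooth_on_subset)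
  moreover have "smooth_on (- C) (\<lambda>x. \<phi> x * f x)"
    using C by (intro smooth_on_cong[OF _ smooth_on_const[of _ 0]]) (auto simp: compact_imp_closed)
  ultimately have "smooth_on (U \<union> - C) (\<lambda>x. \<phi> x * f x)" by (rule smooth_on_Un)
  then show ?thesis
    using C by (intro test_functionsI[of _ C]) (auto intro: smooth_on_subset)
qed

lemma nth_deriv_zero: "nth_deriv n (\<lambda>x. 0) = (\<lambda>x. 0)"
proof (induction n)
  case (Suc n)
  have "nth_deriv (Suc n) (\<lambda>x. 0) x = 0" for x
    unfolding nth_deriv_Suc Suc by simp
  then show ?case by blast
qed simp

lemma test_functions_nth_deriv:
  assumes "\<phi> \<in> test_functions U" shows "nth_deriv n \<phi> \<in> test_functions U"
proof -
  obtain C where C: "smooth_on UNIV \<phi>" "compact C" "C \<subseteq> U" "\<And>x. x \<notin> C \<Longrightarrow> \<phi> x = 0"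
    using test_functionsE[OF assms(1)] by blast
  have "nth_deriv n \<phi> x = 0" if "x \<notin> C" for x
    using nth_deriv_cong_open[of "- C" x \<phi> "\<lambda>x. 0" n] C(2,4) that
    by (simp add: compact_imp_closed nth_deriv_zero open_Compl)
  then show ?thesis
    using C by (intro test_functionsI[of _ C]) (auto intro: smooth_on_nth_deriv)
qed

lemma test_functions_bounded:
  assumes "\<phi> \<in> test_functions U"
  obtains B where "B > 0" "\<And>x. norm (\<phi> x) \<le> B"
proof -
  obtain C where C: "smooth_on UNIV \<phi>" "compact C" "C \<subseteq> U" "\<And>x. x \<notin> C \<Longrightarrow> \<phi> x = 0"
    using test_functionsE[OF assms(1)] by blast
  have "compact (\<phi> ` C)"
    using C smooth_on_continuous[OF C(1)] by (meson compact_continuous_image continuous_on_subset subset_UNIV)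
  then obtain B where B: "B > 0" "\<And>x. x \<in> C \<Longrightarrow> norm (\<phi> x) \<le> B"
    by (metis bounded_pos compact_imp_bounded image_eqI)
  have "norm (\<phi> x) \<le> B" for x
    using B(2)[of x] C(4)[of x] B(1) by (cases "x \<in> C") auto
  with B(1) show ?thesis by (rule that)
qed

lemma test_functions_borel [measurable_dest]: "\<phi> \<in> test_functions U \<Longrightarrow> \<phi> \<in> borel_measurable borel"
  by (intro borel_measurable_continuous_onI smooth_on_continuous test_functions_smooth)

lemma test_functions_integrable:
  assumes "\<phi> \<in> test_functions U" shows "integrable lborel \<phi>"
proof -
  obtain C where C: "smooth_on UNIV \<phi>" "compact C" "C \<subseteq> U" "\<And>x. x \<notin> C \<Longrightarrow> \<phi> x = 0"
    using test_functionsE[OF assms(1)] by blast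
  have "set_integrable lborel C \<phi>"
    using C smooth_on_continuous[OF C(1)]
    unfolding set_integrable_def
    by (intro borel_integrable_compact) (auto intro: continuous_on_subset)
  moreover have "(\<lambda>x. indicat_real C x *\<^sub>R \<phi> x) = \<phi>"
    using C(4) by (auto simp: indicator_def fun_eq_iff)
  ultimately show ?thesis
    by (simp add: set_integrable_def)
qed

lemma test_functions_schwartz:
  assumes "\<phi> \<in> test_functions U" shows "\<phi> \<in> schwartz"
  unfolding schwartz_def
proof (intro CollectI conjI allI)
  show "smooth_on UNIV \<phi>" using assms test_functions_smooth by blast
  fix k m
  have "(\<lambda>x. of_real x ^ k * nth_deriv m \<phi> x) \<in> test_functions U"
    using assms
    by (intro test_functions_mult test_functions_nth_deriv smooth_on_power smooth_on_of_real) auto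
  then obtain B where "\<And>x. norm (of_real x ^ k * nth_deriv m \<phi> x) \<le> B"
    using test_functions_bounded by blast
  then show "bounded (range (\<lambda>x. x ^ k *\<^sub>R nth_deriv m \<phi> x))"
    by (intro boundedI[of _ B]) (auto simp: scaleR_conv_of_real)
qed

section \<open>Differentiation under the integral sign\<close>

lemma norm_diff_le_vector_derivative:
  fixes f :: "real \<Rightarrow> complex"
  assumes "\<And>x. (f has_vector_derivative f' x) (at x)" "\<And>x. norm (f' x) \<le> B"
  shows "norm (f x - f y) \<le> B * \<bar>x - y\<bar>"
proof -
  have "norm (f x - f y) \<le> B * norm (x - y)"
  proof (rule differentiable_bound[OF convex_UNIV])
    show "(f has_derivative (\<lambda>h. h *\<^sub>R f' x)) (at x within UNIV)" for x
      using assms(1)[of x] by (simp add: has_vector_derivative_def)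
    show "onorm (\<lambda>h. h *\<^sub>R f' x) \<le> B" for x
      using assms(2)[of x] order_trans[OF norm_ge_zero assms(2)]
      by (intro onorm_bound) (auto simp: mult.commute[of B] intro!: mult_left_mono)
  qed auto
  then show ?thesis by simp
qed

text \<open>Since \<open>w\<close> bounds the derivative, by the mean value inequality it bounds the
  difference quotients too, and \<open>2 * w\<close> dominates the remainder of the linear
  approximation. Dominated convergence along sequences gives the derivative.\<close>

lemma has_vector_derivative_integral:
  fixes F :: "real \<Rightarrow> 'a \<Rightarrow> complex"
  assumes int: "\<And>x. integrable M (F x)"
    and der: "\<And>x t. ((\<lambda>x. F x t) has_vector_derivative F' x t) (at x)"
    and meas: "\<And>x. F' x \<in> borel_measurable M"
    and bound: "\<And>x t. norm (F' x t) \<le> w t" and w: "integrable M w"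
  shows "((\<lambda>x. \<integral>t. F x t \<partial>M) has_vector_derivative (\<integral>t. F' x t \<partial>M)) (at x)"
proof -
  have intF': "integrable M (F' x)"
    using w by (rule Bochner_Integration.integrable_bound)
      (use bound meas in \<open>auto intro!: AE_I2 order_trans[OF bound abs_ge_self]\<close>)
  \<comment> \<open>The quotient that tends to 0 in the definition of the derivative, before
    integration.\<close>
  define q where "q y t = (F y t - F x t - (y - x) *\<^sub>R F' x t) /\<^sub>R norm (y - x)" for y t
  have meas_F[measurable]: "F y \<in> borel_measurable M" for y using int[of y] by auto
  note meas[measurable]
  have "((\<lambda>y. \<integral>t. q y t \<partial>M) \<longlongrightarrow> 0) (at x)"
    unfolding tendsto_at_iff_sequentially o_def
  proof (intro allI impI)
    fix X assume X: "\<forall>i. X i \<in> UNIV - {x}" "X \<longlonglongrightarrow> x"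
    have "(\<lambda>i. \<integral>t. q (X i) t \<partial>M) \<longlonglongrightarrow> (\<integral>t. 0 \<partial>M)"
    proof (rule integral_dominated_convergence[where w = "\<lambda>t. 2 * w t"])
      show "AE t in M. (\<lambda>i. q (X i) t) \<longlonglongrightarrow> 0"
      proof (rule AE_I2)
        fix t
        have "((\<lambda>y. (F y t - F x t - (y - x) *\<^sub>R F' x t) /\<^sub>R norm (y - x)) \<longlongrightarrow> 0) (at x)"
          using der[of t x] unfolding has_vector_derivative_def has_derivative_at_within by simp
        then show "(\<lambda>i. q (X i) t) \<longlonglongrightarrow> 0"
          using X unfolding q_def tendsto_at_iff_sequentially o_def by blast
      qed
      show "AE t in M. norm (q (X i) t) \<le> 2 * w t" for i
      proof (rule AE_I2)
        fix t
        have "norm (F (X i) t - F x t) \<le> w t * \<bar>X i - x\<bar>"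
          by (rule norm_diff_le_vector_derivative[OF der bound])
        moreover have "norm ((X i - x) *\<^sub>R F' x t) \<le> w t * \<bar>X i - x\<bar>"
          using bound[of x t] by (simp add: mult.commute[of "\<bar>X i - x\<bar>"] mult_right_mono)
        ultimately have "norm (F (X i) t - F x t - (X i - x) *\<^sub>R F' x t) \<le> 2 * w t * \<bar>X i - x\<bar>"
          using norm_triangle_ineq4[of "F (X i) t - F x t" "(X i - x) *\<^sub>R F' x t"] by linarith
        moreover have "X i \<noteq> x" using X by auto
        ultimately show "norm (q (X i) t) \<le> 2 * w t"
          unfolding q_def by (simp add: divide_simps mult_ac flip: divide_inverse_commute)
      qed
    qed (use w in \<open>auto simp: q_def\<close>)
    then show "(\<lambda>i. \<integral>t. q (X i) t \<partial>M) \<longlonglongrightarrow> 0" by simp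
  qed
  moreover have "(\<integral>t. q y t \<partial>M) =
      ((\<integral>t. F y t \<partial>M) - (\<integral>t. F x t \<partial>M) - (y - x) *\<^sub>R (\<integral>t. F' x t \<partial>M)) /\<^sub>R norm (y - x)" for y
    unfolding q_def using int intF' by (simp add: Bochner_Integration.integral_diff)
  ultimately show ?thesis
    unfolding has_vector_derivative_def has_derivative_at_within
    by (auto intro: bounded_linear_scaleR_left)
qed

lemma has_vector_derivative_iexp:
  fixes c :: complex
  shows "((\<lambda>\<tau>. exp (c * of_real \<tau>)) has_vector_derivative c * exp (c * of_real \<tau>)) (at \<tau>)"
proof -
  have "((\<lambda>z. exp (c * z)) has_field_derivative c * exp (c * of_real \<tau>)) (at (of_real \<tau>))"
    by (auto intro!: derivative_eq_intros)
  from has_vector_derivative_real_field[OF this] show ?thesis by (simp add: o_def)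
qed

subsection \<open>Schwartz functions\<close>

lemma schwartz_smooth: "\<psi> \<in> schwartz \<Longrightarrow> smooth_on UNIV \<psi>"
  by (simp add: schwartz_def)

lemma schwartz_bound:
  assumes "\<psi> \<in> schwartz"
  obtains C where "C \<ge> 0" "\<And>x. \<bar>x\<bar> ^ k * norm (nth_deriv m \<psi> x) \<le> C"
proof -
  have "bounded (range (\<lambda>x. x ^ k *\<^sub>R nth_deriv m \<psi> x))"
    using assms by (simp add: schwartz_def)
  then obtain C where "C > 0" "\<And>x. norm (x ^ k *\<^sub>R nth_deriv m \<psi> x) \<le> C"
    unfolding bounded_pos by blast
  then show ?thesis by (intro that[of C]) (auto simp: power_abs)
qed

lemma schwartzI:
  assumes "smooth_on UNIV \<psi>" "\<And>k m. \<exists>C. \<forall>x. \<bar>x\<bar> ^ k * norm (nth_deriv m \<psi> x) \<le> C"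
  shows "\<psi> \<in> schwartz"
  unfolding schwartz_def
proof (intro CollectI conjI allI assms(1))
  fix k m
  obtain C where "\<forall>x. \<bar>x\<bar> ^ k * norm (nth_deriv m \<psi> x) \<le> C" using assms(2) by blast
  then show "bounded (range (\<lambda>x. x ^ k *\<^sub>R nth_deriv m \<psi> x))"
    by (intro boundedI[of _ C]) (auto simp: power_abs)
qed

lemma schwartz_nth_deriv: "\<psi> \<in> schwartz \<Longrightarrow> nth_deriv n \<psi> \<in> schwartz"
  unfolding schwartz_def by (auto simp: smooth_on_nth_deriv simp flip: nth_deriv_add)

lemma schwartz_add:
  assumes "\<phi> \<in> schwartz" "\<psi> \<in> schwartz" shows "(\<lambda>x. \<phi> x + \<psi> x) \<in> schwartz"
proof (rule schwartzI)
  note s = schwartz_smooth[OF assms(1)] schwartz_smooth[OF assms(2)]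
  show "smooth_on UNIV (\<lambda>x. \<phi> x + \<psi> x)" by (intro smooth_on_add s) auto
  fix k m
  obtain C D where C: "\<And>x. \<bar>x\<bar> ^ k * norm (nth_deriv m \<phi> x) \<le> C" and D: "\<And>x. \<bar>x\<bar> ^ k * norm (nth_deriv m \<psi> x) \<le> D"
    using schwartz_bound[OF assms(1)] schwartz_bound[OF assms(2)] by metis
  have "\<bar>x\<bar> ^ k * norm (nth_deriv m (\<lambda>x. \<phi> x + \<psi> x) x) \<le> C + D" for x
  proof -
    have "\<bar>x\<bar> ^ k * norm (nth_deriv m \<phi> x + nth_deriv m \<psi> x) \<le> \<bar>x\<bar> ^ k * (norm (nth_deriv m \<phi> x) + norm (nth_deriv m \<psi> x))"
      by (intro mult_left_mono norm_triangle_ineq) auto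
    then show ?thesis
      using C[of x] D[of x] by (simp add: nth_deriv_plus[OF open_UNIV s UNIV_I] distrib_left)
  qed
  then show "\<exists>C. \<forall>x. \<bar>x\<bar> ^ k * norm (nth_deriv m (\<lambda>x. \<phi> x + \<psi> x) x) \<le> C" by blast
qed

lemma schwartz_cmult:
  assumes "\<phi> \<in> schwartz" shows "(\<lambda>x. c * \<phi> x) \<in> schwartz"
proof (rule schwartzI)
  note s = schwartz_smooth[OF assms(1)]
  show "smooth_on UNIV (\<lambda>x. c * \<phi> x)" by (intro smooth_on_mult smooth_on_const s) auto
  fix k m
  obtain C where C: "\<And>x. \<bar>x\<bar> ^ k * norm (nth_deriv m \<phi> x) \<le> C"
    using schwartz_bound[OF assms(1)] by metis
  have "\<bar>x\<bar> ^ k * norm (nth_deriv m (\<lambda>x. c * \<phi> x) x) \<le> norm c * C" for x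
    using mult_left_mono[OF C[of x], of "norm c"]
    by (simp add: nth_deriv_mult_const[OF open_UNIV s UNIV_I] norm_mult mult_ac)
  then show "\<exists>C. \<forall>x. \<bar>x\<bar> ^ k * norm (nth_deriv m (\<lambda>x. c * \<phi> x) x) \<le> C" by blast
qed

text \<open>For |x| \<le> 1 the weight is at most 2^k, beyond that it is at most (2|x|)^k, so the
  seminorms of exponents 0 and k suffice.\<close>

lemma schwartz_decay:
  assumes "\<psi> \<in> schwartz"
  obtains C where "C \<ge> 0" "\<And>x. norm (\<psi> x) * (1 + \<bar>x\<bar>) ^ k \<le> C"
proof -
  obtain C D where C: "C \<ge> 0" "\<And>x. \<bar>x\<bar> ^ 0 * norm (nth_deriv 0 \<psi> x) \<le> C"
    and D: "D \<ge> 0" "\<And>x. \<bar>x\<bar> ^ k * norm (nth_deriv 0 \<psi> x) \<le> D"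
    using schwartz_bound[OF assms] by metis
  have "norm (\<psi> x) * (1 + \<bar>x\<bar>) ^ k \<le> 2 ^ k * (C + D)" for x
  proof (cases "\<bar>x\<bar> \<le> 1")
    case True
    then have "(1 + \<bar>x\<bar>) ^ k \<le> 2 ^ k" by (intro power_mono) auto
    then have "norm (\<psi> x) * (1 + \<bar>x\<bar>) ^ k \<le> C * 2 ^ k" using C(1) C(2)[of x] by (intro mult_mono) auto
    also have "\<dots> \<le> 2 ^ k * (C + D)" using D(1) by (simp add: mult.commute)
    finally show ?thesis .
  next
    case False
    then have "(1 + \<bar>x\<bar>) ^ k \<le> (2 * \<bar>x\<bar>) ^ k" by (intro power_mono) auto
    then have "norm (\<psi> x) * (1 + \<bar>x\<bar>) ^ k \<le> norm (\<psi> x) * (2 * \<bar>x\<bar>) ^ k" by (intro mult_left_mono) auto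
    also have "\<dots> = 2 ^ k * (\<bar>x\<bar> ^ k * norm (\<psi> x))" by (simp add: power_mult_distrib mult_ac)
    also have "\<dots> \<le> 2 ^ k * (C + D)" using D(2)[of x] C(1) by (intro mult_left_mono) auto
    finally show ?thesis .
  qed
  then show ?thesis using C D by (intro that[of "2 ^ k * (C + D)"]) auto
qed

lemma schwartz_borel: "\<psi> \<in> schwartz \<Longrightarrow> \<psi> \<in> borel_measurable borel"
  by (intro borel_measurable_continuous_onI smooth_on_continuous schwartz_smooth)

lemma integrable_inverse_square:
  "integrable lborel (\<lambda>x::real. inverse (1 + x\<^sup>2))"
  using integrable_inverse_1_plus_square by (simp add: set_integrable_def)

lemma schwartz_integrable:
  assumes "\<psi> \<in> schwartz" shows "integrable lborel \<psi>"
proof -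
  obtain C where C: "C \<ge> 0" "\<And>x. norm (\<psi> x) * (1 + \<bar>x\<bar>) ^ 2 \<le> C"
    using schwartz_decay[OF assms] by metis
  have "norm (\<psi> x) \<le> norm (C * inverse (1 + x\<^sup>2))" for x
  proof -
    have "norm (\<psi> x) * (1 + x\<^sup>2) \<le> norm (\<psi> x) * (1 + \<bar>x\<bar>) ^ 2"
      by (intro mult_left_mono) (auto simp: power2_eq_square algebra_simps)
    then have "norm (\<psi> x) * (1 + x\<^sup>2) \<le> C" using C(2)[of x] by linarith
    moreover have "1 + x\<^sup>2 > 0" by (simp add: add_pos_nonneg)
    ultimately show ?thesis using C(1) by (simp add: field_simps)
  qed
  then show ?thesis
    by (intro Bochner_Integration.integrable_bound[OF integrable_mult_right[OF integrable_inverse_square, of C]])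
      (auto simp: schwartz_borel[OF assms])
qed

section \<open>Tempered functionals and the convergence of cutoffs\<close>

lemma schwartz_seminorm_le:
  "(\<And>x. \<bar>x\<bar> ^ i * norm (nth_deriv j \<phi> x) \<le> C) \<Longrightarrow> schwartz_seminorm i j \<phi> \<le> C"
  unfolding schwartz_seminorm_def by (intro cSUP_least) (auto simp: power_abs)

lemma tempered_plus:
  "tempered u \<Longrightarrow> \<phi> \<in> schwartz \<Longrightarrow> \<psi> \<in> schwartz \<Longrightarrow> u (\<lambda>x. \<phi> x + \<psi> x) = u \<phi> + u \<psi>"
  unfolding tempered_def by metis

lemma tempered_mult: "tempered u \<Longrightarrow> \<phi> \<in> schwartz \<Longrightarrow> u (\<lambda>x. z * \<phi> x) = z * u \<phi>"
  unfolding tempered_def by metis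

text \<open>A tempered functional is controlled by finitely many seminorms, so a rate 1/n in each
  seminorm, with its own constant, gives the rate 1/n for the values. The difference is written as a
  sum with (-1) times \<open>\<psi>\<close> to fit the linearity clauses of
  \<open>tempered\<close>.\<close>

lemma tempered_tendsto:
  assumes u: "tempered u" and \<psi>: "\<psi> \<in> schwartz" and \<phi>: "\<And>n. \<phi> n \<in> schwartz"
    and conv: "\<And>i j. \<exists>C. \<forall>n x. \<bar>x\<bar> ^ i * norm (nth_deriv j (\<lambda>x. \<phi> n x + (-1) * \<psi> x) x) \<le> C / real (Suc n)"
  shows "(\<lambda>n. u (\<phi> n)) \<longlonglongrightarrow> u \<psi>"
proof -
  obtain B k where Bk: "\<And>\<phi>. \<phi> \<in> schwartz \<Longrightarrow> norm (u \<phi>) \<le> B * (\<Sum>i\<le>k. \<Sum>j\<le>k. schwartz_seminorm i j \<phi>)"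
    using u unfolding tempered_def by blast
  have diff: "(\<lambda>x. \<phi> n x + (-1) * \<psi> x) \<in> schwartz" for n
    by (intro schwartz_add schwartz_cmult \<phi> \<psi>)
  have u_diff: "u (\<lambda>x. \<phi> n x + (-1) * \<psi> x) = u (\<phi> n) - u \<psi>" for n
    using tempered_plus[OF u \<phi>[of n] schwartz_cmult[OF \<psi>, of "-1"]] tempered_mult[OF u \<psi>, of "-1"] by simp
  obtain C where C: "\<And>i j n x. \<bar>x\<bar> ^ i * norm (nth_deriv j (\<lambda>x. \<phi> n x + (-1) * \<psi> x) x) \<le> C i j / real (Suc n)"
    using conv by metis
  have "norm (u (\<phi> n) - u \<psi>) \<le> \<bar>B\<bar> * (\<Sum>i\<le>k. \<Sum>j\<le>k. C i j) / real (Suc n)" for n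
  proof -
    let ?s = "\<Sum>i\<le>k. \<Sum>j\<le>k. schwartz_seminorm i j (\<lambda>x. \<phi> n x + (-1) * \<psi> x)"
    \<comment> \<open>The constant \<open>B\<close> may be negative; as the seminorms are
      nonnegative, it can be replaced by its absolute value.\<close>
    have pos: "0 \<le> schwartz_seminorm i j (\<lambda>x. \<phi> n x + (-1) * \<psi> x)" for i j
      unfolding schwartz_seminorm_def
      by (rule cSUP_upper2[of _ _ 0])
        (use diff[of n] in \<open>auto simp: schwartz_def bdd_above_norm[symmetric] image_image simp del: norm_scaleR\<close>)
    have "norm (u (\<phi> n) - u \<psi>) \<le> B * ?s" using Bk[OF diff] u_diff by simp
    also have "\<dots> \<le> \<bar>B\<bar> * ?s" using pos by (intro mult_right_mono sum_nonneg) auto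
    also have "\<dots> \<le> \<bar>B\<bar> * (\<Sum>i\<le>k. \<Sum>j\<le>k. C i j / real (Suc n))"
      by (intro mult_left_mono sum_mono schwartz_seminorm_le C) auto
    finally show ?thesis by (simp only: sum_divide_distrib[symmetric] times_divide_eq_right)
  qed
  moreover have "(\<lambda>n. \<bar>B\<bar> * (\<Sum>i\<le>k. \<Sum>j\<le>k. C i j) / real (Suc n)) \<longlonglongrightarrow> 0"
    using LIMSEQ_Suc[OF lim_const_over_n] by blast
  ultimately have "(\<lambda>n. u (\<phi> n) - u \<psi>) \<longlonglongrightarrow> 0"
    by (intro Lim_null_comparison[of "\<lambda>n. u (\<phi> n) - u \<psi>"]) auto
  then show ?thesis by (rule LIM_zero_cancel)
qed

lemma has_vector_derivative_rescale:
  assumes "smooth_on UNIV f"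
  shows "((\<lambda>x. f (x / c)) has_vector_derivative of_real (1 / c) * nth_deriv 1 f (x / c)) (at x)"
proof -
  have "((\<lambda>x. x / c) has_vector_derivative 1 / c) (at x)"
    by (cases "c = 0") (auto intro!: derivative_eq_intros)
  from vector_diff_chain_at[OF this smooth_on_has_vector_derivative[OF assms UNIV_I]]
  show ?thesis by (simp add: o_def scaleR_conv_of_real)
qed

lemma smooth_on_rescale: "smooth_on UNIV f \<Longrightarrow> smooth_on UNIV (\<lambda>x. f (x / c))"
  using smooth_on_affine[of f "1 / c" 0] by simp

text \<open>Each derivative that falls on the dilated cutoff brings a factor 1/N \<le> 1. Both
  factors vary in the induction because the product rule differentiates either of them.\<close>

lemma scaled_product_bounded:
  assumes "\<theta> \<in> test_functions UNIV" "\<psi> \<in> schwartz"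
  shows "\<exists>C. \<forall>N x. N \<ge> 1 \<longrightarrow> \<bar>x\<bar> ^ i * norm (nth_deriv j (\<lambda>x. \<theta> (x / N) * \<psi> x) x) \<le> C"
  using assms
proof (induction j arbitrary: \<theta> \<psi>)
  case 0
  obtain B where B: "\<And>x. norm (\<theta> x) \<le> B" "B > 0" using test_functions_bounded[OF 0(1)] by metis
  obtain C where C: "\<And>x. \<bar>x\<bar> ^ i * norm (nth_deriv 0 \<psi> x) \<le> C" "C \<ge> 0" using schwartz_bound[OF 0(2)] by metis
  have "\<bar>x\<bar> ^ i * norm (nth_deriv 0 (\<lambda>x. \<theta> (x / N) * \<psi> x) x) \<le> B * C" if N: "N \<ge> 1" for N x
  proof -
    have "norm (\<theta> (x / N)) * (\<bar>x\<bar> ^ i * norm (\<psi> x)) \<le> B * C"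
      using B C by (intro mult_mono) (auto intro: less_imp_le)
    then show ?thesis by (simp add: norm_mult mult_ac)
  qed
  then show ?case by blast
next
  case (Suc j)
  note s = test_functions_smooth[OF Suc.prems(1)] schwartz_smooth[OF Suc.prems(2)]
  let ?\<theta> = "nth_deriv 1 \<theta>" and ?\<psi> = "nth_deriv 1 \<psi>"
  have t: "?\<theta> \<in> test_functions UNIV" "?\<psi> \<in> schwartz"
    using Suc.prems test_functions_nth_deriv schwartz_nth_deriv by blast+
  obtain C where C: "\<And>N x. N \<ge> 1 \<Longrightarrow> \<bar>x\<bar> ^ i * norm (nth_deriv j (\<lambda>x. ?\<theta> (x / N) * \<psi> x) x) \<le> C"
    using Suc.IH[OF t(1) Suc.prems(2)] by blast
  obtain D where D: "\<And>N x. N \<ge> 1 \<Longrightarrow> \<bar>x\<bar> ^ i * norm (nth_deriv j (\<lambda>x. \<theta> (x / N) * ?\<psi> x) x) \<le> D"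
    using Suc.IH[OF Suc.prems(1) t(2)] by blast
  have "\<bar>x\<bar> ^ i * norm (nth_deriv (Suc j) (\<lambda>x. \<theta> (x / N) * \<psi> x) x) \<le> C + D" if N: "N \<ge> 1" for N x
  proof -
    define c where "c = complex_of_real (1 / N)"
    have c: "norm c = 1 / N" using N by (simp add: c_def norm_divide)
    have sm: "smooth_on UNIV (\<lambda>x. ?\<theta> (x / N) * \<psi> x)" "smooth_on UNIV (\<lambda>x. \<theta> (x / N) * ?\<psi> x)"
      using s t by (intro smooth_on_mult smooth_on_rescale smooth_on_nth_deriv open_UNIV; simp)+
    have "nth_deriv (Suc j) (\<lambda>x. \<theta> (x / N) * \<psi> x) x =
       nth_deriv j (\<lambda>x. c * (?\<theta> (x / N) * \<psi> x) + \<theta> (x / N) * ?\<psi> x) x"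
      by (rule nth_deriv_Suc_eq[OF open_UNIV UNIV_I])
        (use has_vector_derivative_mult[OF has_vector_derivative_rescale[OF s(1), of N] smooth_on_has_vector_derivative[OF s(2)]]
          in \<open>simp add: c_def mult_ac add_ac\<close>)
    also have "\<dots> = c * nth_deriv j (\<lambda>x. ?\<theta> (x / N) * \<psi> x) x + nth_deriv j (\<lambda>x. \<theta> (x / N) * ?\<psi> x) x"
      by (simp only: nth_deriv_plus[OF open_UNIV smooth_on_mult[OF open_UNIV smooth_on_const[OF open_UNIV] sm(1)] sm(2) UNIV_I]
          nth_deriv_mult_const[OF open_UNIV sm(1) UNIV_I])
    finally have eq: "nth_deriv (Suc j) (\<lambda>x. \<theta> (x / N) * \<psi> x) x = \<dots>" .
    have "norm (c * nth_deriv j (\<lambda>x. ?\<theta> (x / N) * \<psi> x) x) \<le> 1 * norm (nth_deriv j (\<lambda>x. ?\<theta> (x / N) * \<psi> x) x)"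
      unfolding norm_mult by (intro mult_right_mono) (use N c in auto)
    then have "norm (nth_deriv (Suc j) (\<lambda>x. \<theta> (x / N) * \<psi> x) x) \<le>
       norm (nth_deriv j (\<lambda>x. ?\<theta> (x / N) * \<psi> x) x) + norm (nth_deriv j (\<lambda>x. \<theta> (x / N) * ?\<psi> x) x)"
      unfolding eq by (intro order_trans[OF norm_triangle_ineq]) auto
    then have "\<bar>x\<bar> ^ i * norm (nth_deriv (Suc j) (\<lambda>x. \<theta> (x / N) * \<psi> x) x) \<le> \<bar>x\<bar> ^ i *
       (norm (nth_deriv j (\<lambda>x. ?\<theta> (x / N) * \<psi> x) x) + norm (nth_deriv j (\<lambda>x. \<theta> (x / N) * ?\<psi> x) x))"
      by (intro mult_left_mono) auto
    then show ?thesis using C[OF N, of x] D[OF N, of x] unfolding distrib_left by linarith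
  qed
  then show ?case by blast
qed

text \<open>The cutoff is Lipschitz with value 1 at 0, so one extra power of x in the Schwartz bound
  of \<open>\<psi>\<close> pays for the factor 1/N. A derivative that falls on the cutoff brings 1/N
  by itself, and what it leaves is bounded uniformly in N.\<close>

lemma scaled_cutoff_converges:
  assumes \<theta>: "\<theta> \<in> test_functions UNIV" "\<theta> 0 = 1" and \<psi>: "\<psi> \<in> schwartz"
  shows "\<exists>C. \<forall>N x. N \<ge> 1 \<longrightarrow> \<bar>x\<bar> ^ i * norm (nth_deriv j (\<lambda>x. (\<theta> (x / N) - 1) * \<psi> x) x) \<le> C / N"
  using \<psi>
proof (induction j arbitrary: \<psi>)
  case 0
  obtain B where B: "\<And>x. norm (nth_deriv 1 \<theta> x) \<le> B" "B > 0"
    using test_functions_bounded[OF test_functions_nth_deriv[OF \<theta>(1)]] by metis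
  have lip: "norm (\<theta> x - 1) \<le> B * \<bar>x\<bar>" for x
    using norm_diff_le_vector_derivative[OF smooth_on_has_vector_derivative[OF test_functions_smooth[OF \<theta>(1)]], of B x 0] B \<theta>(2) by auto
  obtain C where C: "\<And>x. \<bar>x\<bar> ^ (Suc i) * norm (nth_deriv 0 \<psi> x) \<le> C" "C \<ge> 0" using schwartz_bound[OF 0] by metis
  have "\<bar>x\<bar> ^ i * norm (nth_deriv 0 (\<lambda>x. (\<theta> (x / N) - 1) * \<psi> x) x) \<le> B * C / N" if N: "N \<ge> 1" for N x
  proof -
    have "norm (\<theta> (x / N) - 1) * (\<bar>x\<bar> ^ i * norm (\<psi> x)) \<le> B * \<bar>x / N\<bar> * (\<bar>x\<bar> ^ i * norm (\<psi> x))"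
      by (intro mult_right_mono lip) auto
    also have "\<dots> = B / N * (\<bar>x\<bar> ^ Suc i * norm (\<psi> x))" using N by (simp add: field_simps)
    also have "\<dots> \<le> B / N * C"
      using B C(1)[of x] N by (intro mult_left_mono) auto
    finally show ?thesis by (simp add: norm_mult mult_ac)
  qed
  then show ?case by blast
next
  case (Suc j)
  note s = test_functions_smooth[OF \<theta>(1)] schwartz_smooth[OF Suc.prems]
  let ?\<theta> = "nth_deriv 1 \<theta>" and ?\<psi> = "nth_deriv 1 \<psi>"
  have t: "?\<theta> \<in> test_functions UNIV" "?\<psi> \<in> schwartz"
    using Suc.prems \<theta>(1) test_functions_nth_deriv schwartz_nth_deriv by blast+
  obtain C where C: "\<And>N x. N \<ge> 1 \<Longrightarrow> \<bar>x\<bar> ^ i * norm (nth_deriv j (\<lambda>x. ?\<theta> (x / N) * \<psi> x) x) \<le> C"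
    using scaled_product_bounded[OF t(1) Suc.prems] by blast
  obtain D where D: "\<And>N x. N \<ge> 1 \<Longrightarrow> \<bar>x\<bar> ^ i * norm (nth_deriv j (\<lambda>x. (\<theta> (x / N) - 1) * ?\<psi> x) x) \<le> D / N"
    using Suc.IH[OF t(2)] by blast
  have "\<bar>x\<bar> ^ i * norm (nth_deriv (Suc j) (\<lambda>x. (\<theta> (x / N) - 1) * \<psi> x) x) \<le> (C + D) / N" if N: "N \<ge> 1" for N x
  proof -
    define c where "c = complex_of_real (1 / N)"
    have c: "norm c = 1 / N" using N by (simp add: c_def norm_divide)
    have sm: "smooth_on UNIV (\<lambda>x. ?\<theta> (x / N) * \<psi> x)" "smooth_on UNIV (\<lambda>x. (\<theta> (x / N) - 1) * ?\<psi> x)"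
      using s t by (intro smooth_on_mult smooth_on_diff smooth_on_const smooth_on_rescale smooth_on_nth_deriv open_UNIV; simp)+
    have d: "((\<lambda>x. \<theta> (x / N) - 1) has_vector_derivative c * ?\<theta> (x / N)) (at x)" for x
      using has_vector_derivative_diff[OF has_vector_derivative_rescale[OF s(1), of "N" x] has_vector_derivative_const[of 1]]
      by (simp only: c_def diff_0_right)
    have "nth_deriv (Suc j) (\<lambda>x. (\<theta> (x / N) - 1) * \<psi> x) x =
       nth_deriv j (\<lambda>x. c * (?\<theta> (x / N) * \<psi> x) + (\<theta> (x / N) - 1) * ?\<psi> x) x"
      by (rule nth_deriv_Suc_eq[OF open_UNIV UNIV_I])
        (use has_vector_derivative_mult[OF d smooth_on_has_vector_derivative[OF s(2)]]
          in \<open>simp add: c_def mult_ac add_ac\<close>)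
    also have "\<dots> = c * nth_deriv j (\<lambda>x. ?\<theta> (x / N) * \<psi> x) x + nth_deriv j (\<lambda>x. (\<theta> (x / N) - 1) * ?\<psi> x) x"
      by (simp only: nth_deriv_plus[OF open_UNIV smooth_on_mult[OF open_UNIV smooth_on_const[OF open_UNIV] sm(1)] sm(2) UNIV_I]
          nth_deriv_mult_const[OF open_UNIV sm(1) UNIV_I])
    finally have eq: "nth_deriv (Suc j) (\<lambda>x. (\<theta> (x / N) - 1) * \<psi> x) x = \<dots>" .
    have "norm (nth_deriv (Suc j) (\<lambda>x. (\<theta> (x / N) - 1) * \<psi> x) x) \<le>
       1 / N * norm (nth_deriv j (\<lambda>x. ?\<theta> (x / N) * \<psi> x) x) + norm (nth_deriv j (\<lambda>x. (\<theta> (x / N) - 1) * ?\<psi> x) x)"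
      unfolding eq by (intro order_trans[OF norm_triangle_ineq]) (auto simp: norm_mult c)
    then have "\<bar>x\<bar> ^ i * norm (nth_deriv (Suc j) (\<lambda>x. (\<theta> (x / N) - 1) * \<psi> x) x) \<le> \<bar>x\<bar> ^ i *
       (1 / N * norm (nth_deriv j (\<lambda>x. ?\<theta> (x / N) * \<psi> x) x) + norm (nth_deriv j (\<lambda>x. (\<theta> (x / N) - 1) * ?\<psi> x) x))"
      by (intro mult_left_mono) auto
    also have "\<dots> = 1 / N * (\<bar>x\<bar> ^ i * norm (nth_deriv j (\<lambda>x. ?\<theta> (x / N) * \<psi> x) x))
       + \<bar>x\<bar> ^ i * norm (nth_deriv j (\<lambda>x. (\<theta> (x / N) - 1) * ?\<psi> x) x)"
      by (simp only: distrib_left mult_ac)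
    also have "\<dots> \<le> 1 / N * C + D / N"
      by (intro add_mono mult_left_mono C D N) (use N in auto)
    finally show ?thesis by (simp add: add_divide_distrib)
  qed
  then show ?case by blast
qed

text \<open>A smooth transition from 0 to 1 within [0, R]. A primitive of
  \<open>\<chi>\<^sub>0\<close> is one, so the hypothesis on \<open>\<chi>\<^sub>0\<close> supplies
  every cutoff of the proof. \<open>B\<close> bounds both the function and its derivative.\<close>

locale smooth_step =
  fixes F :: "real \<Rightarrow> complex" and R B :: real
  assumes smooth: "smooth_on UNIV F" and zero: "\<And>x. x \<le> 0 \<Longrightarrow> F x = 0"
    and R: "R > 0" and one: "\<And>x. x \<ge> R \<Longrightarrow> F x = 1"
    and bound: "\<And>x. norm (F x) \<le> B" and deriv_bound: "\<And>x. norm (nth_deriv 1 F x) \<le> B"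

lemma lebesgue_integral_eq_lborel:
  fixes f :: "real \<Rightarrow> complex"
  shows "f \<in> borel_measurable borel \<Longrightarrow> (LINT x|lebesgue. f x) = (LINT x|lborel. f x)"
  by (intro integral_completion) simp

lemma smooth_step_exists:
  assumes \<rho>: "\<rho> \<in> test_functions {0<..}" and int: "(LINT \<sigma>:{0<..}|lebesgue. \<rho> \<sigma>) = 1"
  obtains F R B where "smooth_step F R B"
proof -
  obtain C where C: "smooth_on UNIV \<rho>" "compact C" "C \<subseteq> {0<..}" "\<And>x. x \<notin> C \<Longrightarrow> \<rho> x = 0"
    using test_functionsE[OF \<rho>] by metis
  obtain R where R: "R > 0" "\<And>x. x \<in> C \<Longrightarrow> norm x \<le> R"
    using compact_imp_bounded[OF C(2)] unfolding bounded_pos by metis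
  have out: "\<rho> x = 0" if "x \<le> 0 \<or> x > R" for x
    using C(3) C(4)[of x] R(2)[of x] that by fastforce
  have cont: "continuous_on S \<rho>" for S
    using smooth_on_continuous[OF C(1)] continuous_on_subset by blast
  define F where "F x = integral {-1..x} \<rho>" for x
  have zero: "F x = 0" if "x \<le> 0" for x
    unfolding F_def using out that by (intro integral_unique has_integral_is_0) auto
  have total: "(LINT x|lborel. \<rho> x) = 1"
  proof -
    have "(LINT \<sigma>:{0<..}|lebesgue. \<rho> \<sigma>) = (LINT x|lebesgue. \<rho> x)"
      unfolding set_lebesgue_integral_def using out
      by (intro Bochner_Integration.integral_cong) (auto simp: indicator_def)
    then show ?thesis using int lebesgue_integral_eq_lborel[OF test_functions_borel[OF \<rho>]] by simp
  qed
  have one: "F x = 1" if "x \<ge> R" for x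
  proof -
    have "set_integrable lborel {-1..x} \<rho>" by (intro borel_integrable_atLeastAtMost' cont)
    then have "F x = (LINT y:{-1..x}|lborel. \<rho> y)"
      unfolding F_def by (simp add: set_borel_integral_eq_integral(2))
    also have "\<dots> = (LINT y|lborel. \<rho> y)"
      unfolding set_lebesgue_integral_def using out that
      by (intro Bochner_Integration.integral_cong) (auto simp: indicator_def)
    finally show ?thesis using total by simp
  qed
  \<comment> \<open>To the left of 0 the function is constantly 0. Otherwise x is an interior point
    of {-1..x+1}, and the derivative within that interval is a full derivative.\<close>
  have der: "(F has_vector_derivative \<rho> x) (at x)" for x
  proof (cases "x < 0")
    case True
    have "(F has_vector_derivative 0) (at x)"
      by (rule has_vector_derivative_transform_within_open[of "\<lambda>x. 0" _ _ "{..<0}"])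
        (use True zero in auto)
    then show ?thesis using out[of x] True by simp
  next
    case False
    have "((\<lambda>u. integral {-1..u} \<rho>) has_vector_derivative \<rho> x) (at x within {-1..x+1})"
      using False by (intro integral_has_vector_derivative cont) auto
    then show ?thesis
      using at_within_interior[of x "{-1..x+1}"] False by (simp add: F_def[abs_def])
  qed
  have smooth: "smooth_on UNIV F"
    using smooth_on_derivD[OF open_UNIV C(1) der] .
  have dF: "nth_deriv 1 F x = \<rho> x" for x
    using nth_deriv_Suc_eq[OF open_UNIV UNIV_I der, of 0 x] by simp
  obtain B1 where B1: "\<And>x. norm (\<rho> x) \<le> B1" using test_functions_bounded[OF \<rho>] by metis
  have "compact (F ` {0..R})"
    by (intro compact_continuous_image continuous_on_subset[OF smooth_on_continuous[OF smooth]]) auto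
  then obtain B2 where B2: "B2 > 0" "\<And>x. x \<in> {0..R} \<Longrightarrow> norm (F x) \<le> B2"
    by (metis bounded_pos compact_imp_bounded image_eqI)
  have "norm (F x) \<le> max 1 (max B1 B2)" for x
  proof -
    consider "x \<le> 0" | "x \<ge> R" | "x \<in> {0..R}" by force
    then show ?thesis
      by cases (use zero[of x] one[of x] B2(2)[of x] in auto)
  qed
  moreover have "norm (nth_deriv 1 F x) \<le> max 1 (max B1 B2)" for x
    unfolding dF using B1[of x] by auto
  ultimately have "smooth_step F R (max 1 (max B1 B2))"
    using smooth zero R(1) one by unfold_locales auto
  then show ?thesis by (rule that)
qed

context smooth_step
begin

text \<open>A smooth indicator of {a..b}. For \<open>d > 0\<close> its two transitions take place in
  [a, a + R d] and [b - R d, b], so \<open>d\<close> is their scale, while the bound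
  \<open>B * B\<close> does not depend on \<open>d\<close>.\<close>

definition bump :: "real \<Rightarrow> real \<Rightarrow> real \<Rightarrow> real \<Rightarrow> complex" where
  "bump a b d x = F ((x - a) / d) * F ((b - x) / d)"

lemma smooth_bump: "smooth_on UNIV (bump a b d)"
  unfolding bump_def[abs_def]
  using smooth_on_affine[OF smooth, of "1 / d" "- a / d"] smooth_on_affine[OF smooth, of "- 1 / d" "b / d"]
  by (intro smooth_on_mult) (auto simp: diff_divide_distrib)

lemma bump_zero: "d > 0 \<Longrightarrow> x \<le> a \<or> x \<ge> b \<Longrightarrow> bump a b d x = 0"
  unfolding bump_def using zero[of "(x - a) / d"] zero[of "(b - x) / d"] by (auto simp: field_simps)

lemma bump_one: "d > 0 \<Longrightarrow> a + R * d \<le> x \<Longrightarrow> x \<le> b - R * d \<Longrightarrow> bump a b d x = 1"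
  unfolding bump_def using one[of "(x - a) / d"] one[of "(b - x) / d"] by (auto simp: field_simps)

lemma bump_test: "d > 0 \<Longrightarrow> {a..b} \<subseteq> U \<Longrightarrow> bump a b d \<in> test_functions U"
  by (rule test_functionsI[OF smooth_bump, of "{a..b}"]) (auto simp: bump_zero)

lemma B_nonneg: "B \<ge> 0"
  using bound[of 0] norm_ge_zero order_trans by blast

lemma bump_bound: "norm (bump a b d x) \<le> B * B"
  unfolding bump_def norm_mult by (intro mult_mono bound B_nonneg norm_ge_zero)

lemma bump_tendsto_indicator:
  assumes "x \<noteq> a" "x \<noteq> b"
  shows "(\<lambda>n. bump a b (1 / real (Suc n)) x) \<longlonglongrightarrow> indicator {a..b} x"
proof (cases "a < x \<and> x < b")
  case True
  define e where "e = min (x - a) (b - x)"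
  have e: "e > 0" using True by (auto simp: e_def)
  have "(\<lambda>n. R * (1 / real (Suc n))) \<longlonglongrightarrow> R * 0"
    by (intro tendsto_mult_left LIMSEQ_Suc[OF lim_1_over_n])
  then have "\<forall>\<^sub>F n in sequentially. R * (1 / real (Suc n)) < e"
    using e by (intro order_tendstoD(2)) auto
  then have "\<forall>\<^sub>F n in sequentially. bump a b (1 / real (Suc n)) x = indicator {a..b} x"
  proof eventually_elim
    case (elim n)
    then have "bump a b (1 / real (Suc n)) x = 1" by (intro bump_one) (auto simp: e_def)
    then show ?case using True by (simp add: indicator_def)
  qed
  then show ?thesis by (rule tendsto_eventually)
next
  case False
  then have "bump a b (1 / real (Suc n)) x = 0" for n using assms by (intro bump_zero) auto
  moreover have "indicator {a..b} x = (0::complex)" using False assms by (auto simp: indicator_def)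
  ultimately show ?thesis by simp
qed

text \<open>A test function with value 1 at the origin, whose dilations serve as cutoffs that
  exhaust the line.\<close>

lemma bump_unit_at_0: "bump (- 2 * R) (2 * R) 1 0 = 1"
  using R by (intro bump_one) auto

end

subsection \<open>The Fourier transform\<close>

lemma borel_measurable_kernel [measurable]:
  "(\<lambda>x. exp (- (\<i> * complex_of_real \<tau> * complex_of_real x))) \<in> borel_measurable borel"
  by (intro borel_measurable_continuous_onI continuous_intros)

lemma fourier_lborel:
  "f \<in> borel_measurable borel \<Longrightarrow>
    fourier f \<tau> = (LINT \<sigma>|lborel. exp (- (\<i> * of_real \<tau> * of_real \<sigma>)) * f \<sigma>)"
  unfolding fourier_def by (intro lebesgue_integral_eq_lborel) simp

lemma integrable_bounded_mult:
  fixes f k :: "real \<Rightarrow> complex"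
  assumes "integrable lborel f" "k \<in> borel_measurable borel" "\<And>x. norm (k x) \<le> C"
  shows "integrable lborel (\<lambda>x. k x * f x)"
proof (rule Bochner_Integration.integrable_bound[of _ "\<lambda>x. C * norm (f x)"])
  show "AE x in lborel. norm (k x * f x) \<le> norm (C * norm (f x))"
    using assms(3) by (intro AE_I2) (auto simp: norm_mult abs_mult intro!: mult_right_mono order_trans[OF _ abs_ge_self])
qed (use assms in auto)

lemma integrable_kernel:
  "integrable lborel f \<Longrightarrow> integrable lborel (\<lambda>\<sigma>. exp (- (\<i> * of_real \<tau> * of_real \<sigma>)) * f \<sigma>)"
  by (rule integrable_bounded_mult[where C = 1]) (auto simp: norm_exp_eq_Re)

lemma norm_fourier_le:
  assumes "integrable lborel f" shows "norm (fourier f \<tau>) \<le> (LINT \<sigma>|lborel. norm (f \<sigma>))"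
proof -
  have "norm (LINT \<sigma>|lborel. exp (- (\<i> * of_real \<tau> * of_real \<sigma>)) * f \<sigma>) \<le> (LINT \<sigma>|lborel. norm (exp (- (\<i> * of_real \<tau> * of_real \<sigma>)) * f \<sigma>))"
    by (rule integral_norm_bound)
  then show ?thesis using assms by (subst fourier_lborel) (auto simp: norm_mult norm_exp_eq_Re)
qed

lemma fourier_add:
  assumes "integrable lborel f" "integrable lborel g"
  shows "fourier (\<lambda>x. f x + g x) \<tau> = fourier f \<tau> + fourier g \<tau>"
  using assms integrable_kernel[OF assms(1)] integrable_kernel[OF assms(2)]
  by (simp add: fourier_lborel distrib_left Bochner_Integration.integral_add)

lemma fourier_cmult: "fourier (\<lambda>x. c * f x) \<tau> = c * fourier f \<tau>"
  by (simp add: fourier_def mult.left_commute[of _ c])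

lemma fourier_has_vector_derivative:
  assumes f: "integrable lborel f" and xf: "integrable lborel (\<lambda>x. of_real x * f x)"
  shows "(fourier f has_vector_derivative fourier (\<lambda>x. - \<i> * of_real x * f x) \<tau>) (at \<tau>)"
proof -
  have m[measurable]: "f \<in> borel_measurable borel" using f by auto
  have "((\<lambda>\<tau>. LINT \<sigma>|lborel. exp (- (\<i> * of_real \<tau> * of_real \<sigma>)) * f \<sigma>) has_vector_derivative
     (LINT \<sigma>|lborel. exp (- (\<i> * of_real \<tau> * of_real \<sigma>)) * (- \<i> * of_real \<sigma> * f \<sigma>))) (at \<tau>)"
  proof (rule has_vector_derivative_integral[where w = "\<lambda>x. norm (of_real x * f x)"])
    show "integrable lborel (\<lambda>\<sigma>. exp (- (\<i> * of_real \<tau> * of_real \<sigma>)) * f \<sigma>)" for \<tau>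
      by (rule integrable_kernel[OF f])
    show "((\<lambda>\<tau>. exp (- (\<i> * of_real \<tau> * of_real \<sigma>)) * f \<sigma>) has_vector_derivative
        exp (- (\<i> * of_real \<tau> * of_real \<sigma>)) * (- \<i> * of_real \<sigma> * f \<sigma>)) (at \<tau>)" for \<tau> \<sigma>
      using has_vector_derivative_mult_left[OF has_vector_derivative_iexp[of "- \<i> * of_real \<sigma>" \<tau>], of "f \<sigma>"]
      by (simp add: mult_ac)
    show "norm (exp (- (\<i> * of_real \<tau> * of_real \<sigma>)) * (- \<i> * of_real \<sigma> * f \<sigma>)) \<le> norm (of_real \<sigma> * f \<sigma>)" for \<tau> \<sigma>
      by (simp add: norm_mult norm_exp_eq_Re)
    show "integrable lborel (\<lambda>x. norm (of_real x * f x))" using xf by (rule integrable_norm)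
  qed measurable
  moreover have "fourier f = (\<lambda>\<tau>. LINT \<sigma>|lborel. exp (- (\<i> * of_real \<tau> * of_real \<sigma>)) * f \<sigma>)"
    by (simp add: fourier_lborel fun_eq_iff)
  ultimately show ?thesis
    by (simp add: fourier_lborel)
qed

lemma integral_deriv_test_function:
  assumes "\<phi> \<in> test_functions UNIV" shows "(LINT x|lborel. nth_deriv 1 \<phi> x) = 0"
proof -
  obtain C where C: "smooth_on UNIV \<phi>" "compact C" "\<And>x. x \<notin> C \<Longrightarrow> \<phi> x = 0"
    using test_functionsE[OF assms] by metis
  obtain D where D: "compact D" "\<And>x. x \<notin> D \<Longrightarrow> nth_deriv 1 \<phi> x = 0"
    using test_functionsE[OF test_functions_nth_deriv[OF assms]] by metis
  obtain R where R: "R > 0" "\<And>x. x \<in> C \<union> D \<Longrightarrow> norm x \<le> R"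
    using compact_imp_bounded[OF compact_Un[OF C(2) D(1)]] unfolding bounded_pos by metis
  have out: "\<phi> x = 0" "nth_deriv 1 \<phi> x = 0" if "\<bar>x\<bar> > R" for x
    using R(2)[of x] that C(3)[of x] D(2)[of x] by fastforce+
  have "(LINT x|lborel. indicator {-(R+1)..R+1} x *\<^sub>R nth_deriv 1 \<phi> x) = \<phi> (R+1) - \<phi> (-(R+1))"
    using R(1) by (intro integral_FTC_atLeastAtMost)
      (auto intro: has_vector_derivative_at_within smooth_on_has_vector_derivative[OF C(1)]
        continuous_on_subset[OF smooth_on_continuous[OF smooth_on_nth_deriv[OF C(1)]]] simp del: One_nat_def)
  moreover have "(\<lambda>x. indicator {-(R+1)..R+1} x *\<^sub>R nth_deriv 1 \<phi> x) = nth_deriv 1 \<phi>"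
  proof
    fix x show "indicator {-(R+1)..R+1} x *\<^sub>R nth_deriv 1 \<phi> x = nth_deriv 1 \<phi> x"
      using out(2)[of x] by (cases "\<bar>x\<bar> \<le> R") (auto simp: indicator_def)
  qed
  ultimately show ?thesis using out[of "R+1"] out[of "-(R+1)"] R by simp
qed

text \<open>The derivative of the test function e^{-i\<tau>x} \<phi>(x) integrates to 0.\<close>

lemma fourier_nth_deriv_1:
  assumes "\<phi> \<in> test_functions UNIV"
  shows "fourier (nth_deriv 1 \<phi>) \<tau> = \<i> * of_real \<tau> * fourier \<phi> \<tau>"
proof -
  define e where "e x = exp (- (\<i> * of_real \<tau>) * of_real x)" for x :: real
  have se: "smooth_on UNIV e" unfolding e_def[abs_def] by (rule smooth_on_exp) simp
  have t: "(\<lambda>x. e x * \<phi> x) \<in> test_functions UNIV" by (rule test_functions_mult[OF assms se])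
  have d: "nth_deriv 1 (\<lambda>x. e x * \<phi> x) x = e x * nth_deriv 1 \<phi> x - \<i> * of_real \<tau> * (e x * \<phi> x)" for x
  proof -
    have "(e has_vector_derivative - (\<i> * of_real \<tau>) * e x) (at x)" for x
      unfolding e_def by (rule has_vector_derivative_iexp)
    from has_vector_derivative_mult[OF this smooth_on_has_vector_derivative[OF test_functions_smooth[OF assms] UNIV_I]]
    have "((\<lambda>x. e x * \<phi> x) has_vector_derivative e x * nth_deriv 1 \<phi> x + - (\<i> * of_real \<tau>) * e x * \<phi> x) (at x)" for x .
    from nth_deriv_Suc_eq[OF open_UNIV UNIV_I this, of 0 x] show ?thesis by simp
  qed
  note i1 = test_functions_integrable[OF t]
  have i2: "integrable lborel (\<lambda>x. e x * nth_deriv 1 \<phi> x)"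
    using test_functions_integrable[OF test_functions_mult[OF test_functions_nth_deriv[OF assms, of 1] se]] .
  have "0 = (LINT x|lborel. e x * nth_deriv 1 \<phi> x - \<i> * of_real \<tau> * (e x * \<phi> x))"
    using integral_deriv_test_function[OF t] unfolding d by simp
  also have "\<dots> = (LINT x|lborel. e x * nth_deriv 1 \<phi> x) - \<i> * of_real \<tau> * (LINT x|lborel. e x * \<phi> x)"
    using i1 i2 by (subst Bochner_Integration.integral_diff) auto
  finally show ?thesis
    using test_functions_borel[OF assms] test_functions_borel[OF test_functions_nth_deriv[OF assms, of 1]]
    by (simp add: fourier_lborel e_def mult.assoc)
qed

lemma test_functions_mult_of_real:
  "\<phi> \<in> test_functions U \<Longrightarrow> (\<lambda>x. c * of_real x * \<phi> x) \<in> test_functions U"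
  by (rule test_functions_mult) (auto intro!: smooth_on_mult smooth_on_const smooth_on_of_real)

lemma fourier_test_step:
  assumes "\<phi> \<in> test_functions UNIV"
  shows "\<exists>\<phi>'\<in>test_functions UNIV. \<forall>x. (fourier \<phi> has_vector_derivative fourier \<phi>' x) (at x)"
proof
  show "(\<lambda>x. - \<i> * of_real x * \<phi> x) \<in> test_functions UNIV" by (rule test_functions_mult_of_real[OF assms])
  show "\<forall>x. (fourier \<phi> has_vector_derivative fourier (\<lambda>x. - \<i> * of_real x * \<phi> x) x) (at x)"
    using fourier_has_vector_derivative[OF test_functions_integrable[OF assms]]
      test_functions_integrable[OF test_functions_mult_of_real[OF assms, of 1]] by simp
qed

text \<open>Each power of \<tau> is traded for a derivative of \<open>\<phi>\<close>, which is again
  a test function with a bounded transform.\<close>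

lemma fourier_decay:
  assumes "\<phi> \<in> test_functions UNIV"
  shows "\<exists>C. \<forall>\<tau>. \<bar>\<tau>\<bar> ^ k * norm (fourier \<phi> \<tau>) \<le> C"
  using assms
proof (induction k arbitrary: \<phi>)
  case 0
  then show ?case using norm_fourier_le[OF test_functions_integrable[OF 0]] by auto
next
  case (Suc k)
  obtain C where "\<And>\<tau>. \<bar>\<tau>\<bar> ^ k * norm (fourier (nth_deriv 1 \<phi>) \<tau>) \<le> C"
    using Suc.IH[OF test_functions_nth_deriv[OF Suc.prems]] by blast
  then have "\<bar>\<tau>\<bar> ^ Suc k * norm (fourier \<phi> \<tau>) \<le> C" for \<tau>
    unfolding fourier_nth_deriv_1[OF Suc.prems] by (simp add: norm_mult mult_ac)
  then show ?case by blast
qed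

text \<open>The transforms of test functions form a class closed under differentiation, so the rapid
  decay of each member bounds all the Schwartz seminorms.\<close>

lemma fourier_schwartz:
  assumes "\<phi> \<in> test_functions UNIV" shows "fourier \<phi> \<in> schwartz"
proof (rule schwartzI)
  let ?P = "\<lambda>f. \<exists>\<phi>\<in>test_functions UNIV. f = fourier \<phi>"
  have step: "\<exists>f'. ?P f' \<and> (\<forall>x\<in>UNIV. (f has_vector_derivative f' x) (at x))" if "?P f" for f
    using that fourier_test_step by blast
  have P: "?P (fourier \<phi>)" using assms by blast
  show "smooth_on UNIV (fourier \<phi>)"
    by (rule smooth_on_coinduct[of UNIV ?P, OF open_UNIV P step])
  fix k m
  obtain \<phi>' where "\<phi>' \<in> test_functions UNIV" "\<forall>x. nth_deriv m (fourier \<phi>) x = fourier \<phi>' x"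
    using nth_deriv_eq_coinduct[of UNIV ?P "fourier \<phi>" m, OF open_UNIV P step] by auto
  then show "\<exists>C. \<forall>x. \<bar>x\<bar> ^ k * norm (nth_deriv m (fourier \<phi>) x) \<le> C"
    using fourier_decay by simp
qed

text \<open>The kernel is bounded, so C |f| |g| dominates the integrand on the plane. Both the
  complex exponential and the mollifying kernel are of this kind.\<close>

lemma lborel_Fubini_kernel:
  fixes f g :: "real \<Rightarrow> complex" and k :: "real \<Rightarrow> real \<Rightarrow> complex"
  assumes f: "integrable lborel f" and g: "integrable lborel g"
    and k: "(\<lambda>p. k (fst p) (snd p)) \<in> borel_measurable (borel \<Otimes>\<^sub>M borel)"
    and bound: "\<And>x y. norm (k x y) \<le> C"
  shows "(LINT y|lborel. (LINT x|lborel. k x y * f x) * g y) = (LINT x|lborel. f x * (LINT y|lborel. k x y * g y))"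
proof -
  have m[measurable]: "f \<in> borel_measurable borel" "g \<in> borel_measurable borel" using f g by auto
  note k[measurable]
  have kxy[measurable]: "(\<lambda>y. k x y) \<in> borel_measurable borel" "(\<lambda>y. k y x) \<in> borel_measurable borel" for x
    using measurable_compose[of "\<lambda>y. (x, y)" borel "borel \<Otimes>\<^sub>M borel", OF _ k]
      measurable_compose[of "\<lambda>y. (y, x)" borel "borel \<Otimes>\<^sub>M borel", OF _ k] by simp_all
  have C: "C \<ge> 0" using bound[of 0 0] norm_ge_zero order_trans by blast
  have int: "integrable (lborel \<Otimes>\<^sub>M lborel) (\<lambda>(x, y). k x y * f x * g y)"
  proof (rule Bochner_Integration.integrable_bound)
    show "integrable (lborel \<Otimes>\<^sub>M lborel) (\<lambda>(x, y). (C * norm (f x)) * norm (g y))"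
    proof (rule lborel_pair.Fubini_integrable)
      show "(\<lambda>(x, y). (C * norm (f x)) * norm (g y)) \<in> borel_measurable (lborel \<Otimes>\<^sub>M lborel)"
        by measurable
    qed (use f g C in \<open>auto simp: abs_mult\<close>)
    have "(\<lambda>p. k (fst p) (snd p) * f (fst p) * g (snd p)) \<in> borel_measurable (borel \<Otimes>\<^sub>M borel)"
      by measurable
    then show "(\<lambda>(x, y). k x y * f x * g y) \<in> borel_measurable (lborel \<Otimes>\<^sub>M lborel)"
      by (simp add: case_prod_beta cong: measurable_cong_sets sets_pair_measure_cong)
    show "AE p in lborel \<Otimes>\<^sub>M lborel. norm ((\<lambda>(x, y). k x y * f x * g y) p) \<le> norm ((\<lambda>(x, y). (C * norm (f x)) * norm (g y)) p)"
      using bound C by (intro AE_I2) (auto simp: norm_mult abs_mult intro!: mult_right_mono)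
  qed
  have "(LINT y|lborel. (LINT x|lborel. k x y * f x * g y)) = (LINT x|lborel. (LINT y|lborel. k x y * f x * g y))"
    using lborel_pair.Fubini_integral[of "\<lambda>x y. k x y * f x * g y"] int by simp
  moreover have "(LINT x|lborel. k x y * f x * g y) = (LINT x|lborel. k x y * f x) * g y" for y
    by simp
  moreover have "(LINT y|lborel. k x y * f x * g y) = f x * (LINT y|lborel. k x y * g y)" for x
    by (simp add: mult_ac flip: integral_mult_right_zero)
  ultimately show ?thesis by simp
qed

lemma borel_measurable_kernel2 [measurable]:
  "(\<lambda>p. exp (- (\<i> * complex_of_real (snd p) * complex_of_real (fst p)))) \<in> borel_measurable (borel \<Otimes>\<^sub>M borel)"
  unfolding borel_prod by (intro borel_measurable_continuous_onI continuous_intros)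

lemma fourier_multiplication:
  assumes f: "integrable lborel f" and g: "integrable lborel g"
  shows "(LINT \<tau>|lborel. fourier f \<tau> * g \<tau>) = (LINT \<sigma>|lborel. f \<sigma> * fourier g \<sigma>)"
proof -
  have m: "f \<in> borel_measurable borel" "g \<in> borel_measurable borel" using f g by auto
  show ?thesis
    using lborel_Fubini_kernel[OF f g borel_measurable_kernel2, of 1]
    by (simp add: fourier_lborel m norm_exp_eq_Re mult_ac)
qed

section \<open>Fourier inversion by Gaussian summation\<close>

lemma integrable_lebesgue_iff_lborel:
  fixes f :: "real \<Rightarrow> 'a::{banach, second_countable_topology}"
  shows "f \<in> borel_measurable borel \<Longrightarrow> integrable lebesgue f \<longleftrightarrow> integrable lborel f"
  by (intro integrable_completion) simp

lemma gaussian_eq_density: "exp (- (t\<^sup>2) / 2) = sqrt (2 * pi) * std_normal_density t"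
  by (simp add: std_normal_density_def)

lemma integrable_gaussian:
  assumes "N > 0" shows "integrable lborel (\<lambda>t. complex_of_real (exp (- ((t / N)\<^sup>2) / 2)))"
proof -
  have "integrable lborel (\<lambda>t. sqrt (2 * pi) * std_normal_density (0 + 1 / N * t))"
    using assms by (intro integrable_mult_right lborel_integrable_real_affine) auto
  then show ?thesis unfolding gaussian_eq_density by (simp del: of_real_mult)
qed

text \<open>After the substitution \<tau> = N t the integral is a multiple of the characteristic
  function of the normal distribution at N s, which is again Gaussian.\<close>

lemma gaussian_fourier:
  assumes N: "N > 0"
  shows "(LINT \<tau>|lborel. exp (\<i> * of_real \<tau> * of_real s) * complex_of_real (exp (- ((\<tau> / N)\<^sup>2) / 2)))
    = of_real (2 * pi * N * std_normal_density (N * s))"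
proof -
  have "(LINT \<tau>|lborel. exp (\<i> * of_real \<tau> * of_real s) * complex_of_real (exp (- ((\<tau> / N)\<^sup>2) / 2)))
    = N *\<^sub>R (LINT t|lborel. exp (\<i> * of_real (N * t) * of_real s) * complex_of_real (exp (- (t\<^sup>2) / 2)))"
    using N by (subst lborel_integral_real_affine[of N _ 0]) auto
  also have "(LINT t|lborel. exp (\<i> * of_real (N * t) * of_real s) * complex_of_real (exp (- (t\<^sup>2) / 2)))
     = of_real (sqrt (2 * pi)) * (LINT t|lborel. std_normal_density t *\<^sub>R iexp ((N * s) * t))"
    unfolding gaussian_eq_density
    by (simp add: scaleR_conv_of_real mult_ac flip: integral_mult_right_zero)
  also have "(LINT t|lborel. std_normal_density t *\<^sub>R iexp ((N * s) * t)) = char std_normal_distribution (N * s)"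
    unfolding char_def by (subst integral_density) auto
  also have "\<dots> = of_real (sqrt (2 * pi) * std_normal_density (N * s))"
    unfolding char_std_normal_distribution gaussian_eq_density ..
  finally show ?thesis
    by (simp add: scaleR_conv_of_real flip: of_real_mult)
qed

definition inverse_fourier :: "(real \<Rightarrow> complex) \<Rightarrow> real \<Rightarrow> complex" where
  "inverse_fourier f \<tau> = of_real (1 / (2 * pi)) * fourier f (- \<tau>)"

lemma inverse_fourier_schwartz:
  assumes "\<omega> \<in> test_functions UNIV" shows "inverse_fourier \<omega> \<in> schwartz"
proof -
  have "(\<lambda>\<tau>. \<omega> (- \<tau>)) \<in> test_functions UNIV"
  proof -
    obtain C where C: "smooth_on UNIV \<omega>" "compact C" "\<And>x. x \<notin> C \<Longrightarrow> \<omega> x = 0"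
      using test_functionsE[OF assms] by metis
    show ?thesis
    proof (rule test_functionsI[of _ "uminus ` C"])
      show "\<omega> (- x) = 0" if "x \<notin> uminus ` C" for x
        using that C(3)[of "- x"] by (force simp: image_iff)
    qed (use smooth_on_affine[OF C(1), of "-1" 0] compact_continuous_image[OF _ C(2)] continuous_on_minus[OF continuous_on_id]
        in auto)
  qed
  then have "(\<lambda>\<tau>. of_real (1 / (2 * pi)) * fourier (\<lambda>\<tau>. \<omega> (- \<tau>)) \<tau>) \<in> schwartz"
    by (intro schwartz_cmult fourier_schwartz)
  moreover have "fourier (\<lambda>\<tau>. \<omega> (- \<tau>)) \<tau> = fourier \<omega> (- \<tau>)" for \<tau>
  proof -
    have m[measurable]: "\<omega> \<in> borel_measurable borel" using test_functions_borel[OF assms] .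
    have "fourier (\<lambda>\<tau>. \<omega> (- \<tau>)) \<tau> = (LINT \<sigma>|lborel. exp (- (\<i> * of_real \<tau> * of_real \<sigma>)) * \<omega> (- \<sigma>))"
      by (intro fourier_lborel) measurable
    also have "\<dots> = fourier \<omega> (- \<tau>)"
      unfolding fourier_lborel[OF m] by (subst lborel_integral_real_affine[of "-1" _ 0]) auto
    finally show ?thesis .
  qed
  ultimately show ?thesis unfolding inverse_fourier_def[abs_def] by simp
qed

text \<open>The double integral over \<sigma> and \<tau> is not absolutely convergent. The Gaussian
  factor \<open>g n\<close> makes it so; Fubini then exchanges the order, and the transform of the
  Gaussian turns the value into 2\<pi> times a normal mean of \<open>\<omega>\<close> around
  \<open>x\<close> on the scale 1/(n+1). Both limits in n are taken under a majorant.\<close>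

lemma fourier_inverse_fourier:
  assumes \<omega>: "\<omega> \<in> test_functions UNIV"
  shows "fourier (inverse_fourier \<omega>) x = \<omega> x"
proof -
  define f where "f = fourier \<omega>"
  define G where "G \<tau> = exp (- (\<i> * of_real x * of_real \<tau>)) * f (- \<tau>)" for \<tau>
  define g where "g n \<tau> = complex_of_real (exp (- ((\<tau> / real (Suc n))\<^sup>2) / 2))" for n \<tau>
  have \<omega>m[measurable]: "\<omega> \<in> borel_measurable borel" using test_functions_borel[OF \<omega>] .
  have \<omega>i: "integrable lborel \<omega>" using test_functions_integrable[OF \<omega>] .
  have inv: "integrable lborel (inverse_fourier \<omega>)"
    using schwartz_integrable[OF inverse_fourier_schwartz[OF \<omega>]] .
  have "integrable lborel (\<lambda>\<tau>. of_real (2 * pi) * inverse_fourier \<omega> \<tau>)" by (intro integrable_mult_right inv)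
  then have fi: "integrable lborel (\<lambda>\<tau>. f (- \<tau>))" by (simp add: inverse_fourier_def f_def)
  have G: "integrable lborel G" unfolding G_def by (rule integrable_kernel[OF fi])
  have g1: "norm (g n \<tau>) \<le> 1" for n \<tau> by (simp add: g_def)
  have gm[measurable]: "g n \<in> borel_measurable borel" for n unfolding g_def by measurable
  have Gm[measurable]: "G \<in> borel_measurable borel" using G by auto
  have lim1: "(\<lambda>n. LINT \<tau>|lborel. G \<tau> * g n \<tau>) \<longlonglongrightarrow> (LINT \<tau>|lborel. G \<tau>)"
  proof (rule integral_dominated_convergence[where w = "\<lambda>\<tau>. norm (G \<tau>)"])
    show "AE \<tau> in lborel. (\<lambda>n. G \<tau> * g n \<tau>) \<longlonglongrightarrow> G \<tau>"
    proof (rule AE_I2)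
      fix \<tau>
      have "(\<lambda>n. \<tau> / real (Suc n)) \<longlonglongrightarrow> 0" using LIMSEQ_Suc[OF lim_const_over_n] .
      then have "(\<lambda>n. exp (- ((\<tau> / real (Suc n))\<^sup>2) / 2)) \<longlonglongrightarrow> exp (- (0\<^sup>2) / 2)" by (intro tendsto_intros) auto
      then have "(\<lambda>n. G \<tau> * complex_of_real (exp (- ((\<tau> / real (Suc n))\<^sup>2) / 2))) \<longlonglongrightarrow> G \<tau> * of_real (exp (- (0\<^sup>2) / 2))"
        by (intro tendsto_mult_left tendsto_of_real)
      then show "(\<lambda>n. G \<tau> * g n \<tau>) \<longlonglongrightarrow> G \<tau>" by (simp add: g_def)
    qed
    show "AE \<tau> in lborel. norm (G \<tau> * g n \<tau>) \<le> norm (G \<tau>)" for n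
      using g1[of n] by (intro AE_I2) (auto simp: norm_mult intro!: mult_left_le)
    show "integrable lborel (\<lambda>\<tau>. norm (G \<tau>))" using G by (rule integrable_norm)
  qed auto
  have eq: "(LINT \<tau>|lborel. G \<tau> * g n \<tau>) = of_real (2 * pi) * (LINT y|lborel. \<omega> (x + 1 / real (Suc n) * y) * of_real (std_normal_density y))" for n
  proof -
    let ?N = "real (Suc n)"
    have gi: "integrable lborel (\<lambda>\<tau>. exp (- (\<i> * of_real x * of_real \<tau>)) * g n \<tau>)"
      unfolding g_def by (intro integrable_kernel integrable_gaussian) simp
    have k: "(\<lambda>p. exp (- (\<i> * complex_of_real (- (snd p)) * complex_of_real (fst p)))) \<in> borel_measurable (borel \<Otimes>\<^sub>M borel)"
      unfolding borel_prod by (intro borel_measurable_continuous_onI continuous_intros)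
    have inner: "(LINT \<tau>|lborel. exp (- (\<i> * of_real (- \<tau>) * of_real \<sigma>)) * (exp (- (\<i> * of_real x * of_real \<tau>)) * g n \<tau>))
        = of_real (2 * pi * ?N * std_normal_density (?N * (\<sigma> - x)))" for \<sigma>
    proof -
      have "exp (- (\<i> * of_real (- \<tau>) * of_real \<sigma>)) * (exp (- (\<i> * of_real x * of_real \<tau>)) * g n \<tau>)
        = exp (\<i> * of_real \<tau> * of_real (\<sigma> - x)) * g n \<tau>" for \<tau>
      proof -
        have "exp (- (\<i> * complex_of_real (- \<tau>) * of_real \<sigma>)) * exp (- (\<i> * of_real x * of_real \<tau>))
          = exp (\<i> * of_real \<tau> * of_real (\<sigma> - x))"
          unfolding mult_exp_exp by (rule arg_cong[of _ _ exp]) (simp add: algebra_simps)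
        then show ?thesis by (simp only: mult.assoc[symmetric])
      qed
      then show ?thesis
        using gaussian_fourier[of ?N "\<sigma> - x"] by (simp only: g_def)
    qed
    have "(LINT \<tau>|lborel. G \<tau> * g n \<tau>) = (LINT \<tau>|lborel.
        (LINT \<sigma>|lborel. exp (- (\<i> * of_real (- \<tau>) * of_real \<sigma>)) * \<omega> \<sigma>) * (exp (- (\<i> * of_real x * of_real \<tau>)) * g n \<tau>))"
      unfolding G_def f_def fourier_lborel[OF \<omega>m] by (simp add: mult_ac)
    also have "\<dots> = (LINT \<sigma>|lborel. \<omega> \<sigma> * (LINT \<tau>|lborel. exp (- (\<i> * of_real (- \<tau>) * of_real \<sigma>)) * (exp (- (\<i> * of_real x * of_real \<tau>)) * g n \<tau>)))"
      by (rule lborel_Fubini_kernel[OF \<omega>i gi k, of 1]) (simp add: norm_exp_eq_Re)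
    also have "\<dots> = (LINT \<sigma>|lborel. \<omega> \<sigma> * of_real (2 * pi * ?N * std_normal_density (?N * (\<sigma> - x))))"
      by (simp only: inner)
    also have "\<dots> = (1 / ?N) *\<^sub>R (LINT y|lborel. \<omega> (x + 1 / ?N * y) * of_real (2 * pi * ?N * std_normal_density (?N * ((x + 1 / ?N * y) - x))))"
      by (subst lborel_integral_real_affine[of "1 / ?N" _ x]) auto
    also have "\<dots> = (1 / ?N) *\<^sub>R (LINT y|lborel. of_real (2 * pi * ?N) * (\<omega> (x + 1 / ?N * y) * of_real (std_normal_density y)))"
    proof -
      have "?N * ((x + 1 / ?N * y) - x) = y" for y by (simp del: of_nat_Suc)
      then show ?thesis by (simp only: of_real_mult mult_ac)
    qed
    also have "\<dots> = ((1 / ?N) *\<^sub>R of_real (2 * pi * ?N)) * (LINT y|lborel. \<omega> (x + 1 / ?N * y) * of_real (std_normal_density y))"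
      by (simp only: integral_mult_right_zero mult_scaleR_left)
    also have "(1 / ?N) *\<^sub>R of_real (2 * pi * ?N) = complex_of_real (2 * pi)"
      by (simp add: scaleR_conv_of_real del: of_nat_Suc)
    finally show ?thesis .
  qed
  obtain B where B: "B > 0" "\<And>x. norm (\<omega> x) \<le> B" using test_functions_bounded[OF \<omega>] by metis
  have "(\<lambda>n. LINT y|lborel. \<omega> (x + 1 / real (Suc n) * y) * of_real (std_normal_density y))
     \<longlonglongrightarrow> (LINT y|lborel. \<omega> x * of_real (std_normal_density y))"
  proof (rule integral_dominated_convergence[where w = "\<lambda>y. B * std_normal_density y"])
    show "AE y in lborel. (\<lambda>n. \<omega> (x + 1 / real (Suc n) * y) * of_real (std_normal_density y)) \<longlonglongrightarrow> \<omega> x * of_real (std_normal_density y)"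
    proof (intro AE_I2 tendsto_mult_right)
      fix y
      have "isCont \<omega> x"
        using smooth_on_continuous[OF test_functions_smooth[OF \<omega>]] by (simp add: continuous_on_eq_continuous_at)
      moreover have "(\<lambda>n. x + 1 / real (Suc n) * y) \<longlonglongrightarrow> x + 0 * y"
        by (intro tendsto_intros LIMSEQ_Suc[OF lim_1_over_n])
      ultimately show "(\<lambda>n. \<omega> (x + 1 / real (Suc n) * y)) \<longlonglongrightarrow> \<omega> x"
        using isCont_tendsto_compose[of x \<omega>] by simp
    qed
    show "AE y in lborel. norm (\<omega> (x + 1 / real (Suc n) * y) * of_real (std_normal_density y)) \<le> B * std_normal_density y" for n
      using B(2) by (intro AE_I2) (auto simp: norm_mult intro!: mult_right_mono)
  qed auto
  then have "(\<lambda>n. LINT \<tau>|lborel. G \<tau> * g n \<tau>) \<longlonglongrightarrow> of_real (2 * pi) * \<omega> x"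
    unfolding eq by (intro tendsto_mult_left) (simp del: of_real_mult)
  then have "(LINT \<tau>|lborel. G \<tau>) = of_real (2 * pi) * \<omega> x"
    using lim1 LIMSEQ_unique by blast
  moreover have "fourier (inverse_fourier \<omega>) x = of_real (1 / (2 * pi)) * (LINT \<tau>|lborel. G \<tau>)"
    using inv by (subst fourier_lborel) (auto simp: inverse_fourier_def G_def f_def mult_ac simp flip: integral_mult_right_zero)
  ultimately show ?thesis by simp
qed

section \<open>Tempered extensions as absolutely convergent integrals\<close>

lemma tempered_extension_distribution_of:
  "tempered_extension f u \<Longrightarrow> tempered_extension f (distribution_of f)"
  unfolding distribution_of_def by (metis someI)

lemma integrable_mult_schwartz:
  assumes \<gamma>: "\<gamma> \<in> borel_measurable lebesgue" "AE x in lebesgue. norm (\<gamma> x) \<le> C * (1 + \<bar>x\<bar>) ^ k"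
    and \<psi>: "\<psi> \<in> schwartz"
  shows "integrable lebesgue (\<lambda>x. \<gamma> x * \<psi> x)"
proof -
  \<comment> \<open>Two powers beyond the growth exponent \<open>k\<close> leave the integrable
    majorant 1/(1+x^2).\<close>
  obtain D where D: "D \<ge> 0" "\<And>x. norm (\<psi> x) * (1 + \<bar>x\<bar>) ^ (k + 2) \<le> D"
    using schwartz_decay[OF \<psi>] by metis
  show ?thesis
  proof (rule Bochner_Integration.integrable_bound)
    show "integrable lebesgue (\<lambda>x. \<bar>C\<bar> * D * inverse (1 + x\<^sup>2))"
      using integrable_inverse_square by (subst integrable_lebesgue_iff_lborel) auto
    show "(\<lambda>x. \<gamma> x * \<psi> x) \<in> borel_measurable lebesgue"
      using schwartz_borel[OF \<psi>] by (intro borel_measurable_times \<gamma>(1) measurable_completion[of \<psi> lborel borel]) auto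
    show "AE x in lebesgue. norm (\<gamma> x * \<psi> x) \<le> norm (\<bar>C\<bar> * D * inverse (1 + x\<^sup>2))"
      using \<gamma>(2)
    proof eventually_elim
      case (elim x)
      have p: "1 + x\<^sup>2 > 0" by (simp add: add_pos_nonneg)
      have "norm (\<gamma> x) \<le> \<bar>C\<bar> * (1 + \<bar>x\<bar>) ^ k"
        using elim by (rule order_trans) (auto intro!: mult_right_mono)
      then have "norm (\<gamma> x * \<psi> x) * (1 + x\<^sup>2) \<le> (\<bar>C\<bar> * (1 + \<bar>x\<bar>) ^ k * norm (\<psi> x)) * (1 + \<bar>x\<bar>)\<^sup>2"
        unfolding norm_mult
        by (intro mult_mono mult_right_mono) (auto simp: power2_eq_square algebra_simps)
      also have "\<dots> = \<bar>C\<bar> * (norm (\<psi> x) * (1 + \<bar>x\<bar>) ^ (k + 2))"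
        by (simp only: power_add mult_ac)
      also have "\<dots> \<le> \<bar>C\<bar> * D" using D by (intro mult_left_mono) auto
      finally show ?case using p D(1) by (simp add: field_simps)
    qed
  qed
qed

text \<open>The extension is tied to \<open>\<gamma>\<close> on test functions only, but
  \<open>\<gamma>\<close> will be paired with Fourier transforms, which are not of compact support.
  Along the cutoffs \<theta>(x/n) \<psi>(x) the integral converges by polynomial growth and
  \<open>u\<close> converges by temperedness, so the two agree in the limit.\<close>

lemma tempered_extension_eq_integral:
  assumes u: "tempered_extension \<gamma> u"
    and \<gamma>: "\<gamma> \<in> borel_measurable lebesgue" "AE x in lebesgue. norm (\<gamma> x) \<le> C * (1 + \<bar>x\<bar>) ^ k"
    and \<theta>: "\<theta> \<in> test_functions UNIV" "\<theta> 0 = 1" and \<psi>: "\<psi> \<in> schwartz"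
  shows "u \<psi> = (LINT x|lebesgue. \<gamma> x * \<psi> x)"
proof -
  define \<phi> where "\<phi> n x = \<theta> (x / real (Suc n)) * \<psi> x" for n x
  have t: "\<phi> n \<in> test_functions UNIV" for n
  proof -
    obtain D where D: "smooth_on UNIV \<theta>" "compact D" "\<And>x. x \<notin> D \<Longrightarrow> \<theta> x = 0"
      using test_functionsE[OF \<theta>(1)] by metis
    have "(\<lambda>x. \<theta> (x / real (Suc n))) \<in> test_functions UNIV"
    proof (rule test_functionsI[of _ "(\<lambda>x. x * real (Suc n)) ` D"])
      show "compact ((\<lambda>x. x * real (Suc n)) ` D)"
        by (intro compact_continuous_image D continuous_intros)
      show "\<theta> (x / real (Suc n)) = 0" if "x \<notin> (\<lambda>x. x * real (Suc n)) ` D" for x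
      proof (rule D(3), rule notI)
        assume "x / real (Suc n) \<in> D"
        then have "x / real (Suc n) * real (Suc n) \<in> (\<lambda>x. x * real (Suc n)) ` D" by (rule imageI)
        then show False using that by simp
      qed
    qed (use smooth_on_rescale[OF D(1)] in auto)
    from test_functions_mult[OF this schwartz_smooth[OF \<psi>]]
    show ?thesis unfolding \<phi>_def[abs_def] by (simp add: mult.commute)
  qed
  have temp: "tempered u" and eq: "u \<phi> = (LINT x|lebesgue. \<gamma> x * \<phi> x)" if "\<phi> \<in> test_functions UNIV" for \<phi>
    using u that by (auto simp: tempered_extension_def equals_function_on_def function_pairing_def)
  have "(\<lambda>n. u (\<phi> n)) \<longlonglongrightarrow> u \<psi>"
  proof (rule tempered_tendsto[OF temp[OF t] \<psi> test_functions_schwartz[OF t]])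
    fix i j
    obtain D where "\<And>N x. N \<ge> 1 \<Longrightarrow> \<bar>x\<bar> ^ i * norm (nth_deriv j (\<lambda>x. (\<theta> (x / N) - 1) * \<psi> x) x) \<le> D / N"
      using scaled_cutoff_converges[OF \<theta> \<psi>, of i j] by blast
    moreover have "(\<lambda>x. \<phi> n x + (-1) * \<psi> x) = (\<lambda>x. (\<theta> (x / real (Suc n)) - 1) * \<psi> x)" for n
      by (simp add: \<phi>_def fun_eq_iff algebra_simps)
    ultimately have "\<forall>n x. \<bar>x\<bar> ^ i * norm (nth_deriv j (\<lambda>x. \<phi> n x + (-1) * \<psi> x) x) \<le> D / real (Suc n)"
      by auto
    then show "\<exists>C. \<forall>n x. \<bar>x\<bar> ^ i * norm (nth_deriv j (\<lambda>x. \<phi> n x + (-1) * \<psi> x) x) \<le> C / real (Suc n)" by blast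
  qed
  moreover have "(\<lambda>n. LINT x|lebesgue. \<gamma> x * \<phi> n x) \<longlonglongrightarrow> (LINT x|lebesgue. \<gamma> x * \<psi> x)"
  proof -
    obtain B where B: "B > 0" "\<And>x. norm (\<theta> x) \<le> B" using test_functions_bounded[OF \<theta>(1)] by metis
    have int: "integrable lebesgue (\<lambda>x. \<gamma> x * \<psi> x)" by (rule integrable_mult_schwartz[OF \<gamma> \<psi>])
    show ?thesis
    proof (rule integral_dominated_convergence[where w = "\<lambda>x. B * norm (\<gamma> x * \<psi> x)"])
      show "AE x in lebesgue. (\<lambda>n. \<gamma> x * \<phi> n x) \<longlonglongrightarrow> \<gamma> x * \<psi> x"
      proof (intro AE_I2 tendsto_mult_left)
        fix x
        have "isCont \<theta> 0"
          using smooth_on_continuous[OF test_functions_smooth[OF \<theta>(1)]] by (simp add: continuous_on_eq_continuous_at)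
        moreover have "(\<lambda>n. x / real (Suc n)) \<longlonglongrightarrow> 0" using LIMSEQ_Suc[OF lim_const_over_n] .
        ultimately have "(\<lambda>n. \<theta> (x / real (Suc n))) \<longlonglongrightarrow> 1"
          using isCont_tendsto_compose[of 0 \<theta>] \<theta>(2) by fastforce
        then have "(\<lambda>n. \<theta> (x / real (Suc n)) * \<psi> x) \<longlonglongrightarrow> 1 * \<psi> x" by (intro tendsto_mult_right)
        then show "(\<lambda>n. \<phi> n x) \<longlonglongrightarrow> \<psi> x" by (simp add: \<phi>_def)
      qed
      show "AE x in lebesgue. norm (\<gamma> x * \<phi> n x) \<le> B * norm (\<gamma> x * \<psi> x)" for n
      proof (intro AE_I2)
        fix x
        have "norm (\<theta> (x / real (Suc n))) * norm (\<gamma> x * \<psi> x) \<le> B * norm (\<gamma> x * \<psi> x)"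
          by (intro mult_right_mono B) auto
        then show "norm (\<gamma> x * \<phi> n x) \<le> B * norm (\<gamma> x * \<psi> x)"
          by (simp add: \<phi>_def norm_mult mult_ac)
      qed
      show "(\<lambda>x. \<gamma> x * \<phi> n x) \<in> borel_measurable lebesgue" for n
        using borel_measurable_integrable[OF integrable_mult_schwartz[OF \<gamma> test_functions_schwartz[OF t]]] .
    qed (use int in auto)
  qed
  ultimately show ?thesis
    using LIMSEQ_unique by (simp add: eq[OF t])
qed

subsection \<open>The distributions \<open>(\<tau> - i0)\<^sup>s\<close>\<close>

text \<open>For \<epsilon> > 0 the transform of this density is \<Gamma>(j) (\<epsilon> +
  i\<tau>)^{-j}. The limit case \<epsilon> = 0 is, up to a constant, the inverse transform of
  (\<tau> - i0)^{-j}.\<close>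

definition gamma_density :: "real \<Rightarrow> real \<Rightarrow> real \<Rightarrow> complex" where
  "gamma_density \<epsilon> j \<sigma> = of_real (if \<sigma> > 0 then \<sigma> powr (j - 1) * exp (- (\<epsilon> * \<sigma>)) else 0)"

lemma gamma_density_borel [measurable]: "gamma_density \<epsilon> j \<in> borel_measurable borel"
  unfolding gamma_density_def by measurable

text \<open>The shape of the integrand in Euler's integral for the complex Gamma function, to which
  integrability and the value of the integral are traced back.\<close>

lemma gamma_density_alt:
  "gamma_density \<epsilon> j \<sigma> = indicator {0<..} \<sigma> *\<^sub>R (of_real \<sigma> powr (of_real j - 1) / of_real (exp (\<epsilon> * \<sigma>)))"
proof (cases "\<sigma> > 0")
  case True
  then have "complex_of_real \<sigma> powr (of_real (j - 1)) = of_real (\<sigma> powr (j - 1))"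
    by (intro powr_of_real) auto
  then show ?thesis using True by (simp add: gamma_density_def exp_minus divide_inverse exp_of_real)
qed (simp add: gamma_density_def)

lemma gamma_density_integrable:
  assumes "\<epsilon> > 0" "j > 0" shows "integrable lborel (gamma_density \<epsilon> j)"
proof -
  have "set_integrable lebesgue {0<..} (\<lambda>t. complex_of_real t powr (of_real j - 1) / of_real (exp (\<epsilon> * t)))"
    using absolutely_integrable_Gamma_integral[of "of_real j" \<epsilon>] assms by simp
  then have "integrable lebesgue (gamma_density \<epsilon> j)"
    unfolding set_integrable_def gamma_density_alt[abs_def] .
  then show ?thesis by (subst (asm) integrable_lebesgue_iff_lborel) auto
qed

lemma gamma_density_mult: "of_real \<sigma> * gamma_density \<epsilon> j \<sigma> = gamma_density \<epsilon> (j + 1) \<sigma>"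
  using powr_mult_base[of \<sigma> "j - 1"] by (simp add: gamma_density_def flip: of_real_mult)

lemma integral_gamma_density:
  assumes "\<epsilon> > 0" "j > 0"
  shows "(LINT \<sigma>|lborel. gamma_density \<epsilon> j \<sigma>) = of_real (Gamma j * \<epsilon> powr (- j))"
proof -
  have one: "(LINT \<sigma>|lborel. gamma_density 1 j \<sigma>) = of_real (Gamma j)"
  proof -
    have "((\<lambda>t. complex_of_real t powr (of_real j - 1) / of_real (exp t)) has_integral Gamma (of_real j)) {0<..}"
      using assms by (intro Gamma_integral_complex') auto
    then have "((\<lambda>t. if t \<in> {0<..} then complex_of_real t powr (of_real j - 1) / of_real (exp t) else 0)
        has_integral Gamma (of_real j)) UNIV"
      by (subst has_integral_restrict_UNIV)
    moreover have "(\<lambda>t. if t \<in> {0<..} then complex_of_real t powr (of_real j - 1) / of_real (exp t) else 0) = gamma_density 1 j"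
      by (auto simp: gamma_density_alt fun_eq_iff)
    ultimately have "(gamma_density 1 j has_integral Gamma (of_real j)) UNIV" by simp
    moreover have "(gamma_density 1 j has_integral (LINT \<sigma>|lborel. gamma_density 1 j \<sigma>)) UNIV"
      using assms by (intro has_integral_integral_lborel gamma_density_integrable) auto
    ultimately show ?thesis
      using has_integral_unique by (metis Gamma_complex_of_real)
  qed
  have "(LINT \<sigma>|lborel. gamma_density \<epsilon> j \<sigma>) = (1 / \<epsilon>) *\<^sub>R (LINT \<sigma>|lborel. gamma_density \<epsilon> j (0 + 1 / \<epsilon> * \<sigma>))"
    using assms lborel_integral_real_affine[of "1 / \<epsilon>" "gamma_density \<epsilon> j" 0] by simp
  also have "(\<lambda>\<sigma>. gamma_density \<epsilon> j (0 + 1 / \<epsilon> * \<sigma>)) = (\<lambda>\<sigma>. of_real (\<epsilon> powr (1 - j)) * gamma_density 1 j \<sigma>)"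
  proof
    fix \<sigma>
    have "(\<sigma> / \<epsilon>) powr (j - 1) = \<epsilon> powr (1 - j) * \<sigma> powr (j - 1)" if "\<sigma> > 0"
    proof -
      have "(\<sigma> / \<epsilon>) powr (j - 1) = \<sigma> powr (j - 1) / \<epsilon> powr (j - 1)"
        by (rule powr_divide)
      also have "\<dots> = \<epsilon> powr (1 - j) * \<sigma> powr (j - 1)"
        using powr_minus[of \<epsilon> "j - 1"] by (simp add: divide_inverse)
      finally show ?thesis .
    qed
    then show "gamma_density \<epsilon> j (0 + 1 / \<epsilon> * \<sigma>) = of_real (\<epsilon> powr (1 - j)) * gamma_density 1 j \<sigma>"
      using assms by (simp add: gamma_density_def zero_less_divide_iff)
  qed
  also have "(LINT \<sigma>|lborel. of_real (\<epsilon> powr (1 - j)) * gamma_density 1 j \<sigma>) = of_real (\<epsilon> powr (1 - j)) * of_real (Gamma j)"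
    unfolding integral_mult_right_zero one ..
  also have "(1 / \<epsilon>) *\<^sub>R (complex_of_real (\<epsilon> powr (1 - j)) * of_real (Gamma j)) = of_real (Gamma j * \<epsilon> powr (- j))"
    using assms by (simp add: scaleR_conv_of_real powr_diff powr_minus divide_inverse mult_ac)
  finally show ?thesis .
qed

lemma tendsto_powr_exp_at_top:
  assumes "\<epsilon> > 0" "j > 0" shows "((\<lambda>x::real. x powr j * exp (- (\<epsilon> * x))) \<longlongrightarrow> 0) at_top"
proof -
  obtain n :: nat where n: "j \<le> real n" using real_arch_simple by blast
  have "((\<lambda>x::real. x ^ n / exp x) \<longlongrightarrow> 0) at_top" by (rule tendsto_power_div_exp_0)
  moreover have "filterlim (\<lambda>x. \<epsilon> * x) at_top at_top"
    using assms by (intro filterlim_tendsto_pos_mult_at_top[OF tendsto_const]) (auto intro: filterlim_ident)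
  ultimately have "((\<lambda>x. (\<epsilon> * x) ^ n / exp (\<epsilon> * x)) \<longlongrightarrow> 0) at_top"
    by (rule filterlim_compose)
  then have lim: "((\<lambda>x. (1 / \<epsilon> ^ n) * ((\<epsilon> * x) ^ n / exp (\<epsilon> * x))) \<longlongrightarrow> 0) at_top"
    by (intro tendsto_mult_right_zero)
  show ?thesis
  proof (rule Lim_null_comparison[OF _ lim])
    show "\<forall>\<^sub>F x in at_top. norm (x powr j * exp (- (\<epsilon> * x))) \<le> (1 / \<epsilon> ^ n) * ((\<epsilon> * x) ^ n / exp (\<epsilon> * x))"
      using eventually_ge_at_top[of 1]
    proof eventually_elim
      case (elim x)
      then have "x powr j \<le> x powr real n" using n by (intro powr_mono) auto
      then have "x powr j \<le> x ^ n" using elim by (simp add: powr_realpow)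
      moreover have "(1 / \<epsilon> ^ n) * ((\<epsilon> * x) ^ n / exp (\<epsilon> * x)) = x ^ n * exp (- (\<epsilon> * x))"
        using assms by (simp add: exp_minus divide_inverse power_mult_distrib)
      ultimately show ?case
        using assms elim by (simp add: mult_right_mono)
    qed
  qed
qed

text \<open>The derivative of \<sigma>^j e^{-z\<sigma>} with z = \<epsilon> + i\<tau> integrates to
  0 over the half-line: j > 0 kills the boundary value at the origin, \<epsilon> > 0 the one at
  infinity.\<close>

lemma fourier_gamma_density_recurrence:
  assumes \<epsilon>: "\<epsilon> > 0" and j: "j > 0"
  shows "of_real j * fourier (gamma_density \<epsilon> j) \<tau> =
    (of_real \<epsilon> + \<i> * of_real \<tau>) * fourier (gamma_density \<epsilon> (j + 1)) \<tau>"
proof -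
  define z where "z = of_real \<epsilon> + \<i> * complex_of_real \<tau>"
  define e where "e \<sigma> = exp (- (\<i> * complex_of_real \<tau> * complex_of_real \<sigma>))" for \<sigma>
  define F where "F \<sigma> = complex_of_real (\<sigma> powr j) * exp (- z * of_real \<sigma>)" for \<sigma>
  define f where "f \<sigma> = of_real j * (e \<sigma> * gamma_density \<epsilon> j \<sigma>) - z * (e \<sigma> * gamma_density \<epsilon> (j + 1) \<sigma>)" for \<sigma>
  have i1: "integrable lborel (\<lambda>\<sigma>. e \<sigma> * gamma_density \<epsilon> j \<sigma>)"
    unfolding e_def using assms by (intro integrable_kernel gamma_density_integrable)
  have i2: "integrable lborel (\<lambda>\<sigma>. e \<sigma> * gamma_density \<epsilon> (j + 1) \<sigma>)"
    unfolding e_def using assms by (intro integrable_kernel gamma_density_integrable) auto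
  have fi: "integrable lborel f" unfolding f_def using i1 i2 by auto
  have f_pos: "f \<sigma> = of_real j * (of_real (\<sigma> powr (j - 1)) * exp (- z * of_real \<sigma>))
      - z * (of_real (\<sigma> powr j) * exp (- z * of_real \<sigma>))" if "\<sigma> > 0" for \<sigma>
  proof -
    have "exp (- z * of_real \<sigma>) = e \<sigma> * of_real (exp (- (\<epsilon> * \<sigma>)))"
      by (simp add: e_def z_def exp_of_real[symmetric] mult_exp_exp algebra_simps)
    then show ?thesis using that by (simp add: f_def gamma_density_def mult_ac)
  qed
  have der: "(F has_vector_derivative f \<sigma>) (at \<sigma>)" if "\<sigma> > 0" for \<sigma>
  proof -
    have "((\<lambda>\<sigma>. \<sigma> powr j) has_vector_derivative (j * \<sigma> powr (j - 1))) (at \<sigma>)"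
      using that has_real_derivative_powr[of \<sigma> j] by (simp add: has_real_derivative_iff_has_vector_derivative)
    then have "((\<lambda>\<sigma>. complex_of_real (\<sigma> powr j)) has_vector_derivative of_real (j * \<sigma> powr (j - 1))) (at \<sigma>)"
      by (rule bounded_linear.has_vector_derivative[OF bounded_linear_of_real])
    from has_vector_derivative_mult[OF this has_vector_derivative_iexp[of "- z" \<sigma>]]
    show ?thesis unfolding F_def[abs_def] f_pos[OF that] by (simp add: mult_ac)
  qed
  have cont: "isCont f \<sigma>" if "\<sigma> > 0" for \<sigma>
  proof -
    have "isCont (\<lambda>\<sigma>. of_real j * (of_real (\<sigma> powr (j - 1)) * exp (- z * of_real \<sigma>))
      - z * (of_real (\<sigma> powr j) * exp (- z * of_real \<sigma>))) \<sigma>"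
      using that by (intro continuous_intros) auto
    moreover have "\<forall>\<^sub>F \<sigma> in nhds \<sigma>. of_real j * (of_real (\<sigma> powr (j - 1)) * exp (- z * of_real \<sigma>))
      - z * (of_real (\<sigma> powr j) * exp (- z * of_real \<sigma>)) = f \<sigma>"
      using eventually_nhds_in_open[of "{0<..}" \<sigma>] that by (auto elim!: eventually_mono simp: f_pos)
    ultimately show ?thesis using isCont_cong by fast
  qed
  have norm_F: "norm (F \<sigma>) = \<sigma> powr j * exp (- (\<epsilon> * \<sigma>))" for \<sigma>
    by (simp add: F_def norm_mult norm_exp_eq_Re z_def)
  have "(LBINT \<sigma>=0..\<infinity>. f \<sigma>) = 0 - 0"
  proof (rule interval_integral_FTC_integrable)
    show "set_integrable lborel (einterval 0 \<infinity>) f"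
      unfolding set_integrable_def using fi by (intro integrable_mult_indicator) auto
    have ev: "\<forall>\<^sub>F \<sigma> in at_right (0::real). 0 \<le> \<sigma>"
      using eventually_at_right_less[of 0] by eventually_elim simp
    have "((\<lambda>\<sigma>. \<sigma> powr j) \<longlongrightarrow> 0 powr j) (at_right 0)"
      by (rule tendsto_powr'[OF tendsto_ident_at tendsto_const]) (use j ev in simp)
    moreover have "((\<lambda>\<sigma>. exp (- (\<epsilon> * \<sigma>))) \<longlongrightarrow> exp (- (\<epsilon> * 0))) (at_right 0)"
      by (intro tendsto_exp tendsto_minus tendsto_mult tendsto_const tendsto_ident_at)
    ultimately have "((\<lambda>\<sigma>. \<sigma> powr j * exp (- (\<epsilon> * \<sigma>))) \<longlongrightarrow> 0 powr j * exp (- (\<epsilon> * 0))) (at_right 0)"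
      by (rule tendsto_mult)
    then have "(F \<longlongrightarrow> 0) (at_right 0)"
      by - (rule tendsto_norm_zero_cancel, simp add: norm_F)
    then show "((F \<circ> real_of_ereal) \<longlongrightarrow> 0) (at_right 0)"
      by (simp add: zero_ereal_def ereal_tendsto_simps)
    have "(F \<longlongrightarrow> 0) at_top"
      using tendsto_powr_exp_at_top[OF assms] by - (rule tendsto_norm_zero_cancel, simp add: norm_F)
    then show "((F \<circ> real_of_ereal) \<longlongrightarrow> 0) (at_left \<infinity>)"
      by (simp add: ereal_tendsto_simps)
  qed (use der cont in \<open>auto simp: zero_ereal_def\<close>)
  moreover have "(LBINT \<sigma>=0..\<infinity>. f \<sigma>) = (LINT \<sigma>|lborel. f \<sigma>)"
    unfolding interval_lebesgue_integral_def set_lebesgue_integral_def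
    by (auto intro!: Bochner_Integration.integral_cong simp: einterval_def indicator_def f_def gamma_density_def zero_ereal_def)
  moreover have "(LINT \<sigma>|lborel. f \<sigma>) = of_real j * (LINT \<sigma>|lborel. e \<sigma> * gamma_density \<epsilon> j \<sigma>) - z * (LINT \<sigma>|lborel. e \<sigma> * gamma_density \<epsilon> (j + 1) \<sigma>)"
    unfolding f_def using i1 i2 by simp
  ultimately show ?thesis
    by (simp add: fourier_lborel e_def z_def)
qed

text \<open>Differentiation in \<tau> raises \<open>j\<close> by one, and the recurrence brings it
  back: the transform L satisfies L' = -i j L / z with z = \<epsilon> + i\<tau>. Hence L z^j is
  constant, and its value at \<tau> = 0 is \<Gamma>(j).\<close>

lemma fourier_gamma_density:
  assumes \<epsilon>: "\<epsilon> > 0" and j: "j > 0"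
  shows "fourier (gamma_density \<epsilon> j) \<tau> = of_real (Gamma j) * (of_real \<epsilon> + \<i> * of_real \<tau>) powr (- of_real j)"
proof -
  define z where "z \<tau> = of_real \<epsilon> + \<i> * complex_of_real \<tau>" for \<tau>
  define L where "L = fourier (gamma_density \<epsilon> j)"
  \<comment> \<open>The real part \<epsilon> is positive, so z stays off the branch cut and its
    power is differentiable.\<close>
  have znz: "z \<tau> \<notin> \<real>\<^sub>\<le>\<^sub>0" "z \<tau> \<noteq> 0" for \<tau>
    using \<epsilon> by (auto simp: z_def complex_nonpos_Reals_iff complex_eq_iff)
  have der: "((\<lambda>\<tau>. L \<tau> * z \<tau> powr of_real j) has_vector_derivative 0) (at \<tau>)" for \<tau>
  proof -
    have "integrable lborel (\<lambda>\<sigma>. of_real \<sigma> * gamma_density \<epsilon> j \<sigma>)"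
      unfolding gamma_density_mult using assms by (intro gamma_density_integrable) auto
    from fourier_has_vector_derivative[OF gamma_density_integrable[OF assms] this]
    have "(L has_vector_derivative fourier (\<lambda>\<sigma>. (- \<i>) * (of_real \<sigma> * gamma_density \<epsilon> j \<sigma>)) \<tau>) (at \<tau>)"
      unfolding L_def by (simp only: mult.assoc)
    then have "(L has_vector_derivative - \<i> * fourier (gamma_density \<epsilon> (j + 1)) \<tau>) (at \<tau>)"
      unfolding gamma_density_mult fourier_cmult .
    then have dL: "(L has_vector_derivative - \<i> * (of_real j * L \<tau> / z \<tau>)) (at \<tau>)"
      using fourier_gamma_density_recurrence[OF assms, of \<tau>] znz(2)[of \<tau>] by (simp add: L_def z_def)
    have "(z has_vector_derivative \<i>) (at \<tau>)"
      unfolding z_def[abs_def]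
      by (auto intro!: derivative_eq_intros has_vector_derivative_mult_right has_vector_derivative_of_real
          simp: has_vector_derivative_add_const)
    from field_vector_diff_chain_at[OF this has_field_derivative_powr[OF znz(1)[of \<tau>], where s = "of_real j"]]
    have dz: "((\<lambda>\<tau>. z \<tau> powr of_real j) has_vector_derivative \<i> * (of_real j * (z \<tau> powr of_real j / z \<tau>))) (at \<tau>)"
      using znz(2)[of \<tau>] by (simp add: o_def powr_diff)
    from has_vector_derivative_mult[OF dL dz] show ?thesis by (simp add: field_simps)
  qed
  have "\<exists>c. \<forall>\<tau>\<in>UNIV. L \<tau> * z \<tau> powr of_real j = c"
    using der by (intro has_derivative_zero_constant) (auto simp: has_vector_derivative_def)
  then have "L \<tau> * z \<tau> powr of_real j = L 0 * z 0 powr of_real j" by auto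
  also have "L 0 = of_real (Gamma j * \<epsilon> powr (- j))"
    using integral_gamma_density[OF assms] by (simp add: L_def fourier_lborel)
  also have "z 0 powr of_real j = of_real (\<epsilon> powr j)"
    using \<epsilon> by (simp add: z_def powr_of_real)
  also have "complex_of_real (Gamma j * \<epsilon> powr (- j)) * of_real (\<epsilon> powr j) = of_real (Gamma j)"
    using \<epsilon> by (simp add: powr_minus flip: of_real_mult)
  finally have "L \<tau> * z \<tau> powr of_real j = of_real (Gamma j)" .
  then have "L \<tau> = of_real (Gamma j) / z \<tau> powr of_real j"
    using znz(2)[of \<tau>] by (simp add: field_simps)
  then show ?thesis by (simp add: L_def z_def powr_minus divide_inverse)
qed

text \<open>Multiplication by i carries the lower half-plane to the right half-plane and adds
  \<pi>/2 to the principal argument without crossing the cut. This quarter turn is the origin of the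
  phases e^{i\<pi>j/2} in the expansion.\<close>

lemma minus_i0_base:
  assumes "\<epsilon> > 0"
  shows "(of_real \<tau> - \<i> * of_real \<epsilon>) powr of_real (- j)
    = exp (\<i> * of_real pi * of_real j / 2) * (of_real \<epsilon> + \<i> * of_real \<tau>) powr (- of_real j)"
proof -
  define w where "w = of_real \<tau> - \<i> * complex_of_real \<epsilon>"
  have w: "w \<noteq> 0" "Im w < 0" using assms by (auto simp: w_def complex_eq_iff)
  have iw: "\<i> * w = of_real \<epsilon> + \<i> * of_real \<tau>" by (simp add: w_def algebra_simps)
  have "Ln (\<i> * w) = Ln w + \<i> * of_real pi / 2" using w by (simp add: Ln_times_ii)
  then have "w powr of_real (- j) = exp (\<i> * of_real pi * of_real j / 2) * (\<i> * w) powr (- of_real j)"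
    using w by (simp add: powr_def mult_exp_exp algebra_simps)
  then show ?thesis unfolding iw by (simp add: w_def)
qed

text \<open>For \<epsilon> > 0 the multiplication formula moves the transform from the power to the
  test function. Then \<epsilon> tends to 0, the density for \<epsilon> = 0 times
  \<open>\<omega>\<close> being the majorant.\<close>

lemma minus_i0_powr_inverse_fourier:
  assumes j: "j > 0" and \<omega>: "\<omega> \<in> test_functions UNIV"
  shows "minus_i0_powr (- j) (inverse_fourier \<omega>) =
    exp (\<i> * of_real pi * of_real j / 2) / of_real (Gamma j) * (LINT \<sigma>|lborel. gamma_density 0 j \<sigma> * \<omega> \<sigma>)"
proof -
  define c where "c = exp (\<i> * of_real pi * of_real j / 2) / complex_of_real (Gamma j)"
  have \<omega>m[measurable]: "\<omega> \<in> borel_measurable borel" using test_functions_borel[OF \<omega>] .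
  have inv: "integrable lborel (inverse_fourier \<omega>)"
    using schwartz_integrable[OF inverse_fourier_schwartz[OF \<omega>]] .
  have invm[measurable]: "inverse_fourier \<omega> \<in> borel_measurable borel" using inv by auto
  have eq: "(LINT \<tau>|lebesgue. (of_real \<tau> - \<i> * of_real \<epsilon>) powr of_real (- j) * inverse_fourier \<omega> \<tau>)
    = c * (LINT \<sigma>|lborel. gamma_density \<epsilon> j \<sigma> * \<omega> \<sigma>)" if \<epsilon>: "\<epsilon> > 0" for \<epsilon>
  proof -
    have G: "Gamma j \<noteq> 0" using Gamma_real_pos[OF j] by simp
    have pw: "(of_real \<tau> - \<i> * of_real \<epsilon>) powr of_real (- j) = c * fourier (gamma_density \<epsilon> j) \<tau>" for \<tau>
      unfolding minus_i0_base[OF \<epsilon>] fourier_gamma_density[OF \<epsilon> j] c_def using G by simp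
    have fm: "fourier (gamma_density \<epsilon> j) \<in> borel_measurable borel"
    proof (intro borel_measurable_continuous_onI continuous_at_imp_continuous_on ballI)
      fix \<tau>
      have "integrable lborel (\<lambda>\<sigma>. of_real \<sigma> * gamma_density \<epsilon> j \<sigma>)"
        unfolding gamma_density_mult using \<epsilon> j by (intro gamma_density_integrable) auto
      from fourier_has_vector_derivative[OF gamma_density_integrable[OF \<epsilon> j] this, of \<tau>]
      show "isCont (fourier (gamma_density \<epsilon> j)) \<tau>" by (rule has_vector_derivative_continuous)
    qed
    have "(LINT \<tau>|lebesgue. (of_real \<tau> - \<i> * of_real \<epsilon>) powr of_real (- j) * inverse_fourier \<omega> \<tau>)
      = (LINT \<tau>|lborel. c * (fourier (gamma_density \<epsilon> j) \<tau> * inverse_fourier \<omega> \<tau>))"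
      unfolding pw mult.assoc by (intro lebesgue_integral_eq_lborel borel_measurable_times borel_measurable_const fm invm)
    also have "\<dots> = c * (LINT \<tau>|lborel. fourier (gamma_density \<epsilon> j) \<tau> * inverse_fourier \<omega> \<tau>)"
      by (rule integral_mult_right_zero)
    also have "(LINT \<tau>|lborel. fourier (gamma_density \<epsilon> j) \<tau> * inverse_fourier \<omega> \<tau>)
      = (LINT \<sigma>|lborel. gamma_density \<epsilon> j \<sigma> * fourier (inverse_fourier \<omega>) \<sigma>)"
      by (rule fourier_multiplication[OF gamma_density_integrable[OF \<epsilon> j] inv])
    finally show ?thesis unfolding fourier_inverse_fourier[OF \<omega>] .
  qed
  \<comment> \<open>The density for \<epsilon> = 0 is not integrable at infinity. Giving it the
    factor e^{-\<sigma>} and compensating with e^\<sigma> on the compact support of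
    \<open>\<omega>\<close> reduces the claim to \<epsilon> = 1.\<close>
  have exp1: "gamma_density 0 j \<sigma> * \<omega> \<sigma> = (exp (1 * of_real \<sigma>) * \<omega> \<sigma>) * gamma_density 1 j \<sigma>" for \<sigma>
    by (simp add: gamma_density_def exp_minus exp_of_real field_simps)
  have int0: "integrable lborel (\<lambda>\<sigma>. gamma_density 0 j \<sigma> * \<omega> \<sigma>)"
  proof -
    have t: "(\<lambda>\<sigma>. exp (1 * of_real \<sigma>) * \<omega> \<sigma>) \<in> test_functions UNIV"
      by (rule test_functions_mult[OF \<omega> smooth_on_exp]) simp
    obtain B where "\<And>x. norm (exp (1 * of_real x) * \<omega> x) \<le> B"
      using test_functions_bounded[OF t] by metis
    then show ?thesis
      unfolding exp1 using j by (intro integrable_bounded_mult gamma_density_integrable test_functions_borel[OF t]) auto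
  qed
  have "((\<lambda>\<epsilon>. LINT \<sigma>|lborel. gamma_density \<epsilon> j \<sigma> * \<omega> \<sigma>) \<longlongrightarrow> (LINT \<sigma>|lborel. gamma_density 0 j \<sigma> * \<omega> \<sigma>)) (at_right 0)"
    unfolding tendsto_at_iff_sequentially o_def
  proof (intro allI impI)
    fix X :: "nat \<Rightarrow> real" assume X: "\<forall>i. X i \<in> {0<..} - {0}" "X \<longlonglongrightarrow> 0"
    show "(\<lambda>n. LINT \<sigma>|lborel. gamma_density (X n) j \<sigma> * \<omega> \<sigma>) \<longlonglongrightarrow> (LINT \<sigma>|lborel. gamma_density 0 j \<sigma> * \<omega> \<sigma>)"
    proof (rule integral_dominated_convergence[where w = "\<lambda>\<sigma>. norm (gamma_density 0 j \<sigma> * \<omega> \<sigma>)"])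
      show "AE \<sigma> in lborel. (\<lambda>n. gamma_density (X n) j \<sigma> * \<omega> \<sigma>) \<longlonglongrightarrow> gamma_density 0 j \<sigma> * \<omega> \<sigma>"
      proof (intro AE_I2 tendsto_mult_right)
        fix \<sigma>
        have "(\<lambda>n. \<sigma> powr (j - 1) * exp (- (X n * \<sigma>))) \<longlonglongrightarrow> \<sigma> powr (j - 1) * exp (- (0 * \<sigma>))"
          by (intro tendsto_intros X)
        then have "(\<lambda>n. complex_of_real (\<sigma> powr (j - 1) * exp (- (X n * \<sigma>)))) \<longlonglongrightarrow> of_real (\<sigma> powr (j - 1) * exp (- (0 * \<sigma>)))"
          by (rule tendsto_of_real)
        then show "(\<lambda>n. gamma_density (X n) j \<sigma>) \<longlonglongrightarrow> gamma_density 0 j \<sigma>"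
          by (cases "\<sigma> > 0") (auto simp: gamma_density_def)
      qed
      show "AE \<sigma> in lborel. norm (gamma_density (X n) j \<sigma> * \<omega> \<sigma>) \<le> norm (gamma_density 0 j \<sigma> * \<omega> \<sigma>)" for n
      proof (intro AE_I2)
        fix \<sigma>
        have "X n > 0" using X(1) by auto
        then have "norm (gamma_density (X n) j \<sigma>) \<le> norm (gamma_density 0 j \<sigma>)"
          by (auto simp: gamma_density_def norm_mult intro!: mult_left_le)
        then show "norm (gamma_density (X n) j \<sigma> * \<omega> \<sigma>) \<le> norm (gamma_density 0 j \<sigma> * \<omega> \<sigma>)"
          unfolding norm_mult by (intro mult_right_mono) auto
      qed
    qed (use int0 in auto)
  qed
  then have "((\<lambda>\<epsilon>. c * (LINT \<sigma>|lborel. gamma_density \<epsilon> j \<sigma> * \<omega> \<sigma>)) \<longlongrightarrow> c * (LINT \<sigma>|lborel. gamma_density 0 j \<sigma> * \<omega> \<sigma>)) (at_right 0)"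
    by (rule tendsto_mult_left)
  then have "((\<lambda>\<epsilon>. LINT \<tau>|lebesgue. (of_real \<tau> - \<i> * of_real \<epsilon>) powr of_real (- j) * inverse_fourier \<omega> \<tau>)
      \<longlongrightarrow> c * (LINT \<sigma>|lborel. gamma_density 0 j \<sigma> * \<omega> \<sigma>)) (at_right 0)"
    by (rule Lim_transform_eventually) (use eq in \<open>auto intro!: eventually_mono[OF eventually_at_right_less]\<close>)
  then show ?thesis
    unfolding minus_i0_powr_def c_def[symmetric] by (intro tendsto_Lim) auto
qed

lemma gamma_density_0_integral:
  assumes j: "j > 0" and S: "S \<ge> 0"
  shows "gamma_density 0 j absolutely_integrable_on {0..S}"
    and "(LINT \<sigma>:{0..S}|lebesgue. gamma_density 0 j \<sigma>) = of_real (S powr j / j)"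
proof -
  have hi: "((\<lambda>x. x powr (j - 1)) has_integral (S powr j / j)) {0..S}"
    using has_integral_powr_from_0[of "j - 1" S] j S by simp
  then have "((\<lambda>x. complex_of_real (x powr (j - 1))) has_integral of_real (S powr j / j)) {0..S}"
    by (rule has_integral_of_real)
  then have hc: "(gamma_density 0 j has_integral of_real (S powr j / j)) {0..S}"
    by (rule has_integral_spike[of "{0}", rotated 2]) (auto simp: gamma_density_def)
  have "(\<lambda>x. x powr (j - 1)) absolutely_integrable_on {0..S}"
    using hi by (intro nonnegative_absolutely_integrable_1) (auto simp: has_integral_integrable)
  then have "(\<lambda>x. complex_of_real (x powr (j - 1))) absolutely_integrable_on {0..S}"
    using absolutely_integrable_linear[OF _ bounded_linear_of_real] by (fastforce simp: o_def)
  then show ai: "gamma_density 0 j absolutely_integrable_on {0..S}"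
    by (rule absolutely_integrable_spike[of _ _ "{0}"]) (auto simp: gamma_density_def)
  show "(LINT \<sigma>:{0..S}|lebesgue. gamma_density 0 j \<sigma>) = of_real (S powr j / j)"
    using set_lebesgue_integral_eq_integral(2)[OF ai] hc by (simp add: integral_unique)
qed

subsection \<open>The kernel of the means of order \<open>M\<close>\<close>

text \<open>Poisson's integral: for x > 0 a constant multiple of x^{-\<nu>} J_\<nu>(x) with \<nu> =
  M + 1/2. The relations below are the classical ones of these Bessel functions, derived from the
  integral.\<close>

definition riesz_kernel :: "nat \<Rightarrow> real \<Rightarrow> real" where
  "riesz_kernel M x = integral {-1..1} (\<lambda>t. (1 - t\<^sup>2) ^ M * cos (t * x))"

text \<open>The primitive of \<open>riesz_kernel M\<close> that vanishes at 0. The factor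
  \<open>x * sinc (t * x)\<close> is sin(tx)/t with the removable singularity at t = 0 filled
  in.\<close>

definition riesz_step :: "nat \<Rightarrow> real \<Rightarrow> real" where
  "riesz_step M x = integral {-1..1} (\<lambda>t. (1 - t\<^sup>2) ^ M * (x * sinc (t * x)))"

lemma mult_sinc: "t * (x * sinc (t * x)) = sin (t * x)"
  by auto

lemma integral_derivative_eq_zero:
  fixes F :: "real \<Rightarrow> real"
  assumes "\<And>t. (F has_real_derivative f t) (at t)" "F (-1) = c" "F 1 = c"
  shows "(f has_integral 0) {-1..1}"
  using fundamental_theorem_of_calculus[of "-1" 1 F f] assms
  by (auto simp: has_real_derivative_iff_has_vector_derivative intro: has_vector_derivative_at_within)

lemma integrable_poly_trig [simp]:
  "(\<lambda>t::real. (1 - t\<^sup>2) ^ M * cos (t * x)) integrable_on {-1..1}"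
  "(\<lambda>t::real. t * (1 - t\<^sup>2) ^ M * sin (t * x)) integrable_on {-1..1}"
  "(\<lambda>t::real. (1 - t\<^sup>2) ^ M * (x * sinc (t * x))) integrable_on {-1..1}"
  by (intro integrable_continuous_interval continuous_intros continuous_on_compose2[OF continuous_on_sinc[of UNIV]]; simp)+

text \<open>The derivative of (1-t^2)^{M+1} sin(tx) integrates to 0, since the function vanishes at
  both ends. In this way the derivative of one kernel is expressed through the next kernel.\<close>

lemma riesz_kernel_sin:
  "integral {-1..1} (\<lambda>t. t * (1 - t\<^sup>2) ^ M * sin (t * x)) = x / (2 * real (Suc M)) * riesz_kernel (Suc M) x"
proof -
  have "((\<lambda>t. x * ((1 - t\<^sup>2) ^ Suc M * cos (t * x)) - 2 * real (Suc M) * (t * (1 - t\<^sup>2) ^ M * sin (t * x)))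
      has_integral 0) {-1..1}"
    by (rule integral_derivative_eq_zero[where F = "\<lambda>t. (1 - t\<^sup>2) ^ Suc M * sin (t * x)" and c = 0])
      (auto intro!: derivative_eq_intros simp del: power_Suc simp: algebra_simps)
  moreover have "((\<lambda>t. x * ((1 - t\<^sup>2) ^ Suc M * cos (t * x)) - 2 * real (Suc M) * (t * (1 - t\<^sup>2) ^ M * sin (t * x)))
      has_integral x * riesz_kernel (Suc M) x - 2 * real (Suc M) * integral {-1..1} (\<lambda>t. t * (1 - t\<^sup>2) ^ M * sin (t * x))) {-1..1}"
    unfolding riesz_kernel_def
    by (intro has_integral_diff has_integral_mult_right integrable_integral integrable_poly_trig)
  ultimately have "x * riesz_kernel (Suc M) x - 2 * real (Suc M) * integral {-1..1} (\<lambda>t. t * (1 - t\<^sup>2) ^ M * sin (t * x)) = 0"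
    using has_integral_unique by blast
  then show ?thesis by (simp add: field_simps del: of_nat_Suc)
qed

lemma riesz_kernel_has_derivative:
  "(riesz_kernel M has_real_derivative - (x / (2 * real (Suc M)) * riesz_kernel (Suc M) x)) (at x)"
proof -
  have "((\<lambda>x. integral (cbox (-1) 1) (\<lambda>t. (1 - t\<^sup>2) ^ M * cos (t * x))) has_field_derivative
     integral (cbox (-1) 1) (\<lambda>t. - (t * (1 - t\<^sup>2) ^ M * sin (t * x)))) (at x within UNIV)"
  proof (rule leibniz_rule_field_derivative)
    show "continuous_on (UNIV \<times> cbox (-1) 1) (\<lambda>(x::real, t). - (t * (1 - t\<^sup>2) ^ M * sin (t * x)))"
      unfolding split_beta by (intro continuous_intros)
  qed (auto intro!: derivative_eq_intros)
  then show ?thesis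
    by (simp add: riesz_kernel_def[abs_def] riesz_kernel_sin[unfolded riesz_kernel_def])
qed

lemma riesz_kernel_0: "x \<noteq> 0 \<Longrightarrow> riesz_kernel 0 x = 2 * sin x / x"
proof -
  assume x: "x \<noteq> 0"
  have "((\<lambda>t. cos (t * x)) has_integral sin (1 * x) / x - sin (-1 * x) / x) {-1..1}"
    by (rule fundamental_theorem_of_calculus)
      (use x in \<open>auto simp flip: has_real_derivative_iff_has_vector_derivative intro!: derivative_eq_intros\<close>)
  then show ?thesis by (simp add: riesz_kernel_def integral_unique)
qed

text \<open>The weight has exponent 0 here, so the primitive t cos(tx) does not vanish at the ends
  and contributes 2 cos x.\<close>

lemma riesz_kernel_1: "x \<noteq> 0 \<Longrightarrow> riesz_kernel 1 x = 4 / x\<^sup>2 * (sin x / x - cos x)"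
proof -
  assume x: "x \<noteq> 0"
  have h1: "((\<lambda>t. (1 - t\<^sup>2) ^ 0 * cos (t * x) - x * (t * (1 - t\<^sup>2) ^ 0 * sin (t * x))) has_integral 1 * cos (1 * x) - (-1) * cos (-1 * x)) {-1..1}"
    by (rule fundamental_theorem_of_calculus)
      (auto simp flip: has_real_derivative_iff_has_vector_derivative intro!: derivative_eq_intros)
  have h2: "((\<lambda>t. (1 - t\<^sup>2) ^ 0 * cos (t * x) - x * (t * (1 - t\<^sup>2) ^ 0 * sin (t * x))) has_integral
      riesz_kernel 0 x - x * integral {-1..1} (\<lambda>t. t * (1 - t\<^sup>2) ^ 0 * sin (t * x))) {-1..1}"
    unfolding riesz_kernel_def
    by (intro has_integral_diff has_integral_mult_right integrable_integral integrable_poly_trig)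
  have "riesz_kernel 0 x - x * integral {-1..1} (\<lambda>t. t * (1 - t\<^sup>2) ^ 0 * sin (t * x)) = 2 * cos x"
    using has_integral_unique[OF h2 h1] by (simp only: cos_minus mult_minus_left mult_1)
  then have "2 * sin x / x - x\<^sup>2 / 2 * riesz_kernel 1 x = 2 * cos x"
    unfolding riesz_kernel_sin riesz_kernel_0[OF x] by (simp add: power2_eq_square)
  then show ?thesis using x by (simp add: field_simps)
qed

text \<open>The three-term recurrence of Bessel functions. It comes from the primitive t
  (1-t^2)^{M+1} cos(tx), which vanishes at both ends, after t^2 has been rewritten as 1 -
  (1-t^2).\<close>

lemma riesz_kernel_Suc_Suc:
  "x\<^sup>2 * riesz_kernel (Suc (Suc M)) x = 2 * real (Suc (Suc M)) *
    (real (2 * M + 3) * riesz_kernel (Suc M) x - 2 * real (Suc M) * riesz_kernel M x)"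
proof -
  let ?I = "integral {-1..1} (\<lambda>t. t * (1 - t\<^sup>2) ^ Suc M * sin (t * x))"
  have der: "((\<lambda>t. t * (1 - t\<^sup>2) ^ Suc M * cos (t * x)) has_real_derivative
     real (2 * M + 3) * ((1 - t\<^sup>2) ^ Suc M * cos (t * x)) - 2 * real (Suc M) * ((1 - t\<^sup>2) ^ M * cos (t * x))
       - x * (t * (1 - t\<^sup>2) ^ Suc M * sin (t * x))) (at t)" for t
  proof -
    have "((\<lambda>t. t * (1 - t\<^sup>2) ^ Suc M * cos (t * x)) has_real_derivative
      (1 * (1 - t\<^sup>2) ^ Suc M + t * (real (Suc M) * (1 - t\<^sup>2) ^ M * (- (2 * t)))) * cos (t * x)
      + (t * (1 - t\<^sup>2) ^ Suc M) * (- (sin (t * x) * x))) (at t)"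
      by (auto intro!: derivative_eq_intros simp del: power_Suc simp: algebra_simps)
    moreover have "(1 * (1 - t\<^sup>2) ^ Suc M + t * (real (Suc M) * (1 - t\<^sup>2) ^ M * (- (2 * t)))) * cos (t * x)
      + (t * (1 - t\<^sup>2) ^ Suc M) * (- (sin (t * x) * x)) =
      real (2 * M + 3) * ((1 - t\<^sup>2) ^ Suc M * cos (t * x)) - 2 * real (Suc M) * ((1 - t\<^sup>2) ^ M * cos (t * x))
       - x * (t * (1 - t\<^sup>2) ^ Suc M * sin (t * x))"
    proof -
      \<comment> \<open>With the powers and the trigonometric values as free letters, the relation q
        = 1 - t^2 is all that the polynomial identity depends on.\<close>
      have "(1 * (q * p) + t * (m * p * (- (2 * t)))) * c + (t * (q * p)) * (- (s * x))
        = (2 * m + 1) * (q * p * c) - 2 * m * (p * c) - x * (t * (q * p) * s)"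
        if "q = 1 - t\<^sup>2" for q p c s m :: real
        unfolding that by (simp add: algebra_simps power2_eq_square)
      from this[OF refl, of "(1 - t\<^sup>2) ^ M" "real (Suc M)" "cos (t * x)" "sin (t * x)"]
      show ?thesis by (simp add: add_ac)
    qed
    ultimately show ?thesis by (rule DERIV_cong)
  qed
  have "((\<lambda>t. real (2 * M + 3) * ((1 - t\<^sup>2) ^ Suc M * cos (t * x)) - 2 * real (Suc M) * ((1 - t\<^sup>2) ^ M * cos (t * x))
       - x * (t * (1 - t\<^sup>2) ^ Suc M * sin (t * x))) has_integral 0) {-1..1}"
    by (rule integral_derivative_eq_zero[OF der, of 0]) auto
  moreover have "((\<lambda>t. real (2 * M + 3) * ((1 - t\<^sup>2) ^ Suc M * cos (t * x)) - 2 * real (Suc M) * ((1 - t\<^sup>2) ^ M * cos (t * x))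
       - x * (t * (1 - t\<^sup>2) ^ Suc M * sin (t * x))) has_integral
     real (2 * M + 3) * riesz_kernel (Suc M) x - 2 * real (Suc M) * riesz_kernel M x - x * ?I) {-1..1}"
    unfolding riesz_kernel_def
    by (intro has_integral_diff has_integral_mult_right integrable_integral integrable_poly_trig)
  ultimately have "real (2 * M + 3) * riesz_kernel (Suc M) x - 2 * real (Suc M) * riesz_kernel M x - x * ?I = 0"
    using has_integral_unique by blast
  then have "real (2 * M + 3) * riesz_kernel (Suc M) x - 2 * real (Suc M) * riesz_kernel M x
      = x * (x / (2 * real (Suc (Suc M))) * riesz_kernel (Suc (Suc M)) x)"
    unfolding riesz_kernel_sin by linarith
  then show ?thesis by (simp add: power2_eq_square field_simps del: of_nat_Suc)
qed

text \<open>Division of the recurrence by x^2 gains two powers over the bound for \<open>M\<close>,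
  which is the claim for \<open>M + 2\<close>. The recurrence has three terms, hence two base
  cases.\<close>

lemma riesz_kernel_decay: "\<exists>C\<ge>0. \<forall>x\<ge>1. \<bar>riesz_kernel M x\<bar> \<le> C / x ^ Suc M"
proof (induction M rule: induct_nat_012)
  case 0
  show ?case
  proof (intro exI[of _ 2] conjI allI impI)
    fix x :: real assume "x \<ge> 1"
    then show "\<bar>riesz_kernel 0 x\<bar> \<le> 2 / x ^ Suc 0"
      by (simp add: riesz_kernel_0 abs_mult divide_right_mono)
  qed auto
next
  case 1
  show ?case
  proof (intro exI[of _ 8] conjI allI impI)
    fix x :: real assume x: "x \<ge> 1"
    have "\<bar>sin x / x\<bar> \<le> 1 / 1" unfolding abs_divide using x by (intro frac_le) auto
    then have "\<bar>sin x / x - cos x\<bar> \<le> 2" using abs_cos_le_one[of x] by linarith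
    then have "4 / x\<^sup>2 * \<bar>sin x / x - cos x\<bar> \<le> 4 / x\<^sup>2 * 2" by (intro mult_left_mono) auto
    moreover have "\<bar>riesz_kernel 1 x\<bar> = 4 / x\<^sup>2 * \<bar>sin x / x - cos x\<bar>"
      using x by (subst riesz_kernel_1) (auto simp only: abs_mult, simp)
    ultimately have "\<bar>riesz_kernel 1 x\<bar> \<le> 8 / x\<^sup>2" by simp
    then show "\<bar>riesz_kernel (Suc 0) x\<bar> \<le> 8 / x ^ Suc (Suc 0)"
      by (simp add: power2_eq_square)
  qed auto
next
  case (ge2 M)
  obtain C D where C: "C \<ge> 0" "\<And>x. x \<ge> 1 \<Longrightarrow> \<bar>riesz_kernel M x\<bar> \<le> C / x ^ Suc M"
    and D: "D \<ge> 0" "\<And>x. x \<ge> 1 \<Longrightarrow> \<bar>riesz_kernel (Suc M) x\<bar> \<le> D / x ^ Suc (Suc M)"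
    using ge2 by metis
  define E where "E = 2 * real (Suc (Suc M)) * (real (2 * M + 3) * D + 2 * real (Suc M) * C)"
  have "\<bar>riesz_kernel (Suc (Suc M)) x\<bar> \<le> E / x ^ Suc (Suc (Suc M))" if x: "x \<ge> 1" for x
  proof -
    have "D / x ^ Suc (Suc M) \<le> D / x ^ Suc M"
      using x D(1) by (intro divide_left_mono power_increasing) auto
    then have d: "\<bar>riesz_kernel (Suc M) x\<bar> \<le> D / x ^ Suc M" using D(2)[OF x] by linarith
    have "x\<^sup>2 * \<bar>riesz_kernel (Suc (Suc M)) x\<bar> = \<bar>x\<^sup>2 * riesz_kernel (Suc (Suc M)) x\<bar>"
      by (simp add: abs_mult)
    also have "\<dots> = 2 * real (Suc (Suc M)) *
      \<bar>real (2 * M + 3) * riesz_kernel (Suc M) x - 2 * real (Suc M) * riesz_kernel M x\<bar>"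
      unfolding riesz_kernel_Suc_Suc by (simp add: abs_mult)
    also have "\<dots> \<le> 2 * real (Suc (Suc M)) *
      (real (2 * M + 3) * (D / x ^ Suc M) + 2 * real (Suc M) * (C / x ^ Suc M))"
    proof (intro mult_left_mono)
      have "\<bar>real (2 * M + 3) * riesz_kernel (Suc M) x - 2 * real (Suc M) * riesz_kernel M x\<bar>
        \<le> real (2 * M + 3) * \<bar>riesz_kernel (Suc M) x\<bar> + 2 * real (Suc M) * \<bar>riesz_kernel M x\<bar>"
        by (rule order_trans[OF abs_triangle_ineq4]) (simp add: abs_mult)
      also have "\<dots> \<le> real (2 * M + 3) * (D / x ^ Suc M) + 2 * real (Suc M) * (C / x ^ Suc M)"
        using d C(2)[OF x] by (intro add_mono mult_left_mono) auto
      finally show "\<bar>real (2 * M + 3) * riesz_kernel (Suc M) x - 2 * real (Suc M) * riesz_kernel M x\<bar>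
        \<le> real (2 * M + 3) * (D / x ^ Suc M) + 2 * real (Suc M) * (C / x ^ Suc M)" .
    qed auto
    also have "\<dots> = E / x ^ Suc M" by (simp only: E_def times_divide_eq_right add_divide_distrib[symmetric])
    finally have "x\<^sup>2 * \<bar>riesz_kernel (Suc (Suc M)) x\<bar> \<le> E / x ^ Suc M" .
    then show ?thesis using x by (simp add: field_simps power2_eq_square)
  qed
  moreover have "E \<ge> 0" using C D by (simp add: E_def)
  ultimately show ?case by blast
qed

section \<open>The primitive of the kernel and its rate of convergence\<close>

lemma riesz_step_has_derivative: "(riesz_step M has_real_derivative riesz_kernel M x) (at x)"
proof -
  have der: "((\<lambda>x. x * sinc (t * x)) has_real_derivative cos (t * x)) (at x)" for t x :: real
  proof (cases "t = 0")
    case False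
    have "((\<lambda>x. sin (t * x) / t) has_real_derivative cos (t * x)) (at x)"
      using False by (auto intro!: derivative_eq_intros)
    moreover have "(\<lambda>x. x * sinc (t * x)) = (\<lambda>x. sin (t * x) / t)"
      using False by (auto simp: fun_eq_iff)
    ultimately show ?thesis by simp
  qed (auto intro!: derivative_eq_intros)
  have "((\<lambda>x. integral (cbox (-1) 1) (\<lambda>t. (1 - t\<^sup>2) ^ M * (x * sinc (t * x)))) has_field_derivative
     integral (cbox (-1) 1) (\<lambda>t. (1 - t\<^sup>2) ^ M * cos (t * x))) (at x within UNIV)"
  proof (rule leibniz_rule_field_derivative)
    show "continuous_on (UNIV \<times> cbox (-1) 1) (\<lambda>(x::real, t). (1 - t\<^sup>2) ^ M * cos (t * x))"
      unfolding split_beta by (intro continuous_intros)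
    show "((\<lambda>x. (1 - t\<^sup>2) ^ M * (x * sinc (t * x))) has_real_derivative (1 - t\<^sup>2) ^ M * cos (t * x)) (at x within UNIV)" for x t
      by (rule DERIV_cmult[OF der])
    show "(\<lambda>t. (1 - t\<^sup>2) ^ M * (x * sinc (t * x))) integrable_on cbox (-1) 1" for x :: real
      using integrable_poly_trig(3)[of M x] by simp
  qed auto
  then show ?thesis by (simp add: riesz_step_def[abs_def] riesz_kernel_def)
qed

lemma riesz_step_minus: "riesz_step M (- x) = - riesz_step M x"
proof -
  have "sinc (t * - x) = sinc (t * x)" for t
    using sinc_neg[of "t * x"] by (simp only: mult_minus_right)
  then have "riesz_step M (- x) = integral {-1..1} (\<lambda>t. - ((1 - t\<^sup>2) ^ M * (x * sinc (t * x))))"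
    unfolding riesz_step_def by (intro integral_cong) (simp only: mult_minus_left mult_minus_right)
  then show ?thesis by (simp only: riesz_step_def integral_neg)
qed

text \<open>Both sides vanish at 0 and have the same derivative, twice the cardinal sine.\<close>

lemma riesz_step_0: "riesz_step 0 x = 2 * Si x"
proof -
  have "((\<lambda>x. riesz_step 0 x - 2 * Si x) has_real_derivative riesz_kernel 0 x - 2 * sinc x) (at x)" for x
    by (intro DERIV_diff DERIV_cmult riesz_step_has_derivative DERIV_Si)
  moreover have "riesz_kernel 0 x - 2 * sinc x = 0" for x
    by (cases "x = 0") (auto simp: riesz_kernel_0, simp add: riesz_kernel_def)
  ultimately have "((\<lambda>x. riesz_step 0 x - 2 * Si x) has_real_derivative 0) (at x)" for x by simp
  then have "riesz_step 0 x - 2 * Si x = riesz_step 0 0 - 2 * Si 0" by (rule DERIV_isconst_all[rule_format])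
  also have "\<dots> = 0" by (simp add: riesz_step_def Si_def zero_ereal_def)
  finally show ?thesis by simp
qed

lemma riesz_step_Suc:
  "riesz_step (Suc M) x = riesz_step M x - x / (2 * real (Suc M)) * riesz_kernel (Suc M) x"
proof -
  have "riesz_step M x - riesz_step (Suc M) x = integral {-1..1}
      (\<lambda>t. (1 - t\<^sup>2) ^ M * (x * sinc (t * x)) - (1 - t\<^sup>2) ^ Suc M * (x * sinc (t * x)))"
    unfolding riesz_step_def by (rule integral_diff[symmetric]) (rule integrable_poly_trig)+
  also have "\<dots> = integral {-1..1} (\<lambda>t. t * (1 - t\<^sup>2) ^ M * sin (t * x))"
  proof (rule integral_cong)
    fix t :: real
    have "(1 - t\<^sup>2) ^ M * (x * sinc (t * x)) - (1 - t\<^sup>2) ^ Suc M * (x * sinc (t * x))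
      = t * (1 - t\<^sup>2) ^ M * (t * (x * sinc (t * x)))"
      by (simp add: algebra_simps power2_eq_square del: sinc_neg)
    then show "(1 - t\<^sup>2) ^ M * (x * sinc (t * x)) - (1 - t\<^sup>2) ^ Suc M * (x * sinc (t * x))
      = t * (1 - t\<^sup>2) ^ M * sin (t * x)" unfolding mult_sinc .
  qed
  finally show ?thesis unfolding riesz_kernel_sin by linarith
qed

text \<open>Passage from \<open>M\<close> to \<open>M + 1\<close> changes the primitive only by x
  times a kernel that decays like x^{-(M+2)}. So all limits equal the one for \<open>M = 0\<close>,
  twice Dirichlet's integral \<pi>/2.\<close>

lemma riesz_step_tendsto: "(riesz_step M \<longlongrightarrow> pi) at_top"
proof (induction M)
  case 0
  have "((\<lambda>x. 2 * Si x) \<longlongrightarrow> 2 * (pi / 2)) at_top" by (intro tendsto_mult_left Si_at_top)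
  moreover have "riesz_step 0 = (\<lambda>x. 2 * Si x)" by (simp add: fun_eq_iff riesz_step_0)
  ultimately show ?case by simp
next
  case (Suc M)
  obtain C where C: "C \<ge> 0" "\<And>x. x \<ge> 1 \<Longrightarrow> \<bar>riesz_kernel (Suc M) x\<bar> \<le> C / x ^ Suc (Suc M)"
    using riesz_kernel_decay[of "Suc M"] by metis
  have "((\<lambda>x. x / (2 * real (Suc M)) * riesz_kernel (Suc M) x) \<longlongrightarrow> 0) at_top"
  proof (rule Lim_null_comparison)
    show "((\<lambda>x. C * inverse x) \<longlongrightarrow> 0) at_top"
      by (intro tendsto_mult_right_zero tendsto_inverse_0_at_top filterlim_ident)
    show "\<forall>\<^sub>F x in at_top. norm (x / (2 * real (Suc M)) * riesz_kernel (Suc M) x) \<le> C * inverse x"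
      using eventually_ge_at_top[of 1]
    proof eventually_elim
      case (elim x)
      have "\<bar>x / (2 * real (Suc M)) * riesz_kernel (Suc M) x\<bar> = x / (2 * real (Suc M)) * \<bar>riesz_kernel (Suc M) x\<bar>"
        using elim by (simp add: abs_mult)
      also have "\<dots> \<le> x * (C / x ^ Suc (Suc M))"
        using elim C by (intro mult_mono) (auto simp: field_simps)
      also have "\<dots> \<le> x * (C / x ^ 2)"
        using elim C(1) by (intro mult_left_mono divide_left_mono power_increasing) auto
      also have "\<dots> = C * inverse x" using elim by (simp add: power2_eq_square field_simps)
      finally show ?case by simp
    qed
  qed
  from tendsto_diff[OF Suc.IH this] show ?case by (simp add: riesz_step_Suc[abs_def])
qed

text \<open>The kernel of order M + 1 is O(x^{-(M+2)}), and integration of this bound over [x,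
  \<infinity>) would give only x^{-(M+1)}. The missing power comes from oscillation: a multiple of
  the kernel of order M over x, itself O(x^{-(M+2)}), is added, and the derivative of the sum is
  O(x^{-(M+3)}).\<close>

lemma riesz_step_rate: "\<exists>C\<ge>0. \<forall>x\<ge>1. \<bar>riesz_step (Suc M) x - pi\<bar> \<le> C / x ^ (M + 2)"
proof -
  obtain C where C: "C \<ge> 0" "\<And>x. x \<ge> 1 \<Longrightarrow> \<bar>riesz_kernel M x\<bar> \<le> C / x ^ Suc M"
    using riesz_kernel_decay[of M] by metis
  define m where "m = 2 * real (Suc M)"
  have m: "m > 0" by (simp add: m_def)
  \<comment> \<open>The multiple m = 2 (M+1) is the one for which the terms with
    \<open>riesz_kernel (Suc M)\<close> cancel in the derivative of \<open>F\<close>.\<close>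
  define F where "F x = riesz_step (Suc M) x + m * (riesz_kernel M x / x)" for x
  have dF: "(F has_real_derivative - (m * riesz_kernel M x / x\<^sup>2)) (at x)" if "x \<ge> 1" for x
  proof -
    have "(F has_real_derivative riesz_kernel (Suc M) x + m * ((- (x / m * riesz_kernel (Suc M) x) * x - riesz_kernel M x * 1) / (x * x))) (at x)"
      unfolding F_def[abs_def] m_def
      using that by (intro DERIV_add DERIV_cmult DERIV_divide riesz_step_has_derivative riesz_kernel_has_derivative DERIV_ident) auto
    moreover have "riesz_kernel (Suc M) x + m * ((- (x / m * riesz_kernel (Suc M) x) * x - riesz_kernel M x * 1) / (x * x))
      = - (m * riesz_kernel M x / x\<^sup>2)"
      using that m by (simp add: field_simps power2_eq_square)
    ultimately show ?thesis by simp
  qed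
  define D where "D = m * C"
  define G where "G x = D * inverse (x ^ (M + 2))" for x :: real
  have dG: "(G has_real_derivative - (real (M + 2) * D / x ^ (M + 3))) (at x)" if "x \<ge> 1" for x
  proof -
    have "(G has_real_derivative D * (- (inverse (x ^ (M + 2)) * (real (M + 2) * x ^ (M + 1)) * inverse (x ^ (M + 2))))) (at x)"
      unfolding G_def[abs_def] using that
      using DERIV_pow[of "M + 2" x] by (intro DERIV_cmult DERIV_inverse') auto
    moreover have "D * (- (inverse (x ^ (M + 2)) * (real (M + 2) * x ^ (M + 1)) * inverse (x ^ (M + 2)))) = - (real (M + 2) * D / x ^ (M + 3))"
      using that by (simp add: field_simps power_add power2_eq_square power3_eq_cube)
    ultimately show ?thesis by simp
  qed
  have bnd: "\<bar>m * riesz_kernel M x / x\<^sup>2\<bar> \<le> real (M + 2) * D / x ^ (M + 3)" if x: "x \<ge> 1" for x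
  proof -
    have "\<bar>m * riesz_kernel M x / x\<^sup>2\<bar> = m * \<bar>riesz_kernel M x\<bar> / x\<^sup>2" using m by (simp add: abs_mult)
    also have "\<dots> \<le> m * (C / x ^ Suc M) / x\<^sup>2" using m C(2)[OF x] x by (intro divide_right_mono mult_left_mono) auto
    also have "\<dots> = 1 * D / x ^ (M + 3)" using x by (simp add: D_def field_simps power_add power2_eq_square power3_eq_cube)
    also have "\<dots> \<le> real (M + 2) * D / x ^ (M + 3)" using x m C(1) by (intro divide_right_mono mult_right_mono) (auto simp: D_def)
    finally show ?thesis .
  qed
  have limG: "(G \<longlongrightarrow> 0) at_top"
    unfolding G_def[abs_def]
    by (intro tendsto_mult_right_zero tendsto_inverse_0_at_top filterlim_pow_at_top filterlim_ident) simp
  have limk: "((\<lambda>x. m * (riesz_kernel M x / x)) \<longlongrightarrow> 0) at_top"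
  proof (rule Lim_null_comparison)
    show "((\<lambda>x. D * inverse x) \<longlongrightarrow> 0) at_top"
      by (intro tendsto_mult_right_zero tendsto_inverse_0_at_top filterlim_ident)
    show "\<forall>\<^sub>F x in at_top. norm (m * (riesz_kernel M x / x)) \<le> D * inverse x"
      using eventually_ge_at_top[of 1]
    proof eventually_elim
      case (elim x)
      have "C / x ^ Suc M \<le> C / 1" using elim C(1) by (intro divide_left_mono one_le_power) auto
      then have "\<bar>riesz_kernel M x\<bar> \<le> C" using C(2)[OF elim] by simp
      then have "m * (\<bar>riesz_kernel M x\<bar> / x) \<le> m * (C / x)"
        using m elim by (intro mult_left_mono divide_right_mono) auto
      then show ?case using m elim by (simp add: D_def abs_mult divide_inverse mult_ac)
    qed
  qed
  from tendsto_add[OF riesz_step_tendsto[of "Suc M"] limk]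
  have limF: "(F \<longlongrightarrow> pi) at_top" by (simp add: F_def[abs_def])
  have "\<bar>F x - pi\<bar> \<le> G x" if x: "x \<ge> 1" for x
  proof -
    \<comment> \<open>The slope of \<open>G\<close> dominates that of \<open>F\<close>, and
      \<open>G\<close> tends to 0. So F + G and G - F are nonincreasing, and comparison with their
      limits \<pi> and -\<pi> bounds F - \<pi> by \<open>G\<close> on both sides.\<close>
    have up: "F y + G y \<le> F x + G x" if "y \<ge> x" for y
    proof (rule DERIV_nonpos_imp_nonincreasing[OF that, of "\<lambda>x. F x + G x"])
      fix z assume "x \<le> z" "z \<le> y"
      then have z: "z \<ge> 1" using x by simp
      show "\<exists>d. ((\<lambda>x. F x + G x) has_real_derivative d) (at z) \<and> d \<le> 0"
        by (rule exI, rule conjI, rule DERIV_add[OF dF[OF z] dG[OF z]]) (use bnd[OF z] in linarith)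
    qed
    have down: "G y - F y \<le> G x - F x" if "y \<ge> x" for y
    proof (rule DERIV_nonpos_imp_nonincreasing[OF that, of "\<lambda>x. G x - F x"])
      fix z assume "x \<le> z" "z \<le> y"
      then have z: "z \<ge> 1" using x by simp
      show "\<exists>d. ((\<lambda>x. G x - F x) has_real_derivative d) (at z) \<and> d \<le> 0"
        by (rule exI, rule conjI, rule DERIV_diff[OF dG[OF z] dF[OF z]]) (use bnd[OF z] in linarith)
    qed
    have "pi + 0 \<le> F x + G x"
      using up by (intro tendsto_upperbound[OF tendsto_add[OF limF limG]] eventually_mono[OF eventually_ge_at_top[of x]]) auto
    moreover have "0 - pi \<le> G x - F x"
      using down by (intro tendsto_upperbound[OF tendsto_diff[OF limG limF]] eventually_mono[OF eventually_ge_at_top[of x]]) auto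
    ultimately show ?thesis by linarith
  qed
  moreover have "\<bar>m * (riesz_kernel M x / x)\<bar> \<le> D / x ^ (M + 2)" if x: "x \<ge> 1" for x
  proof -
    have "\<bar>m * (riesz_kernel M x / x)\<bar> = m * (\<bar>riesz_kernel M x\<bar> / x)" using m x by (simp add: abs_mult)
    also have "\<dots> \<le> m * (C / x ^ Suc M / x)" using m C(2)[OF x] x by (intro mult_left_mono divide_right_mono) auto
    also have "\<dots> = D / x ^ (M + 2)" by (simp add: D_def mult_ac)
    finally show ?thesis .
  qed
  ultimately have "\<bar>riesz_step (Suc M) x - pi\<bar> \<le> (2 * D) / x ^ (M + 2)" if "x \<ge> 1" for x
    using that unfolding F_def G_def by (fastforce simp: divide_inverse)
  moreover have "D \<ge> 0" using m C(1) by (simp add: D_def)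
  ultimately show ?thesis by (intro exI[of _ "2 * D"]) auto
qed

text \<open>The mean of the indicator of (0, \<infinity>): the primitive is odd with limit \<pi>, so
  this tends to 0 at -\<infinity> and to 1 at \<infinity>.\<close>

definition smoothed_step :: "nat \<Rightarrow> real \<Rightarrow> real" where
  "smoothed_step M x = 1 / 2 + riesz_step M x / (2 * pi)"

lemma abs_riesz_step_le: "\<bar>riesz_step M x\<bar> \<le> 2 * \<bar>x\<bar>"
proof -
  have sinc_le: "\<bar>sinc y\<bar> \<le> 1" for y
    using abs_sin_x_le_abs_x[of y] by (cases "y = 0") (auto simp: divide_simps)
  have "norm ((1 - t\<^sup>2) ^ M * (x * sinc (t * x))) \<le> \<bar>x\<bar>" if "t \<in> {-1..1}" for t
  proof -
    have "t\<^sup>2 \<le> 1" using that by (simp add: abs_square_le_1 abs_le_iff)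
    then have "\<bar>(1 - t\<^sup>2) ^ M\<bar> \<le> 1" by (simp add: power_le_one)
    moreover have "\<bar>x\<bar> * \<bar>sinc (t * x)\<bar> \<le> \<bar>x\<bar> * 1" by (intro mult_left_mono sinc_le abs_ge_zero)
    ultimately have "\<bar>(1 - t\<^sup>2) ^ M\<bar> * (\<bar>x\<bar> * \<bar>sinc (t * x)\<bar>) \<le> 1 * (\<bar>x\<bar> * 1)" by (rule mult_mono) (simp_all only: abs_ge_zero mult_nonneg_nonneg zero_le_one)
    then show ?thesis by (simp only: real_norm_def abs_mult mult_1 mult_1_right)
  qed
  then have "norm (integral {-1..1} (\<lambda>t. (1 - t\<^sup>2) ^ M * (x * sinc (t * x)))) \<le> \<bar>x\<bar> * (1 - (-1))"
    by (intro integral_bound continuous_intros continuous_on_compose2[OF continuous_on_sinc[of UNIV]]) auto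
  then show ?thesis by (simp add: riesz_step_def)
qed

lemma smoothed_step_rate:
  assumes "M \<ge> 1"
  obtains C where "C \<ge> 0"
    "\<And>x. \<bar>smoothed_step M x - (if x > 0 then 1 else 0)\<bar> \<le> C / (1 + \<bar>x\<bar>) ^ (M + 1)"
proof -
  obtain m where m: "M = Suc m" using assms by (cases M) auto
  obtain C where C: "C \<ge> 0" "\<And>x. x \<ge> 1 \<Longrightarrow> \<bar>riesz_step M x - pi\<bar> \<le> C / x ^ (M + 1)"
    using riesz_step_rate[of m] unfolding m by auto
  \<comment> \<open>The factor 2^{M+1} turns powers of x into powers of 1 + x for x \<ge> 1. The
    summand 2 covers |x| < 1, where the difference is at most 2.\<close>
  define D where "D = (2 + C) * 2 ^ (M + 1)"
  have far: "C / (2 * pi) / x ^ (M + 1) \<le> D / (1 + x) ^ (M + 1)" if "x \<ge> 1" for x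
  proof -
    have "(1 + x) ^ (M + 1) \<le> 2 ^ (M + 1) * x ^ (M + 1)"
      unfolding power_mult_distrib[symmetric] using that by (intro power_mono) auto
    then have "C * (1 + x) ^ (M + 1) \<le> C * (2 ^ (M + 1) * x ^ (M + 1))"
      using C(1) by (intro mult_left_mono)
    also have "\<dots> \<le> D * x ^ (M + 1)"
      using that C(1) by (simp add: D_def algebra_simps)
    finally have "C * (1 + x) ^ (M + 1) \<le> D * x ^ (M + 1)" .
    moreover have "C / q \<le> D / p" if "C * p \<le> D * q" "p > 0" "q > 0" for p q :: real
      using that by (simp add: field_simps)
    ultimately have "C / x ^ (M + 1) \<le> D / (1 + x) ^ (M + 1)"
      using that by (metis add_pos_pos less_le_trans zero_less_one zero_less_power)
    moreover have "C / (2 * pi) \<le> C / 1" using C(1) pi_gt3 by (intro divide_left_mono) auto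
    then have "C / (2 * pi) / x ^ (M + 1) \<le> C / 1 / x ^ (M + 1)" using that by (intro divide_right_mono) auto
    ultimately show ?thesis by simp
  qed
  have "\<bar>smoothed_step M x - (if x > 0 then 1 else 0)\<bar> \<le> D / (1 + \<bar>x\<bar>) ^ (M + 1)" for x
  proof -
    consider "x \<ge> 1" | "x \<le> -1" | "\<bar>x\<bar> < 1" by linarith
    then show ?thesis
    proof cases
      case 1
      have "smoothed_step M x - 1 = (riesz_step M x - pi) / (2 * pi)"
        by (simp add: smoothed_step_def diff_divide_distrib)
      then have "\<bar>smoothed_step M x - 1\<bar> = \<bar>riesz_step M x - pi\<bar> / (2 * pi)" by (simp only: abs_divide) simp
      also have "\<dots> \<le> C / x ^ (M + 1) / (2 * pi)"
        by (intro divide_right_mono C(2)[OF 1]) simp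
      also have "\<dots> = C / (2 * pi) / x ^ (M + 1)" by simp
      finally show ?thesis using far[OF 1] 1 by simp
    next
      case 2
      have "smoothed_step M x = - (riesz_step M (- x) - pi) / (2 * pi)"
        by (simp add: smoothed_step_def riesz_step_minus field_simps)
      then have "\<bar>smoothed_step M x\<bar> = \<bar>riesz_step M (- x) - pi\<bar> / (2 * pi)" by (simp only: abs_divide abs_minus_cancel) simp
      also have "\<dots> \<le> C / (- x) ^ (M + 1) / (2 * pi)"
        using 2 by (intro divide_right_mono C(2)) auto
      also have "\<dots> = C / (2 * pi) / (- x) ^ (M + 1)" by simp
      finally show ?thesis using far[of "- x"] 2 by simp
    next
      case 3
      have "\<bar>riesz_step M x / (2 * pi)\<bar> \<le> 2 * 1 / (2 * 1)"
        unfolding abs_divide using abs_riesz_step_le[of M x] 3 pi_gt3 by (intro frac_le) auto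
      then have "\<bar>smoothed_step M x - (if x > 0 then 1 else 0)\<bar> \<le> 2"
        unfolding smoothed_step_def by (cases "x > 0"; simp only: if_True if_False; linarith)
      also have "2 \<le> D / (1 + \<bar>x\<bar>) ^ (M + 1)"
      proof -
        have "(1 + \<bar>x\<bar>) ^ (M + 1) \<le> 2 ^ (M + 1)" using 3 by (intro power_mono) auto
        then have "2 * (1 + \<bar>x\<bar>) ^ (M + 1) \<le> D"
          unfolding D_def using C(1) by (intro mult_mono) auto
        moreover have "0 < (1 + \<bar>x\<bar>) ^ (M + 1)" by (intro zero_less_power) auto
        ultimately show ?thesis by (simp only: pos_le_divide_eq)
      qed
      finally show ?thesis .
    qed
  qed
  moreover have "D \<ge> 0" using C(1) by (simp add: D_def)
  ultimately show ?thesis using that by blast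
qed

lemma continuous_smoothed_step: "continuous_on UNIV (smoothed_step M)"
  unfolding smoothed_step_def[abs_def]
  using DERIV_continuous[OF riesz_step_has_derivative]
  by (intro continuous_at_imp_continuous_on ballI continuous_intros) auto

subsection \<open>Oscillatory integrals against Sobolev functions\<close>

text \<open>One weak derivative at a time on (-T, T): \<open>has_weak_deriv\<close> ties every
  derivative to \<open>u\<close> itself, whereas integration by parts moves from each derivative to
  the next.\<close>

definition weak_step :: "real \<Rightarrow> (real \<Rightarrow> complex) \<Rightarrow> (real \<Rightarrow> complex) \<Rightarrow> bool" where
  "weak_step T v v' \<longleftrightarrow> set_integrable lebesgue {-T..T} v \<and> set_integrable lebesgue {-T..T} v' \<and>
    (\<forall>\<phi>\<in>test_functions {-T<..<T}.
      (LINT x:{-T..T}|lebesgue. v x * nth_deriv 1 \<phi> x) = - (LINT x:{-T..T}|lebesgue. v' x * \<phi> x))"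

lemma set_integral_dominated_convergence:
  fixes v :: "real \<Rightarrow> complex" and f :: "nat \<Rightarrow> real \<Rightarrow> complex"
  assumes v: "set_integrable lebesgue A v"
    and f: "\<And>n. f n \<in> borel_measurable borel" "f' \<in> borel_measurable borel"
    and lim: "AE x in lebesgue. x \<in> A \<longrightarrow> (\<lambda>n. f n x) \<longlonglongrightarrow> f' x"
    and bound: "\<And>n x. x \<in> A \<Longrightarrow> norm (f n x) \<le> C"
  shows "(\<lambda>n. LINT x:A|lebesgue. v x * f n x) \<longlonglongrightarrow> (LINT x:A|lebesgue. v x * f' x)"
  unfolding set_lebesgue_integral_def
proof (rule integral_dominated_convergence[where w = "\<lambda>x. C * norm (indicator A x *\<^sub>R v x)"])
  have vm: "(\<lambda>x. indicator A x *\<^sub>R v x) \<in> borel_measurable lebesgue"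
    using v unfolding set_integrable_def by (rule borel_measurable_integrable)
  have m: "(\<lambda>x. indicator A x *\<^sub>R (v x * k x)) \<in> borel_measurable lebesgue" if "k \<in> borel_measurable borel" for k
  proof -
    have "k \<in> borel_measurable lebesgue" using that by (intro measurable_completion) simp
    then have "(\<lambda>x. indicator A x *\<^sub>R v x * k x) \<in> borel_measurable lebesgue" by (rule borel_measurable_times[OF vm])
    then show ?thesis by simp
  qed
  show "(\<lambda>x. indicator A x *\<^sub>R (v x * f' x)) \<in> borel_measurable lebesgue"
    "\<And>n. (\<lambda>x. indicator A x *\<^sub>R (v x * f n x)) \<in> borel_measurable lebesgue"
    by (intro m f)+
  show "integrable lebesgue (\<lambda>x. C * norm (indicator A x *\<^sub>R v x))"
    using v unfolding set_integrable_def by (intro integrable_mult_right integrable_norm)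
  show "AE x in lebesgue. (\<lambda>n. indicator A x *\<^sub>R (v x * f n x)) \<longlonglongrightarrow> indicator A x *\<^sub>R (v x * f' x)"
    using lim
  proof eventually_elim
    case (elim x)
    then show ?case by (cases "x \<in> A") (auto intro: tendsto_mult_left)
  qed
  show "AE x in lebesgue. norm (indicator A x *\<^sub>R (v x * f n x)) \<le> C * norm (indicator A x *\<^sub>R v x)" for n
  proof (rule AE_I2)
    fix x
    show "norm (indicator A x *\<^sub>R (v x * f n x)) \<le> C * norm (indicator A x *\<^sub>R v x)"
      using mult_left_mono[OF bound[of x n] norm_ge_zero[of "v x"]]
      by (cases "x \<in> A") (auto simp: norm_mult mult.commute)
  qed
qed

lemma set_integrable_mult_bounded:
  fixes v f :: "real \<Rightarrow> complex"
  assumes v: "set_integrable lebesgue A v" and f: "f \<in> borel_measurable borel"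
    and bound: "\<And>x. x \<in> A \<Longrightarrow> norm (f x) \<le> C"
  shows "set_integrable lebesgue A (\<lambda>x. v x * f x)"
  unfolding set_integrable_def
proof (rule Bochner_Integration.integrable_bound)
  have vm: "(\<lambda>x. indicator A x *\<^sub>R v x) \<in> borel_measurable lebesgue"
    using v unfolding set_integrable_def by (rule borel_measurable_integrable)
  have "f \<in> borel_measurable lebesgue" using f by (intro measurable_completion) simp
  then have "(\<lambda>x. indicator A x *\<^sub>R v x * f x) \<in> borel_measurable lebesgue" by (rule borel_measurable_times[OF vm])
  then show "(\<lambda>x. indicator A x *\<^sub>R (v x * f x)) \<in> borel_measurable lebesgue" by simp
  show "integrable lebesgue (\<lambda>x. C * norm (indicator A x *\<^sub>R v x))"
    using v unfolding set_integrable_def by (intro integrable_mult_right integrable_norm)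
  show "AE x in lebesgue. norm (indicator A x *\<^sub>R (v x * f x)) \<le> norm (C * norm (indicator A x *\<^sub>R v x))"
  proof (rule AE_I2)
    fix x
    show "norm (indicator A x *\<^sub>R (v x * f x)) \<le> norm (C * norm (indicator A x *\<^sub>R v x))"
      using mult_left_mono[OF bound[of x] norm_ge_zero[of "v x"]]
      by (cases "x \<in> A") (auto simp: norm_mult mult.commute intro: order_trans[OF _ abs_ge_self])
  qed
qed

lemma smooth_bounded_interval:
  assumes "smooth_on U f" "{a..b} \<subseteq> U" obtains C where "C > 0" "\<And>x. x \<in> {a..b} \<Longrightarrow> norm (f x) \<le> C"
proof -
  have "compact (f ` {a..b})"
    by (intro compact_continuous_image) (auto intro: continuous_on_subset[OF smooth_on_continuous[OF assms(1)] assms(2)])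
  from compact_imp_bounded[OF this] obtain C where C: "C > 0" "\<forall>y\<in>f ` {a..b}. norm y \<le> C"
    unfolding bounded_pos by blast
  show ?thesis by (rule that[OF C(1)]) (use C(2) in blast)
qed

lemma smooth_lipschitz_interval:
  assumes f: "smooth_on U f" and ab: "{a..b} \<subseteq> U"
  obtains C where "C > 0" "\<And>x y. x \<in> {a..b} \<Longrightarrow> y \<in> {a..b} \<Longrightarrow> norm (f x - f y) \<le> C * \<bar>x - y\<bar>"
proof -
  obtain C where C: "C > 0" "\<And>x. x \<in> {a..b} \<Longrightarrow> norm (nth_deriv 1 f x) \<le> C"
    using smooth_bounded_interval[OF smooth_on_nth_deriv[OF f] ab] by metis
  have "norm (f x - f y) \<le> C * norm (x - y)" if "x \<in> {a..b}" "y \<in> {a..b}" for x y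
  proof (rule differentiable_bound[of "{a..b}" f "\<lambda>x h. h *\<^sub>R nth_deriv 1 f x"])
    show "(f has_derivative (\<lambda>h. h *\<^sub>R nth_deriv 1 f z)) (at z within {a..b})" if "z \<in> {a..b}" for z
      using has_vector_derivative_at_within[OF smooth_on_has_vector_derivative[OF f subsetD[OF ab that]]]
      by (simp add: has_vector_derivative_def)
    show "onorm (\<lambda>h. h *\<^sub>R nth_deriv 1 f z) \<le> C" if "z \<in> {a..b}" for z
      using C(1) mult_left_mono[OF C(2)[OF that]] by (intro onorm_bound) (auto simp: mult.commute[of C])
  qed (use that in auto)
  then show ?thesis using that[OF C(1)] by simp
qed

lemma smooth_borel: "smooth_on UNIV f \<Longrightarrow> f \<in> borel_measurable borel"
  by (intro borel_measurable_continuous_onI smooth_on_continuous)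

context smooth_step
begin

lemma deriv_zero: "x < 0 \<or> x > R \<Longrightarrow> nth_deriv 1 F x = 0"
proof -
  have "nth_deriv 1 F x = nth_deriv 1 (\<lambda>x. 0) x" if "x < 0"
    by (rule nth_deriv_cong_open[of "{..<0}"]) (use that zero in auto)
  moreover have "nth_deriv 1 F x = nth_deriv 1 (\<lambda>x. 1) x" if "x > R"
    by (rule nth_deriv_cong_open[of "{R<..}"]) (use that one in auto)
  moreover have "nth_deriv 1 (\<lambda>x. c) x = 0" for c
    by (simp add: nth_deriv_Suc)
  ultimately show "x < 0 \<or> x > R \<Longrightarrow> nth_deriv 1 F x = 0" by metis
qed

lemma bump_has_vector_derivative:
  "(bump a b d has_vector_derivative
    F ((x - a) / d) * (of_real (- 1 / d) * nth_deriv 1 F ((b - x) / d))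
    + of_real (1 / d) * nth_deriv 1 F ((x - a) / d) * F ((b - x) / d)) (at x)"
proof -
  have "((\<lambda>x. (x - a) / d) has_vector_derivative 1 / d) (at x)"
    by (cases "d = 0") (auto intro!: derivative_eq_intros)
  from vector_diff_chain_at[OF this smooth_on_has_vector_derivative[OF smooth UNIV_I]]
  have 1: "((\<lambda>x. F ((x - a) / d)) has_vector_derivative of_real (1 / d) * nth_deriv 1 F ((x - a) / d)) (at x)"
    by (simp add: o_def scaleR_conv_of_real)
  have "((\<lambda>x. (b - x) / d) has_vector_derivative - 1 / d) (at x)"
    by (cases "d = 0") (auto intro!: derivative_eq_intros)
  from vector_diff_chain_at[OF this smooth_on_has_vector_derivative[OF smooth UNIV_I]]
  have 2: "((\<lambda>x. F ((b - x) / d)) has_vector_derivative of_real (- 1 / d) * nth_deriv 1 F ((b - x) / d)) (at x)"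
    by (simp add: o_def scaleR_conv_of_real)
  show ?thesis unfolding bump_def[abs_def] by (rule has_vector_derivative_mult[OF 1 2])
qed

lemma inner_bump_test:
  assumes "d > 0" "smooth_on UNIV f"
  shows "(\<lambda>x. bump (-T + d) (T - d) d x * f x) \<in> test_functions {-T<..<T}"
proof -
  have "bump (-T + d) (T - d) d \<in> test_functions {-T<..<T}" using assms by (intro bump_test) auto
  from test_functions_mult[OF this assms(2)] show ?thesis by (simp add: mult.commute)
qed

text \<open>The inner bump begins at distance d from an end of the interval and takes a further R d
  to reach 1, whence R + 1.\<close>

lemma inner_bump_eventually:
  assumes "x \<in> {-T<..<T}"
  shows "\<forall>\<^sub>F n in sequentially. x \<in> {-T + (R + 1) * (1 / real (Suc n))<..<T - (R + 1) * (1 / real (Suc n))}"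
proof -
  have "(\<lambda>n. (R + 1) * (1 / real (Suc n))) \<longlonglongrightarrow> (R + 1) * 0"
    by (intro tendsto_mult_left LIMSEQ_Suc[OF lim_1_over_n])
  then have "\<forall>\<^sub>F n in sequentially. (R + 1) * (1 / real (Suc n)) < min (x + T) (T - x)"
    using assms by (intro order_tendstoD(2)) auto
  then show ?thesis by eventually_elim auto
qed

lemma inner_bump_one:
  assumes "d > 0" "x \<in> {-T + (R + 1) * d<..<T - (R + 1) * d}"
  shows "bump (-T + d) (T - d) d x = 1"
  using assms by (intro bump_one) (auto simp: algebra_simps)

lemma AE_interior: "AE x in lebesgue. x \<in> {-T..T} \<longrightarrow> x \<in> {-T<..<T::real}"
proof -
  have "AE x in lborel. x \<noteq> T \<and> x \<noteq> -T"
    using AE_lborel_singleton[of T] AE_lborel_singleton[of "-T"] by eventually_elim auto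
  then have "AE x in lebesgue. x \<noteq> T \<and> x \<noteq> -T" by (rule AE_completion)
  then show ?thesis by eventually_elim auto
qed

lemma integral_inner_bump_tendsto:
  assumes v: "set_integrable lebesgue {-T..T} v" and f: "smooth_on UNIV f"
  shows "(\<lambda>n. LINT x:{-T..T}|lebesgue. v x * (bump (-T + 1 / real (Suc n)) (T - 1 / real (Suc n)) (1 / real (Suc n)) x * f x))
    \<longlonglongrightarrow> (LINT x:{-T..T}|lebesgue. v x * f x)"
proof -
  obtain C where C: "C > 0" "\<And>x. x \<in> {-T..T} \<Longrightarrow> norm (f x) \<le> C" using smooth_bounded_interval[OF f subset_UNIV] by metis
  show ?thesis
  proof (rule set_integral_dominated_convergence[OF v])
    show "(\<lambda>x. bump (-T + 1 / real (Suc n)) (T - 1 / real (Suc n)) (1 / real (Suc n)) x * f x) \<in> borel_measurable borel" for n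
      by (intro smooth_borel smooth_on_mult smooth_bump f) simp
    show "f \<in> borel_measurable borel" by (rule smooth_borel[OF f])
    show "norm (bump (-T + 1 / real (Suc n)) (T - 1 / real (Suc n)) (1 / real (Suc n)) x * f x) \<le> B * B * C" if "x \<in> {-T..T}" for n x
      unfolding norm_mult by (intro mult_mono bump_bound C that) (auto simp: B_nonneg)
    show "AE x in lebesgue. x \<in> {-T..T} \<longrightarrow>
      (\<lambda>n. bump (-T + 1 / real (Suc n)) (T - 1 / real (Suc n)) (1 / real (Suc n)) x * f x) \<longlonglongrightarrow> f x"
      using AE_interior[of T]
    proof eventually_elim
      case (elim x)
      show ?case
      proof
        assume "x \<in> {-T..T}"
        then have "\<forall>\<^sub>F n in sequentially. bump (-T + 1 / real (Suc n)) (T - 1 / real (Suc n)) (1 / real (Suc n)) x * f x = f x"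
        proof -
          have "x \<in> {-T<..<T}" using \<open>x \<in> {-T..T}\<close> elim by blast
          from inner_bump_eventually[OF this] show ?thesis
          proof eventually_elim
            case (elim n)
            then show ?case by (subst inner_bump_one) auto
          qed
        qed
        then show "(\<lambda>n. bump (-T + 1 / real (Suc n)) (T - 1 / real (Suc n)) (1 / real (Suc n)) x * f x) \<longlonglongrightarrow> f x"
          by (rule tendsto_eventually)
      qed
    qed
  qed
qed

text \<open>Weak derivatives are defined by test functions supported inside the open interval, and
  \<open>f\<close> merely vanishes at its ends. After multiplication by an inner bump on the scale
  d, the derivative of the bump is O(1/d) but lives within (R+1) d of an end, where \<open>f\<close>
  is O(d). This extra term stays bounded and is eventually 0 at every inner point, so dominated
  convergence removes it.\<close>

lemma weak_step_parts:
  assumes T: "T > 0" and v: "weak_step T v v'" and f: "smooth_on UNIV f" and ends: "f T = 0" "f (-T) = 0"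
  shows "(LINT x:{-T..T}|lebesgue. v x * nth_deriv 1 f x) = - (LINT x:{-T..T}|lebesgue. v' x * f x)"
proof -
  define b where "b n = bump (-T + 1 / real (Suc n)) (T - 1 / real (Suc n)) (1 / real (Suc n))" for n
  define b' where "b' n x = (let d = 1 / real (Suc n) in
    F ((x - (-T + d)) / d) * (of_real (- 1 / d) * nth_deriv 1 F ((T - d - x) / d))
    + of_real (1 / d) * nth_deriv 1 F ((x - (-T + d)) / d) * F ((T - d - x) / d))" for n x
  note int = v[unfolded weak_step_def]
  have db: "(b n has_vector_derivative b' n x) (at x)" for n x
    unfolding b_def b'_def Let_def by (rule bump_has_vector_derivative)
  have sb: "smooth_on UNIV (b n)" for n unfolding b_def by (rule smooth_bump)
  have dbf: "nth_deriv 1 (\<lambda>x. b n x * f x) x = b n x * nth_deriv 1 f x + b' n x * f x" for n x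
    using nth_deriv_Suc_eq[OF open_UNIV UNIV_I has_vector_derivative_mult[OF db smooth_on_has_vector_derivative[OF f UNIV_I]], of 0 n x]
    by simp
  obtain C1 where C1: "C1 > 0" "\<And>x. x \<in> {-T..T} \<Longrightarrow> norm (nth_deriv 1 f x) \<le> C1"
    using smooth_bounded_interval[OF smooth_on_nth_deriv[OF f] subset_UNIV] by metis
  obtain C where C: "C > 0" and lip: "\<And>x y. x \<in> {-T..T} \<Longrightarrow> y \<in> {-T..T} \<Longrightarrow> norm (f x - f y) \<le> C * \<bar>x - y\<bar>"
    using smooth_lipschitz_interval[OF f subset_UNIV] by metis
  \<comment> \<open>The summand of the product rule in which the bump is differentiated. The factor
    1/d cancels against the Lipschitz bound of \<open>f\<close>, separately at either end.\<close>
  have b'f: "norm (b' n x * f x) \<le> 2 * (B * B * (C * (R + 1)))" if x: "x \<in> {-T..T}" for n x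
  proof -
    define d where "d = 1 / real (Suc n)"
    have d: "d > 0" by (simp add: d_def)
    have term1: "norm (F ((x - (-T + d)) / d) * (of_real (- 1 / d) * nth_deriv 1 F ((T - d - x) / d)) * f x) \<le> B * B * (C * (R + 1))"
    proof (cases "(T - d - x) / d < 0 \<or> (T - d - x) / d > R")
      case True
      then show ?thesis using deriv_zero[OF True] R C B_nonneg by simp
    next
      case False
      then have "T - x \<le> (R + 1) * d" using d by (simp add: field_simps)
      then have "C * \<bar>x - T\<bar> \<le> C * ((R + 1) * d)" using x C by (intro mult_left_mono) auto
      moreover have "norm (f x) \<le> C * \<bar>x - T\<bar>" using lip[of x T] x ends T by simp
      ultimately have "norm (f x) \<le> C * ((R + 1) * d)" by linarith
      then have "norm (F ((x - (-T + d)) / d)) * (1 / d * norm (nth_deriv 1 F ((T - d - x) / d))) * norm (f x)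
        \<le> B * (1 / d * B) * (C * ((R + 1) * d))"
        using d B_nonneg R by (intro mult_mono bound deriv_bound mult_nonneg_nonneg) auto
      also have "\<dots> = B * B * (C * (R + 1))" using d by simp
      finally show ?thesis using d by (simp add: norm_mult norm_divide)
    qed
    have term2: "norm (of_real (1 / d) * nth_deriv 1 F ((x - (-T + d)) / d) * F ((T - d - x) / d) * f x) \<le> B * B * (C * (R + 1))"
    proof (cases "(x - (-T + d)) / d < 0 \<or> (x - (-T + d)) / d > R")
      case True
      then show ?thesis using deriv_zero[OF True] R C B_nonneg by simp
    next
      case False
      then have "x + T \<le> (R + 1) * d" using d by (simp add: field_simps)
      then have "C * \<bar>x - (-T)\<bar> \<le> C * ((R + 1) * d)" using x C by (intro mult_left_mono) auto
      moreover have "norm (f x) \<le> C * \<bar>x - (-T)\<bar>" using lip[of x "-T"] x ends T by simp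
      ultimately have "norm (f x) \<le> C * ((R + 1) * d)" by linarith
      then have "(1 / d * norm (nth_deriv 1 F ((x - (-T + d)) / d))) * norm (F ((T - d - x) / d)) * norm (f x)
        \<le> (1 / d * B) * B * (C * ((R + 1) * d))"
        using d B_nonneg R by (intro mult_mono bound deriv_bound mult_nonneg_nonneg) auto
      also have "\<dots> = B * B * (C * (R + 1))" using d by simp
      finally show ?thesis using d by (simp add: norm_mult norm_divide)
    qed
    have "b' n x * f x = F ((x - (-T + d)) / d) * (of_real (- 1 / d) * nth_deriv 1 F ((T - d - x) / d)) * f x
      + of_real (1 / d) * nth_deriv 1 F ((x - (-T + d)) / d) * F ((T - d - x) / d) * f x"
      unfolding b'_def Let_def d_def by (rule distrib_right)
    then show ?thesis
      using norm_triangle_mono[OF term1 term2] by simp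
  qed
  have lim1: "(\<lambda>n. LINT x:{-T..T}|lebesgue. v x * nth_deriv 1 (\<lambda>x. b n x * f x) x) \<longlonglongrightarrow> (LINT x:{-T..T}|lebesgue. v x * nth_deriv 1 f x)"
  proof (rule set_integral_dominated_convergence)
    show "set_integrable lebesgue {-T..T} v" using int by blast
    show "nth_deriv 1 (\<lambda>x. b n x * f x) \<in> borel_measurable borel" for n
      by (intro smooth_borel smooth_on_nth_deriv smooth_on_mult sb f) simp
    show "nth_deriv 1 f \<in> borel_measurable borel" by (intro smooth_borel smooth_on_nth_deriv f)
    show "norm (nth_deriv 1 (\<lambda>x. b n x * f x) x) \<le> B * B * C1 + 2 * (B * B * (C * (R + 1)))" if "x \<in> {-T..T}" for n x
    proof -
      have "norm (b n x * nth_deriv 1 f x) \<le> B * B * C1"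
        unfolding norm_mult b_def by (intro mult_mono bump_bound C1 that) (auto simp: B_nonneg)
      then show ?thesis unfolding dbf by (rule norm_triangle_mono[OF _ b'f[OF that]])
    qed
    show "AE x in lebesgue. x \<in> {-T..T} \<longrightarrow> (\<lambda>n. nth_deriv 1 (\<lambda>x. b n x * f x) x) \<longlonglongrightarrow> nth_deriv 1 f x"
      using AE_interior[of T]
    proof eventually_elim
      case (elim x)
      show ?case
      proof
        assume "x \<in> {-T..T}"
        then have "\<forall>\<^sub>F n in sequentially. x \<in> {-T + (R + 1) * (1 / real (Suc n))<..<T - (R + 1) * (1 / real (Suc n))}"
          using inner_bump_eventually[of x T] elim by auto
        then have "\<forall>\<^sub>F n in sequentially. nth_deriv 1 (\<lambda>x. b n x * f x) x = nth_deriv 1 f x"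
        proof eventually_elim
          case (elim n)
          show ?case
          proof (rule nth_deriv_cong_open[OF open_greaterThanLessThan elim])
            fix y assume "y \<in> {-T + (R + 1) * (1 / real (Suc n))<..<T - (R + 1) * (1 / real (Suc n))}"
            then show "b n y * f y = f y" unfolding b_def by (subst inner_bump_one) auto
          qed
        qed
        then show "(\<lambda>n. nth_deriv 1 (\<lambda>x. b n x * f x) x) \<longlonglongrightarrow> nth_deriv 1 f x"
          by (rule tendsto_eventually)
      qed
    qed
  qed
  have lim2: "(\<lambda>n. LINT x:{-T..T}|lebesgue. v' x * (b n x * f x)) \<longlonglongrightarrow> (LINT x:{-T..T}|lebesgue. v' x * f x)"
    unfolding b_def using int by (intro integral_inner_bump_tendsto f) auto
  have eq: "(LINT x:{-T..T}|lebesgue. v x * nth_deriv 1 (\<lambda>x. b n x * f x) x) = - (LINT x:{-T..T}|lebesgue. v' x * (b n x * f x))" for n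
  proof -
    have "(\<lambda>x. b n x * f x) \<in> test_functions {-T<..<T}"
      unfolding b_def by (rule inner_bump_test[OF _ f]) simp
    then show ?thesis using int by blast
  qed
  show ?thesis
    using LIMSEQ_unique[OF lim1[unfolded eq] tendsto_minus[OF lim2]] .
qed

text \<open>Every integration by parts gains 1/S and differentiates either the Sobolev function or
  the polynomial. The ends contribute nothing as long as 1 - x^2 divides \<open>P\<close>; a
  derivative of \<open>P\<close> loses at most one such factor, so n factors allow n steps. The
  induction runs over all such \<open>P\<close>, and \<open>C\<close> depends on \<open>P\<close>
  and n alone, uniformly in \<open>T\<close>, \<open>S\<close> and \<open>v\<close>.\<close>

lemma oscillatory_bound:
  fixes P :: "real poly"
  assumes "[:1, 0, -1:] ^ n dvd P"
  shows "\<exists>C\<ge>0. \<forall>T\<ge>1. \<forall>S>0. \<forall>v. (\<forall>j\<le>n. set_integrable lebesgue {-T..T} (v j)) \<and> (\<forall>j<n. weak_step T (v j) (v (Suc j))) \<longrightarrow>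
    norm (LINT \<tau>:{-T..T}|lebesgue. v 0 \<tau> * (of_real (poly P (\<tau> / T)) * exp (\<i> * of_real S * of_real \<tau>)))
      \<le> C / S ^ n * (\<Sum>j\<le>n. LINT \<tau>:{-T..T}|lebesgue. norm (v j \<tau>))"
  using assms
proof (induction n arbitrary: P)
  case 0
  have "compact (poly P ` {-1..1})" by (intro compact_continuous_image continuous_intros) auto
  from compact_imp_bounded[OF this] obtain C where C: "C > 0" "\<And>x. x \<in> {-1..1} \<Longrightarrow> \<bar>poly P x\<bar> \<le> C"
    unfolding bounded_pos by auto
  have "norm (LINT \<tau>:{-T..T}|lebesgue. v \<tau> * (of_real (poly P (\<tau> / T)) * exp (\<i> * of_real S * of_real \<tau>)))
      \<le> C * (LINT \<tau>:{-T..T}|lebesgue. norm (v \<tau>))" if T: "T \<ge> 1" and v: "set_integrable lebesgue {-T..T} v" for T S v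
  proof -
    define k where "k \<tau> = of_real (poly P (\<tau> / T)) * exp (\<i> * of_real S * complex_of_real \<tau>)" for \<tau>
    have km: "k \<in> borel_measurable borel"
      unfolding k_def by (intro borel_measurable_continuous_onI continuous_intros) (use T in auto)
    have kb: "norm (k \<tau>) \<le> C" if "\<tau> \<in> {-T..T}" for \<tau>
    proof -
      have "\<tau> / T \<in> {-1..1}" using that T by (auto simp: field_simps)
      from C(2)[OF this] show ?thesis by (simp add: k_def norm_mult norm_exp_eq_Re)
    qed
    have vk: "set_integrable lebesgue {-T..T} (\<lambda>\<tau>. v \<tau> * k \<tau>)" by (rule set_integrable_mult_bounded[OF v km kb])
    have "norm (LINT \<tau>:{-T..T}|lebesgue. v \<tau> * k \<tau>) \<le> (LINT \<tau>:{-T..T}|lebesgue. norm (v \<tau> * k \<tau>))"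
      by (rule set_integral_norm_bound[OF vk])
    also have "\<dots> \<le> (LINT \<tau>:{-T..T}|lebesgue. C * norm (v \<tau>))"
    proof (rule set_integral_mono)
      show "set_integrable lebesgue {-T..T} (\<lambda>\<tau>. norm (v \<tau> * k \<tau>))" by (rule set_integrable_norm[OF vk])
      show "set_integrable lebesgue {-T..T} (\<lambda>\<tau>. C * norm (v \<tau>))"
        by (intro set_integrable_mult_right set_integrable_norm[OF v])
      show "norm (v \<tau> * k \<tau>) \<le> C * norm (v \<tau>)" if "\<tau> \<in> {-T..T}" for \<tau>
        using mult_left_mono[OF kb[OF that] norm_ge_zero[of "v \<tau>"]] by (simp add: norm_mult mult.commute)
    qed
    finally show ?thesis by (simp add: k_def)
  qed
  then show ?case using C(1) by (intro exI[of _ C]) auto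
next
  case (Suc n)
  let ?q = "[:1, 0, -1:] :: real poly"
  obtain Q where Q: "P = ?q ^ Suc n * Q" using Suc.prems by (auto elim: dvdE)
  have "?q ^ n dvd P" unfolding Q by (intro dvd_mult2 le_imp_power_dvd) simp
  then obtain C where C: "C \<ge> 0" "\<And>T S v. T \<ge> 1 \<Longrightarrow> S > 0 \<Longrightarrow> \<forall>j\<le>n. set_integrable lebesgue {-T..T} (v j) \<Longrightarrow> \<forall>j<n. weak_step T (v j) (v (Suc j)) \<Longrightarrow>
    norm (LINT \<tau>:{-T..T}|lebesgue. v 0 \<tau> * (of_real (poly P (\<tau> / T)) * exp (\<i> * of_real S * of_real \<tau>)))
      \<le> C / S ^ n * (\<Sum>j\<le>n. LINT \<tau>:{-T..T}|lebesgue. norm (v j \<tau>))"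
    using Suc.IH[of P] by blast
  \<comment> \<open>A factor is lost only in the term where the power itself is
    differentiated.\<close>
  have "q ^ n dvd pderiv (q ^ Suc n * Q)" for q Q :: "real poly"
    unfolding pderiv_mult pderiv_power_Suc
    by (intro dvd_add dvd_mult dvd_mult2 dvd_smult le_imp_power_dvd dvd_refl) simp_all
  from this[of ?q Q] have "?q ^ n dvd pderiv P" unfolding Q .
  then obtain D where D: "D \<ge> 0" "\<And>T S v. T \<ge> 1 \<Longrightarrow> S > 0 \<Longrightarrow> \<forall>j\<le>n. set_integrable lebesgue {-T..T} (v j) \<Longrightarrow> \<forall>j<n. weak_step T (v j) (v (Suc j)) \<Longrightarrow>
    norm (LINT \<tau>:{-T..T}|lebesgue. v 0 \<tau> * (of_real (poly (pderiv P) (\<tau> / T)) * exp (\<i> * of_real S * of_real \<tau>)))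
      \<le> D / S ^ n * (\<Sum>j\<le>n. LINT \<tau>:{-T..T}|lebesgue. norm (v j \<tau>))"
    using Suc.IH[of "pderiv P"] by blast
  have ends: "poly P 1 = 0" "poly P (-1) = 0" unfolding Q by auto
  have "norm (LINT \<tau>:{-T..T}|lebesgue. v 0 \<tau> * (of_real (poly P (\<tau> / T)) * exp (\<i> * of_real S * of_real \<tau>)))
      \<le> (C + D) / S ^ Suc n * (\<Sum>j\<le>Suc n. LINT \<tau>:{-T..T}|lebesgue. norm (v j \<tau>))"
    if T: "T \<ge> 1" and S: "S > 0" and v: "\<forall>j\<le>Suc n. set_integrable lebesgue {-T..T} (v j)"
      and w: "\<forall>j<Suc n. weak_step T (v j) (v (Suc j))" for T S v
  proof -
    define e where "e \<tau> = exp (\<i> * of_real S * complex_of_real \<tau>)" for \<tau>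
    define I where "I j Q = (LINT \<tau>:{-T..T}|lebesgue. v j \<tau> * (of_real (poly Q (\<tau> / T)) * e \<tau>))" for j and Q :: "real poly"
    define Z where "Z = (\<Sum>j\<le>Suc n. LINT \<tau>:{-T..T}|lebesgue. norm (v j \<tau>))"
    have nn: "0 \<le> (LINT \<tau>:{-T..T}|lebesgue. norm (v j \<tau>))" for j
      unfolding set_lebesgue_integral_def by (intro Bochner_Integration.integral_nonneg) auto
    have polyder: "((\<lambda>\<tau>. complex_of_real (poly Q (\<tau> / T))) has_vector_derivative of_real (1 / T) * of_real (poly (pderiv Q) (\<tau> / T))) (at \<tau>)" for Q \<tau>
    proof -
      have "((\<lambda>\<tau>. poly Q (\<tau> / T)) has_real_derivative poly (pderiv Q) (\<tau> / T) * (1 / T)) (at \<tau>)"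
        using T by (intro DERIV_chain2[OF poly_DERIV]) (auto intro!: derivative_eq_intros)
      then have "((\<lambda>\<tau>. poly Q (\<tau> / T)) has_vector_derivative poly (pderiv Q) (\<tau> / T) * (1 / T)) (at \<tau>)"
        by (simp add: has_real_derivative_iff_has_vector_derivative)
      from bounded_linear.has_vector_derivative[OF bounded_linear_of_real this]
      show ?thesis by (simp only: of_real_mult mult.commute)
    qed
    have spoly: "smooth_on UNIV (\<lambda>\<tau>. complex_of_real (poly Q (\<tau> / T)))" for Q
    proof (rule smooth_on_coinduct[where P = "\<lambda>h. \<exists>c Q. h = (\<lambda>\<tau>. c * complex_of_real (poly Q (\<tau> / T)))"])
      show "\<exists>c Q'. (\<lambda>\<tau>. complex_of_real (poly Q (\<tau> / T))) = (\<lambda>\<tau>. c * complex_of_real (poly Q' (\<tau> / T)))"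
        by (intro exI[of _ 1] exI[of _ Q]) simp
      fix h assume "\<exists>c Q. h = (\<lambda>\<tau>. c * complex_of_real (poly Q (\<tau> / T)))"
      then obtain c Q where h: "h = (\<lambda>\<tau>. c * complex_of_real (poly Q (\<tau> / T)))" by blast
      have "(h has_vector_derivative (c * of_real (1 / T)) * of_real (poly (pderiv Q) (\<tau> / T))) (at \<tau>)" for \<tau>
        unfolding h mult.assoc by (rule has_vector_derivative_mult_right[OF polyder])
      then show "\<exists>h'. (\<exists>c Q. h' = (\<lambda>\<tau>. c * complex_of_real (poly Q (\<tau> / T)))) \<and> (\<forall>x\<in>UNIV. (h has_vector_derivative h' x) (at x))"
        by - (rule exI, rule conjI, rule exI, rule exI, rule refl, rule ballI, assumption)
    qed simp
    have se: "smooth_on UNIV e" unfolding e_def[abs_def] by (rule smooth_on_exp) simp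
    define f where "f \<tau> = complex_of_real (poly P (\<tau> / T)) * e \<tau>" for \<tau>
    have sf: "smooth_on UNIV f" unfolding f_def[abs_def] by (rule smooth_on_mult[OF open_UNIV spoly se])
    have df: "nth_deriv 1 f \<tau> = \<i> * of_real S * (of_real (poly P (\<tau> / T)) * e \<tau>) + of_real (1 / T) * (of_real (poly (pderiv P) (\<tau> / T)) * e \<tau>)" for \<tau>
    proof -
      have "(e has_vector_derivative \<i> * of_real S * e \<tau>) (at \<tau>)" for \<tau> unfolding e_def by (rule has_vector_derivative_iexp)
      from nth_deriv_Suc_eq[OF open_UNIV UNIV_I has_vector_derivative_mult[OF polyder this], of 0 P \<tau>]
      show ?thesis by (simp add: f_def[abs_def] mult_ac)
    qed
    have int: "set_integrable lebesgue {-T..T} (\<lambda>\<tau>. v 0 \<tau> * (of_real (poly Q (\<tau> / T)) * e \<tau>))" for Q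
    proof -
      have s: "smooth_on UNIV (\<lambda>\<tau>. of_real (poly Q (\<tau> / T)) * e \<tau>)" by (rule smooth_on_mult[OF open_UNIV spoly se])
      obtain c where "\<And>x. x \<in> {-T..T} \<Longrightarrow> norm (of_real (poly Q (x / T)) * e x) \<le> c" using smooth_bounded_interval[OF s subset_UNIV] by metis
      then show ?thesis using v by (intro set_integrable_mult_bounded smooth_borel[OF s]) auto
    qed
    have "(LINT x:{-T..T}|lebesgue. v 0 x * nth_deriv 1 f x) = - (LINT x:{-T..T}|lebesgue. v (Suc 0) x * f x)"
      using w T ends by (intro weak_step_parts sf) (auto simp: f_def)
    moreover have "(LINT x:{-T..T}|lebesgue. v 0 x * nth_deriv 1 f x) = \<i> * of_real S * I 0 P + of_real (1 / T) * I 0 (pderiv P)"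
    proof -
      have "(LINT x:{-T..T}|lebesgue. v 0 x * nth_deriv 1 f x) = (LINT x:{-T..T}|lebesgue.
         \<i> * of_real S * (v 0 x * (of_real (poly P (x / T)) * e x)) + of_real (1 / T) * (v 0 x * (of_real (poly (pderiv P) (x / T)) * e x)))"
        unfolding df by (intro set_lebesgue_integral_cong) (simp_all add: algebra_simps)
      also have "\<dots> = \<i> * of_real S * I 0 P + of_real (1 / T) * I 0 (pderiv P)"
        unfolding I_def by (subst set_integral_add) (auto intro!: set_integrable_mult_right int)
      finally show ?thesis .
    qed
    ultimately have "\<i> * of_real S * I 0 P = - I 1 P - of_real (1 / T) * I 0 (pderiv P)"
      by (simp add: I_def f_def algebra_simps)
    then have "norm (\<i> * of_real S * I 0 P) \<le> norm (I 1 P) + norm (of_real (1 / T) * I 0 (pderiv P))"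
      using norm_triangle_ineq4[of "- I 1 P" "of_real (1 / T) * I 0 (pderiv P)"] by simp
    \<comment> \<open>The inner derivative 1/T is at most 1, which keeps the constant independent of
      \<open>T\<close>.\<close>
    moreover have "norm (of_real (1 / T) * I 0 (pderiv P)) \<le> 1 * norm (I 0 (pderiv P))"
      unfolding norm_mult using T by (intro mult_right_mono) (auto simp: norm_divide)
    moreover have "norm (I 1 P) \<le> C / S ^ n * Z"
    proof -
      \<comment> \<open>The induction hypothesis for the same \<open>P\<close> and the shifted
        sequence, whose first member is the derivative of \<open>v 0\<close>.\<close>
      have "norm (I 1 P) \<le> C / S ^ n * (\<Sum>j\<le>n. LINT \<tau>:{-T..T}|lebesgue. norm (v (Suc j) \<tau>))"
        using C(2)[OF T S, of "\<lambda>j. v (Suc j)"] v w by (simp add: I_def e_def)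
      also have "\<dots> \<le> C / S ^ n * Z"
        unfolding Z_def sum.atMost_Suc_shift using C(1) S nn by (intro mult_left_mono) auto
      finally show ?thesis .
    qed
    moreover have "norm (I 0 (pderiv P)) \<le> D / S ^ n * Z"
    proof -
      have "norm (I 0 (pderiv P)) \<le> D / S ^ n * (\<Sum>j\<le>n. LINT \<tau>:{-T..T}|lebesgue. norm (v j \<tau>))"
        using D(2)[OF T S, of v] v w by (simp add: I_def e_def)
      also have "\<dots> \<le> D / S ^ n * Z"
        unfolding Z_def using D(1) S nn by (intro mult_left_mono) auto
      finally show ?thesis .
    qed
    ultimately have "S * norm (I 0 P) \<le> (C + D) / S ^ n * Z"
      using S by (simp add: norm_mult add_divide_distrib distrib_right)
    then have "norm (I 0 P) \<le> (C + D) / S ^ Suc n * Z"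
      using S by (simp add: field_simps)
    then show ?thesis by (simp add: I_def e_def Z_def)
  qed
  then show ?case using C(1) D(1) by (intro exI[of _ "C + D"]) auto
qed

text \<open>At x = \<tau>/T the weight is the M-th power of 1 - x^2, and N \<le> M factors are
  consumed by N integrations by parts.\<close>

lemma sobolev_oscillatory_bound:
  assumes MN: "N \<le> M"
  obtains C where "C \<ge> 0" "\<And>T S u. T \<ge> 1 \<Longrightarrow> S > 0 \<Longrightarrow> u \<in> sobolev_L1 N {-T..T} \<Longrightarrow>
    norm (LINT \<tau>:{-T..T}|lebesgue. u \<tau> * (of_real ((1 - \<tau>\<^sup>2 / T\<^sup>2) ^ M) * exp (\<i> * of_real S * of_real \<tau>)))
      \<le> C / S ^ N * sobolev_L1_norm N {-T..T} u"
proof -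
  let ?P = "[:1, 0, -1:] ^ M :: real poly"
  have polyP: "poly ?P (\<tau> / T) = (1 - \<tau>\<^sup>2 / T\<^sup>2) ^ M" for \<tau> T
    by (simp add: poly_power power2_eq_square)
  have "[:1, 0, -1:] ^ N dvd ?P" using MN by (rule le_imp_power_dvd)
  from oscillatory_bound[OF this] obtain C where C: "C \<ge> 0"
    "\<And>T S v. T \<ge> 1 \<Longrightarrow> S > 0 \<Longrightarrow> \<forall>j\<le>N. set_integrable lebesgue {-T..T} (v j) \<Longrightarrow> \<forall>j<N. weak_step T (v j) (v (Suc j)) \<Longrightarrow>
    norm (LINT \<tau>:{-T..T}|lebesgue. v 0 \<tau> * (of_real (poly ?P (\<tau> / T)) * exp (\<i> * of_real S * of_real \<tau>)))
      \<le> C / S ^ N * (\<Sum>j\<le>N. LINT \<tau>:{-T..T}|lebesgue. norm (v j \<tau>))" by blast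
  show ?thesis
  proof (rule that[OF C(1)])
    fix T S :: real and u assume T: "T \<ge> 1" and S: "S > 0" and u: "u \<in> sobolev_L1 N {-T..T}"
    define v where "v j = weak_deriv j {-T..T} u" for j
    have wd: "has_weak_deriv j {-T..T} u (v j)" if "j \<le> N" for j
      using u that unfolding sobolev_L1_def v_def weak_deriv_def by (metis (mono_tags, lifting) mem_Collect_eq someI_ex)
    have int: "set_integrable lebesgue {-T..T} (v j)" if "j \<le> N" for j
      using wd[OF that] by (simp add: has_weak_deriv_def)
    have ui: "set_integrable lebesgue {-T..T} u" using wd[of 0] by (simp add: has_weak_deriv_def)
    have eq: "(LINT x:{-T..T}|lebesgue. u x * nth_deriv j \<phi> x) = (-1) ^ j * (LINT x:{-T..T}|lebesgue. v j x * \<phi> x)"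
      if "j \<le> N" "\<phi> \<in> test_functions {-T<..<T}" for j \<phi>
      using wd[OF that(1)] that(2) by (simp add: has_weak_deriv_def)
    have step: "weak_step T (v j) (v (Suc j))" if "j < N" for j
      unfolding weak_step_def
    proof (intro conjI ballI)
      fix \<phi> assume \<phi>: "\<phi> \<in> test_functions {-T<..<T}"
      \<comment> \<open>Both sides are the integral of \<open>u\<close> against the derivative of
        \<phi> of order j + 1, read once as the j-th derivative of \<phi>' and once as the next
        derivative of \<phi>.\<close>
      have "(-1) ^ j * (LINT x:{-T..T}|lebesgue. v j x * nth_deriv 1 \<phi> x) = (-1) ^ j * - (LINT x:{-T..T}|lebesgue. v (Suc j) x * \<phi> x)"
        using eq[of j "nth_deriv 1 \<phi>"] eq[of "Suc j" \<phi>] that \<phi> test_functions_nth_deriv[OF \<phi>, of 1]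
        by (simp add: nth_deriv_Suc'[of j \<phi>])
      then show "(LINT x:{-T..T}|lebesgue. v j x * nth_deriv 1 \<phi> x) = - (LINT x:{-T..T}|lebesgue. v (Suc j) x * \<phi> x)"
        by (rule mult_left_cancel[THEN iffD1, rotated]) simp
    qed (use int that in auto)
    define f where "f \<tau> = complex_of_real ((1 - \<tau>\<^sup>2 / T\<^sup>2) ^ M) * exp (\<i> * of_real S * of_real \<tau>)" for \<tau>
    have sf: "smooth_on UNIV f"
    proof -
      have "smooth_on UNIV (\<lambda>\<tau>. (1 - of_real (1 / T\<^sup>2) * (complex_of_real \<tau>)\<^sup>2) ^ M * exp ((\<i> * of_real S) * of_real \<tau>))"
        by (intro smooth_on_intros open_UNIV)
      then show ?thesis unfolding f_def by simp
    qed
    \<comment> \<open>\<open>weak_deriv 0\<close> is an arbitrary choice and need not be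
      \<open>u\<close> itself. Their weak equality on test functions passes to \<open>f\<close>,
      which does not have support inside the open interval, through inner bumps.\<close>
    have "(LINT x:{-T..T}|lebesgue. u x * f x) = (LINT x:{-T..T}|lebesgue. v 0 x * f x)"
    proof (rule LIMSEQ_unique)
      show "(\<lambda>n. LINT x:{-T..T}|lebesgue. u x * (bump (-T + 1 / real (Suc n)) (T - 1 / real (Suc n)) (1 / real (Suc n)) x * f x))
        \<longlonglongrightarrow> (LINT x:{-T..T}|lebesgue. u x * f x)"
        by (rule integral_inner_bump_tendsto[OF ui sf])
      have "(LINT x:{-T..T}|lebesgue. u x * (bump (-T + 1 / real (Suc n)) (T - 1 / real (Suc n)) (1 / real (Suc n)) x * f x))
        = (LINT x:{-T..T}|lebesgue. v 0 x * (bump (-T + 1 / real (Suc n)) (T - 1 / real (Suc n)) (1 / real (Suc n)) x * f x))" for n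
        using eq[of 0, OF _ inner_bump_test[OF _ sf, of "1 / real (Suc n)"]] by simp
      then show "(\<lambda>n. LINT x:{-T..T}|lebesgue. u x * (bump (-T + 1 / real (Suc n)) (T - 1 / real (Suc n)) (1 / real (Suc n)) x * f x))
        \<longlonglongrightarrow> (LINT x:{-T..T}|lebesgue. v 0 x * f x)"
        using integral_inner_bump_tendsto[OF int[of 0] sf] by simp
    qed
    moreover have "norm (LINT x:{-T..T}|lebesgue. v 0 x * f x) \<le> C / S ^ N * (\<Sum>j\<le>N. LINT \<tau>:{-T..T}|lebesgue. norm (v j \<tau>))"
      using C(2)[OF T S, of v] int step unfolding polyP f_def by blast
    ultimately show "norm (LINT \<tau>:{-T..T}|lebesgue. u \<tau> * (of_real ((1 - \<tau>\<^sup>2 / T\<^sup>2) ^ M) * exp (\<i> * of_real S * of_real \<tau>)))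
      \<le> C / S ^ N * sobolev_L1_norm N {-T..T} u"
      by (simp add: f_def sobolev_L1_norm_def v_def)
  qed
qed

end

subsection \<open>Extending the pairing to discontinuous functions\<close>

definition mollify :: "(real \<Rightarrow> complex) \<Rightarrow> real \<Rightarrow> (real \<Rightarrow> complex) \<Rightarrow> real \<Rightarrow> complex" where
  "mollify \<rho> \<delta> f x = of_real (1 / \<delta>) * (LINT t|lborel. \<rho> ((x - t) / \<delta>) * f t)"

lemma mollify_alt:
  assumes "\<delta> > 0"
  shows "mollify \<rho> \<delta> f x = (LINT y|lborel. \<rho> y * f (x - \<delta> * y))"
proof -
  have "(LINT t|lborel. \<rho> ((x - t) / \<delta>) * f t) = \<bar>- \<delta>\<bar> *\<^sub>R (LINT y|lborel. \<rho> ((x - (x + (- \<delta>) * y)) / \<delta>) * f (x + (- \<delta>) * y))"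
    using assms by (intro lborel_integral_real_affine) simp
  also have "(\<lambda>y. \<rho> ((x - (x + (- \<delta>) * y)) / \<delta>) * f (x + (- \<delta>) * y)) = (\<lambda>y. \<rho> y * f (x - \<delta> * y))"
    using assms by (intro ext) simp
  finally show ?thesis
    using assms by (simp add: mollify_def scaleR_conv_of_real)
qed

text \<open>The invariant admits scalar multiples and every test function as kernel, since each
  derivative falls on the kernel and brings a factor 1/\<delta>.\<close>

lemma smooth_mollify:
  assumes \<rho>: "\<rho> \<in> test_functions UNIV" and f: "integrable lborel f"
  shows "smooth_on UNIV (mollify \<rho> \<delta> f)"
proof (rule smooth_on_coinduct[where P = "\<lambda>q. \<exists>c. \<exists>\<rho>\<in>test_functions UNIV. q = (\<lambda>x. c * (LINT t|lborel. \<rho> ((x - t) / \<delta>) * f t))"])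
  show "\<exists>c. \<exists>\<eta>\<in>test_functions UNIV. mollify \<rho> \<delta> f = (\<lambda>x. c * (LINT t|lborel. \<eta> ((x - t) / \<delta>) * f t))"
    by (intro exI[of _ "of_real (1 / \<delta>)"] bexI[OF _ \<rho>]) (simp add: mollify_def fun_eq_iff)
  fix q assume "\<exists>c. \<exists>\<rho>\<in>test_functions UNIV. q = (\<lambda>x. c * (LINT t|lborel. \<rho> ((x - t) / \<delta>) * f t))"
  then obtain c \<eta> where \<eta>: "\<eta> \<in> test_functions UNIV" and q: "q = (\<lambda>x. c * (LINT t|lborel. \<eta> ((x - t) / \<delta>) * f t))" by blast
  let ?\<eta> = "nth_deriv 1 \<eta>"
  have \<eta>': "?\<eta> \<in> test_functions UNIV" by (rule test_functions_nth_deriv[OF \<eta>])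
  obtain B where B: "B > 0" "\<And>x. norm (?\<eta> x) \<le> B" using test_functions_bounded[OF \<eta>'] by metis
  obtain B0 where B0: "B0 > 0" "\<And>x. norm (\<eta> x) \<le> B0" using test_functions_bounded[OF \<eta>] by metis
  have [measurable]: "\<eta> \<in> borel_measurable borel" "?\<eta> \<in> borel_measurable borel" "f \<in> borel_measurable borel"
    using test_functions_borel[OF \<eta>] test_functions_borel[OF \<eta>'] f by auto
  have "((\<lambda>x. LINT t|lborel. \<eta> ((x - t) / \<delta>) * f t) has_vector_derivative
      (LINT t|lborel. of_real (1 / \<delta>) * (?\<eta> ((x - t) / \<delta>) * f t))) (at x)" for x
  proof (rule has_vector_derivative_integral[where w = "\<lambda>t. \<bar>1 / \<delta>\<bar> * B * norm (f t)"])
    show "integrable lborel (\<lambda>t. \<eta> ((x - t) / \<delta>) * f t)" for x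
      by (rule integrable_bounded_mult[OF f _ B0(2)]) measurable
    show "((\<lambda>x. \<eta> ((x - t) / \<delta>) * f t) has_vector_derivative of_real (1 / \<delta>) * (?\<eta> ((x - t) / \<delta>) * f t)) (at x)" for x t
    proof -
      have "((\<lambda>x. (x - t) / \<delta>) has_vector_derivative 1 / \<delta>) (at x)"
        by (cases "\<delta> = 0") (auto intro!: derivative_eq_intros)
      from vector_diff_chain_at[OF this smooth_on_has_vector_derivative[OF test_functions_smooth[OF \<eta>] UNIV_I]]
      have "((\<lambda>x. \<eta> ((x - t) / \<delta>)) has_vector_derivative of_real (1 / \<delta>) * ?\<eta> ((x - t) / \<delta>)) (at x)"
        by (simp add: o_def scaleR_conv_of_real)
      from has_vector_derivative_mult_left[OF this, of "f t"] show ?thesis by (simp only: mult.assoc)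
    qed
    show "norm (of_real (1 / \<delta>) * (?\<eta> ((x - t) / \<delta>) * f t)) \<le> \<bar>1 / \<delta>\<bar> * B * norm (f t)" for x t
      unfolding norm_mult norm_of_real mult.assoc by (intro mult_left_mono mult_right_mono B) auto
    show "integrable lborel (\<lambda>t. \<bar>1 / \<delta>\<bar> * B * norm (f t))"
      by (intro integrable_mult_right integrable_norm f)
  qed measurable
  then have "(q has_vector_derivative (c * of_real (1 / \<delta>)) * (LINT t|lborel. ?\<eta> ((x - t) / \<delta>) * f t)) (at x)" for x
    unfolding q mult.assoc integral_mult_right_zero by (rule has_vector_derivative_mult_right)
  then show "\<exists>q'. (\<exists>c. \<exists>\<rho>\<in>test_functions UNIV. q' = (\<lambda>x. c * (LINT t|lborel. \<rho> ((x - t) / \<delta>) * f t))) \<and>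
      (\<forall>x\<in>UNIV. (q has_vector_derivative q' x) (at x))"
    by - (rule exI, rule conjI, rule exI, rule bexI[OF refl \<eta>'], rule ballI, assumption)
qed simp

lemma norm_mult_le_left: "norm b \<le> C \<Longrightarrow> norm (a * b) \<le> C * norm a" for a b :: complex
  by (subst mult.commute) (auto simp: norm_mult intro: mult_right_mono)

lemma norm_mollify_le:
  assumes \<delta>: "\<delta> > 0" and \<rho>: "integrable lborel \<rho>" and f: "f \<in> borel_measurable borel" "\<And>x. norm (f x) \<le> C"
  shows "norm (mollify \<rho> \<delta> f x) \<le> C * (LINT y|lborel. norm (\<rho> y))"
proof -
  note [measurable] = f(1)
  have "integrable lborel (\<lambda>y. f (x - \<delta> * y) * \<rho> y)"
    by (rule integrable_bounded_mult[OF \<rho> _ f(2)]) measurable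
  then have i: "integrable lborel (\<lambda>y. \<rho> y * f (x - \<delta> * y))" by (simp add: mult.commute)
  have "norm (mollify \<rho> \<delta> f x) \<le> (LINT y|lborel. norm (\<rho> y * f (x - \<delta> * y)))"
    unfolding mollify_alt[OF \<delta>] by (rule integral_norm_bound)
  also have "\<dots> \<le> (LINT y|lborel. C * norm (\<rho> y))"
    using f(2) \<rho> i by (intro integral_mono integrable_norm integrable_mult_right)
      (auto intro: norm_mult_le_left)
  finally show ?thesis by simp
qed

lemma mollify_tendsto:
  assumes \<delta>: "\<And>n. \<delta> n > 0" "\<delta> \<longlonglongrightarrow> 0" and \<rho>: "integrable lborel \<rho>" "(LINT y|lborel. \<rho> y) = 1"
    and f: "f \<in> borel_measurable borel" "\<And>x. norm (f x) \<le> C" and cont: "isCont f x"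
  shows "(\<lambda>n. mollify \<rho> (\<delta> n) f x) \<longlonglongrightarrow> f x"
proof -
  note [measurable] = f(1) borel_measurable_integrable[OF \<rho>(1), simplified]
  have "(\<lambda>n. LINT y|lborel. \<rho> y * f (x - \<delta> n * y)) \<longlonglongrightarrow> (LINT y|lborel. \<rho> y * f x)"
  proof (rule integral_dominated_convergence[where w = "\<lambda>y. C * norm (\<rho> y)"])
    show "AE y in lborel. (\<lambda>n. \<rho> y * f (x - \<delta> n * y)) \<longlonglongrightarrow> \<rho> y * f x"
    proof (intro AE_I2 tendsto_mult_left)
      fix y
      have "(\<lambda>n. x - \<delta> n * y) \<longlonglongrightarrow> x - 0 * y" by (intro tendsto_intros \<delta>)
      then show "(\<lambda>n. f (x - \<delta> n * y)) \<longlonglongrightarrow> f x"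
        using isCont_tendsto_compose[OF cont] by simp
    qed
    show "AE y in lborel. norm (\<rho> y * f (x - \<delta> n * y)) \<le> C * norm (\<rho> y)" for n
      using f(2) by (intro AE_I2) (auto intro: norm_mult_le_left)
    show "integrable lborel (\<lambda>y. C * norm (\<rho> y))" using \<rho>(1) by simp
  qed measurable
  then show ?thesis by (simp add: mollify_alt \<delta>(1) \<rho>(2))
qed

text \<open>The identity known for test functions is extended to a bounded \<open>f\<close> that is
  continuous almost everywhere. Mollification multiplies the transform of \<open>f\<close> by the
  transform of \<open>\<rho>\<close> at \<open>\<delta> n * \<sigma>\<close>, which is bounded and
  tends to 1, so the left side converges under a multiple of the given integrable function. The
  right side converges almost everywhere, boundedly and on a fixed compact subset of
  \<open>U\<close>.\<close>

lemma mollified_pairing: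
  fixes \<gamma> G h f :: "real \<Rightarrow> complex"
  assumes \<rho>: "\<rho> \<in> test_functions UNIV" "(LINT y|lborel. \<rho> y) = 1"
    and f: "f \<in> borel_measurable borel" "\<And>x. norm (f x) \<le> C" "AE x in lborel. isCont f x"
    and K: "compact K" "K \<subseteq> U" "open U" "\<And>x. x \<notin> K \<Longrightarrow> f x = 0"
    and \<gamma>: "integrable lebesgue (\<lambda>x. \<gamma> x * fourier f x)"
    and G: "locally_integrable G" and h: "continuous_on U h"
    and eq: "\<And>\<phi>. \<phi> \<in> test_functions U \<Longrightarrow>
      (LINT x|lebesgue. \<gamma> x * fourier \<phi> x) = (LINT x|lebesgue. G x * \<phi> x) + (LINT x|lebesgue. h x * \<phi> x)"
  shows "(LINT x|lebesgue. \<gamma> x * fourier f x) = (LINT x|lebesgue. G x * f x) + (LINT x|lebesgue. h x * f x)"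
proof -
  note [measurable] = f(1) test_functions_borel[OF \<rho>(1)]
  have \<rho>i: "integrable lborel \<rho>" by (rule test_functions_integrable[OF \<rho>(1)])
  have fi: "integrable lborel f"
  proof (rule Bochner_Integration.integrable_bound)
    show "integrable lborel (\<lambda>x. indicator K x *\<^sub>R C)" using K(1) by (intro borel_integrable_compact) auto
    show "AE x in lborel. norm (f x) \<le> norm (indicator K x *\<^sub>R C)"
    proof (rule AE_I2)
      fix x show "norm (f x) \<le> norm (indicator K x *\<^sub>R C)"
        using f(2)[of x] K(4)[of x] by (cases "x \<in> K") auto
    qed
  qed simp
  obtain e where e: "e > 0" "(\<Union>x\<in>K. cball x e) \<subseteq> U"
    using compact_subset_open_imp_cball_epsilon_subset[OF K(1,3,2)] by metis
  \<comment> \<open>The closed \<open>e\<close>-neighbourhood of \<open>K\<close>, still inside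
    \<open>U\<close>, holds the supports of all mollifications.\<close>
  define K' where "K' = {x + y |x y. x \<in> K \<and> y \<in> cball 0 e}"
  have K'_iff: "x \<in> K'" if "t \<in> K" "\<bar>x - t\<bar> \<le> e" for x t
    using that unfolding K'_def by (intro CollectI exI[of _ t] exI[of _ "x - t"]) auto
  have K': "compact K'" "K' \<subseteq> U" "K \<subseteq> K'"
  proof -
    show "compact K'" unfolding K'_def by (rule compact_sums[OF K(1) compact_cball])
    show "K' \<subseteq> U"
    proof
      fix z assume "z \<in> K'"
      then obtain x y where "z = x + y" "x \<in> K" "y \<in> cball 0 e" unfolding K'_def by blast
      then have "z \<in> cball x e" by (simp add: dist_norm)
      then show "z \<in> U" using e(2) \<open>x \<in> K\<close> by blast
    qed
    show "K \<subseteq> K'" using K'_iff e(1) by auto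
  qed
  obtain D where D: "compact D" "\<And>x. x \<notin> D \<Longrightarrow> \<rho> x = 0" using test_functionsE[OF \<rho>(1)] by metis
  obtain r where r: "r > 0" "\<forall>x\<in>D. norm x \<le> r" using compact_imp_bounded[OF D(1)] unfolding bounded_pos by blast
  have \<rho>0: "\<rho> x = 0" if "\<bar>x\<bar> > r" for x
    using r(2) that D(2)[of x] by (metis linorder_not_less real_norm_def)
  obtain C\<rho> where C\<rho>: "C\<rho> > 0" "\<And>x. norm (\<rho> x) \<le> C\<rho>" using test_functions_bounded[OF \<rho>(1)] by metis
  \<comment> \<open>As \<open>\<rho>\<close> is supported in [-r, r], the mollification spreads
    supports by at most \<open>\<delta> n * r\<close>, which must not exceed
    \<open>e\<close>.\<close>
  define \<delta> where "\<delta> n = e / r * (1 / real (Suc n))" for n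
  have \<delta>: "\<delta> n > 0" "\<delta> n * r \<le> e" for n
  proof -
    show "\<delta> n > 0" unfolding \<delta>_def using e(1) r(1) by (intro mult_pos_pos divide_pos_pos) auto
    have "\<delta> n * r = e * (1 / real (Suc n))" using r(1) by (simp add: \<delta>_def)
    also have "\<dots> \<le> e * 1" using e(1) by (intro mult_left_mono) auto
    finally show "\<delta> n * r \<le> e" by simp
  qed
  have \<delta>lim: "\<delta> \<longlonglongrightarrow> 0"
    unfolding \<delta>_def[abs_def] by (intro tendsto_mult_right_zero LIMSEQ_Suc[OF lim_1_over_n])
  have supp: "\<rho> ((x - t) / \<delta> n) * f t = 0" if "x \<notin> K'" for x t n
  proof (cases "t \<in> K")
    case True
    then have "\<bar>x - t\<bar> > e" using K'_iff[of t x] that by fastforce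
    then have "\<bar>x - t\<bar> > \<delta> n * r" using \<delta>(2)[of n] by linarith
    then have "\<bar>(x - t) / \<delta> n\<bar> > r" using \<delta>(1)[of n] by (simp add: pos_less_divide_eq mult.commute)
    then show ?thesis by (simp add: \<rho>0)
  qed (simp add: K(4))
  define F where "F n = mollify \<rho> (\<delta> n) f" for n
  have F0: "F n x = 0" if "x \<notin> K'" for n x
    unfolding F_def mollify_def by (simp only: supp[OF that]) simp
  have Ft: "F n \<in> test_functions U" for n
    by (rule test_functionsI[OF _ K'(1,2) F0]) (unfold F_def, rule smooth_mollify[OF \<rho>(1) fi])
  have Fm[measurable]: "F n \<in> borel_measurable borel" for n by (rule test_functions_borel[OF Ft])
  have FF: "fourier (F n) \<sigma> = fourier \<rho> (\<delta> n * \<sigma>) * fourier f \<sigma>" for n \<sigma>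
  proof -
    define E where "E x = exp (- (\<i> * complex_of_real \<sigma> * complex_of_real x))" for x
    have Em[measurable]: "E \<in> borel_measurable borel" unfolding E_def by measurable
    \<comment> \<open>The exponential is integrable only after restriction to \<open>K'\<close>,
      which changes nothing because \<open>F n\<close> vanishes elsewhere. Fubini is applied to this
      restriction.\<close>
    have "integrable lborel (\<lambda>x. indicator K' x *\<^sub>R E x)"
      unfolding E_def by (intro borel_integrable_compact K' continuous_intros)
    moreover have "(\<lambda>p. \<rho> ((snd p - fst p) / \<delta> n)) \<in> borel_measurable (borel \<Otimes>\<^sub>M borel)" by measurable
    ultimately have Fub: "(LINT x|lborel. (LINT t|lborel. \<rho> ((x - t) / \<delta> n) * f t) * (indicator K' x *\<^sub>R E x))
      = (LINT t|lborel. f t * (LINT x|lborel. \<rho> ((x - t) / \<delta> n) * (indicator K' x *\<^sub>R E x)))"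
      by (intro lborel_Fubini_kernel[OF fi, where C = C\<rho>] C\<rho>)
    have "fourier (F n) \<sigma> = (LINT x|lborel. E x * F n x)"
      by (simp add: fourier_lborel E_def)
    also have "(\<lambda>x. E x * F n x) = (\<lambda>x. of_real (1 / \<delta> n) * ((LINT t|lborel. \<rho> ((x - t) / \<delta> n) * f t) * (indicator K' x *\<^sub>R E x)))"
    proof
      fix x
      show "E x * F n x = of_real (1 / \<delta> n) * ((LINT t|lborel. \<rho> ((x - t) / \<delta> n) * f t) * (indicator K' x *\<^sub>R E x))"
        using F0[of x n] by (cases "x \<in> K'") (auto simp: F_def mollify_def mult_ac)
    qed
    also have "(LINT x|lborel. of_real (1 / \<delta> n) * ((LINT t|lborel. \<rho> ((x - t) / \<delta> n) * f t) * (indicator K' x *\<^sub>R E x)))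
      = of_real (1 / \<delta> n) * (LINT t|lborel. f t * (LINT x|lborel. \<rho> ((x - t) / \<delta> n) * (indicator K' x *\<^sub>R E x)))"
      unfolding integral_mult_right_zero Fub ..
    also have "(\<lambda>t. f t * (LINT x|lborel. \<rho> ((x - t) / \<delta> n) * (indicator K' x *\<^sub>R E x)))
      = (\<lambda>t. of_real (\<delta> n) * (fourier \<rho> (\<delta> n * \<sigma>) * (E t * f t)))"
    proof
      fix t
      show "f t * (LINT x|lborel. \<rho> ((x - t) / \<delta> n) * (indicator K' x *\<^sub>R E x))
        = of_real (\<delta> n) * (fourier \<rho> (\<delta> n * \<sigma>) * (E t * f t))"
      proof (cases "f t = 0")
        case False
        have "\<rho> ((x - t) / \<delta> n) * (indicator K' x *\<^sub>R E x) = \<rho> ((x - t) / \<delta> n) * E x" for x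
          using supp[of x t n] False by (cases "x \<in> K'") auto
        then have "(LINT x|lborel. \<rho> ((x - t) / \<delta> n) * (indicator K' x *\<^sub>R E x)) = (LINT x|lborel. \<rho> ((x - t) / \<delta> n) * E x)"
          by simp
        also have "\<dots> = \<bar>\<delta> n\<bar> *\<^sub>R (LINT y|lborel. \<rho> ((t + \<delta> n * y - t) / \<delta> n) * E (t + \<delta> n * y))"
          using \<delta>(1)[of n] by (intro lborel_integral_real_affine) simp
        also have "(\<lambda>y. \<rho> ((t + \<delta> n * y - t) / \<delta> n) * E (t + \<delta> n * y)) = (\<lambda>y. E t * (exp (- (\<i> * of_real (\<delta> n * \<sigma>) * of_real y)) * \<rho> y))"
        proof
          fix y
          have "E (t + \<delta> n * y) = E t * exp (- (\<i> * of_real (\<delta> n * \<sigma>) * of_real y))"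
            unfolding E_def mult_exp_exp by (rule arg_cong[of _ _ exp]) (simp add: algebra_simps)
          moreover have "(t + \<delta> n * y - t) / \<delta> n = y" using \<delta>(1)[of n] by simp
          ultimately show "\<rho> ((t + \<delta> n * y - t) / \<delta> n) * E (t + \<delta> n * y) = E t * (exp (- (\<i> * of_real (\<delta> n * \<sigma>) * of_real y)) * \<rho> y)"
            by (simp only: mult_ac)
        qed
        also have "(LINT y|lborel. E t * (exp (- (\<i> * of_real (\<delta> n * \<sigma>) * of_real y)) * \<rho> y)) = E t * fourier \<rho> (\<delta> n * \<sigma>)"
          unfolding integral_mult_right_zero fourier_lborel[OF test_functions_borel[OF \<rho>(1)]] ..
        finally show ?thesis
          using \<delta>(1)[of n] by (simp add: scaleR_conv_of_real mult_ac)
      qed simp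
    qed
    also have "of_real (1 / \<delta> n) * (LINT t|lborel. of_real (\<delta> n) * (fourier \<rho> (\<delta> n * \<sigma>) * (E t * f t)))
      = of_real (1 / \<delta> n) * (of_real (\<delta> n) * (fourier \<rho> (\<delta> n * \<sigma>) * fourier f \<sigma>))"
      unfolding integral_mult_right_zero by (simp add: fourier_lborel E_def)
    finally show ?thesis using \<delta>(1)[of n] by simp
  qed
  have lim1: "(\<lambda>n. LINT x|lebesgue. \<gamma> x * fourier (F n) x) \<longlonglongrightarrow> (LINT x|lebesgue. \<gamma> x * fourier f x)"
  proof -
    have cont: "continuous_on UNIV (fourier \<rho>)"
      by (rule smooth_on_continuous[OF schwartz_smooth[OF fourier_schwartz[OF \<rho>(1)]]])
    have \<rho>m: "(\<lambda>x. fourier \<rho> (\<delta> n * x)) \<in> borel_measurable lebesgue" for n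
    proof (rule measurable_completion)
      show "(\<lambda>x. fourier \<rho> (\<delta> n * x)) \<in> borel_measurable lborel"
        using cont by (auto intro!: borel_measurable_continuous_onI continuous_on_compose2[OF cont] continuous_intros)
    qed
    show ?thesis
    proof (rule integral_dominated_convergence[where w = "\<lambda>x. (LINT y|lborel. norm (\<rho> y)) * norm (\<gamma> x * fourier f x)"])
      show "AE x in lebesgue. (\<lambda>n. \<gamma> x * fourier (F n) x) \<longlonglongrightarrow> \<gamma> x * fourier f x"
      proof (intro AE_I2 tendsto_mult_left)
        fix x
        have "(\<lambda>n. \<delta> n * x) \<longlonglongrightarrow> 0 * x" by (intro tendsto_intros \<delta>lim)
        moreover have "isCont (fourier \<rho>) 0" using cont by (simp add: continuous_on_eq_continuous_at)
        ultimately have "(\<lambda>n. fourier \<rho> (\<delta> n * x)) \<longlonglongrightarrow> fourier \<rho> 0"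
          using isCont_tendsto_compose[of 0 "fourier \<rho>" "\<lambda>n. \<delta> n * x" sequentially] by simp
        also have "fourier \<rho> 0 = 1" using \<rho>(2) by (simp add: fourier_lborel)
        finally have "(\<lambda>n. fourier \<rho> (\<delta> n * x) * fourier f x) \<longlonglongrightarrow> 1 * fourier f x" by (rule tendsto_mult_right)
        then show "(\<lambda>n. fourier (F n) x) \<longlonglongrightarrow> fourier f x" by (simp add: FF)
      qed
      show "AE x in lebesgue. norm (\<gamma> x * fourier (F n) x) \<le> (LINT y|lborel. norm (\<rho> y)) * norm (\<gamma> x * fourier f x)" for n
      proof (rule AE_I2)
        fix x
        have "norm (fourier \<rho> (\<delta> n * x)) * norm (\<gamma> x * fourier f x) \<le> (LINT y|lborel. norm (\<rho> y)) * norm (\<gamma> x * fourier f x)"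
          by (intro mult_right_mono norm_fourier_le[OF \<rho>i]) auto
        then show "norm (\<gamma> x * fourier (F n) x) \<le> (LINT y|lborel. norm (\<rho> y)) * norm (\<gamma> x * fourier f x)"
          by (simp add: FF norm_mult mult_ac)
      qed
      show "integrable lebesgue (\<lambda>x. (LINT y|lborel. norm (\<rho> y)) * norm (\<gamma> x * fourier f x))"
        using \<gamma> by simp
      show "(\<lambda>x. \<gamma> x * fourier f x) \<in> borel_measurable lebesgue" using \<gamma> by auto
      show "(\<lambda>x. \<gamma> x * fourier (F n) x) \<in> borel_measurable lebesgue" for n
      proof -
        have "(\<lambda>x. (\<gamma> x * fourier f x) * fourier \<rho> (\<delta> n * x)) \<in> borel_measurable lebesgue"
          by (rule borel_measurable_times[OF borel_measurable_integrable[OF \<gamma>] \<rho>m])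
        then show ?thesis by (simp add: FF mult_ac)
      qed
    qed
  qed
  have lim2: "(\<lambda>n. LINT x|lebesgue. v x * F n x) \<longlonglongrightarrow> (LINT x|lebesgue. v x * f x)"
    if v: "set_integrable lebesgue K' v" for v
  proof -
    have restr: "(LINT x|lebesgue. v x * q x) = (LINT x:K'|lebesgue. v x * q x)" if "\<And>x. x \<notin> K' \<Longrightarrow> q x = 0" for q :: "real \<Rightarrow> complex"
      unfolding set_lebesgue_integral_def using that
      by (intro Bochner_Integration.integral_cong) (auto simp: indicator_def)
    have fK': "f x = 0" if "x \<notin> K'" for x using that K' K(4) by blast
    have "(\<lambda>n. LINT x:K'|lebesgue. v x * F n x) \<longlonglongrightarrow> (LINT x:K'|lebesgue. v x * f x)"
    proof (rule set_integral_dominated_convergence[OF v])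
      have "AE x in lborel. (\<lambda>n. F n x) \<longlonglongrightarrow> f x"
        using f(3)
      proof eventually_elim
        case (elim x)
        show ?case unfolding F_def by (rule mollify_tendsto[OF \<delta>(1) \<delta>lim \<rho>i \<rho>(2) f(1,2) elim])
      qed
      then have "AE x in lebesgue. (\<lambda>n. F n x) \<longlonglongrightarrow> f x" by (rule AE_completion)
      then show "AE x in lebesgue. x \<in> K' \<longrightarrow> (\<lambda>n. F n x) \<longlonglongrightarrow> f x" by eventually_elim simp
      show "norm (F n x) \<le> C * (LINT y|lborel. norm (\<rho> y))" for n x
        unfolding F_def by (rule norm_mollify_le[OF \<delta>(1) \<rho>i f(1,2)])
    qed (use Fm f in auto)
    moreover have "(LINT x|lebesgue. v x * F n x) = (LINT x:K'|lebesgue. v x * F n x)" for n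
      by (rule restr) (rule F0)
    moreover have "(LINT x|lebesgue. v x * f x) = (LINT x:K'|lebesgue. v x * f x)"
      by (rule restr) (rule fK')
    ultimately show ?thesis by simp
  qed
  have "set_integrable lebesgue K' G" using G K'(1) by (simp add: locally_integrable_def)
  moreover have "set_integrable lebesgue K' h"
  proof -
    have "integrable lborel (\<lambda>x. indicator K' x *\<^sub>R h x)"
      by (intro borel_integrable_compact K' continuous_on_subset[OF h])
    then show ?thesis unfolding set_integrable_def by (subst integrable_completion) auto
  qed
  ultimately have "(\<lambda>n. (LINT x|lebesgue. G x * F n x) + (LINT x|lebesgue. h x * F n x)) \<longlonglongrightarrow>
      (LINT x|lebesgue. G x * f x) + (LINT x|lebesgue. h x * f x)"
    by (intro tendsto_add lim2)
  then have "(\<lambda>n. LINT x|lebesgue. \<gamma> x * fourier (F n) x) \<longlonglongrightarrow>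
      (LINT x|lebesgue. G x * f x) + (LINT x|lebesgue. h x * f x)"
    by (simp add: eq[OF Ft])
  then show ?thesis using LIMSEQ_unique[OF lim1] by simp
qed

subsection \<open>The smoothed step as a Fourier transform\<close>

definition truncated_wave :: "nat \<Rightarrow> real \<Rightarrow> real \<Rightarrow> real \<Rightarrow> complex" where
  "truncated_wave M T S \<tau> =
    (if \<bar>\<tau>\<bar> \<le> T then exp (\<i> * of_real \<tau> * of_real S) * of_real ((1 - \<tau>\<^sup>2 / T\<^sup>2) ^ M) else 0)"

text \<open>The second wave removes the pole at \<open>\<tau> = 0\<close>; on the side of \<open>\<sigma>\<close> it moves the lower end of
  the step from \<open>-\<infinity>\<close> to \<open>Y\<close>.\<close>

definition step_symbol :: "nat \<Rightarrow> real \<Rightarrow> real \<Rightarrow> real \<Rightarrow> real \<Rightarrow> real \<Rightarrow> complex" where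
  "step_symbol M T S r Y \<tau> =
    (truncated_wave M T S \<tau> - truncated_wave M r Y \<tau>) / (2 * of_real pi * \<i> * of_real \<tau>)"

lemma truncated_wave_borel [measurable]: "truncated_wave M T S \<in> borel_measurable borel"
  unfolding truncated_wave_def by measurable

lemma step_symbol_borel [measurable]: "step_symbol M T S r Y \<in> borel_measurable borel"
  unfolding step_symbol_def by measurable

lemma norm_truncated_wave_le: "norm (truncated_wave M T S \<tau>) \<le> 1"
proof (cases "\<bar>\<tau>\<bar> \<le> T")
  case True
  then have "\<tau>\<^sup>2 \<le> T\<^sup>2" by (simp add: abs_le_square_iff[symmetric])
  then have "0 \<le> \<tau>\<^sup>2 / T\<^sup>2" "\<tau>\<^sup>2 / T\<^sup>2 \<le> 1" by (auto simp: divide_le_eq_1)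
  then have "\<bar>(1 - \<tau>\<^sup>2 / T\<^sup>2) ^ M\<bar> \<le> 1" by (simp add: power_abs power_le_one)
  then show ?thesis using True
    by (simp only: truncated_wave_def if_True norm_mult norm_of_real norm_exp_eq_Re) simp
qed (simp add: truncated_wave_def)

lemma smooth_wave: "smooth_on UNIV (\<lambda>\<tau>. exp (\<i> * of_real \<tau> * of_real S) * complex_of_real ((1 - \<tau>\<^sup>2 / T\<^sup>2) ^ M))"
proof -
  have "smooth_on UNIV (\<lambda>\<tau>. exp ((\<i> * of_real S) * of_real \<tau>) * (1 - of_real (1 / T\<^sup>2) * (complex_of_real \<tau>)\<^sup>2) ^ M)"
    by (intro smooth_on_intros open_UNIV)
  then show ?thesis by (simp add: mult_ac)
qed

lemma isCont_truncated_wave: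
  assumes "\<bar>\<tau>\<bar> \<noteq> T" shows "isCont (truncated_wave M T S) \<tau>"
proof (cases "\<bar>\<tau>\<bar> < T")
  case True
  have "isCont (\<lambda>\<tau>. exp (\<i> * of_real \<tau> * of_real S) * complex_of_real ((1 - \<tau>\<^sup>2 / T\<^sup>2) ^ M)) \<tau>"
    using smooth_on_continuous[OF smooth_wave] by (simp add: continuous_on_eq_continuous_at)
  moreover have "\<forall>\<^sub>F x in nhds \<tau>. exp (\<i> * of_real x * of_real S) * complex_of_real ((1 - x\<^sup>2 / T\<^sup>2) ^ M) = truncated_wave M T S x"
  proof -
    have "\<tau> \<in> {-T<..<T}" using True by auto
    then have "\<forall>\<^sub>F x in nhds \<tau>. x \<in> {-T<..<T}" by (intro eventually_nhds_in_open) auto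
    then show ?thesis
    proof eventually_elim
      case (elim x)
      then have "\<bar>x\<bar> \<le> T" by auto
      then show ?case by (simp only: truncated_wave_def if_True)
    qed
  qed
  ultimately show ?thesis using isCont_cong by fast
next
  case False
  then have "\<tau> \<in> - {-T..T}" using assms by auto
  then have "\<forall>\<^sub>F x in nhds \<tau>. x \<in> - {-T..T}" by (intro eventually_nhds_in_open) auto
  then have "\<forall>\<^sub>F x in nhds \<tau>. 0 = truncated_wave M T S x"
    by eventually_elim (auto simp: truncated_wave_def)
  moreover have "isCont (\<lambda>x. 0::complex) \<tau>" by simp
  ultimately show ?thesis using isCont_cong by fast
qed

lemma step_symbol_zero: "r < T \<Longrightarrow> T < \<bar>\<tau>\<bar> \<Longrightarrow> step_symbol M T S r Y \<tau> = 0"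
  by (simp add: step_symbol_def truncated_wave_def)

text \<open>The division by \<tau> is undone at the origin as well, since both waves equal 1
  there.\<close>

lemma step_symbol_mult:
  assumes "0 < r" "0 < T"
  shows "of_real \<tau> * step_symbol M T S r Y \<tau> =
    (truncated_wave M T S \<tau> - truncated_wave M r Y \<tau>) / (2 * of_real pi * \<i>)"
  using assms by (cases "\<tau> = 0") (auto simp: step_symbol_def truncated_wave_def)

lemma isCont_step_symbol:
  "\<tau> \<noteq> 0 \<Longrightarrow> \<bar>\<tau>\<bar> \<noteq> T \<Longrightarrow> \<bar>\<tau>\<bar> \<noteq> r \<Longrightarrow> isCont (step_symbol M T S r Y) \<tau>"
  unfolding step_symbol_def[abs_def]
  by (intro continuous_intros isCont_truncated_wave) auto

text \<open>For |\<tau>| \<le> r the numerator is a difference of smooth functions that agree at 0,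
  hence O(|\<tau>|). Beyond r both waves are at most 1 in modulus and the denominator exceeds
  r.\<close>

lemma step_symbol_bounded:
  assumes r: "0 < r" "r < T"
  obtains C where "\<And>\<tau>. norm (step_symbol M T S r Y \<tau>) \<le> C"
proof -
  define w where "w T S \<tau> = exp (\<i> * of_real \<tau> * of_real S) * complex_of_real ((1 - \<tau>\<^sup>2 / T\<^sup>2) ^ M)" for T S \<tau>
  have "smooth_on UNIV (\<lambda>\<tau>. w T S \<tau> - w r Y \<tau>)"
    unfolding w_def by (intro smooth_on_diff smooth_wave) simp
  from smooth_lipschitz_interval[OF this subset_UNIV, of "-r" r] obtain C where C: "C > 0"
    "\<And>x y. x \<in> {-r..r} \<Longrightarrow> y \<in> {-r..r} \<Longrightarrow> norm ((w T S x - w r Y x) - (w T S y - w r Y y)) \<le> C * \<bar>x - y\<bar>" by metis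
  have "norm (step_symbol M T S r Y \<tau>) \<le> C + 2 / r" for \<tau>
  proof (cases "\<tau> = 0")
    case False
    have n: "norm (2 * of_real pi * \<i> * complex_of_real \<tau>) = 2 * pi * \<bar>\<tau>\<bar>" by (simp add: norm_mult)
    show ?thesis
    proof (cases "\<bar>\<tau>\<bar> \<le> r")
      case True
      have "norm (w T S \<tau> - w r Y \<tau>) \<le> C * \<bar>\<tau>\<bar>"
        using C(2)[of \<tau> 0] True r by (simp add: w_def abs_le_iff)
      also have "\<dots> \<le> (C * \<bar>\<tau>\<bar>) * (2 * pi)" using mult_left_mono[of 1 "2 * pi" "C * \<bar>\<tau>\<bar>"] C(1) pi_gt3 by simp
      finally have "norm (w T S \<tau> - w r Y \<tau>) / (2 * pi * \<bar>\<tau>\<bar>) \<le> C"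
        using False by (simp add: divide_le_eq mult_ac)
      moreover have "step_symbol M T S r Y \<tau> = (w T S \<tau> - w r Y \<tau>) / (2 * of_real pi * \<i> * of_real \<tau>)"
        using True r by (simp add: step_symbol_def truncated_wave_def w_def)
      moreover have "0 \<le> 2 / r" using r by simp
      ultimately show ?thesis by (simp only: norm_divide n)
    next
      case False
      have "norm (truncated_wave M T S \<tau> - truncated_wave M r Y \<tau>) \<le> 1 + 1"
        by (intro norm_triangle_le_diff add_mono norm_truncated_wave_le)
      then have "norm (truncated_wave M T S \<tau> - truncated_wave M r Y \<tau>) / (2 * pi * \<bar>\<tau>\<bar>) \<le> 2 / (1 * r)"
        using False r pi_gt3 by (intro frac_le mult_mono) auto
      then show ?thesis using C(1) unfolding step_symbol_def norm_divide n by simp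
    qed
  qed (use C(1) r in \<open>simp add: step_symbol_def\<close>)
  then show ?thesis by (rule that)
qed

lemma integrable_bounded_support:
  fixes f :: "real \<Rightarrow> complex"
  assumes "f \<in> borel_measurable borel" "\<And>x. norm (f x) \<le> C" "\<And>x. x \<notin> {a..b} \<Longrightarrow> f x = 0"
  shows "integrable lborel f"
proof (rule Bochner_Integration.integrable_bound)
  show "integrable lborel (\<lambda>x. indicator {a..b} x *\<^sub>R C)" by (intro borel_integrable_compact) auto
  show "AE x in lborel. norm (f x) \<le> norm (indicator {a..b} x *\<^sub>R C)"
  proof (rule AE_I2)
    fix x show "norm (f x) \<le> norm (indicator {a..b} x *\<^sub>R C)"
      using assms(2)[of x] assms(3)[of x] by (cases "x \<in> {a..b}") auto
  qed
qed (use assms in simp)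

lemma integrable_step_symbol: "0 < r \<Longrightarrow> r < T \<Longrightarrow> integrable lborel (step_symbol M T S r Y)"
proof -
  assume r: "0 < r" "r < T"
  obtain C where "\<And>\<tau>. norm (step_symbol M T S r Y \<tau>) \<le> C" using step_symbol_bounded[OF r] by metis
  then show ?thesis
    using step_symbol_zero[OF r(2)] by (intro integrable_bounded_support[of _ C "-T" T]) auto
qed

lemma riesz_step_lborel:
  assumes T: "T > 0"
  shows "integrable lborel (\<lambda>\<tau>. indicator {-T..T} \<tau> * ((1 - \<tau>\<^sup>2 / T\<^sup>2) ^ M * (x * sinc (\<tau> * x))))"
    and "(LINT \<tau>|lborel. indicator {-T..T} \<tau> * ((1 - \<tau>\<^sup>2 / T\<^sup>2) ^ M * (x * sinc (\<tau> * x)))) = riesz_step M (T * x)"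
proof -
  have "integrable lborel (\<lambda>\<tau>. indicator {-T..T} \<tau> *\<^sub>R ((1 - \<tau>\<^sup>2 / T\<^sup>2) ^ M * (x * sinc (\<tau> * x))))"
    using T by (intro borel_integrable_compact continuous_intros continuous_on_compose2[OF continuous_on_sinc[of UNIV]]) auto
  then show "integrable lborel (\<lambda>\<tau>. indicator {-T..T} \<tau> * ((1 - \<tau>\<^sup>2 / T\<^sup>2) ^ M * (x * sinc (\<tau> * x))))" by simp
  have "(LINT \<tau>|lborel. indicator {-T..T} \<tau> * ((1 - \<tau>\<^sup>2 / T\<^sup>2) ^ M * (x * sinc (\<tau> * x))))
    = \<bar>T\<bar> *\<^sub>R (LINT t|lborel. indicator {-T..T} (0 + T * t) * ((1 - (0 + T * t)\<^sup>2 / T\<^sup>2) ^ M * (x * sinc ((0 + T * t) * x))))"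
    using T by (intro lborel_integral_real_affine) simp
  also have "\<dots> = (LINT t|lborel. T * (indicator {-T..T} (0 + T * t) * ((1 - (0 + T * t)\<^sup>2 / T\<^sup>2) ^ M * (x * sinc ((0 + T * t) * x)))))"
    using T by simp
  also have "\<dots> = (LINT t|lborel. indicator {-1..1} t *\<^sub>R ((1 - t\<^sup>2) ^ M * ((T * x) * sinc (t * (T * x)))))"
  proof (rule Bochner_Integration.integral_cong[OF refl])
    fix t
    have "(indicator {-T..T} (0 + T * t) :: real) = indicator {-1..1} t"
      using mult_le_cancel_left_pos[OF T, of "-1" t] mult_le_cancel_left_pos[OF T, of t 1] by (simp add: indicator_def)
    moreover have "(0 + T * t)\<^sup>2 / T\<^sup>2 = t\<^sup>2" using T by (simp add: power_mult_distrib)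
    moreover have "(0 + T * t) * x = t * (T * x)" by simp
    ultimately show "T * (indicator {-T..T} (0 + T * t) * ((1 - (0 + T * t)\<^sup>2 / T\<^sup>2) ^ M * (x * sinc ((0 + T * t) * x))))
      = indicator {-1..1} t *\<^sub>R ((1 - t\<^sup>2) ^ M * ((T * x) * sinc (t * (T * x))))"
      by (simp only: real_scaleR_def mult_ac)
  qed
  also have "\<dots> = riesz_step M (T * x)"
  proof -
    have "set_integrable lborel {-1..1} (\<lambda>t. (1 - t\<^sup>2) ^ M * ((T * x) * sinc (t * (T * x))))"
      unfolding set_integrable_def
      by (intro borel_integrable_compact continuous_intros continuous_on_compose2[OF continuous_on_sinc[of UNIV]]) auto
    from set_borel_integral_eq_integral(2)[OF this] show ?thesis
      unfolding riesz_step_def set_lebesgue_integral_def .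
  qed
  finally show "(LINT \<tau>|lborel. indicator {-T..T} \<tau> * ((1 - \<tau>\<^sup>2 / T\<^sup>2) ^ M * (x * sinc (\<tau> * x)))) = riesz_step M (T * x)" .
qed

text \<open>The cosine part of the transform is odd and integrates to zero.\<close>

lemma fourier_step_symbol:
  assumes r: "0 < r" "r < T"
  shows "fourier (step_symbol M T S r Y) \<sigma> =
    of_real (smoothed_step M (T * (S - \<sigma>)) - smoothed_step M (r * (Y - \<sigma>)))"
proof -
  define q where "q \<tau> = exp (- (\<i> * of_real \<sigma> * of_real \<tau>)) * step_symbol M T S r Y \<tau>" for \<tau>
  define D where "D T x \<tau> = indicator {-T..T} \<tau> * ((1 - \<tau>\<^sup>2 / T\<^sup>2) ^ M * (x * sinc (\<tau> * x)))" for T x \<tau> :: real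
  have q: "integrable lborel q"
    unfolding q_def by (intro integrable_kernel integrable_step_symbol r)
  have qm[measurable]: "q \<in> borel_measurable borel" using q by auto
  have refl_int: "(LINT \<tau>|lborel. q (- \<tau>)) = (LINT \<tau>|lborel. q \<tau>)"
    using lborel_integral_real_affine[of "-1" q 0] by simp
  have q': "integrable lborel (\<lambda>\<tau>. q (- \<tau>))"
    using lborel_integrable_real_affine[OF q, of "-1" 0] by simp
  have T: "T > 0" using r by simp
  have Di: "integrable lborel (D T x)" "(LINT \<tau>|lborel. D T x \<tau>) = riesz_step M (T * x)" if "T > 0" for T x
    unfolding D_def[abs_def] by (rule riesz_step_lborel[OF that])+
  \<comment> \<open>By reflection this is twice the integral. In the symmetrized integrand each wave
    has lost its pole at 0, so that the two waves can be integrated separately.\<close>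
  have "(LINT \<tau>|lborel. q \<tau>) + (LINT \<tau>|lborel. q (- \<tau>)) = (LINT \<tau>|lborel. q \<tau> + q (- \<tau>))"
    using q q' by simp
  also have "\<dots> = (LINT \<tau>|lborel. complex_of_real ((D T (S - \<sigma>) \<tau> - D r (Y - \<sigma>) \<tau>) / pi))"
  proof (rule integral_cong_AE)
    have "AE \<tau> in lborel. \<tau> \<noteq> (0::real)" by (rule AE_lborel_singleton)
    then show "AE \<tau> in lborel. q \<tau> + q (- \<tau>) = complex_of_real ((D T (S - \<sigma>) \<tau> - D r (Y - \<sigma>) \<tau>) / pi)"
    proof eventually_elim
      case (elim \<tau>)
      have tw: "exp (- (\<i> * of_real \<sigma> * of_real t)) * truncated_wave M T S t
        = of_real (indicator {-T..T} t * (1 - t\<^sup>2 / T\<^sup>2) ^ M) * cis (t * (S - \<sigma>))" for T S t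
      proof -
        have "exp (- (\<i> * complex_of_real \<sigma> * of_real t)) * exp (\<i> * of_real t * of_real S) = cis (t * (S - \<sigma>))"
          unfolding mult_exp_exp cis_conv_exp by (rule arg_cong[of _ _ exp]) (simp add: algebra_simps)
        then show ?thesis
          by (auto simp: truncated_wave_def indicator_def abs_le_iff mult.assoc[symmetric])
      qed
      define A where "A T = indicator {-T..T} \<tau> * (1 - \<tau>\<^sup>2 / T\<^sup>2) ^ M" for T
      have A: "indicator {-T..T} (- \<tau>) * (1 - (- \<tau>)\<^sup>2 / T\<^sup>2) ^ M = A T" for T
        by (auto simp: A_def indicator_def)
      have cisd: "cis t - cis (- t) = 2 * \<i> * of_real (sin t)" for t by (simp add: complex_eq_iff)
      have sD: "complex_of_real (D T x \<tau>) = of_real (A T) * of_real (sin (\<tau> * x)) / of_real \<tau>" for T x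
      proof -
        have "x * sinc (\<tau> * x) = sin (\<tau> * x) / \<tau>" using elim by auto
        then show ?thesis by (simp add: D_def A_def)
      qed
      have "q \<tau> + q (- \<tau>) = (of_real (A T) * (cis (\<tau> * (S - \<sigma>)) - cis (- (\<tau> * (S - \<sigma>))))
         - of_real (A r) * (cis (\<tau> * (Y - \<sigma>)) - cis (- (\<tau> * (Y - \<sigma>))))) / (2 * of_real pi * \<i> * of_real \<tau>)"
      proof -
        have 1: "q \<tau> = (of_real (A T) * cis (\<tau> * (S - \<sigma>)) - of_real (A r) * cis (\<tau> * (Y - \<sigma>))) / (2 * of_real pi * \<i> * of_real \<tau>)"
          unfolding q_def step_symbol_def times_divide_eq_right right_diff_distrib tw A_def ..
        have "q (- \<tau>) = (of_real (A T) * cis (- \<tau> * (S - \<sigma>)) - of_real (A r) * cis (- \<tau> * (Y - \<sigma>))) / (2 * of_real pi * \<i> * of_real (- \<tau>))"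
          unfolding q_def step_symbol_def times_divide_eq_right right_diff_distrib tw A ..
        then have 2: "q (- \<tau>) = - (of_real (A T) * cis (- (\<tau> * (S - \<sigma>))) - of_real (A r) * cis (- (\<tau> * (Y - \<sigma>)))) / (2 * of_real pi * \<i> * of_real \<tau>)"
          by (simp add: diff_divide_distrib)
        show ?thesis unfolding 1 2 add_divide_distrib[symmetric] by (simp add: algebra_simps)
      qed
      also have "\<dots> = (2 * \<i> * (of_real (A T) * of_real (sin (\<tau> * (S - \<sigma>))) - of_real (A r) * of_real (sin (\<tau> * (Y - \<sigma>))))) / (2 * \<i> * (of_real pi * of_real \<tau>))"
        unfolding cisd by (simp add: algebra_simps)
      also have "\<dots> = (of_real (A T) * of_real (sin (\<tau> * (S - \<sigma>))) - of_real (A r) * of_real (sin (\<tau> * (Y - \<sigma>)))) / (of_real pi * of_real \<tau>)"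
        by simp
      also have "\<dots> = complex_of_real ((D T (S - \<sigma>) \<tau> - D r (Y - \<sigma>) \<tau>) / pi)"
        unfolding of_real_divide of_real_diff sD diff_divide_distrib by (simp add: mult_ac)
      finally show ?case .
    qed
    show "(\<lambda>\<tau>. q \<tau> + q (- \<tau>)) \<in> borel_measurable lborel" by simp
    show "(\<lambda>\<tau>. complex_of_real ((D T (S - \<sigma>) \<tau> - D r (Y - \<sigma>) \<tau>) / pi)) \<in> borel_measurable lborel"
      using borel_measurable_integrable[OF Di(1)[OF T]] borel_measurable_integrable[OF Di(1)[OF r(1)]] by measurable
  qed
  also have "\<dots> = of_real ((riesz_step M (T * (S - \<sigma>)) - riesz_step M (r * (Y - \<sigma>))) / pi)"
    using Di[OF T] Di[OF r(1)] by (simp del: of_real_divide of_real_diff)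
  finally have "2 * (LINT \<tau>|lborel. q \<tau>) = of_real ((riesz_step M (T * (S - \<sigma>)) - riesz_step M (r * (Y - \<sigma>))) / pi)"
    unfolding refl_int by simp
  then have "(LINT \<tau>|lborel. q \<tau>) = of_real ((riesz_step M (T * (S - \<sigma>)) - riesz_step M (r * (Y - \<sigma>))) / (2 * pi))"
    by (simp add: field_simps)
  also have "(riesz_step M (T * (S - \<sigma>)) - riesz_step M (r * (Y - \<sigma>))) / (2 * pi) = smoothed_step M (T * (S - \<sigma>)) - smoothed_step M (r * (Y - \<sigma>))"
    by (simp add: smoothed_step_def diff_divide_distrib)
  finally show ?thesis
    by (simp add: fourier_lborel q_def)
qed

subsection \<open>The smoothing error\<close>

lemma integral_inverse_square_scaled:
  assumes T: "T > 0"
  shows "integrable lborel (\<lambda>\<sigma>. inverse (1 + (T * (\<sigma> - S))\<^sup>2))"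
    and "(LINT \<sigma>|lborel. inverse (1 + (T * (\<sigma> - S))\<^sup>2)) = pi / T"
proof -
  have eq: "(\<lambda>\<sigma>. inverse (1 + (T * (\<sigma> - S))\<^sup>2)) = (\<lambda>\<sigma>. inverse (1 + (- T * S + T * \<sigma>)\<^sup>2))"
    by (simp add: algebra_simps)
  show "integrable lborel (\<lambda>\<sigma>. inverse (1 + (T * (\<sigma> - S))\<^sup>2))"
    unfolding eq using lborel_integrable_real_affine[OF integrable_inverse_square, of T "- T * S"] T by simp
  have "(LINT x|lborel. inverse (1 + x\<^sup>2)) = (pi :: real)"
    using LBINT_inverse_1_plus_square by (simp add: interval_lebesgue_integral_def set_lebesgue_integral_def)
  then have "pi = T * (LINT \<sigma>|lborel. inverse (1 + (- T * S + T * \<sigma>)\<^sup>2))"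
    using lborel_integral_real_affine[of T "\<lambda>x. inverse (1 + x\<^sup>2)" "- T * S"] T by simp
  then show "(LINT \<sigma>|lborel. inverse (1 + (T * (\<sigma> - S))\<^sup>2)) = pi / T"
    unfolding eq using T by (simp add: field_simps)
qed

text \<open>In the applications a is 1 + \<sigma> and X is 1 plus the size of the argument of the
  smoothed step. The hypothesis M \<ge> K + 1 leaves the exponent K - M - 1 \<le> -2 of X, which is
  integrable.\<close>

lemma powr_le_shifted:
  fixes a c X K :: real
  assumes a: "1 \<le> a" "a \<le> c * X" and X: "1 \<le> X" and c: "0 \<le> c" and K: "0 \<le> K" "K + 1 \<le> real M"
  shows "a powr K / X ^ (M + 1) \<le> c powr K * inverse (X\<^sup>2)"
proof -
  have "a powr K \<le> (c * X) powr K" using a K by (intro powr_mono2) auto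
  also have "\<dots> = c powr K * X powr K" using X c by (simp add: powr_mult)
  finally have "a powr K / X ^ (M + 1) \<le> c powr K * X powr K / X ^ (M + 1)"
    using X by (intro divide_right_mono) auto
  also have "X powr K / X ^ (M + 1) \<le> inverse (X\<^sup>2)"
  proof -
    have "X powr K * X\<^sup>2 = X powr (K + 2)" using X by (simp add: powr_add)
    also have "\<dots> \<le> X powr real (M + 1)" using X K by (intro powr_mono) auto
    also have "\<dots> = X ^ (M + 1)" using X by (intro powr_realpow) auto
    finally have "X powr K * X\<^sup>2 \<le> X ^ (M + 1)" .
    moreover have "p / z \<le> inverse y" if "p * y \<le> z" "0 < y" "0 < z" for p y z :: real
      using that by (simp add: field_simps)
    ultimately show ?thesis using X by (metis less_le_trans zero_less_one zero_less_power)
  qed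
  then have "c powr K * X powr K / X ^ (M + 1) \<le> c powr K * inverse (X\<^sup>2)"
    unfolding times_divide_eq_right[symmetric] by (intro mult_left_mono) auto
  finally show ?thesis .
qed

text \<open>Membership in the weighted space, restated with 1 + |x| in place of the Japanese
  bracket, together with the support and with the order \<open>M\<close> that beats the
  growth.\<close>

locale slow_growth =
  fixes \<gamma> :: "real \<Rightarrow> complex" and K C\<gamma> :: real and M :: nat
  assumes meas: "\<gamma> \<in> borel_measurable lebesgue" and halfline: "\<And>x. x < 0 \<Longrightarrow> \<gamma> x = 0"
    and growth: "AE x in lebesgue. norm (\<gamma> x) \<le> C\<gamma> * (1 + \<bar>x\<bar>) powr K"
    and C\<gamma>: "0 \<le> C\<gamma>" and K: "0 \<le> K" "K + 1 \<le> real M" and loc: "locally_integrable \<gamma>"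
begin

text \<open>The weighted bound on \<open>b\<close> is asked for on the half-line only, where
  \<open>\<gamma>\<close> lives; elsewhere the product is 0.\<close>

lemma integrable_mult_weight:
  fixes b :: "real \<Rightarrow> real"
  assumes w: "integrable lborel w" and b: "b \<in> borel_measurable borel"
    and bound: "\<And>x. x \<ge> 0 \<Longrightarrow> (1 + x) powr K * \<bar>b x\<bar> \<le> w x" and w0: "\<And>x. 0 \<le> w x"
  shows "integrable lebesgue (\<lambda>x. \<gamma> x * of_real (b x))"
    and "norm (LINT x|lebesgue. \<gamma> x * of_real (b x)) \<le> C\<gamma> * (LINT x|lborel. w x)"
    and "AE x in lebesgue. norm (\<gamma> x * of_real (b x)) \<le> C\<gamma> * w x"
proof -
  have wm: "w \<in> borel_measurable borel" using w by auto
  have wl: "integrable lebesgue (\<lambda>x. C\<gamma> * w x)" "(LINT x|lebesgue. C\<gamma> * w x) = C\<gamma> * (LINT x|lborel. w x)"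
    using w wm by (auto simp: integrable_lebesgue_iff_lborel integral_completion)
  show ae: "AE x in lebesgue. norm (\<gamma> x * of_real (b x)) \<le> C\<gamma> * w x"
    using growth
  proof eventually_elim
    case (elim x)
    show ?case
    proof (cases "x \<ge> 0")
      case True
      have "norm (\<gamma> x) * \<bar>b x\<bar> \<le> C\<gamma> * (1 + x) powr K * \<bar>b x\<bar>"
        using elim True by (intro mult_right_mono) auto
      also have "\<dots> \<le> C\<gamma> * w x"
        unfolding mult.assoc by (intro mult_left_mono bound True C\<gamma>)
      finally show ?thesis by (simp add: norm_mult)
    qed (use halfline[of x] w0[of x] C\<gamma> in simp)
  qed
  show int: "integrable lebesgue (\<lambda>x. \<gamma> x * of_real (b x))"
  proof (rule Bochner_Integration.integrable_bound[OF wl(1)])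
    have "(\<lambda>x. complex_of_real (b x)) \<in> borel_measurable lebesgue"
      using b by (intro measurable_completion) simp
    then show "(\<lambda>x. \<gamma> x * of_real (b x)) \<in> borel_measurable lebesgue" by (rule borel_measurable_times[OF meas])
    show "AE x in lebesgue. norm (\<gamma> x * of_real (b x)) \<le> norm (C\<gamma> * w x)"
      using ae by eventually_elim simp
  qed
  have "norm (LINT x|lebesgue. \<gamma> x * of_real (b x)) \<le> (LINT x|lebesgue. norm (\<gamma> x * of_real (b x)))"
    by (rule integral_norm_bound)
  also have "\<dots> \<le> (LINT x|lebesgue. C\<gamma> * w x)"
    by (intro integral_mono_AE integrable_norm int wl ae)
  finally show "norm (LINT x|lebesgue. \<gamma> x * of_real (b x)) \<le> C\<gamma> * (LINT x|lborel. w x)"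
    unfolding wl(2) .
qed

lemma M1: "1 \<le> M"
  using K by linarith

lemma smoothed_step_borel [measurable]: "smoothed_step M \<in> borel_measurable borel"
  by (rule borel_measurable_continuous_onI[OF continuous_smoothed_step])

text \<open>The deviation from the sharp step is at most H (1 + T|S - \<sigma>|)^{-M-1}. Against it
  the growth of \<gamma> costs (2S)^K and K powers of the weight, and the majorant 1/(1 + T^2
  (\<sigma> - S)^2) that remains has integral \<pi>/T.\<close>

lemma smoothing_error:
  obtains C where "C \<ge> 0"
    "\<And>T S. T \<ge> 1 \<Longrightarrow> S > 1 \<Longrightarrow> integrable lebesgue (\<lambda>\<sigma>. \<gamma> \<sigma> * of_real (smoothed_step M (T * (S - \<sigma>))))"
    "\<And>T S. T \<ge> 1 \<Longrightarrow> S > 1 \<Longrightarrow>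
      norm ((LINT \<sigma>|lebesgue. \<gamma> \<sigma> * of_real (smoothed_step M (T * (S - \<sigma>)))) - (LINT \<sigma>:{0..S}|lebesgue. \<gamma> \<sigma>))
        \<le> C * S powr K / T"
proof -
  obtain H where H: "H \<ge> 0" "\<And>x. \<bar>smoothed_step M x - (if x > 0 then 1 else 0)\<bar> \<le> H / (1 + \<bar>x\<bar>) ^ (M + 1)"
    using smoothed_step_rate[OF M1] by metis
  have main: "integrable lebesgue (\<lambda>\<sigma>. \<gamma> \<sigma> * of_real (smoothed_step M (T * (S - \<sigma>))))"
    "norm ((LINT \<sigma>|lebesgue. \<gamma> \<sigma> * of_real (smoothed_step M (T * (S - \<sigma>)))) - (LINT \<sigma>:{0..S}|lebesgue. \<gamma> \<sigma>))
        \<le> (C\<gamma> * H * 2 powr K * pi) * S powr K / T"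
    if T: "T \<ge> 1" and S: "S > 1" for T S
  proof -
    define b where "b \<sigma> = smoothed_step M (T * (S - \<sigma>)) - (if \<sigma> < S then 1 else 0)" for \<sigma>
    define w where "w \<sigma> = (H * (2 * S) powr K) * inverse (1 + (T * (\<sigma> - S))\<^sup>2)" for \<sigma>
    have bm: "b \<in> borel_measurable borel" unfolding b_def by measurable
    have w0: "0 \<le> w \<sigma>" for \<sigma> unfolding w_def using H(1) by (intro mult_nonneg_nonneg) (auto simp: add_pos_nonneg less_imp_le)
    have wi: "integrable lborel w" unfolding w_def[abs_def]
      using T by (intro integrable_mult_right integral_inverse_square_scaled) auto
    have wv: "(LINT \<sigma>|lborel. w \<sigma>) = H * (2 * S) powr K * (pi / T)"
      unfolding w_def using integral_inverse_square_scaled(2)[of T S] T by simp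
    have bw: "(1 + \<sigma>) powr K * \<bar>b \<sigma>\<bar> \<le> w \<sigma>" if "\<sigma> \<ge> 0" for \<sigma>
    proof -
      define X where "X = 1 + \<bar>T * (S - \<sigma>)\<bar>"
      have X: "X \<ge> 1" by (simp add: X_def)
      have "T * (S - \<sigma>) > 0 \<longleftrightarrow> \<sigma> < S" using T by (auto simp: zero_less_mult_iff)
      then have "\<bar>b \<sigma>\<bar> \<le> H / X ^ (M + 1)" using H(2)[of "T * (S - \<sigma>)"] by (simp add: b_def X_def)
      then have "(1 + \<sigma>) powr K * \<bar>b \<sigma>\<bar> \<le> (1 + \<sigma>) powr K * (H / X ^ (M + 1))" by (intro mult_left_mono) auto
      also have "\<dots> = H * ((1 + \<sigma>) powr K / X ^ (M + 1))" by simp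
      also have "\<dots> \<le> H * ((2 * S) powr K * inverse (X\<^sup>2))"
      proof (intro mult_left_mono powr_le_shifted X K H)
        have "1 * \<bar>S - \<sigma>\<bar> \<le> T * \<bar>S - \<sigma>\<bar>" using T by (intro mult_right_mono) auto
        then have "\<sigma> \<le> S + \<bar>T * (S - \<sigma>)\<bar>" using T by (simp add: abs_mult)
        moreover have "\<bar>T * (S - \<sigma>)\<bar> \<le> S * \<bar>T * (S - \<sigma>)\<bar>" using S by (intro mult_le_cancel_right1[THEN iffD2]) auto
        ultimately show "1 + \<sigma> \<le> 2 * S * X" using S by (simp add: X_def algebra_simps)
      qed (use that S in auto)
      also have "\<dots> \<le> w \<sigma>"
      proof -
        have "(T * (\<sigma> - S))\<^sup>2 = \<bar>T * (S - \<sigma>)\<bar>\<^sup>2" by (simp add: power_mult_distrib power2_commute)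
        then have "1 + (T * (\<sigma> - S))\<^sup>2 \<le> X\<^sup>2" by (simp add: X_def power2_sum)
        then have "inverse (X\<^sup>2) \<le> inverse (1 + (T * (\<sigma> - S))\<^sup>2)" by (intro le_imp_inverse_le) (auto simp: add_pos_nonneg)
        then show ?thesis unfolding w_def mult.assoc using H(1) by (intro mult_left_mono) auto
      qed
      finally show ?thesis .
    qed
    note bb = integrable_mult_weight[OF wi bm bw w0]
    have si: "set_integrable lebesgue {0..S} \<gamma>" using loc by (simp add: locally_integrable_def)
    have si': "integrable lebesgue (\<lambda>\<sigma>. indicator {0..S} \<sigma> *\<^sub>R \<gamma> \<sigma>)" using si by (simp add: set_integrable_def)
    \<comment> \<open>The closed interval [0, S] and the strict inequality in \<open>b\<close>
      disagree at \<sigma> = S only.\<close>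
    have ae: "AE \<sigma> in lebesgue. \<gamma> \<sigma> * of_real (smoothed_step M (T * (S - \<sigma>))) = \<gamma> \<sigma> * of_real (b \<sigma>) + indicator {0..S} \<sigma> *\<^sub>R \<gamma> \<sigma>"
    proof -
      have "AE \<sigma> in lborel. \<sigma> \<noteq> S" by (rule AE_lborel_singleton)
      then have "AE \<sigma> in lebesgue. \<sigma> \<noteq> S" by (rule AE_completion)
      then show ?thesis
      proof eventually_elim
        case (elim \<sigma>)
        consider "\<sigma> < 0" | "0 \<le> \<sigma>" "\<sigma> < S" | "S < \<sigma>" using elim by linarith
        then show ?case by cases (use S in \<open>auto simp: halfline b_def indicator_def algebra_simps\<close>)
      qed
    qed
    have sm: "(\<lambda>\<sigma>. \<gamma> \<sigma> * of_real (smoothed_step M (T * (S - \<sigma>)))) \<in> borel_measurable lebesgue"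
      by (intro borel_measurable_times meas measurable_completion) simp
    have i2: "integrable lebesgue (\<lambda>\<sigma>. \<gamma> \<sigma> * of_real (b \<sigma>) + indicator {0..S} \<sigma> *\<^sub>R \<gamma> \<sigma>)"
      by (intro Bochner_Integration.integrable_add bb si')
    show "integrable lebesgue (\<lambda>\<sigma>. \<gamma> \<sigma> * of_real (smoothed_step M (T * (S - \<sigma>))))"
      using integrable_cong_AE[OF sm borel_measurable_integrable[OF i2] ae] i2 by blast
    have "(LINT \<sigma>|lebesgue. \<gamma> \<sigma> * of_real (smoothed_step M (T * (S - \<sigma>)))) = (LINT \<sigma>|lebesgue. \<gamma> \<sigma> * of_real (b \<sigma>) + indicator {0..S} \<sigma> *\<^sub>R \<gamma> \<sigma>)"
      by (rule integral_cong_AE[OF sm borel_measurable_integrable[OF i2] ae])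
    also have "\<dots> = (LINT \<sigma>|lebesgue. \<gamma> \<sigma> * of_real (b \<sigma>)) + (LINT \<sigma>:{0..S}|lebesgue. \<gamma> \<sigma>)"
      unfolding set_lebesgue_integral_def by (rule Bochner_Integration.integral_add[OF bb(1) si'])
    finally have "(LINT \<sigma>|lebesgue. \<gamma> \<sigma> * of_real (smoothed_step M (T * (S - \<sigma>)))) = \<dots>" .
    then have "norm ((LINT \<sigma>|lebesgue. \<gamma> \<sigma> * of_real (smoothed_step M (T * (S - \<sigma>)))) - (LINT \<sigma>:{0..S}|lebesgue. \<gamma> \<sigma>))
      \<le> C\<gamma> * (H * (2 * S) powr K * (pi / T))" using bb(2) unfolding wv by simp
    then show "norm ((LINT \<sigma>|lebesgue. \<gamma> \<sigma> * of_real (smoothed_step M (T * (S - \<sigma>)))) - (LINT \<sigma>:{0..S}|lebesgue. \<gamma> \<sigma>))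
        \<le> (C\<gamma> * H * 2 powr K * pi) * S powr K / T"
      using S by (simp add: powr_mult mult_ac)
  qed
  show ?thesis
    by (rule that[of "C\<gamma> * H * 2 powr K * pi"]) (use main H(1) C\<gamma> in auto)
qed

text \<open>With Y = -n/r the argument of the smoothed step is -(n + r \<sigma>), which on the
  half-line is at most -n. So the values tend to 0 there, under an integrable bound free of
  n.\<close>

lemma lower_end_vanishes:
  assumes r: "0 < r" "r \<le> 1"
  shows "integrable lebesgue (\<lambda>\<sigma>. \<gamma> \<sigma> * of_real (smoothed_step M (r * (- real n / r - \<sigma>))))"
    and "(\<lambda>n. LINT \<sigma>|lebesgue. \<gamma> \<sigma> * of_real (smoothed_step M (r * (- real n / r - \<sigma>)))) \<longlonglongrightarrow> 0"
proof -
  obtain H where H: "H \<ge> 0" "\<And>x. \<bar>smoothed_step M x - (if x > 0 then 1 else 0)\<bar> \<le> H / (1 + \<bar>x\<bar>) ^ (M + 1)"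
    using smoothed_step_rate[OF M1] by metis
  define b where "b n \<sigma> = smoothed_step M (r * (- real n / r - \<sigma>))" for n \<sigma>
  define w where "w \<sigma> = (H * (1 / r) powr K) * inverse (1 + (r * (\<sigma> - 0))\<^sup>2)" for \<sigma>
  have bm: "b n \<in> borel_measurable borel" for n unfolding b_def by measurable
  have w0: "0 \<le> w \<sigma>" for \<sigma> unfolding w_def using H(1) by (intro mult_nonneg_nonneg) (auto simp: add_pos_nonneg less_imp_le)
  have wi: "integrable lborel w" unfolding w_def[abs_def]
    using r by (intro integrable_mult_right integral_inverse_square_scaled) auto
  have est: "(1 + \<sigma>) powr K * \<bar>b n \<sigma>\<bar> \<le> H * ((1 / r) powr K * inverse ((1 + (real n + r * \<sigma>))\<^sup>2))" if "\<sigma> \<ge> 0" for \<sigma> n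
  proof -
    define X where "X = 1 + (real n + r * \<sigma>)"
    have X: "X \<ge> 1" using r that by (simp add: X_def)
    have arg: "r * (- real n / r - \<sigma>) = - (real n + r * \<sigma>)" using r by (simp add: field_simps)
    have nn: "0 \<le> real n + r * \<sigma>" using r that by simp
    have "\<bar>smoothed_step M (- y)\<bar> \<le> H / (1 + y) ^ (M + 1)" if "0 \<le> y" for y
      using H(2)[of "- y"] that by simp
    from this[OF nn] have "\<bar>b n \<sigma>\<bar> \<le> H / X ^ (M + 1)" unfolding b_def X_def arg .
    then have "(1 + \<sigma>) powr K * \<bar>b n \<sigma>\<bar> \<le> (1 + \<sigma>) powr K * (H / X ^ (M + 1))" by (intro mult_left_mono) auto
    also have "\<dots> = H * ((1 + \<sigma>) powr K / X ^ (M + 1))" by simp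
    also have "\<dots> \<le> H * ((1 / r) powr K * inverse (X\<^sup>2))"
    proof (intro mult_left_mono powr_le_shifted X K H)
      have "r * (1 + \<sigma>) \<le> X" using r that by (simp add: X_def distrib_left add_increasing)
      then show "1 + \<sigma> \<le> 1 / r * X" using r by (simp add: field_simps)
    qed (use that r in auto)
    finally show ?thesis by (simp add: X_def)
  qed
  have bw: "(1 + \<sigma>) powr K * \<bar>b n \<sigma>\<bar> \<le> w \<sigma>" if "\<sigma> \<ge> 0" for \<sigma> n
  proof (rule order_trans[OF est[OF that]])
    have nn: "0 \<le> r * \<sigma>" using r that by simp
    have "1 + (r * (\<sigma> - 0))\<^sup>2 \<le> (1 + r * \<sigma>)\<^sup>2" using nn by (simp add: power2_sum)
    also have "\<dots> \<le> (1 + (real n + r * \<sigma>))\<^sup>2" using nn by (intro power_mono) auto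
    finally have "inverse ((1 + (real n + r * \<sigma>))\<^sup>2) \<le> inverse (1 + (r * (\<sigma> - 0))\<^sup>2)"
      by (intro le_imp_inverse_le) (auto simp: add_pos_nonneg)
    then show "H * ((1 / r) powr K * inverse ((1 + (real n + r * \<sigma>))\<^sup>2)) \<le> w \<sigma>"
      unfolding w_def mult.assoc using H(1) by (intro mult_left_mono) auto
  qed
  note bb = integrable_mult_weight[OF wi bm bw w0]
  show "integrable lebesgue (\<lambda>\<sigma>. \<gamma> \<sigma> * of_real (smoothed_step M (r * (- real n / r - \<sigma>))))"
    using bb(1)[of n] by (simp add: b_def)
  have "(\<lambda>n. LINT \<sigma>|lebesgue. \<gamma> \<sigma> * of_real (b n \<sigma>)) \<longlonglongrightarrow> (LINT \<sigma>|(lebesgue :: real measure). 0)"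
  proof (rule integral_dominated_convergence[where w = "\<lambda>\<sigma>. C\<gamma> * w \<sigma>"])
    show "AE \<sigma> in lebesgue. (\<lambda>n. \<gamma> \<sigma> * of_real (b n \<sigma>)) \<longlonglongrightarrow> 0"
    proof (rule AE_I2)
      fix \<sigma>
      show "(\<lambda>n. \<gamma> \<sigma> * of_real (b n \<sigma>)) \<longlonglongrightarrow> 0"
      proof (cases "\<sigma> \<ge> 0")
        case True
        have "(\<lambda>n. \<bar>b n \<sigma>\<bar>) \<longlonglongrightarrow> 0"
        proof (rule tendsto_sandwich[OF _ _ tendsto_const])
          show "\<forall>\<^sub>F n in sequentially. \<bar>b n \<sigma>\<bar> \<le> (H * (1 / r) powr K) * inverse ((1 + (real n + r * \<sigma>))\<^sup>2)"
          proof (intro always_eventually allI)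
            fix n
            have "1 powr K \<le> (1 + \<sigma>) powr K" using True K by (intro powr_mono2) auto
            then have "1 * \<bar>b n \<sigma>\<bar> \<le> (1 + \<sigma>) powr K * \<bar>b n \<sigma>\<bar>" by (intro mult_right_mono) auto
            then show "\<bar>b n \<sigma>\<bar> \<le> (H * (1 / r) powr K) * inverse ((1 + (real n + r * \<sigma>))\<^sup>2)"
              using est[OF True, of n] unfolding mult.assoc by linarith
          qed
          have "filterlim (\<lambda>n. 1 + r * \<sigma> + real n) at_top sequentially"
            by (intro filterlim_tendsto_add_at_top[OF tendsto_const] filterlim_real_sequentially)
          then have "(\<lambda>n. inverse ((1 + r * \<sigma> + real n)\<^sup>2)) \<longlonglongrightarrow> 0"
            by (intro tendsto_inverse_0_at_top filterlim_pow_at_top) auto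
          then have "(\<lambda>n. (H * (1 / r) powr K) * inverse ((1 + r * \<sigma> + real n)\<^sup>2)) \<longlonglongrightarrow> 0"
            by (intro tendsto_mult_right_zero)
          then show "(\<lambda>n. (H * (1 / r) powr K) * inverse ((1 + (real n + r * \<sigma>))\<^sup>2)) \<longlonglongrightarrow> 0"
            by (simp add: add_ac)
        qed auto
        then have "(\<lambda>n. b n \<sigma>) \<longlonglongrightarrow> 0" by (rule tendsto_rabs_zero_cancel)
        then have "(\<lambda>n. complex_of_real (b n \<sigma>)) \<longlonglongrightarrow> of_real 0" by (rule tendsto_of_real)
        then show ?thesis by (intro tendsto_mult_right_zero) simp
      qed (simp add: halfline)
    qed
    show "integrable lebesgue (\<lambda>\<sigma>. C\<gamma> * w \<sigma>)" using wi by (simp add: integrable_lebesgue_iff_lborel)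
    show "AE \<sigma> in lebesgue. norm (\<gamma> \<sigma> * of_real (b n \<sigma>)) \<le> C\<gamma> * w \<sigma>" for n by (rule bb(3))
    show "(\<lambda>\<sigma>. \<gamma> \<sigma> * of_real (b n \<sigma>)) \<in> borel_measurable lebesgue" for n using bb(1) by auto
  qed auto
  then show "(\<lambda>n. LINT \<sigma>|lebesgue. \<gamma> \<sigma> * of_real (smoothed_step M (r * (- real n / r - \<sigma>)))) \<longlonglongrightarrow> 0"
    by (simp add: b_def)
qed

end

subsection \<open>The truncated pairing as a smoothed step\<close>

lemma integrable_mult_support:
  fixes v k :: "real \<Rightarrow> complex"
  assumes v: "set_integrable lebesgue {a..b} v" and k: "k \<in> borel_measurable borel" "\<And>x. norm (k x) \<le> C"
    and supp: "\<And>x. x \<notin> {a..b} \<Longrightarrow> k x = 0"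
  shows "integrable lebesgue (\<lambda>x. v x * k x)"
    and "(LINT x|lebesgue. v x * k x) = (LINT x:{a..b}|lebesgue. v x * k x)"
proof -
  have eq: "(\<lambda>x. indicator {a..b} x *\<^sub>R (v x * k x)) = (\<lambda>x. v x * k x)"
    using supp by (auto simp: indicator_def fun_eq_iff)
  show "integrable lebesgue (\<lambda>x. v x * k x)"
    using set_integrable_mult_bounded[OF v k(1), of C] k(2) unfolding set_integrable_def eq by blast
  show "(LINT x|lebesgue. v x * k x) = (LINT x:{a..b}|lebesgue. v x * k x)"
    unfolding set_lebesgue_integral_def eq ..
qed

lemma locally_integrableI:
  assumes "\<And>T. T > 0 \<Longrightarrow> set_integrable lebesgue {-T..T} f"
  shows "locally_integrable f"
  unfolding locally_integrable_def
proof (intro allI impI)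
  fix C :: "real set" assume C: "compact C"
  from compact_imp_bounded[OF C] obtain T where T: "T > 0" "\<forall>x\<in>C. norm x \<le> T"
    unfolding bounded_pos by blast
  have "C \<in> sets lebesgue" using C by (simp add: borel_compact sets_completionI_sets)
  moreover have "C \<subseteq> {-T..T}" using T(2) by (auto simp: abs_le_iff)
  ultimately show "set_integrable lebesgue C f"
    by (rule set_integrable_subset[OF assms[OF T(1)]])
qed

lemma locally_integrable_mult_of_real:
  assumes "\<And>T. T > 0 \<Longrightarrow> set_integrable lebesgue {-T..T} u"
  shows "locally_integrable (\<lambda>\<tau>. of_real \<tau> * u \<tau>)"
proof (rule locally_integrableI)
  fix T :: real assume T: "T > 0"
  have "set_integrable lebesgue {-T..T} (\<lambda>\<tau>. u \<tau> * of_real \<tau>)"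
    by (rule set_integrable_mult_bounded[OF assms[OF T], of _ T]) auto
  then show "set_integrable lebesgue {-T..T} (\<lambda>\<tau>. of_real \<tau> * u \<tau>)" by (simp add: mult.commute)
qed

text \<open>The indicators of the intervals tend to 0 everywhere except at the origin, a null
  set.\<close>

lemma integral_shrinking_interval:
  fixes f :: "real \<Rightarrow> complex"
  assumes r: "r > 0" and f: "set_integrable lebesgue {-r..r} f"
  shows "(\<lambda>m. LINT \<tau>:{- (r / real (Suc m))..r / real (Suc m)}|lebesgue. norm (f \<tau>)) \<longlonglongrightarrow> 0"
proof -
  let ?I = "\<lambda>m. {- (r / real (Suc m))..r / real (Suc m)}"
  have sub: "?I m \<subseteq> {-r..r}" for m
  proof -
    have "r / real (Suc m) \<le> r / 1" using r by (intro divide_left_mono) auto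
    then show ?thesis by auto
  qed
  have "(\<lambda>m. LINT \<tau>|lebesgue. indicator (?I m) \<tau> *\<^sub>R norm (f \<tau>)) \<longlonglongrightarrow> (LINT \<tau>|(lebesgue :: real measure). 0)"
  proof (rule integral_dominated_convergence[where w = "\<lambda>\<tau>. norm (indicator {-r..r} \<tau> *\<^sub>R f \<tau>)"])
    show "integrable lebesgue (\<lambda>\<tau>. norm (indicator {-r..r} \<tau> *\<^sub>R f \<tau>))"
      using f unfolding set_integrable_def by (rule integrable_norm)
    have "AE \<tau> in lborel. \<tau> \<noteq> (0::real)" by (rule AE_lborel_singleton)
    then have "AE \<tau> in lebesgue. \<tau> \<noteq> (0::real)" by (rule AE_completion)
    then show "AE \<tau> in lebesgue. (\<lambda>m. indicator (?I m) \<tau> *\<^sub>R norm (f \<tau>)) \<longlonglongrightarrow> 0"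
    proof eventually_elim
      case (elim \<tau>)
      have "(\<lambda>m. r / real (Suc m)) \<longlonglongrightarrow> 0" using LIMSEQ_Suc[OF lim_const_over_n] .
      then have "\<forall>\<^sub>F m in sequentially. r / real (Suc m) < \<bar>\<tau>\<bar>" using elim by (intro order_tendstoD(2)) auto
      then have "\<forall>\<^sub>F m in sequentially. indicator (?I m) \<tau> *\<^sub>R norm (f \<tau>) = 0"
        by eventually_elim (auto simp: indicator_def)
      then show ?case by (rule tendsto_eventually)
    qed
    show "AE \<tau> in lebesgue. norm (indicator (?I m) \<tau> *\<^sub>R norm (f \<tau>)) \<le> norm (indicator {-r..r} \<tau> *\<^sub>R f \<tau>)" for m
    proof (rule AE_I2)
      fix \<tau> show "norm (indicator (?I m) \<tau> *\<^sub>R norm (f \<tau>)) \<le> norm (indicator {-r..r} \<tau> *\<^sub>R f \<tau>)"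
        using sub[of m] by (cases "\<tau> \<in> ?I m") auto
    qed
    show "(\<lambda>\<tau>. indicator (?I m) \<tau> *\<^sub>R norm (f \<tau>)) \<in> borel_measurable lebesgue" for m
    proof -
      have "set_integrable lebesgue (?I m) f" by (rule set_integrable_subset[OF f _ sub]) simp
      then have "set_integrable lebesgue (?I m) (\<lambda>\<tau>. norm (f \<tau>))" by (rule set_integrable_norm)
      then show ?thesis unfolding set_integrable_def by (rule borel_measurable_integrable)
    qed
  qed simp
  then show ?thesis by (simp add: set_lebesgue_integral_def)
qed

context slow_growth
begin

lemma growth_power: "AE x in lebesgue. norm (\<gamma> x) \<le> C\<gamma> * (1 + \<bar>x\<bar>) ^ M"
  using growth
proof eventually_elim
  case (elim x)
  have "(1 + \<bar>x\<bar>) powr K \<le> (1 + \<bar>x\<bar>) powr real M" using K by (intro powr_mono) auto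
  also have "\<dots> = (1 + \<bar>x\<bar>) ^ M" by (intro powr_realpow) auto
  finally have "C\<gamma> * (1 + \<bar>x\<bar>) powr K \<le> C\<gamma> * (1 + \<bar>x\<bar>) ^ M" by (intro mult_left_mono C\<gamma>)
  then show ?case using elim by linarith
qed

text \<open>The symbol of the step between Y and S is split by \<psi>. The part \<open>f1\<close> is
  a test function, and p is applied to it as a distribution. The part \<open>f2\<close> lives where
  p is the function h; it is not smooth, but bounded and continuous almost everywhere, so the
  extended pairing applies. \<open>h1\<close> stands for a bounded version of h/\<tau>
  there.\<close>

lemma truncated_pairing_approx:
  fixes u h \<psi> :: "real \<Rightarrow> complex" and T S :: real
  defines "w \<equiv> \<lambda>\<tau>. exp (\<i> * complex_of_real \<tau> * complex_of_real S) * complex_of_real ((1 - \<tau>\<^sup>2 / T\<^sup>2) ^ M)"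
  assumes T: "T \<ge> 1" and S: "S > 1"
    and \<rho>: "\<rho> \<in> test_functions UNIV" "(LINT y|lborel. \<rho> y) = 1"
    and u: "\<And>T. T > 0 \<Longrightarrow> set_integrable lebesgue {-T..T} u"
    and p: "tempered p"
    and eq: "\<And>\<phi>. \<phi> \<in> test_functions UNIV \<Longrightarrow>
      (LINT x|lebesgue. \<gamma> x * fourier \<phi> x) = (LINT x|lebesgue. of_real x * u x * \<phi> x) + p \<phi>"
    and U: "open U" "smooth_on U h" "equals_function_on p U h"
    and \<psi>: "\<psi> \<in> test_functions ({-T<..<T} - {0})" "closure {\<tau>\<in>{-T..T}. \<psi> \<tau> \<noteq> 1} \<subseteq> U"
    and r: "0 < r" "r < 1" "{-r..r} \<subseteq> U" "\<And>\<tau>. \<bar>\<tau>\<bar> \<le> r \<Longrightarrow> \<psi> \<tau> = 0"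
    and h: "h1 \<in> borel_measurable borel" "\<And>\<tau>. norm (h1 \<tau>) \<le> Ch"
      "\<And>\<tau>. \<tau> \<in> closure {\<tau>\<in>{-T..T}. \<psi> \<tau> \<noteq> 1} \<Longrightarrow> h1 \<tau> = h \<tau> / of_real \<tau>"
    and int_step: "integrable lebesgue (\<lambda>\<sigma>. \<gamma> \<sigma> * of_real (smoothed_step M (T * (S - \<sigma>))))"
    and int_lower: "integrable lebesgue (\<lambda>\<sigma>. \<gamma> \<sigma> * of_real (smoothed_step M (r * (Y - \<sigma>))))"
  shows "(LINT \<sigma>|lebesgue. \<gamma> \<sigma> * of_real (smoothed_step M (T * (S - \<sigma>)))) - (LINT \<sigma>|lebesgue. \<gamma> \<sigma> * of_real (smoothed_step M (r * (Y - \<sigma>))))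
    = ((LINT \<tau>:{-T..T}|lebesgue. u \<tau> * w \<tau>)
       + (p (\<lambda>\<tau>. \<psi> \<tau> * (w \<tau> / of_real \<tau>)) + (LINT \<tau>:{-T..T}|lebesgue. (1 - \<psi> \<tau>) * (h \<tau> / of_real \<tau>) * w \<tau>))
       - (LINT \<tau>:{-r..r}|lebesgue. (u \<tau> + h1 \<tau>) * truncated_wave M r Y \<tau>)) / (2 * of_real pi * \<i>)"
proof -
  define c where "c = 1 / (2 * of_real pi * \<i>)"
  define \<phi> where "\<phi> = step_symbol M T S r Y"
  define E where "E = closure {\<tau>\<in>{-T..T}. \<psi> \<tau> \<noteq> 1}"
  define f1 where "f1 \<tau> = \<psi> \<tau> * \<phi> \<tau>" for \<tau>
  define f2 where "f2 \<tau> = (1 - \<psi> \<tau>) * \<phi> \<tau>" for \<tau>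
  have rT: "r < T" using r T by simp
  have T0: "T > 0" using T by simp
  have M1: "1 \<le> M" by (rule M1)
  have E: "compact E" "E \<subseteq> {-T..T}" "E \<subseteq> U" "{-r..r} \<subseteq> E"
  proof -
    show "E \<subseteq> {-T..T}" unfolding E_def by (rule closure_minimal) auto
    then show "compact E"
      using compact_Int_closed[OF compact_Icc[of "-T" T], of E] by (simp add: E_def Int_absorb1)
    show "E \<subseteq> U" using \<psi>(2) unfolding E_def .
    have "{-r..r} \<subseteq> {\<tau>\<in>{-T..T}. \<psi> \<tau> \<noteq> 1}" using r(4) rT by (auto simp: abs_le_iff)
    then show "{-r..r} \<subseteq> E" unfolding E_def using closure_subset by blast
  qed
  have notE: "\<psi> \<tau> = 1" if "\<tau> \<in> {-T..T}" "\<tau> \<notin> E" for \<tau>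
    using that closure_subset[of "{\<tau>\<in>{-T..T}. \<psi> \<tau> \<noteq> 1}"] unfolding E_def by blast
  have \<psi>m[measurable]: "\<psi> \<in> borel_measurable borel" by (rule test_functions_borel[OF \<psi>(1)])
  obtain B\<psi> where B\<psi>: "B\<psi> > 0" "\<And>x. norm (\<psi> x) \<le> B\<psi>" using test_functions_bounded[OF \<psi>(1)] by metis
  have B1\<psi>: "norm (1 - \<psi> x) \<le> 1 + B\<psi>" for x
    using norm_triangle_ineq4[of 1 "\<psi> x"] B\<psi>(2)[of x] by simp
  have sw: "smooth_on UNIV w" unfolding w_def by (rule smooth_wave)
  have \<phi>m[measurable]: "\<phi> \<in> borel_measurable borel" unfolding \<phi>_def by (rule step_symbol_borel)
  obtain C\<phi> where C\<phi>: "\<And>x. norm (\<phi> x) \<le> C\<phi>" unfolding \<phi>_def using step_symbol_bounded[OF r(1) rT] by metis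
  have C\<phi>0: "0 \<le> C\<phi>" using C\<phi>[of 0] norm_ge_zero order_trans by blast
  have \<phi>0: "\<phi> \<tau> = 0" if "\<tau> \<notin> {-T..T}" for \<tau>
    unfolding \<phi>_def using that by (intro step_symbol_zero rT) auto
  have tw: "truncated_wave M T S \<tau> = w \<tau>" if "\<bar>\<tau>\<bar> \<le> T" for \<tau>
    using that by (simp add: truncated_wave_def w_def)
  define D where "D = {-T<..<T} - {0::real}"
  \<comment> \<open>Where \<psi> is nonzero, |\<tau>| > r, and the second wave is 0.\<close>
  have f1_eq: "f1 = (\<lambda>\<tau>. c * (\<psi> \<tau> * (w \<tau> / of_real \<tau>)))"
  proof
    fix \<tau>
    show "f1 \<tau> = c * (\<psi> \<tau> * (w \<tau> / of_real \<tau>))"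
    proof (cases "\<psi> \<tau> = 0")
      case False
      then have "r < \<bar>\<tau>\<bar>" using r(4)[of \<tau>] by linarith
      moreover obtain C where "C \<subseteq> {-T<..<T} - {0}" "\<And>x. x \<notin> C \<Longrightarrow> \<psi> x = 0" using test_functionsE[OF \<psi>(1)] by metis
      then have "\<tau> \<in> {-T<..<T}" using False by blast
      then have "\<bar>\<tau>\<bar> \<le> T" by auto
      ultimately have "\<phi> \<tau> = w \<tau> / (2 * of_real pi * \<i> * of_real \<tau>)"
        using tw[of \<tau>] by (simp add: \<phi>_def step_symbol_def truncated_wave_def[of M r])
      then show ?thesis by (simp add: f1_def c_def)
    qed (simp add: f1_def)
  qed
  have t0: "(\<lambda>\<tau>. \<psi> \<tau> * (w \<tau> / of_real \<tau>)) \<in> test_functions UNIV"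
  proof -
    have oD: "open D" "0 \<notin> D" unfolding D_def by auto
    have "smooth_on D (\<lambda>\<tau>. w \<tau> * inverse (of_real \<tau>))"
      by (intro smooth_on_mult smooth_on_inverse oD smooth_on_subset[OF sw]) auto
    from test_functions_mult_local[OF \<psi>(1)[folded D_def] oD(1) this]
    have "(\<lambda>\<tau>. \<psi> \<tau> * (w \<tau> / of_real \<tau>)) \<in> test_functions D" by (simp only: divide_inverse)
    then show ?thesis by (rule test_functions_mono) simp
  qed
  have t1: "f1 \<in> test_functions UNIV"
    unfolding f1_eq using test_functions_mult[OF t0 smooth_on_const[OF open_UNIV, of c]] .
  have f1m: "f1 \<in> borel_measurable borel" unfolding f1_def by measurable
  have f2m: "f2 \<in> borel_measurable borel" unfolding f2_def by measurable
  have f1b: "norm (f1 \<tau>) \<le> B\<psi> * C\<phi>" for \<tau>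
    unfolding f1_def norm_mult using B\<psi> C\<phi> C\<phi>0 by (intro mult_mono) (auto intro: less_imp_le)
  have f2b: "norm (f2 \<tau>) \<le> (1 + B\<psi>) * C\<phi>" for \<tau>
    unfolding f2_def norm_mult using B1\<psi> C\<phi> B\<psi>(1) by (intro mult_mono) auto
  have f10: "f1 \<tau> = 0" and f20: "f2 \<tau> = 0" if "\<tau> \<notin> {-T..T}" for \<tau>
    using \<phi>0[OF that] by (auto simp: f1_def f2_def)
  have f2E: "f2 \<tau> = 0" if "\<tau> \<notin> E" for \<tau>
    using notE[of \<tau>] f20[of \<tau>] that by (cases "\<tau> \<in> {-T..T}") (auto simp: f2_def)
  have f1i: "integrable lborel f1" by (rule integrable_bounded_support[OF f1m f1b f10])
  have f2i: "integrable lborel f2" by (rule integrable_bounded_support[OF f2m f2b f20])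
  have \<phi>12: "\<phi> \<tau> = f1 \<tau> + f2 \<tau>" for \<tau> by (simp add: f1_def f2_def algebra_simps)
  have four: "fourier f1 \<sigma> + fourier f2 \<sigma> = of_real (smoothed_step M (T * (S - \<sigma>)) - smoothed_step M (r * (Y - \<sigma>)))" for \<sigma>
  proof -
    have "fourier \<phi> \<sigma> = fourier f1 \<sigma> + fourier f2 \<sigma>"
      using fourier_add[OF f1i f2i] by (simp only: \<phi>12[abs_def])
    then show ?thesis unfolding \<phi>_def fourier_step_symbol[OF r(1) rT] by simp
  qed
  have i1: "integrable lebesgue (\<lambda>\<sigma>. \<gamma> \<sigma> * fourier f1 \<sigma>)"
    by (rule integrable_mult_schwartz[OF meas growth_power fourier_schwartz[OF t1]])
  have iV: "integrable lebesgue (\<lambda>\<sigma>. \<gamma> \<sigma> * of_real (smoothed_step M (T * (S - \<sigma>))) - \<gamma> \<sigma> * of_real (smoothed_step M (r * (Y - \<sigma>))))"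
    by (intro Bochner_Integration.integrable_diff int_step int_lower)
  have f2eq: "\<gamma> \<sigma> * fourier f2 \<sigma> = (\<gamma> \<sigma> * of_real (smoothed_step M (T * (S - \<sigma>))) - \<gamma> \<sigma> * of_real (smoothed_step M (r * (Y - \<sigma>)))) - \<gamma> \<sigma> * fourier f1 \<sigma>" for \<sigma>
  proof -
    have "fourier f2 \<sigma> = of_real (smoothed_step M (T * (S - \<sigma>)) - smoothed_step M (r * (Y - \<sigma>))) - fourier f1 \<sigma>"
      using four[of \<sigma>] by (simp add: eq_diff_eq add.commute)
    then show ?thesis by (simp only: of_real_diff right_diff_distrib)
  qed
  have i2: "integrable lebesgue (\<lambda>\<sigma>. \<gamma> \<sigma> * fourier f2 \<sigma>)"
    unfolding f2eq by (intro Bochner_Integration.integrable_diff iV i1)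
  have lhs: "(LINT \<sigma>|lebesgue. \<gamma> \<sigma> * of_real (smoothed_step M (T * (S - \<sigma>)))) - (LINT \<sigma>|lebesgue. \<gamma> \<sigma> * of_real (smoothed_step M (r * (Y - \<sigma>))))
    = (LINT \<sigma>|lebesgue. \<gamma> \<sigma> * fourier f1 \<sigma>) + (LINT \<sigma>|lebesgue. \<gamma> \<sigma> * fourier f2 \<sigma>)"
    unfolding f2eq by (simp only: Bochner_Integration.integral_diff[OF iV i1] Bochner_Integration.integral_diff[OF int_step int_lower]) simp
  define G where "G \<tau> = of_real \<tau> * u \<tau>" for \<tau>
  have G: "locally_integrable G" unfolding G_def[abs_def] by (rule locally_integrable_mult_of_real[OF u])
  have pair1: "(LINT \<sigma>|lebesgue. \<gamma> \<sigma> * fourier f1 \<sigma>) = (LINT \<tau>|lebesgue. G \<tau> * f1 \<tau>) + c * p (\<lambda>\<tau>. \<psi> \<tau> * (w \<tau> / of_real \<tau>))"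
    using eq[OF t1] tempered_mult[OF p test_functions_schwartz[OF t0], of c] unfolding f1_eq G_def by simp
  have pair2: "(LINT \<sigma>|lebesgue. \<gamma> \<sigma> * fourier f2 \<sigma>) = (LINT \<tau>|lebesgue. G \<tau> * f2 \<tau>) + (LINT \<tau>|lebesgue. h \<tau> * f2 \<tau>)"
  proof (rule mollified_pairing[OF \<rho> f2m f2b _ E(1,3) U(1) f2E i2 G smooth_on_continuous[OF U(2)]])
    have "AE \<tau> in lborel. \<tau> \<noteq> 0 \<and> \<tau> \<noteq> T \<and> \<tau> \<noteq> -T \<and> \<tau> \<noteq> r \<and> \<tau> \<noteq> -r"
      using AE_lborel_singleton[of 0] AE_lborel_singleton[of T] AE_lborel_singleton[of "-T"]
        AE_lborel_singleton[of r] AE_lborel_singleton[of "-r"] by eventually_elim auto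
    then show "AE \<tau> in lborel. isCont f2 \<tau>"
    proof eventually_elim
      case (elim \<tau>)
      have "isCont \<phi> \<tau>" unfolding \<phi>_def using elim by (intro isCont_step_symbol) auto
      moreover have "isCont \<psi> \<tau>"
        using smooth_on_continuous[OF test_functions_smooth[OF \<psi>(1)]] by (simp add: continuous_on_eq_continuous_at)
      ultimately show ?case unfolding f2_def[abs_def] by (intro continuous_intros)
    qed
    show "(LINT x|lebesgue. \<gamma> x * fourier \<phi> x) = (LINT x|lebesgue. G x * \<phi> x) + (LINT x|lebesgue. h x * \<phi> x)"
      if "\<phi> \<in> test_functions U" for \<phi>
      using eq[OF test_functions_mono[OF that subset_UNIV]] U(3) that
      by (simp add: equals_function_on_def function_pairing_def G_def)
  qed
  have GT: "set_integrable lebesgue {-T..T} G" using G by (simp add: locally_integrable_def)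
  \<comment> \<open>G carries the factor \<tau> by which the symbol divides, so that
    \<open>u\<close> meets the two waves themselves and \<psi> drops out of the sum.\<close>
  have G12: "(LINT \<tau>|lebesgue. G \<tau> * f1 \<tau>) + (LINT \<tau>|lebesgue. G \<tau> * f2 \<tau>)
    = c * ((LINT \<tau>:{-T..T}|lebesgue. u \<tau> * w \<tau>) - (LINT \<tau>:{-r..r}|lebesgue. u \<tau> * truncated_wave M r Y \<tau>))"
  proof -
    have tw0: "truncated_wave M T S \<tau> = 0" if "\<tau> \<notin> {-T..T}" for \<tau> T S using that by (auto simp: truncated_wave_def)
    have uT: "integrable lebesgue (\<lambda>\<tau>. u \<tau> * truncated_wave M T S \<tau>)"
      "(LINT \<tau>|lebesgue. u \<tau> * truncated_wave M T S \<tau>) = (LINT \<tau>:{-T..T}|lebesgue. u \<tau> * truncated_wave M T S \<tau>)"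
      by (rule integrable_mult_support[OF u[OF T0] truncated_wave_borel norm_truncated_wave_le tw0]; assumption)+
    have ur: "integrable lebesgue (\<lambda>\<tau>. u \<tau> * truncated_wave M r Y \<tau>)"
      "(LINT \<tau>|lebesgue. u \<tau> * truncated_wave M r Y \<tau>) = (LINT \<tau>:{-r..r}|lebesgue. u \<tau> * truncated_wave M r Y \<tau>)"
      by (rule integrable_mult_support[OF u[OF r(1)] truncated_wave_borel norm_truncated_wave_le tw0]; assumption)+
    have "(LINT \<tau>|lebesgue. G \<tau> * f1 \<tau>) + (LINT \<tau>|lebesgue. G \<tau> * f2 \<tau>) = (LINT \<tau>|lebesgue. G \<tau> * f1 \<tau> + G \<tau> * f2 \<tau>)"
      by (rule Bochner_Integration.integral_add[symmetric,
            OF integrable_mult_support(1)[OF GT f1m f1b f10] integrable_mult_support(1)[OF GT f2m f2b f20]])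
    also have "\<dots> = (LINT \<tau>|lebesgue. c * (u \<tau> * truncated_wave M T S \<tau> - u \<tau> * truncated_wave M r Y \<tau>))"
    proof (rule Bochner_Integration.integral_cong[OF refl])
      fix \<tau>
      have "G \<tau> * f1 \<tau> + G \<tau> * f2 \<tau> = u \<tau> * (of_real \<tau> * \<phi> \<tau>)" by (simp add: \<phi>12 G_def algebra_simps)
      then show "G \<tau> * f1 \<tau> + G \<tau> * f2 \<tau> = c * (u \<tau> * truncated_wave M T S \<tau> - u \<tau> * truncated_wave M r Y \<tau>)"
        unfolding \<phi>_def step_symbol_mult[OF r(1) T0] by (simp add: c_def right_diff_distrib diff_divide_distrib)
    qed
    also have "\<dots> = c * ((LINT \<tau>|lebesgue. u \<tau> * truncated_wave M T S \<tau>) - (LINT \<tau>|lebesgue. u \<tau> * truncated_wave M r Y \<tau>))"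
      unfolding integral_mult_right_zero
      by (rule arg_cong[of _ _ "(*) c"]) (rule Bochner_Integration.integral_diff[OF uT(1) ur(1)])
    also have "(LINT \<tau>|lebesgue. u \<tau> * truncated_wave M T S \<tau>) = (LINT \<tau>:{-T..T}|lebesgue. u \<tau> * w \<tau>)"
      unfolding uT(2) by (rule set_lebesgue_integral_cong) (auto simp: tw abs_le_iff)
    finally show ?thesis unfolding ur(2) .
  qed
  have h1r: "set_integrable lebesgue {-t..t} h1" for t :: real
  proof -
    have "integrable lborel (\<lambda>x. indicator {-t..t} x *\<^sub>R h1 x)"
    proof (rule integrable_bounded_support[of _ "\<bar>Ch\<bar>" "-t" t])
      show "norm (indicator {-t..t} x *\<^sub>R h1 x) \<le> \<bar>Ch\<bar>" for x
        using h(2)[of x] by (cases "x \<in> {-t..t}") auto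
    qed (use h(1) in auto)
    then show ?thesis unfolding set_integrable_def using h(1) by (subst integrable_lebesgue_iff_lborel) auto
  qed
  \<comment> \<open>Here the first wave keeps the factor 1 - \<psi>, while the second one lies where
    \<psi> = 0.\<close>
  have h2: "(LINT \<tau>|lebesgue. h \<tau> * f2 \<tau>) = c * ((LINT \<tau>:{-T..T}|lebesgue. (1 - \<psi> \<tau>) * (h \<tau> / of_real \<tau>) * w \<tau>) - (LINT \<tau>:{-r..r}|lebesgue. h1 \<tau> * truncated_wave M r Y \<tau>))"
  proof -
    have tw0: "truncated_wave M r Y \<tau> = 0" if "\<tau> \<notin> {-r..r}" for \<tau> using that by (auto simp: truncated_wave_def)
    have k0: "(1 - \<psi> \<tau>) * truncated_wave M T S \<tau> = 0" if "\<tau> \<notin> {-T..T}" for \<tau> using that by (auto simp: truncated_wave_def)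
    have kb: "norm ((1 - \<psi> \<tau>) * truncated_wave M T S \<tau>) \<le> (1 + B\<psi>) * 1" for \<tau>
      unfolding norm_mult using B\<psi>(1) by (intro mult_mono B1\<psi> norm_truncated_wave_le) auto
    have km: "(\<lambda>\<tau>. (1 - \<psi> \<tau>) * truncated_wave M T S \<tau>) \<in> borel_measurable borel" by measurable
    have hT: "integrable lebesgue (\<lambda>\<tau>. h1 \<tau> * ((1 - \<psi> \<tau>) * truncated_wave M T S \<tau>))"
      "(LINT \<tau>|lebesgue. h1 \<tau> * ((1 - \<psi> \<tau>) * truncated_wave M T S \<tau>)) = (LINT \<tau>:{-T..T}|lebesgue. h1 \<tau> * ((1 - \<psi> \<tau>) * truncated_wave M T S \<tau>))"
      by (rule integrable_mult_support[OF h1r[of T] km kb k0]; assumption)+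
    have hr: "integrable lebesgue (\<lambda>\<tau>. h1 \<tau> * truncated_wave M r Y \<tau>)"
      "(LINT \<tau>|lebesgue. h1 \<tau> * truncated_wave M r Y \<tau>) = (LINT \<tau>:{-r..r}|lebesgue. h1 \<tau> * truncated_wave M r Y \<tau>)"
      by (rule integrable_mult_support[OF h1r[of r] truncated_wave_borel norm_truncated_wave_le tw0]; assumption)+
    have "(LINT \<tau>|lebesgue. h \<tau> * f2 \<tau>) = (LINT \<tau>|lebesgue. c * (h1 \<tau> * ((1 - \<psi> \<tau>) * truncated_wave M T S \<tau>) - h1 \<tau> * truncated_wave M r Y \<tau>))"
    proof (rule Bochner_Integration.integral_cong[OF refl])
      fix \<tau>
      show "h \<tau> * f2 \<tau> = c * (h1 \<tau> * ((1 - \<psi> \<tau>) * truncated_wave M T S \<tau>) - h1 \<tau> * truncated_wave M r Y \<tau>)"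
      proof (cases "\<tau> \<in> E")
        case True
        have "(1 - \<psi> \<tau>) * truncated_wave M r Y \<tau> = truncated_wave M r Y \<tau>"
          using r(4)[of \<tau>] by (cases "\<bar>\<tau>\<bar> \<le> r") (auto simp: truncated_wave_def)
        then have "h \<tau> * f2 \<tau> = h \<tau> * (((1 - \<psi> \<tau>) * truncated_wave M T S \<tau> - truncated_wave M r Y \<tau>) / (2 * of_real pi * \<i> * of_real \<tau>))"
          by (simp add: f2_def \<phi>_def step_symbol_def right_diff_distrib)
        also have "\<dots> = c * (h \<tau> / of_real \<tau>) * ((1 - \<psi> \<tau>) * truncated_wave M T S \<tau> - truncated_wave M r Y \<tau>)"
          by (simp add: c_def)
        finally show ?thesis using h(3)[of \<tau>] True by (simp add: E_def algebra_simps)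
      next
        case False
        then have "\<tau> \<notin> {-r..r}" using E(4) by blast
        moreover have "(1 - \<psi> \<tau>) * truncated_wave M T S \<tau> = 0"
          using k0[of \<tau>] notE[of \<tau>] False by (cases "\<tau> \<in> {-T..T}") auto
        ultimately show ?thesis using f2E[OF False] tw0[of \<tau>] by simp
      qed
    qed
    also have "\<dots> = c * ((LINT \<tau>|lebesgue. h1 \<tau> * ((1 - \<psi> \<tau>) * truncated_wave M T S \<tau>)) - (LINT \<tau>|lebesgue. h1 \<tau> * truncated_wave M r Y \<tau>))"
      unfolding integral_mult_right_zero
      by (rule arg_cong[of _ _ "(*) c"]) (rule Bochner_Integration.integral_diff[OF hT(1) hr(1)])
    also have "(LINT \<tau>|lebesgue. h1 \<tau> * ((1 - \<psi> \<tau>) * truncated_wave M T S \<tau>)) = (LINT \<tau>:{-T..T}|lebesgue. (1 - \<psi> \<tau>) * (h \<tau> / of_real \<tau>) * w \<tau>)"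
      unfolding hT(2)
    proof (rule set_lebesgue_integral_cong)
      show "\<forall>\<tau>. \<tau> \<in> {-T..T} \<longrightarrow> h1 \<tau> * ((1 - \<psi> \<tau>) * truncated_wave M T S \<tau>) = (1 - \<psi> \<tau>) * (h \<tau> / of_real \<tau>) * w \<tau>"
      proof (intro allI impI)
        fix \<tau> assume \<tau>: "\<tau> \<in> {-T..T}"
        then have "truncated_wave M T S \<tau> = w \<tau>" by (intro tw) auto
        then show "h1 \<tau> * ((1 - \<psi> \<tau>) * truncated_wave M T S \<tau>) = (1 - \<psi> \<tau>) * (h \<tau> / of_real \<tau>) * w \<tau>"
          using notE[OF \<tau>] h(3)[of \<tau>] by (cases "\<tau> \<in> E") (auto simp: E_def)
      qed
    qed simp
    finally show ?thesis unfolding hr(2) .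
  qed
  have sum_r: "(LINT \<tau>:{-r..r}|lebesgue. (u \<tau> + h1 \<tau>) * truncated_wave M r Y \<tau>)
    = (LINT \<tau>:{-r..r}|lebesgue. u \<tau> * truncated_wave M r Y \<tau>) + (LINT \<tau>:{-r..r}|lebesgue. h1 \<tau> * truncated_wave M r Y \<tau>)"
    unfolding distrib_right
    by (intro set_integral_add set_integrable_mult_bounded[where C = 1] u r(1) h1r truncated_wave_borel norm_truncated_wave_le)
  have "(LINT \<sigma>|lebesgue. \<gamma> \<sigma> * of_real (smoothed_step M (T * (S - \<sigma>)))) - (LINT \<sigma>|lebesgue. \<gamma> \<sigma> * of_real (smoothed_step M (r * (Y - \<sigma>))))
    = ((LINT \<tau>|lebesgue. G \<tau> * f1 \<tau>) + (LINT \<tau>|lebesgue. G \<tau> * f2 \<tau>)) + (c * p (\<lambda>\<tau>. \<psi> \<tau> * (w \<tau> / of_real \<tau>)) + (LINT \<tau>|lebesgue. h \<tau> * f2 \<tau>))"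
    unfolding lhs pair1 pair2 by (simp only: add_ac)
  also have "\<dots> = c * ((LINT \<tau>:{-T..T}|lebesgue. u \<tau> * w \<tau>)
       + (p (\<lambda>\<tau>. \<psi> \<tau> * (w \<tau> / of_real \<tau>)) + (LINT \<tau>:{-T..T}|lebesgue. (1 - \<psi> \<tau>) * (h \<tau> / of_real \<tau>) * w \<tau>))
       - (LINT \<tau>:{-r..r}|lebesgue. (u \<tau> + h1 \<tau>) * truncated_wave M r Y \<tau>))"
    unfolding G12 h2 sum_r by (simp only: distrib_left right_diff_distrib) simp
  finally show ?thesis by (simp only: c_def times_divide_eq_left mult_1)
qed

text \<open>Neither side depends on r, and their difference is at most the integral of |u + h1| over
  [-r, r] for every small r; this integral tends to 0.\<close>

lemma truncated_pairing_identity: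
  fixes u h \<psi> :: "real \<Rightarrow> complex" and T S :: real
  defines "w \<equiv> \<lambda>\<tau>. exp (\<i> * complex_of_real \<tau> * complex_of_real S) * complex_of_real ((1 - \<tau>\<^sup>2 / T\<^sup>2) ^ M)"
  assumes T: "T \<ge> 1" and S: "S > 1"
    and \<rho>: "\<rho> \<in> test_functions UNIV" "(LINT y|lborel. \<rho> y) = 1"
    and u: "\<And>T. T > 0 \<Longrightarrow> set_integrable lebesgue {-T..T} u"
    and p: "tempered p"
    and eq: "\<And>\<phi>. \<phi> \<in> test_functions UNIV \<Longrightarrow>
      (LINT x|lebesgue. \<gamma> x * fourier \<phi> x) = (LINT x|lebesgue. of_real x * u x * \<phi> x) + p \<phi>"
    and U: "open U" "0 \<in> U" "smooth_on U h" "equals_function_on p U h" "h 0 = 0"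
    and \<psi>: "\<psi> \<in> test_functions ({-T<..<T} - {0})" "closure {\<tau>\<in>{-T..T}. \<psi> \<tau> \<noteq> 1} \<subseteq> U"
  shows "(LINT \<sigma>|lebesgue. \<gamma> \<sigma> * of_real (smoothed_step M (T * (S - \<sigma>)))) =
    ((LINT \<tau>:{-T..T}|lebesgue. u \<tau> * w \<tau>)
       + (p (\<lambda>\<tau>. \<psi> \<tau> * (w \<tau> / of_real \<tau>)) + (LINT \<tau>:{-T..T}|lebesgue. (1 - \<psi> \<tau>) * (h \<tau> / of_real \<tau>) * w \<tau>)))
     / (2 * of_real pi * \<i>)"
    (is "?A = ?X / _")
proof -
  define E where "E = closure {\<tau>\<in>{-T..T}. \<psi> \<tau> \<noteq> 1}"
  have E: "compact E" "E \<subseteq> U"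
  proof -
    have "E \<subseteq> {-T..T}" unfolding E_def by (rule closure_minimal) auto
    then show "compact E"
      using compact_Int_closed[OF compact_Icc[of "-T" T], of E] by (simp add: E_def Int_absorb1)
    show "E \<subseteq> U" using \<psi>(2) unfolding E_def .
  qed
  obtain C where C: "compact C" "C \<subseteq> {-T<..<T} - {0}" "\<And>x. x \<notin> C \<Longrightarrow> \<psi> x = 0"
    using test_functionsE[OF \<psi>(1)] by metis
  have "open (U \<inter> - C)" using U(1) C(1) by (intro open_Int) (auto simp: compact_imp_closed open_Compl)
  moreover have "0 \<in> U \<inter> - C" using U(2) C(2) by auto
  ultimately obtain e where e: "e > 0" "cball 0 e \<subseteq> U \<inter> - C" using open_contains_cball by metis
  \<comment> \<open>The bound \<open>e\<close> keeps [-r0, r0] inside \<open>U\<close> and off the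
    support of \<psi>; the bound 1/2 keeps r0 below 1 \<le> T, since the second wave has to be the
    shorter one.\<close>
  define r0 where "r0 = min e (1 / 2)"
  have r0: "0 < r0" "r0 < 1" "{-r0..r0} \<subseteq> U" and \<psi>0: "\<And>\<tau>. \<bar>\<tau>\<bar> \<le> r0 \<Longrightarrow> \<psi> \<tau> = 0"
  proof -
    have sub: "\<tau> \<in> U \<inter> - C" if "\<bar>\<tau>\<bar> \<le> r0" for \<tau>
      using that e(2) by (auto simp: r0_def dist_norm)
    show "0 < r0" "r0 < 1" using e(1) by (auto simp: r0_def)
    show "{-r0..r0} \<subseteq> U" using sub by (auto simp: abs_le_iff)
    show "\<psi> \<tau> = 0" if "\<bar>\<tau>\<bar> \<le> r0" for \<tau> using C(3)[of \<tau>] sub[OF that] by blast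
  qed
  \<comment> \<open>The restriction to the compact set \<open>E\<close> controls h away from 0. Near
    0 the quotient is bounded because h is Lipschitz with h(0) = 0, and at 0 it is 0 by the
    convention for division.\<close>
  define h1 where "h1 \<tau> = (indicator E \<tau> *\<^sub>R h \<tau>) / of_real \<tau>" for \<tau>
  have hE: "(\<lambda>\<tau>. indicator E \<tau> *\<^sub>R h \<tau>) \<in> borel_measurable borel"
  proof -
    have "integrable lborel (\<lambda>\<tau>. indicator E \<tau> *\<^sub>R h \<tau>)"
      by (intro borel_integrable_compact E continuous_on_subset[OF smooth_on_continuous[OF U(3)]])
    then show ?thesis by auto
  qed
  have h1m: "h1 \<in> borel_measurable borel" unfolding h1_def using hE by measurable
  obtain Ch where Ch: "\<And>\<tau>. norm (h1 \<tau>) \<le> Ch"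
  proof -
    obtain L where L: "L > 0" "\<And>x y. x \<in> {-r0..r0} \<Longrightarrow> y \<in> {-r0..r0} \<Longrightarrow> norm (h x - h y) \<le> L * \<bar>x - y\<bar>"
      using smooth_lipschitz_interval[OF U(3) r0(3)] by metis
    have "compact (h ` E)" by (intro compact_continuous_image E continuous_on_subset[OF smooth_on_continuous[OF U(3)]])
    from compact_imp_bounded[OF this] obtain B where B: "B > 0" "\<forall>y\<in>h ` E. norm y \<le> B" unfolding bounded_pos by blast
    have "norm (h1 \<tau>) \<le> L + B / r0" for \<tau>
    proof (cases "\<tau> \<in> E \<and> \<tau> \<noteq> 0")
      case True
      show ?thesis
      proof (cases "\<bar>\<tau>\<bar> \<le> r0")
        case True
        then have "norm (h \<tau>) \<le> L * \<bar>\<tau>\<bar>" using L(2)[of \<tau> 0] r0(1) U(5) by (auto simp: abs_le_iff)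
        then have "norm (h \<tau>) / \<bar>\<tau>\<bar> \<le> L" using \<open>\<tau> \<in> E \<and> \<tau> \<noteq> 0\<close> by (simp add: divide_le_eq)
        moreover have "0 \<le> B / r0" using B(1) r0(1) by simp
        ultimately show ?thesis using \<open>\<tau> \<in> E \<and> \<tau> \<noteq> 0\<close> by (simp add: h1_def norm_divide)
      next
        case False
        have "norm (h \<tau>) \<le> B" using B(2) True by auto
        then have "norm (h \<tau>) / \<bar>\<tau>\<bar> \<le> B / r0" using False r0(1) B(1) by (intro frac_le) auto
        then show ?thesis using True L(1) by (simp add: h1_def norm_divide)
      qed
    qed (use L(1) B(1) r0(1) in \<open>auto simp: h1_def\<close>)
    then show ?thesis by (rule that)
  qed
  obtain Ce where int_step: "integrable lebesgue (\<lambda>\<sigma>. \<gamma> \<sigma> * of_real (smoothed_step M (T * (S - \<sigma>))))"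
    using smoothing_error T S by metis
  define Z where "Z r n = (LINT \<sigma>|lebesgue. \<gamma> \<sigma> * of_real (smoothed_step M (r * (- real n / r - \<sigma>))))" for r n
  define \<delta> where "\<delta> r = (LINT \<tau>:{-r..r}|lebesgue. norm (u \<tau> + h1 \<tau>))" for r
  have uh: "set_integrable lebesgue {-r..r} (\<lambda>\<tau>. u \<tau> + h1 \<tau>)" if "r > 0" for r
  proof (rule set_integral_add(1)[OF u[OF that]])
    have "integrable lborel (\<lambda>x. indicator {-r..r} x *\<^sub>R h1 x)"
    proof (rule integrable_bounded_support[of _ "\<bar>Ch\<bar>" "-r" r])
      show "norm (indicator {-r..r} x *\<^sub>R h1 x) \<le> \<bar>Ch\<bar>" for x
        using Ch[of x] by (cases "x \<in> {-r..r}") auto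
    qed (use h1m in auto)
    then show "set_integrable lebesgue {-r..r} h1" unfolding set_integrable_def using h1m by (subst integrable_lebesgue_iff_lborel) auto
  qed
  have bound: "norm (?A - ?X / (2 * of_real pi * \<i>)) \<le> \<delta> r" if r: "0 < r" "r \<le> r0" for r
  proof -
    have r1: "r < 1" "{-r..r} \<subseteq> U" using r r0 by auto
    have ineq: "norm (?A - ?X / (2 * of_real pi * \<i>)) \<le> norm (Z r n) + \<delta> r" for n
    proof -
      let ?W = "LINT \<tau>:{-r..r}|lebesgue. (u \<tau> + h1 \<tau>) * truncated_wave M r (- real n / r) \<tau>"
      have "?A - Z r n = (?X - ?W) / (2 * of_real pi * \<i>)"
        unfolding Z_def w_def
      proof (rule truncated_pairing_approx[OF T S \<rho> u p eq U(1,3,4) \<psi> r(1) r1 _ h1m Ch _ int_step])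
        show "\<psi> \<tau> = 0" if "\<bar>\<tau>\<bar> \<le> r" for \<tau> using \<psi>0[of \<tau>] that r by simp
        show "h1 \<tau> = h \<tau> / of_real \<tau>" if "\<tau> \<in> closure {\<tau>\<in>{-T..T}. \<psi> \<tau> \<noteq> 1}" for \<tau>
          using that by (simp add: h1_def E_def)
        show "integrable lebesgue (\<lambda>\<sigma>. \<gamma> \<sigma> * of_real (smoothed_step M (r * (- real n / r - \<sigma>))))"
          using r r1 by (intro lower_end_vanishes) auto
      qed
      then have "?A - ?X / (2 * of_real pi * \<i>) = Z r n - ?W / (2 * of_real pi * \<i>)"
        by (simp add: diff_divide_distrib algebra_simps)
      then have "norm (?A - ?X / (2 * of_real pi * \<i>)) \<le> norm (Z r n) + norm (?W / (2 * of_real pi * \<i>))"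
        by (simp only: norm_triangle_ineq4)
      moreover have "norm (?W / (2 * of_real pi * \<i>)) \<le> \<delta> r"
      proof -
        have iW: "set_integrable lebesgue {-r..r} (\<lambda>\<tau>. (u \<tau> + h1 \<tau>) * truncated_wave M r (- real n / r) \<tau>)"
          by (intro set_integrable_mult_bounded[where C = 1] uh r(1) truncated_wave_borel norm_truncated_wave_le)
        have "norm ?W \<le> (LINT \<tau>:{-r..r}|lebesgue. norm ((u \<tau> + h1 \<tau>) * truncated_wave M r (- real n / r) \<tau>))"
          by (rule set_integral_norm_bound[OF iW])
        also have "\<dots> \<le> \<delta> r" unfolding \<delta>_def
        proof (rule set_integral_mono)
          show "norm ((u \<tau> + h1 \<tau>) * truncated_wave M r (- real n / r) \<tau>) \<le> norm (u \<tau> + h1 \<tau>)" for \<tau>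
            unfolding norm_mult by (intro mult_left_le norm_truncated_wave_le) auto
        qed (intro set_integrable_norm iW uh r(1))+
        finally have "norm ?W \<le> \<delta> r" .
        moreover have "norm (?W / (2 * of_real pi * \<i>)) = norm ?W / (2 * pi)" by (simp add: norm_divide norm_mult)
        moreover have "norm ?W / (2 * pi) \<le> norm ?W / 1" using pi_gt3 by (intro divide_left_mono) auto
        ultimately show ?thesis by simp
      qed
      ultimately show ?thesis by linarith
    qed
    \<comment> \<open>As \<open>\<delta> r\<close> is free of n, the limit in n can be taken for
      each r by itself.\<close>
    have "(\<lambda>n. norm (Z r n) + \<delta> r) \<longlonglongrightarrow> norm (0::complex) + \<delta> r"
      unfolding Z_def using r r1 by (intro tendsto_intros lower_end_vanishes) auto
    then have "norm (?A - ?X / (2 * of_real pi * \<i>)) \<le> norm (0::complex) + \<delta> r"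
      using ineq by (intro tendsto_lowerbound[of _ _ sequentially]) auto
    then show ?thesis by simp
  qed
  have "(\<lambda>m. \<delta> (r0 / real (Suc m))) \<longlonglongrightarrow> 0"
    unfolding \<delta>_def by (rule integral_shrinking_interval[OF r0(1) uh[OF r0(1)]])
  moreover have "norm (?A - ?X / (2 * of_real pi * \<i>)) \<le> \<delta> (r0 / real (Suc m))" for m
  proof (rule bound)
    show "r0 / real (Suc m) \<le> r0" using r0(1) by (simp add: divide_le_eq)
  qed (use r0 in simp)
  ultimately have "norm (?A - ?X / (2 * of_real pi * \<i>)) \<le> 0"
    by (intro tendsto_lowerbound[of _ _ sequentially]) auto
  then show ?thesis by simp
qed

end

subsection \<open>Existence of the truncated pairing\<close>

text \<open>On disjoint open sets a test function splits into its two restrictions, each again a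
  test function, and additivity of \<open>p\<close> glues the two representations.\<close>

lemma equals_function_on_Un:
  assumes p: "tempered p" and UV: "open U" "open V" "U \<inter> V = {}"
    and f: "equals_function_on p U f" "smooth_on U f" and g: "equals_function_on p V g" "smooth_on V g"
  defines "h \<equiv> \<lambda>x. if x \<in> U then f x else g x"
  shows "equals_function_on p (U \<union> V) h" "smooth_on (U \<union> V) h"
proof -
  have "smooth_on U h" by (rule smooth_on_cong[OF UV(1) f(2)]) (simp add: h_def)
  moreover have "smooth_on V h" by (rule smooth_on_cong[OF UV(2) g(2)]) (use UV(3) in \<open>auto simp: h_def\<close>)
  ultimately show sh: "smooth_on (U \<union> V) h" by (rule smooth_on_Un)
  show "equals_function_on p (U \<union> V) h"
    unfolding equals_function_on_def
  proof
    fix \<phi> assume \<phi>: "\<phi> \<in> test_functions (U \<union> V)"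
    obtain C where C: "smooth_on UNIV \<phi>" "compact C" "C \<subseteq> U \<union> V" "\<And>x. x \<notin> C \<Longrightarrow> \<phi> x = 0"
      using test_functionsE[OF \<phi>] by metis
    \<comment> \<open>\<open>C - A'\<close> is compact and contained in \<open>A\<close>, because
      the two sets cover \<open>C\<close>. Smoothness holds on \<open>A\<close>, on
      \<open>A'\<close> and off \<open>C\<close>, and these open sets exhaust the line.\<close>
    have part: "(\<lambda>x. if x \<in> A then \<phi> x else 0) \<in> test_functions A"
      if A: "open A" "open A'" "A \<inter> A' = {}" "C \<subseteq> A \<union> A'" for A A'
    proof (rule test_functionsI[of _ "C - A'"])
      let ?q = "\<lambda>x. if x \<in> A then \<phi> x else 0"
      have "smooth_on A ?q" by (rule smooth_on_cong[OF A(1) smooth_on_subset[OF C(1)]]) auto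
      moreover have "smooth_on A' ?q" by (rule smooth_on_cong[OF A(2) smooth_on_const[OF A(2), of 0]]) (use A(3) in auto)
      moreover have "open (- C)" using C(2) by (simp add: compact_imp_closed open_Compl)
      then have "smooth_on (- C) ?q"
        by (intro smooth_on_cong[OF _ smooth_on_const[of "- C" 0]]) (auto simp: C(4))
      ultimately have "smooth_on (A \<union> A' \<union> - C) ?q" by (intro smooth_on_Un)
      then show "smooth_on UNIV ?q" by (rule smooth_on_subset) (use A(4) in auto)
      show "compact (C - A')" by (rule compact_diff[OF C(2) A(2)])
      show "C - A' \<subseteq> A" using A(4) by blast
      show "?q x = 0" if "x \<notin> C - A'" for x using that A(3) C(4)[of x] by auto
    qed
    define \<phi>1 where "\<phi>1 x = (if x \<in> U then \<phi> x else 0)" for x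
    define \<phi>2 where "\<phi>2 x = (if x \<in> V then \<phi> x else 0)" for x
    have t1: "\<phi>1 \<in> test_functions U" unfolding \<phi>1_def[abs_def] by (rule part[OF UV C(3)])
    have t2: "\<phi>2 \<in> test_functions V"
      unfolding \<phi>2_def[abs_def] by (rule part[OF UV(2,1)]) (use UV(3) C(3) in auto)
    have sum: "\<phi> = (\<lambda>x. \<phi>1 x + \<phi>2 x)"
    proof
      fix x show "\<phi> x = \<phi>1 x + \<phi>2 x"
        using C(3,4) UV(3) by (auto simp: \<phi>1_def \<phi>2_def)
    qed
    have int: "integrable lebesgue (\<lambda>x. q x * \<eta> x)" if "smooth_on A q" "\<eta> \<in> test_functions A" "open A" for q \<eta> A
    proof -
      have "(\<lambda>x. \<eta> x * q x) \<in> test_functions A" by (rule test_functions_mult_local[OF that(2,3,1)])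
      from test_functions_integrable[OF this] test_functions_borel[OF this]
      have "integrable lebesgue (\<lambda>x. \<eta> x * q x)" by (subst integrable_lebesgue_iff_lborel)
      then show ?thesis by (simp add: mult.commute)
    qed
    have "p \<phi> = p \<phi>1 + p \<phi>2"
      unfolding sum using t1 t2 by (intro tempered_plus[OF p] test_functions_schwartz)
    also have "p \<phi>1 = (LINT x|lebesgue. f x * \<phi>1 x)"
      using f(1) t1 by (simp add: equals_function_on_def function_pairing_def)
    also have "p \<phi>2 = (LINT x|lebesgue. g x * \<phi>2 x)"
      using g(1) t2 by (simp add: equals_function_on_def function_pairing_def)
    also have "(LINT x|lebesgue. f x * \<phi>1 x) + (LINT x|lebesgue. g x * \<phi>2 x) = (LINT x|lebesgue. f x * \<phi>1 x + g x * \<phi>2 x)"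
      by (rule Bochner_Integration.integral_add[symmetric, OF int[OF f(2) t1 UV(1)] int[OF g(2) t2 UV(2)]])
    also have "(\<lambda>x. f x * \<phi>1 x + g x * \<phi>2 x) = (\<lambda>x. h x * \<phi> x)"
    proof
      fix x
      consider "x \<in> U" "x \<notin> V" | "x \<in> V" "x \<notin> U" | "x \<notin> U" "x \<notin> V" using UV(3) by blast
      then show "f x * \<phi>1 x + g x * \<phi>2 x = h x * \<phi> x"
        by cases (use C(3,4) in \<open>auto simp: \<phi>1_def \<phi>2_def h_def\<close>)
    qed
    finally show "p \<phi> = function_pairing h \<phi>" by (simp add: function_pairing_def)
  qed
qed

lemma equals_function_on_subset: "equals_function_on p U h \<Longrightarrow> V \<subseteq> U \<Longrightarrow> equals_function_on p V h"
  unfolding equals_function_on_def using test_functions_mono by blast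

context smooth_step
begin

text \<open>Near each of -T, 0 and T the distribution is a smooth function, and h is glued from
  these three on disjoint balls. The cutoff \<psi> is 1 on the rest of the interval and 0 close to
  the three points.\<close>

lemma truncated_pairing_data:
  assumes p: "tempered p" "vanishes_at_origin p" and T: "T > 0" "T \<notin> sing_supp p" "-T \<notin> sing_supp p"
  obtains U h \<psi> where "open U" "{-T, 0, T} \<subseteq> U" "smooth_on U h" "equals_function_on p U h" "h 0 = 0"
    "\<psi> \<in> test_functions ({-T<..<T} - {0})" "closure {\<tau>\<in>{-T..T}. \<psi> \<tau> \<noteq> 1} \<subseteq> U"
proof -
  obtain U0 h0 where 0: "open U0" "0 \<in> U0" "smooth_on U0 h0" "equals_function_on p U0 h0" "h0 0 = 0"
    using p(2) unfolding vanishes_at_origin_def by blast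
  obtain U1 h1 where 1: "open U1" "T \<in> U1" "smooth_on U1 h1" "equals_function_on p U1 h1"
    using T(2) unfolding sing_supp_def by blast
  obtain U2 h2 where 2: "open U2" "-T \<in> U2" "smooth_on U2 h2" "equals_function_on p U2 h2"
    using T(3) unfolding sing_supp_def by blast
  obtain e0 where e0: "e0 > 0" "ball 0 e0 \<subseteq> U0" using 0(1,2) open_contains_ball by metis
  obtain e1 where e1: "e1 > 0" "ball T e1 \<subseteq> U1" using 1(1,2) open_contains_ball by metis
  obtain e2 where e2: "e2 > 0" "ball (-T) e2 \<subseteq> U2" using 2(1,2) open_contains_ball by metis
  \<comment> \<open>T/4 keeps the three balls disjoint.\<close>
  define e where "e = min (T / 4) (min e0 (min e1 e2))"
  have e: "e > 0" "e \<le> T / 4" "ball 0 e \<subseteq> U0" "ball T e \<subseteq> U1" "ball (-T) e \<subseteq> U2"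
  proof -
    show "e > 0" "e \<le> T / 4" using T e0 e1 e2 by (auto simp: e_def)
    have "ball 0 e \<subseteq> ball 0 e0" "ball T e \<subseteq> ball T e1" "ball (-T) e \<subseteq> ball (-T) e2"
      by (auto simp: e_def)
    then show "ball 0 e \<subseteq> U0" "ball T e \<subseteq> U1" "ball (-T) e \<subseteq> U2" using e0 e1 e2 by auto
  qed
  define h' where "h' x = (if x \<in> ball T e then h1 x else h2 x)" for x
  define h where "h x = (if x \<in> ball 0 e then h0 x else h' x)" for x
  have "ball T e \<inter> ball (-T) e = {}" using e(1,2) by (auto simp: dist_real_def)
  from equals_function_on_Un[OF p(1) open_ball open_ball this
      equals_function_on_subset[OF 1(4) e(4)] smooth_on_subset[OF 1(3) e(4)]
      equals_function_on_subset[OF 2(4) e(5)] smooth_on_subset[OF 2(3) e(5)]]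
  have h': "equals_function_on p (ball T e \<union> ball (-T) e) h'" "smooth_on (ball T e \<union> ball (-T) e) h'"
    unfolding h'_def[abs_def] by simp_all
  have "ball 0 e \<inter> (ball T e \<union> ball (-T) e) = {}" using e(1,2) by (auto simp: dist_real_def)
  from equals_function_on_Un[OF p(1) open_ball _ this
      equals_function_on_subset[OF 0(4) e(3)] smooth_on_subset[OF 0(3) e(3)] h']
  have h: "equals_function_on p (ball 0 e \<union> (ball T e \<union> ball (-T) e)) h" "smooth_on (ball 0 e \<union> (ball T e \<union> ball (-T) e)) h"
    unfolding h_def[abs_def] by (simp_all add: open_Un)
  define U where "U = ball 0 e \<union> (ball T e \<union> ball (-T) e)"
  \<comment> \<open>The transitions have length R d = e/8. Begun at distance e/4 from the three
    points, they end at 3e/8 < e/2, well within the balls of radius e.\<close>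
  define d where "d = e / (8 * R)"
  have d: "d > 0" "R * d = e / 8" using e(1) R by (auto simp: d_def)
  define \<psi> where "\<psi> x = bump (e / 4) (T - e / 4) d x + bump (- (T - e / 4)) (- (e / 4)) d x" for x
  have "\<psi> \<in> test_functions ({-T<..<T} - {0})"
    unfolding \<psi>_def using d(1) e(1,2) T(1) by (intro test_functions_add bump_test) auto
  moreover have "closure {\<tau>\<in>{-T..T}. \<psi> \<tau> \<noteq> 1} \<subseteq> U"
  proof -
    have "{\<tau>\<in>{-T..T}. \<psi> \<tau> \<noteq> 1} \<subseteq> {-(e/2)..e/2} \<union> {T - e/2..T} \<union> {-T..-T + e/2}"
    proof
      fix \<tau> assume "\<tau> \<in> {\<tau>\<in>{-T..T}. \<psi> \<tau> \<noteq> 1}"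
      then have \<tau>: "-T \<le> \<tau>" "\<tau> \<le> T" "\<psi> \<tau> \<noteq> 1" by auto
      show "\<tau> \<in> {-(e/2)..e/2} \<union> {T - e/2..T} \<union> {-T..-T + e/2}"
      proof (rule ccontr)
        assume "\<not> ?thesis"
        then consider "e / 2 < \<tau>" "\<tau> < T - e / 2" | "\<tau> < - (e / 2)" "- T + e / 2 < \<tau>" using \<tau> by force
        then show False
        proof cases
          case 1
          have "bump (e / 4) (T - e / 4) d \<tau> = 1" using 1 d e(1) by (intro bump_one) auto
          moreover have "bump (- (T - e / 4)) (- (e / 4)) d \<tau> = 0" using 1 d e(1) by (intro bump_zero) auto
          ultimately show False using \<tau>(3) by (simp add: \<psi>_def)
        next
          case 2
          have "bump (- (T - e / 4)) (- (e / 4)) d \<tau> = 1" using 2 d e(1) by (intro bump_one) auto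
          moreover have "bump (e / 4) (T - e / 4) d \<tau> = 0" using 2 d e(1) by (intro bump_zero) auto
          ultimately show False using \<tau>(3) by (simp add: \<psi>_def)
        qed
      qed
    qed
    then have "closure {\<tau>\<in>{-T..T}. \<psi> \<tau> \<noteq> 1} \<subseteq> {-(e/2)..e/2} \<union> {T - e/2..T} \<union> {-T..-T + e/2}"
      by (rule closure_minimal) (intro closed_Un closed_atLeastAtMost)
    also have "\<dots> \<subseteq> U" using e(1) by (auto simp: U_def dist_real_def)
    finally show ?thesis .
  qed
  ultimately show ?thesis
    using e(1) 0(5) h by (intro that[of U h \<psi>]) (auto simp: U_def h_def)
qed

lemma integral_bump_tendsto:
  assumes f: "set_integrable lebesgue {0..S} f"
  shows "(\<lambda>n. LINT x|lebesgue. f x * bump 0 S (1 / real (Suc n)) x) \<longlonglongrightarrow> (LINT x:{0..S}|lebesgue. f x)"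
proof -
  have "(\<lambda>n. LINT x:{0..S}|lebesgue. f x * bump 0 S (1 / real (Suc n)) x) \<longlonglongrightarrow> (LINT x:{0..S}|lebesgue. f x * 1)"
  proof (rule set_integral_dominated_convergence[OF f _ _ _ bump_bound])
    have "AE x in lborel. x \<noteq> 0 \<and> x \<noteq> S"
      using AE_lborel_singleton[of 0] AE_lborel_singleton[of S] by eventually_elim auto
    then have "AE x in lebesgue. x \<noteq> 0 \<and> x \<noteq> S" by (rule AE_completion)
    then show "AE x in lebesgue. x \<in> {0..S} \<longrightarrow> (\<lambda>n. bump 0 S (1 / real (Suc n)) x) \<longlonglongrightarrow> 1"
    proof eventually_elim
      case (elim x)
      then show ?case using bump_tendsto_indicator[of x 0 S] by (auto simp: indicator_def)
    qed
  qed (auto intro: smooth_borel smooth_bump)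
  moreover have "(LINT x|lebesgue. f x * bump 0 S (1 / real (Suc n)) x) = (LINT x:{0..S}|lebesgue. f x * bump 0 S (1 / real (Suc n)) x)" for n
    by (rule integrable_mult_support(2)[OF f smooth_borel[OF smooth_bump] bump_bound]) (auto intro!: bump_zero)
  ultimately show ?thesis by simp
qed

end

subsection \<open>The choice of the truncation\<close>

text \<open>Each point is isolated by a member of a countable base, and different points need
  different members.\<close>

lemma discrete_imp_countable:
  fixes D :: "real set" assumes "discrete D" shows "countable D"
proof -
  obtain \<B> :: "real set set" where \<B>: "countable \<B>" "\<And>U. open U \<Longrightarrow> \<exists>\<B>'\<subseteq>\<B>. U = \<Union>\<B>'"
    using univ_second_countable by metis
  have "\<exists>A\<in>\<B>. A \<inter> D = {x}" if x: "x \<in> D" for x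
  proof -
    obtain V where V: "open V" "V \<inter> D = {x}"
      using discreteD[OF assms x] unfolding isolated_in_def by blast
    obtain \<B>' where "\<B>' \<subseteq> \<B>" "V = \<Union>\<B>'" using \<B>(2)[OF V(1)] by blast
    then show ?thesis using V(2) by blast
  qed
  then obtain A where A: "\<And>x. x \<in> D \<Longrightarrow> A x \<in> \<B>" "\<And>x. x \<in> D \<Longrightarrow> A x \<inter> D = {x}" by metis
  have "inj_on A D" using A(2) by (metis inj_onI singleton_inject)
  moreover have "countable (A ` D)" using A(1) by (intro countable_subset[OF _ \<B>(1)]) auto
  ultimately show ?thesis by (rule countable_image_inj_on[rotated])
qed

lemma ex_outside_countable:
  fixes a b :: real assumes "countable D" "a < b"
  obtains T where "a < T" "T < b" "T \<notin> D"
proof -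
  have "\<not> {a<..<b} \<subseteq> D"
    using uncountable_open_interval[of a b] countable_subset[OF _ assms(1)] assms(2) by blast
  then obtain T where "T \<in> {a<..<b}" "T \<notin> D" by blast
  then show ?thesis using that[of T] by simp
qed

text \<open>T balances the errors S^K/T and \<RR>(T)/S^N. If the supremum exceeds 2, any T between
  half of it and itself lies below a member of the set, so T \<RR>(T) \<le> \<Lambda> S^{N-K} by
  monotonicity, and the half costs the factor 2. Otherwise the rate is at most 2, and any T in (1,
  2) will do, as \<RR>(T) \<le> \<RR>(2). Either way an open interval is left in which the countable
  set \<open>D\<close> can be avoided.\<close>

lemma truncation_choice:
  fixes \<RR> :: "real \<Rightarrow> real"
  assumes \<RR>: "\<And>T. T > 0 \<Longrightarrow> \<RR> T > 0" "mono_on {0<..} \<RR>" and \<Lambda>: "\<Lambda> > 0" and K: "K \<ge> 0"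
    and D: "countable D" and S: "S > 1"
  shows "remainder_rate \<RR> \<Lambda> N K S \<ge> 1"
    and "\<exists>T>1. T \<notin> D \<and> S powr K / T + \<RR> T / S ^ N \<le> 2 * (1 + \<RR> 2 + \<Lambda>) * (S powr K / remainder_rate \<RR> \<Lambda> N K S)"
proof -
  define A where "A = {T. T > 0 \<and> T * \<RR> T \<le> \<Lambda> * S powr (real N - K)}"
  define \<rho> where "\<rho> = remainder_rate \<RR> \<Lambda> N K S"
  have \<rho>: "\<rho> = max 1 (Sup A)" by (simp add: \<rho>_def remainder_rate_def A_def)
  then show "remainder_rate \<RR> \<Lambda> N K S \<ge> 1" by (simp add: \<rho>_def)
  have mono: "\<RR> s \<le> \<RR> t" if "0 < s" "s \<le> t" for s t
    using \<RR>(2) that by (auto simp: mono_on_def)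
  have S1: "1 \<le> S powr K" using S K by (simp add: ge_one_powr_ge_zero)
  have SN: "1 \<le> S ^ N" using S by (intro one_le_power) simp
  have nonneg: "0 \<le> \<RR> 2" using \<RR>(1)[of 2] by simp
  show "\<exists>T>1. T \<notin> D \<and> S powr K / T + \<RR> T / S ^ N \<le> 2 * (1 + \<RR> 2 + \<Lambda>) * (S powr K / remainder_rate \<RR> \<Lambda> N K S)"
  proof (cases "Sup A \<le> 2")
    case True
    obtain T where T: "1 < T" "T < 2" "T \<notin> D" using ex_outside_countable[OF D, of 1 2] by auto
    have "\<RR> T / S ^ N \<le> \<RR> 2 / 1"
      using mono[of T 2] T nonneg SN by (intro frac_le) auto
    also have "\<dots> \<le> \<RR> 2 * S powr K" using mult_left_mono[OF S1 nonneg] by simp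
    finally have "\<RR> T / S ^ N \<le> \<RR> 2 * S powr K" .
    moreover have "S powr K / T \<le> S powr K / 1" using T by (intro divide_left_mono) auto
    moreover have "(1 + \<RR> 2) * S powr K \<le> (1 + \<RR> 2 + \<Lambda>) * S powr K" using \<Lambda> by (intro mult_right_mono) auto
    moreover have "1 \<le> 2 / \<rho>" using True \<rho> by simp
    then have "((1 + \<RR> 2 + \<Lambda>) * S powr K) * 1 \<le> ((1 + \<RR> 2 + \<Lambda>) * S powr K) * (2 / \<rho>)"
      using nonneg \<Lambda> by (intro mult_left_mono) auto
    ultimately have "S powr K / T + \<RR> T / S ^ N \<le> ((1 + \<RR> 2 + \<Lambda>) * S powr K) * (2 / \<rho>)"
      by (simp add: algebra_simps)
    also have "\<dots> = 2 * (1 + \<RR> 2 + \<Lambda>) * (S powr K / \<rho>)" by simp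
    finally show ?thesis using T by (auto simp: \<rho>_def)
  next
    case False
    then have \<rho>2: "\<rho> = Sup A" "\<rho> > 2" using \<rho> by auto
    \<comment> \<open>Beyond 1 the product T \<RR>(T) is at least T \<RR>(1).\<close>
    have bdd: "bdd_above A"
    proof (rule bdd_aboveI)
      fix T assume "T \<in> A"
      then have T: "T > 0" "T * \<RR> T \<le> \<Lambda> * S powr (real N - K)" by (auto simp: A_def)
      show "T \<le> max 1 (\<Lambda> * S powr (real N - K) / \<RR> 1)"
      proof (cases "T \<le> 1")
        case False
        have "T * \<RR> 1 \<le> T * \<RR> T" using mono[of 1 T] False by (intro mult_left_mono) auto
        then have "T \<le> \<Lambda> * S powr (real N - K) / \<RR> 1" using T(2) \<RR>(1)[of 1] by (simp add: pos_le_divide_eq)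
        then show ?thesis by simp
      qed simp
    qed
    obtain T where T: "\<rho> / 2 < T" "T < \<rho>" "T \<notin> D" using ex_outside_countable[OF D, of "\<rho> / 2" \<rho>] \<rho>2(2) by auto
    have T1: "T > 1" using T(1) \<rho>2(2) by linarith
    have ne: "A \<noteq> {}"
    proof -
      \<comment> \<open>Below 1 one has \<RR>(t) \<le> \<RR>(1), so a small enough t belongs to the
        set.\<close>
      define t where "t = min 1 (\<Lambda> * S powr (real N - K) / \<RR> 1)"
      have t: "0 < t" "t \<le> 1" using \<Lambda> S \<RR>(1)[of 1] by (auto simp: t_def)
      have "t * \<RR> t \<le> t * \<RR> 1" using mono[of t 1] t by (intro mult_left_mono) auto
      also have "\<dots> \<le> \<Lambda> * S powr (real N - K)"
        using \<RR>(1)[of 1] by (auto simp: t_def min_def pos_le_divide_eq)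
      finally show ?thesis using t by (auto simp: A_def)
    qed
    obtain T' where T': "T' \<in> A" "T < T'" using less_cSup_iff[OF ne bdd, of T] T(2) \<rho>2(1) by auto
    have "T * \<RR> T \<le> T' * \<RR> T'" using mono[of T T'] T' T1 \<RR>(1)[of T] by (intro mult_mono) auto
    also have "\<dots> \<le> \<Lambda> * S powr (real N - K)" using T' by (simp add: A_def)
    finally have "T * \<RR> T \<le> \<Lambda> * S powr (real N - K)" .
    moreover have "S powr (real N - K) = S ^ N / S powr K" using S by (simp add: powr_diff powr_realpow)
    \<comment> \<open>The gain S^{-K} is weakened to S^K, because the other error S^K/T is of that
      size anyway.\<close>
    moreover have "S ^ N / S powr K \<le> S ^ N * S powr K"
    proof -
      have "S ^ N / S powr K \<le> S ^ N / 1" using S1 SN by (intro divide_left_mono) auto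
      also have "\<dots> \<le> S ^ N * S powr K" using S1 SN by (simp add: mult_left_mono)
      finally show ?thesis .
    qed
    ultimately have *: "T * \<RR> T \<le> \<Lambda> * S powr (real N - K)" "S powr (real N - K) \<le> S ^ N * S powr K" by simp_all
    have "T * \<RR> T \<le> \<Lambda> * (S ^ N * S powr K)"
      using *(1) mult_left_mono[OF *(2), of \<Lambda>] \<Lambda> by linarith
    then have "\<RR> T / S ^ N \<le> \<Lambda> * (S powr K / T)"
      using T1 SN by (simp add: field_simps)
    then have "S powr K / T + \<RR> T / S ^ N \<le> (1 + \<Lambda>) * (S powr K / T)"
      unfolding distrib_right by linarith
    also have "\<dots> \<le> (1 + \<RR> 2 + \<Lambda>) * (S powr K / (\<rho> / 2))"
      using T(1) \<rho>2(2) \<Lambda> nonneg by (intro mult_mono divide_left_mono) auto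
    also have "\<dots> = 2 * (1 + \<RR> 2 + \<Lambda>) * (S powr K / \<rho>)" by simp
    finally show ?thesis using T T1 by (auto simp: \<rho>_def)
  qed
qed

section \<open>The growth of \<open>\<gamma>\<close> and the proof of the expansion\<close>

lemma weighted_Linf_growth:
  assumes \<gamma>: "\<gamma> \<in> weighted_Linf K" and K: "K \<ge> 0"
  shows "\<gamma> \<in> borel_measurable lebesgue"
    and "\<exists>C\<ge>0. AE x in lebesgue. norm (\<gamma> x) \<le> C * (1 + \<bar>x\<bar>) powr K"
proof -
  let ?j = "\<lambda>x. complex_of_real (japanese x powr (- K))"
  obtain C where m: "(\<lambda>x. ?j x * \<gamma> x) \<in> borel_measurable lebesgue" and C: "AE x in lebesgue. norm (?j x * \<gamma> x) \<le> C"
    using \<gamma> unfolding weighted_Linf_def by blast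
  have j1: "japanese x \<ge> 1" "japanese x \<le> 1 + \<bar>x\<bar>" for x
  proof -
    show "japanese x \<ge> 1" by (simp add: japanese_def)
    show "japanese x \<le> 1 + \<bar>x\<bar>"
      unfolding japanese_def by (rule real_le_lsqrt) (auto simp: power2_sum)
  qed
  \<comment> \<open>Multiplying the weight back recovers \<open>\<gamma>\<close>, so its
    measurability can be read off from that of the weighted function.\<close>
  have eq: "\<gamma> x = of_real (japanese x powr K) * (?j x * \<gamma> x)" for x
    using j1(1)[of x] by (simp add: powr_minus mult.assoc[symmetric] flip: of_real_mult)
  have "(\<lambda>x. complex_of_real (japanese x powr K)) \<in> borel_measurable borel"
    unfolding japanese_def by measurable
  then have "(\<lambda>x. complex_of_real (japanese x powr K)) \<in> borel_measurable lebesgue"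
    by (intro measurable_completion) simp
  from borel_measurable_times[OF this m]
  show "\<gamma> \<in> borel_measurable lebesgue" unfolding eq[symmetric] .
  have "AE x in lebesgue. norm (\<gamma> x) \<le> \<bar>C\<bar> * (1 + \<bar>x\<bar>) powr K"
    using C
  proof eventually_elim
    case (elim x)
    have "norm (\<gamma> x) = japanese x powr K * norm (?j x * \<gamma> x)"
      by (subst eq) (simp only: norm_mult norm_of_real abs_of_nonneg[OF powr_ge_zero])
    also have "\<dots> \<le> (1 + \<bar>x\<bar>) powr K * \<bar>C\<bar>"
      using elim j1[of x] K by (intro mult_mono powr_mono2) auto
    finally show ?case by (simp add: mult.commute)
  qed
  then show "\<exists>C\<ge>0. AE x in lebesgue. norm (\<gamma> x) \<le> C * (1 + \<bar>x\<bar>) powr K"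
    by (intro exI[of _ "\<bar>C\<bar>"]) simp
qed

theorem theorem3p5:
  fixes \<alpha> \<beta> \<gamma> \<chi>\<^sub>0 g_over_\<tau> :: "real \<Rightarrow> complex"
    and a a\<^sub>0 b c g p :: distribution
    and J :: "real set" and A\<^sub>0 :: "real \<Rightarrow> complex" and a\<^sub>0\<^sub>0 :: complex
    and K \<Lambda> :: real and N M :: nat and \<RR> :: "real \<Rightarrow> real"
  assumes \<alpha>: "\<alpha> \<in> tempered_L1loc_halfline"
    and a: "\<forall>\<phi>\<in>schwartz. a \<phi> = fourier_dist (distribution_of \<alpha>) \<phi>"
    and \<chi>\<^sub>0: "\<chi>\<^sub>0 \<in> test_functions {0<..}" "(LINT \<sigma>:{0<..}|lebesgue. \<chi>\<^sub>0 \<sigma>) = 1"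
    and tempered: "tempered a\<^sub>0" "tempered b" "tempered c" "tempered g" "tempered p"
    and a\<^sub>0: "finite J" "J \<subseteq> {0<..}"
      "\<forall>\<phi>\<in>schwartz. a\<^sub>0 \<phi> = (\<Sum>j\<in>J. A\<^sub>0 j * minus_i0_powr (- j) \<phi>)"
    and b: "\<beta> \<in> tempered_L1loc_halfline"
      "\<forall>\<phi>\<in>schwartz. b \<phi> = fourier_dist (distribution_of \<beta>) \<phi>"
    and c: "\<gamma> \<in> tempered_L1loc_halfline"
      "\<forall>\<phi>\<in>schwartz. c \<phi> = fourier_dist (distribution_of \<gamma>) \<phi>"
      "continuous_near_origin c"
    and g: "g_over_\<tau> \<in> sobolev_L1_loc N"
      "equals_function_on g UNIV (\<lambda>\<tau>. of_real \<tau> * g_over_\<tau> \<tau>)"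
      "discrete (sing_supp g)"
    and p: "discrete (sing_supp p)" "0 \<notin> sing_supp p" "vanishes_at_origin p"
    and decomposition: "\<forall>\<phi>\<in>schwartz.
      a \<phi> = a\<^sub>0\<^sub>0 * function_pairing (fourier \<chi>\<^sub>0) \<phi> + a\<^sub>0 \<phi> + b \<phi> + c \<phi>"
    and c_split: "\<forall>\<phi>\<in>schwartz. c \<phi> = g \<phi> + p \<phi>"
    and K: "K \<ge> 0" and \<gamma>: "\<gamma> \<in> weighted_Linf K"
    and \<RR>: "\<forall>T>0. \<RR> T > 0" "mono_on {0<..} \<RR>" "continuous_on {0<..} \<RR>"
    and g_bound: "\<forall>T\<ge>1. sobolev_L1_norm N {-T..T} g_over_\<tau> \<le> \<RR> T"
    and M: "real M \<ge> max (K + 1) (real N)"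
    and p_bound: "\<exists>B. \<forall>S>1. \<forall>T>1. T \<notin> sing_supp p \<and> - T \<notin> sing_supp p \<longrightarrow>
      (\<forall>I. has_truncated_pairing p T
              (\<lambda>\<tau>. exp (\<i> * of_real \<tau> * of_real S) * of_real ((1 - \<tau>\<^sup>2 / T\<^sup>2) ^ M)) I
            \<longrightarrow> S ^ N / \<RR> T * norm I \<le> B)"
    and \<Lambda>: "\<Lambda> > 0"
  shows "(\<lambda>S. (LINT \<sigma>:{0..S}|lebesgue. \<alpha> \<sigma>)
            - (a\<^sub>0\<^sub>0
               + (\<Sum>j\<in>J. exp (\<i> * of_real pi * of_real j / 2) / of_real (Gamma (j + 1))
                         * A\<^sub>0 j * of_real (S powr j))
               + (LINT \<sigma>:{0..S}|lebesgue. \<beta> \<sigma>)))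
         \<in> O[at_top](\<lambda>S. of_real (S powr K / remainder_rate \<RR> \<Lambda> N K S))"
proof -
  have locint: "set_integrable lebesgue {s..t} f" if "f \<in> tempered_L1loc_halfline" for f s t
    using that by (simp add: tempered_L1loc_halfline_def locally_integrable_def)
  have ext: "tempered_extension f (distribution_of f)" if "f \<in> tempered_L1loc_halfline" for f
    using that tempered_extension_distribution_of by (auto simp: tempered_L1loc_halfline_def)
  obtain F R B where "smooth_step F R B" using smooth_step_exists[OF \<chi>\<^sub>0] by metis
  then interpret smooth_step F R B .
  have \<chi>t: "\<chi>\<^sub>0 \<in> test_functions UNIV" by (rule test_functions_mono[OF \<chi>\<^sub>0(1)]) simp
  have \<chi>m: "\<chi>\<^sub>0 \<in> borel_measurable borel" by (rule test_functions_borel[OF \<chi>t])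
  obtain C where C: "compact C" "C \<subseteq> {0<..}" "\<And>x. x \<notin> C \<Longrightarrow> \<chi>\<^sub>0 x = 0" using test_functionsE[OF \<chi>\<^sub>0(1)] by metis
  from compact_imp_bounded[OF C(1)] obtain r where r: "r > 0" "\<forall>x\<in>C. norm x \<le> r" unfolding bounded_pos by blast
  \<comment> \<open>From S = r on, [0, S] contains the support of \<open>\<chi>\<^sub>0\<close>, and
    the term with coefficient \<open>a\<^sub>0\<^sub>0\<close> is the constant itself.\<close>
  have \<chi>int: "(LINT \<sigma>:{0..S}|lebesgue. \<chi>\<^sub>0 \<sigma>) = 1" if "S \<ge> r" for S
  proof -
    have "(\<lambda>x. indicator {0..S} x *\<^sub>R \<chi>\<^sub>0 x) = (\<lambda>x. indicator {0<..} x *\<^sub>R \<chi>\<^sub>0 x)"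
    proof
      fix x show "indicator {0..S} x *\<^sub>R \<chi>\<^sub>0 x = indicator {0<..} x *\<^sub>R \<chi>\<^sub>0 x"
        using C(2) C(3)[of x] r(2) that by (cases "x \<in> C") (auto simp: indicator_def)
    qed
    then show ?thesis using \<chi>\<^sub>0(2) by (simp add: set_lebesgue_integral_def)
  qed
  have \<chi>1: "(LINT y|lborel. \<chi>\<^sub>0 y) = 1"
  proof -
    have "(LINT y|lborel. \<chi>\<^sub>0 y) = (LINT y|lebesgue. \<chi>\<^sub>0 y)" by (rule lebesgue_integral_eq_lborel[OF \<chi>m, symmetric])
    also have "\<dots> = (LINT y:{0<..}|lebesgue. \<chi>\<^sub>0 y)"
      unfolding set_lebesgue_integral_def using C(2,3)
      by (intro Bochner_Integration.integral_cong) (auto simp: indicator_def)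
    finally show ?thesis using \<chi>\<^sub>0(2) by simp
  qed
  obtain C\<gamma> where C\<gamma>: "C\<gamma> \<ge> 0" "AE x in lebesgue. norm (\<gamma> x) \<le> C\<gamma> * (1 + \<bar>x\<bar>) powr K"
    using weighted_Linf_growth(2)[OF \<gamma> K] by blast
  interpret slow_growth \<gamma> K C\<gamma> M
    using weighted_Linf_growth(1)[OF \<gamma> K] C\<gamma> c(1) K M
    by unfold_locales (auto simp: tempered_L1loc_halfline_def)

  \<comment> \<open>Polynomial growth makes the pairing of \<open>\<gamma>\<close> with every
    Schwartz function an ordinary integral; it will be used at Fourier transforms of test
    functions.\<close>
  have \<gamma>_schwartz: "distribution_of \<gamma> \<psi> = (LINT x|lebesgue. \<gamma> x * \<psi> x)" if "\<psi> \<in> schwartz" for \<psi>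
    by (rule tempered_extension_eq_integral[OF ext[OF c(1)] meas growth_power bump_test bump_unit_at_0 that]) simp_all
  have ug: "set_integrable lebesgue {-T..T} g_over_\<tau>" if "T > 0" for T
    using g(1) that by (auto simp: sobolev_L1_loc_def sobolev_L1_def has_weak_deriv_def)
  have pairing: "(LINT x|lebesgue. \<gamma> x * fourier \<phi> x) = (LINT x|lebesgue. of_real x * g_over_\<tau> x * \<phi> x) + p \<phi>"
    if "\<phi> \<in> test_functions UNIV" for \<phi>
  proof -
    have "\<phi> \<in> schwartz" by (rule test_functions_schwartz[OF that])
    then have "(LINT x|lebesgue. \<gamma> x * fourier \<phi> x) = g \<phi> + p \<phi>"
      using c(2) c_split \<gamma>_schwartz[OF fourier_schwartz[OF that]] by (simp add: fourier_dist_def)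
    also have "g \<phi> = (LINT x|lebesgue. of_real x * g_over_\<tau> x * \<phi> x)"
      using g(2) that by (simp add: equals_function_on_def function_pairing_def)
    finally show ?thesis .
  qed

  have growth_bound: "\<exists>C. \<forall>S>1. norm (LINT \<sigma>:{0..S}|lebesgue. \<gamma> \<sigma>) \<le> C * (S powr K / remainder_rate \<RR> \<Lambda> N K S)"
  proof -
    \<comment> \<open>Both ends T and -T of the truncation must avoid the singular support, hence
      the reflected set.\<close>
    define D where "D = sing_supp p \<union> uminus ` sing_supp p"
    have D: "countable D" unfolding D_def using discrete_imp_countable[OF p(1)] by auto
    have D_iff: "T \<notin> D \<Longrightarrow> T \<notin> sing_supp p \<and> - T \<notin> sing_supp p" for T
      unfolding D_def using image_iff by force
    obtain Cs where Cs: "Cs \<ge> 0"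
      "\<And>T S. T \<ge> 1 \<Longrightarrow> S > 1 \<Longrightarrow>
        norm ((LINT \<sigma>|lebesgue. \<gamma> \<sigma> * of_real (smoothed_step M (T * (S - \<sigma>)))) - (LINT \<sigma>:{0..S}|lebesgue. \<gamma> \<sigma>))
          \<le> Cs * S powr K / T"
      using smoothing_error by metis
    have NM: "N \<le> M" using M by simp
    obtain Cg where Cg: "Cg \<ge> 0"
      "\<And>T S u. T \<ge> 1 \<Longrightarrow> S > 0 \<Longrightarrow> u \<in> sobolev_L1 N {-T..T} \<Longrightarrow>
        norm (LINT \<tau>:{-T..T}|lebesgue. u \<tau> * (of_real ((1 - \<tau>\<^sup>2 / T\<^sup>2) ^ M) * exp (\<i> * of_real S * of_real \<tau>)))
          \<le> Cg / S ^ N * sobolev_L1_norm N {-T..T} u"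
      by (rule sobolev_oscillatory_bound[OF NM]) (rule that)
    obtain Bp where Bp: "\<And>S T I. S > 1 \<Longrightarrow> T > 1 \<Longrightarrow> T \<notin> sing_supp p \<Longrightarrow> - T \<notin> sing_supp p \<Longrightarrow>
        has_truncated_pairing p T (\<lambda>\<tau>. exp (\<i> * of_real \<tau> * of_real S) * of_real ((1 - \<tau>\<^sup>2 / T\<^sup>2) ^ M)) I \<Longrightarrow>
        S ^ N / \<RR> T * norm I \<le> Bp"
      using p_bound by blast
    define C where "C = Cs + Cg + \<bar>Bp\<bar>"
    have C0: "C \<ge> 0" using Cs(1) Cg(1) by (simp add: C_def)
    have "norm (LINT \<sigma>:{0..S}|lebesgue. \<gamma> \<sigma>) \<le> C * (2 * (1 + \<RR> 2 + \<Lambda>)) * (S powr K / remainder_rate \<RR> \<Lambda> N K S)"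
      if S: "S > 1" for S
    proof -
      obtain T where T: "T > 1" "T \<notin> D"
        and rate: "S powr K / T + \<RR> T / S ^ N \<le> 2 * (1 + \<RR> 2 + \<Lambda>) * (S powr K / remainder_rate \<RR> \<Lambda> N K S)"
        using truncation_choice(2)[OF _ \<RR>(2) \<Lambda> K(1) D S] \<RR>(1) by blast
      have RT: "\<RR> T > 0" using \<RR>(1) T(1) by simp
      have SN: "S ^ N > 0" using S by simp
      note good = D_iff[OF T(2)]
      obtain U h \<psi> where U: "open U" "{-T, 0, T} \<subseteq> U" "smooth_on U h" "equals_function_on p U h" "h 0 = 0"
        and \<psi>: "\<psi> \<in> test_functions ({-T<..<T} - {0})" "closure {\<tau>\<in>{-T..T}. \<psi> \<tau> \<noteq> 1} \<subseteq> U"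
        using truncated_pairing_data[OF tempered(5) p(3), of T] T(1) good by auto
      define w where "w \<tau> = exp (\<i> * of_real \<tau> * of_real S) * complex_of_real ((1 - \<tau>\<^sup>2 / T\<^sup>2) ^ M)" for \<tau>
      define I where "I = p (\<lambda>\<tau>. \<psi> \<tau> * (w \<tau> / of_real \<tau>)) + (LINT \<tau>:{-T..T}|lebesgue. (1 - \<psi> \<tau>) * (h \<tau> / of_real \<tau>) * w \<tau>)"
      define X where "X = (LINT \<tau>:{-T..T}|lebesgue. g_over_\<tau> \<tau> * w \<tau>)"
      \<comment> \<open>The hypothesis bounds every value of the truncated pairing, in particular
        the one computed with this \<open>U\<close>, \<open>h\<close> and
        \<open>\<psi>\<close>.\<close>
      have "has_truncated_pairing p T w I"
        unfolding has_truncated_pairing_def I_def using U \<psi> by blast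
      then have "S ^ N / \<RR> T * norm I \<le> Bp"
        unfolding w_def[abs_def] by (intro Bp S T(1)) (use good in auto)
      then have "norm I \<le> Bp * (\<RR> T / S ^ N)" using RT SN by (simp add: field_simps)
      also have "\<dots> \<le> \<bar>Bp\<bar> * (\<RR> T / S ^ N)" using RT SN by (intro mult_right_mono) auto
      finally have I: "norm I \<le> \<bar>Bp\<bar> * (\<RR> T / S ^ N)" .
      have "X = (LINT \<tau>:{-T..T}|lebesgue. g_over_\<tau> \<tau> * (of_real ((1 - \<tau>\<^sup>2 / T\<^sup>2) ^ M) * exp (\<i> * of_real S * of_real \<tau>)))"
        unfolding X_def w_def by (simp only: mult_ac)
      then have "norm X \<le> Cg / S ^ N * sobolev_L1_norm N {-T..T} g_over_\<tau>"
        using Cg(2)[of T S g_over_\<tau>] g(1) T(1) S by (simp add: sobolev_L1_loc_def)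
      also have "\<dots> \<le> Cg / S ^ N * \<RR> T"
        using g_bound T(1) Cg(1) SN by (intro mult_left_mono) auto
      finally have X: "norm X \<le> Cg * (\<RR> T / S ^ N)" by simp
      have "(LINT \<sigma>|lebesgue. \<gamma> \<sigma> * of_real (smoothed_step M (T * (S - \<sigma>)))) = (X + I) / (2 * of_real pi * \<i>)"
        unfolding X_def I_def w_def
        by (rule truncated_pairing_identity[OF _ S \<chi>t \<chi>1 ug tempered(5) pairing U(1) _ U(3,4,5) \<psi>])
          (use T(1) U(2) in auto)
      then have "norm (LINT \<sigma>|lebesgue. \<gamma> \<sigma> * of_real (smoothed_step M (T * (S - \<sigma>)))) = norm (X + I) / (2 * pi)"
        by (simp add: norm_divide norm_mult)
      also have "\<dots> \<le> norm (X + I) / 1" using pi_gt3 by (intro divide_left_mono) auto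
      also have "\<dots> \<le> norm X + norm I" using norm_triangle_ineq[of X I] by simp
      finally have "norm (LINT \<sigma>:{0..S}|lebesgue. \<gamma> \<sigma>) \<le> Cs * S powr K / T + (norm X + norm I)"
        using Cs(2)[of T S] T(1) S
          norm_triangle_ineq2[of "LINT \<sigma>:{0..S}|lebesgue. \<gamma> \<sigma>" "LINT \<sigma>|lebesgue. \<gamma> \<sigma> * of_real (smoothed_step M (T * (S - \<sigma>)))"]
        by (simp add: norm_minus_commute)
      also have "\<dots> \<le> Cs * (S powr K / T) + (Cg + \<bar>Bp\<bar>) * (\<RR> T / S ^ N)"
        unfolding distrib_right using X I by simp
      also have "\<dots> \<le> C * (S powr K / T) + C * (\<RR> T / S ^ N)"
        using Cs(1) Cg(1) T(1) RT SN by (intro add_mono mult_right_mono) (auto simp: C_def)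
      also have "\<dots> = C * (S powr K / T + \<RR> T / S ^ N)" by (simp only: distrib_left)
      also have "\<dots> \<le> C * (2 * (1 + \<RR> 2 + \<Lambda>) * (S powr K / remainder_rate \<RR> \<Lambda> N K S))"
        by (rule mult_left_mono[OF rate C0])
      finally show ?thesis by (simp only: mult.assoc)
    qed
    then show ?thesis by blast
  qed

  define q where "q j = exp (\<i> * of_real pi * of_real j / 2) / complex_of_real (Gamma j)" for j
  \<comment> \<open>The transform in each term falls on \<open>inverse_fourier \<omega>\<close> and
    gives back \<open>\<omega>\<close>, so that only integrals over \<sigma> remain.\<close>
  have weak: "(LINT x|lebesgue. \<alpha> x * \<omega> x) = a\<^sub>0\<^sub>0 * (LINT x|lebesgue. \<chi>\<^sub>0 x * \<omega> x)
      + (\<Sum>j\<in>J. A\<^sub>0 j * (q j * (LINT x|lebesgue. gamma_density 0 j x * \<omega> x)))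
      + (LINT x|lebesgue. \<beta> x * \<omega> x) + (LINT x|lebesgue. \<gamma> x * \<omega> x)"
    if \<omega>: "\<omega> \<in> test_functions UNIV" for \<omega>
  proof -
    let ?\<phi> = "inverse_fourier \<omega>"
    have \<phi>: "?\<phi> \<in> schwartz" by (rule inverse_fourier_schwartz[OF \<omega>])
    have \<phi>i: "integrable lborel ?\<phi>" by (rule schwartz_integrable[OF \<phi>])
    have f\<phi>: "fourier ?\<phi> = \<omega>" using fourier_inverse_fourier[OF \<omega>] by blast
    have \<omega>m: "\<omega> \<in> borel_measurable borel" by (rule test_functions_borel[OF \<omega>])
    have d: "distribution_of f \<omega> = (LINT x|lebesgue. f x * \<omega> x)" if "f \<in> tempered_L1loc_halfline" for f
      using ext[OF that] \<omega> by (simp add: tempered_extension_def equals_function_on_def function_pairing_def)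
    have "function_pairing (fourier \<chi>\<^sub>0) ?\<phi> = (LINT x|lborel. fourier \<chi>\<^sub>0 x * ?\<phi> x)"
      unfolding function_pairing_def
      by (intro lebesgue_integral_eq_lborel borel_measurable_times schwartz_borel fourier_schwartz \<chi>t \<phi>)
    also have "\<dots> = (LINT x|lborel. \<chi>\<^sub>0 x * \<omega> x)"
      using fourier_multiplication[OF test_functions_integrable[OF \<chi>t] \<phi>i] by (simp add: f\<phi>)
    also have "\<dots> = (LINT x|lebesgue. \<chi>\<^sub>0 x * \<omega> x)"
      by (intro lebesgue_integral_eq_lborel[symmetric] borel_measurable_times \<chi>m \<omega>m)
    finally have 0: "function_pairing (fourier \<chi>\<^sub>0) ?\<phi> = (LINT x|lebesgue. \<chi>\<^sub>0 x * \<omega> x)" .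
    have "a\<^sub>0 ?\<phi> = (\<Sum>j\<in>J. A\<^sub>0 j * minus_i0_powr (- j) ?\<phi>)" using a\<^sub>0(3) \<phi> by blast
    also have "\<dots> = (\<Sum>j\<in>J. A\<^sub>0 j * (q j * (LINT x|lebesgue. gamma_density 0 j x * \<omega> x)))"
    proof (rule sum.cong[OF refl])
      fix j assume "j \<in> J"
      then have j: "j > 0" using a\<^sub>0(2) by auto
      have "(LINT x|lborel. gamma_density 0 j x * \<omega> x) = (LINT x|lebesgue. gamma_density 0 j x * \<omega> x)"
        by (intro lebesgue_integral_eq_lborel[symmetric] borel_measurable_times gamma_density_borel \<omega>m)
      then show "A\<^sub>0 j * minus_i0_powr (- j) ?\<phi> = A\<^sub>0 j * (q j * (LINT x|lebesgue. gamma_density 0 j x * \<omega> x))"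
        unfolding minus_i0_powr_inverse_fourier[OF j \<omega>] q_def by simp
    qed
    finally have 1: "a\<^sub>0 ?\<phi> = \<dots>" .
    show ?thesis
      using bspec[OF decomposition \<phi>] bspec[OF a \<phi>] bspec[OF b(2) \<phi>] bspec[OF c(2) \<phi>] 0 1
      by (simp add: fourier_dist_def f\<phi> d[OF \<alpha>] d[OF b(1)] d[OF c(1)])
  qed
  \<comment> \<open>The bumps with transition scale 1/(n+1) tend boundedly to the indicator of
    [0, S]. Every term converges because its function is integrable on [0, S], the power densities
    thanks to j > 0.\<close>
  have strong: "(LINT x:{0..S}|lebesgue. \<alpha> x) = a\<^sub>0\<^sub>0 * (LINT x:{0..S}|lebesgue. \<chi>\<^sub>0 x)
      + (\<Sum>j\<in>J. A\<^sub>0 j * (q j * (LINT x:{0..S}|lebesgue. gamma_density 0 j x)))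
      + (LINT x:{0..S}|lebesgue. \<beta> x) + (LINT x:{0..S}|lebesgue. \<gamma> x)" if S: "S \<ge> 0" for S
  proof (rule LIMSEQ_unique)
    show "(\<lambda>n. LINT x|lebesgue. \<alpha> x * bump 0 S (1 / real (Suc n)) x) \<longlonglongrightarrow> (LINT x:{0..S}|lebesgue. \<alpha> x)"
      by (rule integral_bump_tendsto[OF locint[OF \<alpha>]])
    have \<chi>l: "set_integrable lebesgue {0..S} \<chi>\<^sub>0"
    proof -
      have "integrable lebesgue \<chi>\<^sub>0" using test_functions_integrable[OF \<chi>t] \<chi>m by (subst integrable_lebesgue_iff_lborel)
      then show ?thesis unfolding set_integrable_def by (intro integrable_mult_indicator) auto
    qed
    have "(LINT x|lebesgue. \<alpha> x * bump 0 S (1 / real (Suc n)) x) = a\<^sub>0\<^sub>0 * (LINT x|lebesgue. \<chi>\<^sub>0 x * bump 0 S (1 / real (Suc n)) x)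
      + (\<Sum>j\<in>J. A\<^sub>0 j * (q j * (LINT x|lebesgue. gamma_density 0 j x * bump 0 S (1 / real (Suc n)) x)))
      + (LINT x|lebesgue. \<beta> x * bump 0 S (1 / real (Suc n)) x) + (LINT x|lebesgue. \<gamma> x * bump 0 S (1 / real (Suc n)) x)" for n
      by (intro weak bump_test) auto
    then show "(\<lambda>n. LINT x|lebesgue. \<alpha> x * bump 0 S (1 / real (Suc n)) x) \<longlonglongrightarrow> a\<^sub>0\<^sub>0 * (LINT x:{0..S}|lebesgue. \<chi>\<^sub>0 x)
      + (\<Sum>j\<in>J. A\<^sub>0 j * (q j * (LINT x:{0..S}|lebesgue. gamma_density 0 j x)))
      + (LINT x:{0..S}|lebesgue. \<beta> x) + (LINT x:{0..S}|lebesgue. \<gamma> x)"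
      by (simp only:) (intro tendsto_add tendsto_sum tendsto_mult_left integral_bump_tendsto locint b(1) c(1) \<chi>l
        gamma_density_0_integral(1) S subsetD[OF a\<^sub>0(2), THEN greaterThan_iff[THEN iffD1]])
  qed
  \<comment> \<open>The denominator j of the primitive S^j/j joins \<Gamma>(j) to form \<Gamma>(j+1)
    = j!.\<close>
  have coeff: "A\<^sub>0 j * (q j * (LINT x:{0..S}|lebesgue. gamma_density 0 j x))
    = exp (\<i> * of_real pi * of_real j / 2) / of_real (Gamma (j + 1)) * A\<^sub>0 j * of_real (S powr j)"
    if "j \<in> J" "S \<ge> 0" for j S
  proof -
    have j: "j > 0" using that a\<^sub>0(2) by auto
    then have "Gamma (j + 1) = j * Gamma j" by (intro Gamma_plus1) (auto elim!: nonpos_Ints_cases)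
    then show ?thesis using j that by (simp add: gamma_density_0_integral(2) q_def mult_ac)
  qed

  obtain C where C: "\<And>S. S > 1 \<Longrightarrow> norm (LINT \<sigma>:{0..S}|lebesgue. \<gamma> \<sigma>) \<le> C * (S powr K / remainder_rate \<RR> \<Lambda> N K S)"
    using growth_bound by blast
  show ?thesis
  proof (rule bigoI)
    show "\<forall>\<^sub>F S in at_top. norm ((LINT \<sigma>:{0..S}|lebesgue. \<alpha> \<sigma>)
            - (a\<^sub>0\<^sub>0
               + (\<Sum>j\<in>J. exp (\<i> * of_real pi * of_real j / 2) / of_real (Gamma (j + 1))
                         * A\<^sub>0 j * of_real (S powr j))
               + (LINT \<sigma>:{0..S}|lebesgue. \<beta> \<sigma>))) \<le> C * norm (complex_of_real (S powr K / remainder_rate \<RR> \<Lambda> N K S))"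
      using eventually_gt_at_top[of 1] eventually_ge_at_top[of r]
    proof eventually_elim
      case (elim S)
      have S: "S \<ge> 0" using elim(1) by simp
      have "(\<Sum>j\<in>J. A\<^sub>0 j * (q j * (LINT x:{0..S}|lebesgue. gamma_density 0 j x)))
        = (\<Sum>j\<in>J. exp (\<i> * of_real pi * of_real j / 2) / of_real (Gamma (j + 1)) * A\<^sub>0 j * of_real (S powr j))"
        by (rule sum.cong[OF refl coeff[OF _ S]])
      then have eq: "(LINT \<sigma>:{0..S}|lebesgue. \<alpha> \<sigma>)
            - (a\<^sub>0\<^sub>0
               + (\<Sum>j\<in>J. exp (\<i> * of_real pi * of_real j / 2) / of_real (Gamma (j + 1))
                         * A\<^sub>0 j * of_real (S powr j))
               + (LINT \<sigma>:{0..S}|lebesgue. \<beta> \<sigma>)) = (LINT \<sigma>:{0..S}|lebesgue. \<gamma> \<sigma>)"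
        unfolding strong[OF S] \<chi>int[OF elim(2)] by simp
      \<comment> \<open>Positivity of the rate identifies the norm in the Landau bound with the
        quotient itself.\<close>
      have "remainder_rate \<RR> \<Lambda> N K S \<ge> 1"
        using truncation_choice(1)[OF _ \<RR>(2) \<Lambda> K(1), of "{}" S] \<RR>(1) elim(1) by simp
      then have "norm (complex_of_real (S powr K / remainder_rate \<RR> \<Lambda> N K S)) = S powr K / remainder_rate \<RR> \<Lambda> N K S"
        by (simp only: norm_of_real) simp
      then show ?case unfolding eq using C[OF elim(1)] by simp
    qed
  qed
qed

end
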